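(* Let $M,\widetilde M\subset\mathbb C^N$ be real-analytic generic submanifolds of the same dimension through $p_0$ and $\tilde p_0$, respectively, with $\widetilde M$ of finite type at $\tilde p_0$. Suppose that $H\colon(\mathbb C^N,p_0)\to(\mathbb C^N,\tilde p_0)$ is a (germ of a) holomorphic mapping with $H(M)\subset\widetilde M$, and let $h\colon(\Sigma_{p_0},p_0)\to(\tilde\Sigma_{\tilde p_0},\tilde p_0)$ denote the induced mapping between Segre varieties. If $h$ is finite, then $H$ is CR transversal to $\widetilde M$ at $p_0$ and finite at $p_0$. Furthermore, the multiplicity of $H$ equals that of $h$.
   Context: A real-analytic submanifold $M\subset\mathbb C^N$ of codimension $d$ through $p_0$ is generic if near $p_0$ it is given by $\rho(Z,\bar Z)=0$ for a real-analytic $\mathbb R^d$-valued $\rho=(\rho_1,\dots,\rho_d)$ with $\partial\rho_1\wedge\dots\wedge\partial\rho_d\neq0$ at $p_0$. Set $T^{0,1}M:=\mathbb CTM\cap T^{0,1}\mathbb C^N$ and $T^{1,0}M:=\overline{T^{0,1}M}$. $M$ is of finite type at $p_0$ if the complex Lie algebra $\mathfrak g_M$ generated by all smooth $(1,0)$ and $(0,1)$ vector fields tangent to $M$ (near $p_0$) satisfies $\mathfrak g_M(p_0)=\mathbb CT_{p_0}M$. All statements are local (germs): $H(M)\subset\widetilde M$ means that $H$ maps a sufficiently small neighborhood of $p_0$ in $M$ into $\widetilde M$. The Segre variety $\Sigma_p$ of $M$ at $p$ (near $p_0$) is the complex submanifold (near $p_0$) defined by $\rho(Z,\bar p)=0$,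 where $\rho(Z,\zeta)$ is the complexification of $\rho$; $\tilde\Sigma_{\tilde p}$ denotes the Segre variety of $\widetilde M$. If $H$ maps $M$ into $\widetilde M$, then $H$ maps $\Sigma_{p_0}$ into $\tilde\Sigma_{\tilde p_0}$, and $h$ is the restriction of $H$ to $\Sigma_{p_0}$ so obtained. A germ of a holomorphic mapping $f\colon(X,x_0)\to(Y,y_0)$ between complex manifolds of equal dimension is finite if, in local coordinates centered at $x_0$ and $y_0$, the ideal generated by the components of $f$ has finite codimension (as a complex vector space) in the ring of convergent (equivalently, formal) power series at $x_0$; this codimension is the multiplicity of $f$. $H$ is CR transversal to $\widetilde M$ at $p_0$ if $T^{1,0}_{\tilde p_0}\widetilde M+dH(T^{1,0}_{p_0}\mathbb C^N)=T^{1,0}_{\tilde p_0}\mathbb C^N$. *)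

theory Defs
  imports "HOL-Analysis.Analysis" "HOL-Combinatorics.Permutations"
begin

section \<open>Real-analytic and holomorphic germs\<close>

definition real_analytic_at :: "('a::euclidean_space \<Rightarrow> real) \<Rightarrow> 'a \<Rightarrow> bool" where
  "real_analytic_at f p \<longleftrightarrow>
     (\<exists>(a :: ('a \<Rightarrow> nat) \<Rightarrow> real) r. r > 0 \<and>
        (\<forall>x\<in>ball p r.
           ((\<lambda>\<alpha>. a \<alpha> * (\<Prod>b\<in>Basis. ((x - p) \<bullet> b) ^ \<alpha> b)) has_sum f x)
             {\<alpha>. \<forall>b. b \<notin> Basis \<longrightarrow> \<alpha> b = 0}))"

definition monomial :: "complex^'m \<Rightarrow> ('m::finite \<Rightarrow> nat) \<Rightarrow> complex" where
  "monomial z \<alpha> = (\<Prod>i\<in>UNIV. (z $ i) ^ \<alpha> i)"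

text \<open>A function is holomorphic at a point if near that point it is the sum of a convergent
  power series. (For a family indexed by multi-indices, \<open>has_sum\<close> is absolute convergence.)\<close>

definition holomorphic_at :: "(complex^'m \<Rightarrow> complex) \<Rightarrow> complex^'m::finite \<Rightarrow> bool" where
  "holomorphic_at f p \<longleftrightarrow>
     (\<exists>(a :: ('m \<Rightarrow> nat) \<Rightarrow> complex) r. r > 0 \<and>
        (\<forall>z\<in>ball p r. ((\<lambda>\<alpha>. a \<alpha> * monomial (z - p) \<alpha>) has_sum f z) UNIV))"

definition holomorphic_map_at ::
  "(complex^'m \<Rightarrow> complex^'k) \<Rightarrow> complex^'m::finite \<Rightarrow> bool" where
  "holomorphic_map_at F p \<longleftrightarrow> (\<forall>j. holomorphic_at (\<lambda>z. F z $ j) p)"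

definition cnj_vec :: "complex^'n \<Rightarrow> complex^'n" where
  "cnj_vec v = (\<chi> i. cnj (v $ i))"

text \<open>\<open>R\<close> is the complexification of the real-analytic function \<open>f\<close> near \<open>p\<close>: in the
  expansion of \<open>f\<close> in powers of \<open>Z - p\<close> and its conjugate, the conjugate variable is replaced
  by an independent variable \<open>\<zeta>\<close>. As a germ at the point (\<open>p\<close>, conjugate of \<open>p\<close>), \<open>R\<close> is
  uniquely determined by \<open>f\<close>.\<close>

definition complexification_at ::
  "(complex^'n \<Rightarrow> real) \<Rightarrow> complex^'n::finite \<Rightarrow> (complex^'n \<Rightarrow> complex^'n \<Rightarrow> complex) \<Rightarrow> bool" where
  "complexification_at f p R \<longleftrightarrow>
     (\<exists>(a :: ('n \<Rightarrow> nat) \<times> ('n \<Rightarrow> nat) \<Rightarrow> complex) r. r > 0 \<and>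
        (\<forall>Z\<in>ball p r. \<forall>\<zeta>\<in>ball (cnj_vec p) r.
           ((\<lambda>(\<alpha>, \<beta>). a (\<alpha>, \<beta>) * monomial (Z - p) \<alpha> * monomial (\<zeta> - cnj_vec p) \<beta>)
              has_sum R Z \<zeta>) UNIV) \<and>
        (\<forall>Z\<in>ball p r. R Z (cnj_vec Z) = complex_of_real (f Z)))"

section \<open>Complexified tangent vectors\<close>

definition d_dz :: "'n::finite \<Rightarrow> (complex^'n \<Rightarrow> complex) \<Rightarrow> complex^'n \<Rightarrow> complex" where
  "d_dz j f p = (frechet_derivative f (at p) (axis j 1)
                   - \<i> * frechet_derivative f (at p) (axis j \<i>)) / 2"

definition d_dzbar :: "'n::finite \<Rightarrow> (complex^'n \<Rightarrow> complex) \<Rightarrow> complex^'n \<Rightarrow> complex" where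
  "d_dzbar j f p = (frechet_derivative f (at p) (axis j 1)
                      + \<i> * frechet_derivative f (at p) (axis j \<i>)) / 2"

text \<open>The pair \<open>(a, b)\<close> stands for the complex tangent vector
  \<open>\<Sum>j. a\<^sub>j \<partial>/\<partial>z\<^sub>j + b\<^sub>j \<partial>/\<partial>zbar\<^sub>j\<close>; real tangent vectors are those with \<open>b\<close> conjugate to \<open>a\<close>.\<close>

type_synonym 'n ctvec = "(complex^'n) \<times> (complex^'n)"

definition ct_scale :: "complex \<Rightarrow> 'n::finite ctvec \<Rightarrow> 'n ctvec" where
  "ct_scale c v = (c *s fst v, c *s snd v)"

definition ct_cnj :: "'n::finite ctvec \<Rightarrow> 'n ctvec" where
  "ct_cnj v = (cnj_vec (snd v), cnj_vec (fst v))"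

definition ct_apply :: "'n::finite ctvec \<Rightarrow> (complex^'n \<Rightarrow> complex) \<Rightarrow> complex^'n \<Rightarrow> complex" where
  "ct_apply v f p = (\<Sum>j\<in>UNIV. fst v $ j * d_dz j f p + snd v $ j * d_dzbar j f p)"

text \<open>The complexified differential of \<open>F\<close> at \<open>p\<close>.\<close>

definition pushforward ::
  "(complex^'n \<Rightarrow> complex^'k) \<Rightarrow> complex^'n::finite \<Rightarrow> 'n ctvec \<Rightarrow> 'k::finite ctvec" where
  "pushforward F p v = (\<chi> j. ct_apply v (\<lambda>z. F z $ j) p, \<chi> j. ct_apply v (\<lambda>z. cnj (F z $ j)) p)"

definition T01_space :: "'n::finite ctvec set" where
  "T01_space = {v. fst v = 0}"

definition T10_space :: "'n::finite ctvec set" where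
  "T10_space = {v. snd v = 0}"

section \<open>Generic submanifolds\<close>

text \<open>\<open>wedge d \<omega>\<close> is \<open>\<omega> 0 \<and> \<dots> \<and> \<omega> (d - 1)\<close> as an alternating \<open>d\<close>-linear form.\<close>

definition wedge :: "nat \<Rightarrow> (nat \<Rightarrow> 'v \<Rightarrow> complex) \<Rightarrow> (nat \<Rightarrow> 'v) \<Rightarrow> complex" where
  "wedge d \<omega> v = (\<Sum>\<pi> | \<pi> permutes {..<d}. of_int (sign \<pi>) * (\<Prod>i<d. \<omega> i (v (\<pi> i))))"

definition del :: "(complex^'n \<Rightarrow> real) \<Rightarrow> complex^'n::finite \<Rightarrow> complex^'n \<Rightarrow> complex" where
  "del f p v = (\<Sum>j\<in>UNIV. d_dz j (\<lambda>z. complex_of_real (f z)) p * v $ j)"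

text \<open>\<open>\<rho> 0, \<dots>, \<rho> (d - 1)\<close> define \<open>M\<close> near \<open>p\<close> as a real-analytic generic submanifold of
  codimension \<open>d\<close>.\<close>

definition generic_submanifold ::
  "(complex^'n) set \<Rightarrow> complex^'n::finite \<Rightarrow> nat \<Rightarrow> (nat \<Rightarrow> complex^'n \<Rightarrow> real) \<Rightarrow> bool" where
  "generic_submanifold M p d \<rho> \<longleftrightarrow>
     p \<in> M \<and>
     (\<forall>k<d. real_analytic_at (\<rho> k) p) \<and>
     (\<forall>\<^sub>F Z in nhds p. Z \<in> M \<longleftrightarrow> (\<forall>k<d. \<rho> k Z = 0)) \<and>
     (\<exists>v. wedge d (\<lambda>k. del (\<rho> k) p) v \<noteq> 0)"

text \<open>The complexified, (0,1) and (1,0) tangent spaces of the zero set of \<open>\<rho>\<close> at \<open>p\<close>.\<close>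

definition CT :: "nat \<Rightarrow> (nat \<Rightarrow> complex^'n \<Rightarrow> real) \<Rightarrow> complex^'n::finite \<Rightarrow> 'n ctvec set" where
  "CT d \<rho> p = {v. \<forall>k<d. ct_apply v (\<lambda>z. complex_of_real (\<rho> k z)) p = 0}"

definition T01 :: "nat \<Rightarrow> (nat \<Rightarrow> complex^'n \<Rightarrow> real) \<Rightarrow> complex^'n::finite \<Rightarrow> 'n ctvec set" where
  "T01 d \<rho> p = CT d \<rho> p \<inter> T01_space"

definition T10 :: "nat \<Rightarrow> (nat \<Rightarrow> complex^'n \<Rightarrow> real) \<Rightarrow> complex^'n::finite \<Rightarrow> 'n ctvec set" where
  "T10 d \<rho> p = ct_cnj ` T01 d \<rho> p"

section \<open>Finite type\<close>

primrec C_diff_on ::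
  "nat \<Rightarrow> ('a::real_normed_vector \<Rightarrow> 'b::real_normed_vector) \<Rightarrow> 'a set \<Rightarrow> bool" where
  "C_diff_on 0 f U \<longleftrightarrow> continuous_on U f"
| "C_diff_on (Suc k) f U \<longleftrightarrow>
     (\<forall>x\<in>U. f differentiable (at x)) \<and>
     (\<forall>v. C_diff_on k (\<lambda>x. frechet_derivative f (at x) v) U)"

definition smooth_at :: "('a::euclidean_space \<Rightarrow> 'b::real_normed_vector) \<Rightarrow> 'a \<Rightarrow> bool" where
  "smooth_at f p \<longleftrightarrow> (\<exists>U. open U \<and> p \<in> U \<and> (\<forall>k. C_diff_on k f U))"

definition lie_bracket ::
  "(complex^'n \<Rightarrow> 'n::finite ctvec) \<Rightarrow> (complex^'n \<Rightarrow> 'n ctvec) \<Rightarrow> complex^'n \<Rightarrow> 'n ctvec" where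
  "lie_bracket X Y p =
     (\<chi> j. ct_apply (X p) (\<lambda>q. fst (Y q) $ j) p - ct_apply (Y p) (\<lambda>q. fst (X q) $ j) p,
      \<chi> j. ct_apply (X p) (\<lambda>q. snd (Y q) $ j) p - ct_apply (Y p) (\<lambda>q. snd (X q) $ j) p)"

text \<open>Vector fields on \<open>M\<close> near \<open>p\<close> are represented by smooth extensions to a neighbourhood of
  \<open>p\<close> in the ambient space. Only the values on \<open>M\<close> are constrained; on \<open>M\<close>, the bracket of fields
  tangent to \<open>M\<close> does not depend on the extensions.\<close>

inductive_set lie_alg ::
  "(complex^'n) set \<Rightarrow> nat \<Rightarrow> (nat \<Rightarrow> complex^'n \<Rightarrow> real) \<Rightarrow> complex^'n::finite \<Rightarrow>
   (complex^'n \<Rightarrow> 'n ctvec) set"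
  for M d \<rho> p where
  field10: "smooth_at X p \<Longrightarrow> \<forall>\<^sub>F q in nhds p. q \<in> M \<longrightarrow> X q \<in> T10 d \<rho> q \<Longrightarrow> X \<in> lie_alg M d \<rho> p"
| field01: "smooth_at X p \<Longrightarrow> \<forall>\<^sub>F q in nhds p. q \<in> M \<longrightarrow> X q \<in> T01 d \<rho> q \<Longrightarrow> X \<in> lie_alg M d \<rho> p"
| add: "X \<in> lie_alg M d \<rho> p \<Longrightarrow> Y \<in> lie_alg M d \<rho> p \<Longrightarrow> (\<lambda>q. X q + Y q) \<in> lie_alg M d \<rho> p"
| scale: "X \<in> lie_alg M d \<rho> p \<Longrightarrow> (\<lambda>q. ct_scale c (X q)) \<in> lie_alg M d \<rho> p"
| bracket: "X \<in> lie_alg M d \<rho> p \<Longrightarrow> Y \<in> lie_alg M d \<rho> p \<Longrightarrow> lie_bracket X Y \<in> lie_alg M d \<rho> p"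

definition finite_type ::
  "(complex^'n) set \<Rightarrow> nat \<Rightarrow> (nat \<Rightarrow> complex^'n \<Rightarrow> real) \<Rightarrow> complex^'n::finite \<Rightarrow> bool" where
  "finite_type M d \<rho> p \<longleftrightarrow> (\<lambda>X. X p) ` lie_alg M d \<rho> p = CT d \<rho> p"

section \<open>Segre varieties and local coordinates\<close>

text \<open>Only the germ near the base point of the complexification \<open>R\<close> is meaningful.\<close>

definition segre ::
  "nat \<Rightarrow> (nat \<Rightarrow> complex^'n \<Rightarrow> complex^'n \<Rightarrow> complex) \<Rightarrow> complex^'n::finite \<Rightarrow> (complex^'n) set" where
  "segre d R p = {Z. \<forall>k<d. R k Z (cnj_vec p) = 0}"

text \<open>\<open>\<kappa>\<close> is a holomorphic coordinate system, centered at \<open>x\<close>, of the complex submanifold \<open>X\<close>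
  near \<open>x\<close>, with values in \<open>m\<close>-dimensional complex space; \<open>\<phi>\<close> is its inverse.\<close>

definition local_coords ::
  "(complex^'n) set \<Rightarrow> complex^'n::finite \<Rightarrow>
   (complex^'m::finite \<Rightarrow> complex^'n) \<Rightarrow> (complex^'n \<Rightarrow> complex^'m) \<Rightarrow> bool" where
  "local_coords X x \<phi> \<kappa> \<longleftrightarrow>
     \<phi> 0 = x \<and>
     (\<exists>V W. open V \<and> 0 \<in> V \<and> open W \<and> x \<in> W \<and>
        homeomorphism V (X \<inter> W) \<phi> \<kappa> \<and>
        (\<forall>z\<in>V. holomorphic_map_at \<phi> z \<and> inj (frechet_derivative \<phi> (at z))))"

section \<open>Finite germs and multiplicity\<close>

text \<open>\<open>W\<close> has codimension \<open>k\<close> in \<open>V\<close> (both complex vector spaces of functions): the classes of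
  the \<open>k\<close> elements of \<open>B\<close> are a basis of the quotient \<open>V / W\<close>.\<close>

definition has_codim :: "('a \<Rightarrow> complex) set \<Rightarrow> ('a \<Rightarrow> complex) set \<Rightarrow> nat \<Rightarrow> bool" where
  "has_codim V W k \<longleftrightarrow>
     (\<exists>B. finite B \<and> card B = k \<and> B \<subseteq> V \<and>
        (\<forall>g\<in>V. \<exists>c. (\<lambda>z. g z - (\<Sum>b\<in>B. c b * b z)) \<in> W) \<and>
        (\<forall>c. (\<lambda>z. \<Sum>b\<in>B. c b * b z) \<in> W \<longrightarrow> (\<forall>b\<in>B. c b = 0)))"

text \<open>Convergent power series at \<open>x\<close>, as functions. Functions with the same germ at \<open>x\<close> are not
  identified, but their difference lies in \<open>comp_ideal f x\<close>, so the quotient is that of the ring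
  of convergent power series.\<close>

definition conv_series :: "complex^'m::finite \<Rightarrow> (complex^'m \<Rightarrow> complex) set" where
  "conv_series x = {g. holomorphic_at g x}"

definition comp_ideal ::
  "(complex^'m::finite \<Rightarrow> complex^'m) \<Rightarrow> complex^'m \<Rightarrow> (complex^'m \<Rightarrow> complex) set" where
  "comp_ideal f x =
     {g \<in> conv_series x. \<exists>u. (\<forall>j. u j \<in> conv_series x) \<and>
        (\<forall>\<^sub>F z in nhds x. g z = (\<Sum>j\<in>UNIV. u j z * (f z $ j - f x $ j)))}"

definition finite_germ :: "(complex^'m::finite \<Rightarrow> complex^'m) \<Rightarrow> complex^'m \<Rightarrow> bool" where
  "finite_germ f x \<longleftrightarrow> (\<exists>k. has_codim (conv_series x) (comp_ideal f x) k)"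

definition multiplicity_germ :: "(complex^'m::finite \<Rightarrow> complex^'m) \<Rightarrow> complex^'m \<Rightarrow> nat" where
  "multiplicity_germ f x = (THE k. has_codim (conv_series x) (comp_ideal f x) k)"

section \<open>CR transversality\<close>

definition CR_transversal ::
  "(complex^'n \<Rightarrow> complex^'n) \<Rightarrow> complex^'n::finite \<Rightarrow> nat \<Rightarrow> (nat \<Rightarrow> complex^'n \<Rightarrow> real) \<Rightarrow> bool" where
  "CR_transversal H p d \<rho> \<longleftrightarrow>
     {u + v | u v. u \<in> T10 d \<rho> (H p) \<and> v \<in> pushforward H p ` T10_space} = T10_space"

end

theory Submission
 imports Defs "HOL-Complex_Analysis.Complex_Analysis"
begin

text \<open>The polarised defining functions of \<open>M\<close>, with second variable conjugate to \<open>p\<close>, are completed by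
linear functions to holomorphic coordinates in which the Segre variety of \<open>M\<close> at \<open>p\<close> is a coordinate
subspace. The (1,0) fields \<open>E j\<close> dual to the polarised functions form a frame; for \<open>j\<close> outside the set
\<open>K\<close> of \<open>d\<close> normal indices they are tangent to \<open>M\<close>. In such frames of \<open>M\<close> and \<open>M'\<close> the differential of
\<open>H\<close> is a matrix \<open>X\<close> which is block triangular on \<open>M\<close>, because \<open>H\<close> maps \<open>M\<close> into \<open>M'\<close>. If \<open>\<delta>\<close> and \<open>D\<close>
are the determinants of the tangential and the normal block, then on \<open>M\<close> the Jacobian determinant \<open>J\<close>
of \<open>H\<close> satisfies \<open>J u = \<delta> D\<close> with a unit \<open>u\<close>, and \<open>D\<close> is real (\<open>jacobian_relation\<close>, \<open>cnj_D\<close>). CR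
transversality means that \<open>D\<close> does not vanish at \<open>p\<close>. Then the ideal of \<open>H\<close> contains the normal
coordinates, and the quotient rings that belong to \<open>H\<close> and to the induced map \<open>h\<close> are
isomorphic (\<open>has_codim_slice\<close>).

It remains to show that \<open>D\<close> does not vanish at \<open>p\<close> (\<open>normal_block_nonzero\<close>). A finite germ has fibres of
bounded cardinality (\<open>fiber_bound\<close>), whereas a map with everywhere singular differential has infinite
fibres (\<open>degenerate_fiber\<close>). Hence the Jacobian determinant of \<open>h\<close> does not vanish identically, which
means that \<open>\<delta>\<close> is not flat along some tangential field \<open>L\<close> (\<open>\<delta>_not_flat\<close>). Assume that \<open>D\<close>
vanishes at \<open>p\<close>. As \<open>J\<close> is holomorphic and \<open>D\<close> real, a comparison of leading terms in \<open>J u = \<delta> D\<close>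
shows that \<open>J\<close> is flat along \<open>L\<close> (\<open>leading_term_comparison\<close>). The germs that are flat along a field
modulo a prime ideal form a prime ideal, because leading coefficients multiply (\<open>prime_at_dclose\<close>).
Iterating this over all words in the tangential fields yields a prime ideal that is preserved by these
fields, contains the functions vanishing on \<open>M\<close> and, again by \<open>J u = \<delta> D\<close> and its conjugate, contains
\<open>J\<close>, but neither \<open>\<delta>\<close> nor its conjugate (\<open>words_in_ideals\<close>). Modulo this ideal every CR vector field of
\<open>M'\<close> lifts along \<open>H\<close> after multiplication by \<open>\<delta>\<close> or its conjugate (\<open>transported_field10\<close>), and with
other factors outside the ideal so do iterated brackets (\<open>related_bracket\<close>). By finite type the brackets span at \<open>p'\<close>, so \<open>J\<close> is not in the
ideal (\<open>jacobian_notin_prime\<close>), a contradiction.\<close>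

no_notation fps_nth (infixl "$" 75)

section \<open>Holomorphic functions of several variables\<close>

lemma norm_axis_complex [simp]: "norm (axis j (c::complex) :: complex^'k) = norm c"
proof -
 have "norm (axis j c :: complex^'k) = L2_set (\<lambda>i. if i = j then norm c else 0) UNIV"
  unfolding norm_vec_def axis_def by (intro L2_set_cong) auto
 also have "\<dots> = sqrt (\<Sum>i\<in>UNIV. if i = j then (norm c)\<^sup>2 else 0)"
  unfolding L2_set_def by (intro arg_cong[where f=sqrt] sum.cong) auto
 finally show ?thesis by simp
qed

lemma axis_add: "axis j (a + b) = axis j a + axis j (b::complex)"
 by (simp add: vec_eq_iff axis_def)

lemma bounded_linear_axis: "bounded_linear (axis j :: complex => complex^'k)"
proof (rule bounded_linear_intro[where K=1])
 show "axis j (r *\<^sub>R x) = r *\<^sub>R axis j x" for r and x :: complex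
  by (simp add: vec_eq_iff axis_def)
qed (auto simp: axis_add)

lemmas continuous_on_axis [continuous_intros] =
 bounded_linear.continuous_on[OF bounded_linear_axis]

lemma axis_0 [simp]: "axis j (0::complex) = 0"
 by (simp add: vec_eq_iff axis_def)

lemma vec_scale_axis: "c *s axis j a = axis j (c * (a::complex))"
 by (simp add: vec_eq_iff axis_def)

definition hol_on :: "(complex^'k => complex) => (complex^'k) set => bool" where
 "hol_on f U \<longleftrightarrow> open U \<and>
   (\<forall>z\<in>U. \<exists>D. (f has_derivative D) (at z) \<and> (\<forall>c v. D (c *s v) = c * D v))"

text \<open>The hypotheses of Osgood's lemma, from which a power series is obtained one variable at
a time.\<close>

definition sep_on :: "(complex^'k => complex) => (complex^'k) set => bool" where
 "sep_on f U \<longleftrightarrow> open U \<and> continuous_on U f \<and>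
   (\<forall>z\<in>U. \<forall>j. (\<lambda>t. f (z + axis j t)) field_differentiable (at 0))"

definition pd :: "'k => (complex^'k => complex) => complex^'k => complex" where
 "pd j f z = deriv (\<lambda>t. f (z + axis j t)) 0"

lemma hol_on_imp_sep_on:
 assumes "hol_on f U" shows "sep_on f U"
 unfolding sep_on_def
proof (intro conjI ballI allI)
 show "open U" using assms by (simp add: hol_on_def)
 show "continuous_on U f" using assms unfolding hol_on_def
  by (meson continuous_at_imp_continuous_on has_derivative_continuous)
 fix z j assume "z \<in> U"
 then obtain D where D: "(f has_derivative D) (at z)" "\<forall>c v. D (c *s v) = c * D v"
  using assms unfolding hol_on_def by blast
 have "((\<lambda>t. z + axis j t) has_derivative axis j) (at 0)"
  by (rule has_derivative_eq_rhs[OF has_derivative_add[OF has_derivative_const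
     bounded_linear.has_derivative[OF bounded_linear_axis has_derivative_ident]]]) auto
 moreover have "(f has_derivative D) (at (z + axis j 0))" using D by simp
 ultimately have "((\<lambda>t. f (z + axis j t)) has_derivative (\<lambda>t. D (axis j t))) (at 0)"
  by (rule has_derivative_compose)
 moreover have "D (axis j t) = D (axis j 1) * t" for t
  using D(2)[rule_format, of t "axis j 1"] by (simp add: vec_scale_axis mult.commute)
 then have "(\<lambda>t. D (axis j t)) = (*) (D (axis j 1))" by (intro ext)
 ultimately show "(\<lambda>t. f (z + axis j t)) field_differentiable (at 0)"
  unfolding field_differentiable_def has_field_derivative_def by auto
qed

lemma sep_on_slice:
 assumes "sep_on f U" "open T" "\<And>t. t \<in> T \<Longrightarrow> z + axis j t \<in> U"
 shows "(\<lambda>t. f (z + axis j t)) holomorphic_on T"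
 unfolding holomorphic_on_open[OF assms(2)]
proof
 fix s assume "s \<in> T"
 then have "(\<lambda>t. f ((z + axis j s) + axis j t)) field_differentiable (at 0)"
  using assms by (simp add: sep_on_def)
 then obtain d where "((\<lambda>t. f ((z + axis j s) + axis j t)) has_field_derivative d) (at 0)"
  unfolding field_differentiable_def by blast
 then have "((\<lambda>t. f (z + axis j (t + s))) has_field_derivative d) (at 0)"
  by (simp add: axis_add algebra_simps)
 then have "((\<lambda>t. f (z + axis j t)) has_field_derivative d) (at (0 + s))"
  by (simp only: DERIV_shift[of _ _ 0 s])
 then show "\<exists>d. ((\<lambda>t. f (z + axis j t)) has_field_derivative d) (at s)" by auto
qed

text \<open>The difference quotients in the direction \<open>s\<close> converge locally uniformly,
by Taylor's formula and the Cauchy estimate for the second derivative; hence continuity and separate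
holomorphy pass to the limit.\<close>

lemma sep_on_pd:
 assumes "sep_on f U" shows "sep_on (pd s f) U"
proof -
 have opU: "open U" and cf: "continuous_on U f" using assms by (auto simp: sep_on_def)
 have *: "\<exists>R>0. continuous_on (cball z0 R) (pd s f) \<and> (\<forall>j. (\<lambda>t. pd s f (z0 + axis j t)) holomorphic_on ball 0 R)"
  if z0: "z0 \<in> U" for z0
 proof -
  obtain R' where "R' > 0" "cball z0 R' \<subseteq> U" using opU z0 open_contains_cball_eq by blast
  define R where "R = R' / 3"
  have R: "R > 0" "cball z0 (3*R) \<subseteq> U" using \<open>R' > 0\<close> \<open>cball z0 R' \<subseteq> U\<close> by (auto simp: R_def)
  have "compact (f ` cball z0 (3*R))"
   using cf R by (intro compact_continuous_image) (auto intro: continuous_on_subset)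
  then obtain M where M: "\<And>z. z \<in> cball z0 (3*R) \<Longrightarrow> norm (f z) \<le> M"
   by (meson bounded_iff compact_imp_bounded imageI)
  have mem: "z + axis j t \<in> cball z0 (3*R)" if "z \<in> cball z0 R" "norm t \<le> 2*R" for z t j
  proof -
   have "dist z0 (z + axis j t) \<le> dist z0 z + dist z (z + axis j t)"
    by (rule dist_triangle)
   also have "dist z (z + axis j t) = norm t" by (simp add: dist_norm)
   finally show ?thesis using that by simp
  qed
  have est: "norm ((f (z + axis s t) - f z) / t - pd s f z) \<le> (2 * M / R^2) * norm t"
   if z: "z \<in> cball z0 R" and t: "norm t \<le> R" "t \<noteq> 0" for z t
  proof -
   define g where "g = (\<lambda>t. f (z + axis s t))"
   have g: "g holomorphic_on ball 0 (2*R)" unfolding g_def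
    using mem[OF z] R by (intro sep_on_slice[OF assms]) auto
   have cg: "continuous_on (cball 0 (2*R)) g" unfolding g_def
    by (rule continuous_on_compose2[OF cf]) (use mem[OF z] R in \<open>auto intro!: continuous_intros\<close>)
   have gM: "norm (g t) \<le> M" if "norm t \<le> 2*R" for t
    unfolding g_def using M mem[OF z that] by auto
   have sub: "cball 0 R \<subseteq> ball 0 (2*R)" using R by auto
   have d1: "((deriv ^^ i) g has_field_derivative (deriv ^^ Suc i) g x) (at x within cball 0 R)"
    if x: "x \<in> cball 0 R" for i x
   proof -
    have "x \<in> ball 0 (2*R)" using x sub by blast
    from holomorphic_derivI[OF holomorphic_higher_deriv[OF g open_ball, of i] open_ball this]
    show ?thesis unfolding funpow.simps o_def by (rule has_field_derivative_at_within)
   qed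
   have d2: "cmod ((deriv ^^ Suc 1) g x) \<le> 2 * M / R\<^sup>2" if x: "x \<in> cball 0 R" for x
   proof -
    have ss: "cball x R \<subseteq> cball 0 (2*R)" "ball x R \<subseteq> ball 0 (2*R)"
     using x by (auto simp: cball_subset_cball_iff ball_subset_ball_iff dist_commute)
    have "norm ((deriv ^^ 2) g x) \<le> fact 2 * M / R^2"
    proof (rule Cauchy_inequality)
     show "g holomorphic_on ball x R" using g ss holomorphic_on_subset by blast
     show "continuous_on (cball x R) g" using cg ss continuous_on_subset by blast
     show "cmod (g y) \<le> M" if "cmod (x - y) = R" for y
     proof (rule gM)
      have "y \<in> cball x R" using that by (simp add: dist_norm)
      then show "cmod y \<le> 2 * R" using ss by auto
     qed
    qed (use R in auto)
    then show ?thesis by (simp add: numeral_2_eq_2)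
   qed
   have "norm ((deriv ^^ 0) g t - (\<Sum>i\<le>1. (deriv ^^ i) g 0 * (t - 0) ^ i / fact i)) \<le> (2 * M / R^2) * norm (t - 0) ^ Suc 1 / fact 1"
    by (rule complex_Taylor[of "cball 0 R" 1 "\<lambda>i. (deriv ^^ i) g", OF convex_cball d1 d2]) (use t R in auto)
   then have "norm (g t - g 0 - deriv g 0 * t) \<le> (2 * M / R^2) * norm t ^ 2"
    by (simp add: diff_diff_eq numeral_2_eq_2)
   then have "norm ((g t - g 0 - deriv g 0 * t) / t) \<le> (2 * M / R^2) * norm t"
    using t by (simp add: norm_divide power2_eq_square field_simps)
   moreover have "(g t - g 0 - deriv g 0 * t) / t = (f (z + axis s t) - f z) / t - pd s f z"
    using t unfolding g_def pd_def by (simp add: field_simps)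
   ultimately show ?thesis by metis
  qed
  define q where "q = (\<lambda>n z. (f (z + axis s (of_real (R / (real n + 1)))) - f z) / of_real (R / (real n + 1)))"
  have tn: "norm (of_real (R / (real n + 1)) :: complex) \<le> R" for n
   using R unfolding norm_of_real by (simp add: field_simps abs_of_pos)
  have ul: "uniform_limit (cball z0 R) q (pd s f) sequentially"
  proof (rule uniform_limitI)
   fix e :: real assume "e > 0"
   have "(\<lambda>n. R / (real n + 1)) \<longlonglongrightarrow> 0"
    using LIMSEQ_Suc[OF lim_const_over_n[of R]] by (simp add: add.commute)
   then have "(\<lambda>n. (2 * M / R^2) * (R / (real n + 1))) \<longlonglongrightarrow> 0"
    by (rule tendsto_mult_right_zero)
   then have "\<forall>\<^sub>F n in sequentially. (2 * M / R^2) * (R / (real n + 1)) < e"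
    using \<open>e > 0\<close> by (rule order_tendstoD)
   then show "\<forall>\<^sub>F n in sequentially. \<forall>x\<in>cball z0 R. dist (q n x) (pd s f x) < e"
   proof eventually_elim
    case (elim n)
    have "norm (of_real (R / (real n + 1)) :: complex) = R / (real n + 1)"
     using R unfolding norm_of_real by (simp add: abs_of_pos)
    moreover have "of_real (R / (real n + 1)) \<noteq> (0::complex)"
     using R unfolding of_real_eq_0_iff by (simp add: add_eq_0_iff)
    ultimately show ?case using est[OF _ tn[of n]] elim
     unfolding q_def dist_norm by fastforce
   qed
  qed
  have cq: "continuous_on (cball z0 R) (q n)" for n
  proof -
   have 1: "z + axis s (complex_of_real (R / (real n + 1))) \<in> U" if "z \<in> cball z0 R" for z
    using mem[OF that, of "of_real (R / (real n + 1))" s] tn[of n] R by auto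
   have 2: "continuous_on (cball z0 R) (\<lambda>z. f (z + axis s (of_real (R / (real n + 1)))))"
    by (rule continuous_on_compose2[OF cf]) (use 1 in \<open>auto intro!: continuous_intros\<close>)
   have 3: "continuous_on (cball z0 R) f"
    using R by (intro continuous_on_subset[OF cf]) auto
   have "of_real (R / (real n + 1)) \<noteq> (0::complex)"
    using R unfolding of_real_eq_0_iff by (simp add: add_eq_0_iff)
   then show ?thesis unfolding q_def by (intro continuous_intros 2 3) auto
  qed
  have c: "continuous_on (cball z0 R) (pd s f)"
   by (rule uniform_limit_theorem[OF _ ul]) (auto simp: cq)
  have "(\<lambda>t. pd s f (z0 + axis j t)) holomorphic_on ball 0 R" for j
  proof (rule holomorphic_uniform_limit)
   have m: "z0 + axis j t \<in> cball z0 R" if "t \<in> cball 0 R" for t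
    using that by (simp add: dist_norm)
   show "uniform_limit (cball 0 R) (\<lambda>n t. q n (z0 + axis j t)) (\<lambda>t. pd s f (z0 + axis j t)) sequentially"
    by (rule uniform_limit_compose'[OF ul]) (use m in auto)
   have "(\<lambda>t. q n (z0 + axis j t)) holomorphic_on ball 0 R" for n
   proof -
    have 1: "(\<lambda>t. f ((z0 + axis s (of_real (R / (real n + 1)))) + axis j t)) holomorphic_on ball 0 R"
    proof (rule sep_on_slice[OF assms open_ball])
     fix t :: complex assume "t \<in> ball 0 R"
     then have "(z0 + axis j t) + axis s (of_real (R / (real n + 1))) \<in> cball z0 (3*R)"
      using m tn[of n] R by (intro mem) auto
     then show "z0 + axis s (complex_of_real (R / (real n + 1))) + axis j t \<in> U"
      using R(2) by (auto simp only: add_ac)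
    qed
    have 2: "(\<lambda>t. f (z0 + axis j t)) holomorphic_on ball 0 R"
    proof (rule sep_on_slice[OF assms open_ball])
     fix t :: complex assume "t \<in> ball 0 R"
     then show "z0 + axis j t \<in> U"
      using mem[of z0 t j] R by auto
    qed
    show ?thesis unfolding q_def
     using R 1 2 by (intro holomorphic_intros) (auto simp: algebra_simps)
   qed
   moreover have "continuous_on (cball 0 R) (\<lambda>t. q n (z0 + axis j t))" for n
    by (rule continuous_on_compose2[OF cq]) (use m in \<open>auto intro!: continuous_intros\<close>)
   ultimately show "\<forall>\<^sub>F n in sequentially. continuous_on (cball 0 R) (\<lambda>t. q n (z0 + axis j t)) \<and> (\<lambda>t. q n (z0 + axis j t)) holomorphic_on ball 0 R"
    by simp
  qed auto
  then show ?thesis using c R by blast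
 qed
 show ?thesis unfolding sep_on_def
 proof (intro conjI ballI allI)
  show "open U" by fact
  show "continuous_on U (pd s f)"
   unfolding continuous_on_eq_continuous_at[OF opU]
  proof
   fix z assume "z \<in> U"
   then obtain R where "R > 0" "continuous_on (cball z R) (pd s f)" using * by blast
   then show "isCont (pd s f) z" by (intro continuous_on_interior) auto
  qed
  fix z j assume "z \<in> U"
  then obtain R where "R > 0" "(\<lambda>t. pd s f (z + axis j t)) holomorphic_on ball 0 R" using * by blast
  then show "(\<lambda>t. pd s f (z + axis j t)) field_differentiable (at 0)"
   by (simp add: holomorphic_on_imp_differentiable_at)
 qed
qed

abbreviation (input) polydisc :: "real => (complex^'k) set" where
 "polydisc r \<equiv> {z. \<forall>i. norm (z $ i) < r}"

definition zero_at :: "'k => complex^'k => complex^'k" where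
 "zero_at s z = (\<chi> i. if i = s then 0 else z $ i)"

lemma zero_at_nth [simp]: "zero_at s z $ i = (if i = s then 0 else z $ i)"
 by (simp add: zero_at_def)

lemma zero_at_split: "z = zero_at s z + axis s (z $ s)"
 by (simp add: vec_eq_iff axis_def)

lemma zero_at_axis [simp]: "zero_at s (z + axis j t) = (if j = s then zero_at s z else zero_at s z + axis j t)"
 by (auto simp: vec_eq_iff axis_def)

lemma continuous_on_zero_at [continuous_intros]: "continuous_on A (zero_at s)"
 unfolding zero_at_def
proof (rule continuous_on_vec_lambda)
 show "continuous_on A (\<lambda>x. if i = s then 0 else x $ i)" for i
  by (cases "i = s") (auto intro!: continuous_intros)
qed

lemma open_polydisc: "open (polydisc r :: (complex^'k) set)"
proof -
 have "(polydisc r :: (complex^'k) set) = (\<Inter>i. {z. norm (z $ i) < r})" by auto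
 moreover have "open {z :: complex^'k. norm (z $ i) < r}" for i
  by (intro open_Collect_less continuous_intros)
 ultimately show ?thesis by (metis (no_types, lifting) finite open_INT)
qed

lemma sep_on_pd_funpow:
 assumes "sep_on f U" shows "sep_on ((pd s ^^ n) f) U"
 by (induction n) (auto simp: assms sep_on_pd)

lemma deriv_funpow_slice:
 assumes "sep_on f U" "z + axis s t \<in> U"
 shows "(deriv ^^ n) (\<lambda>t. f (z + axis s t)) t = (pd s ^^ n) f (z + axis s t)"
 using assms(2)
proof (induction n arbitrary: t)
 case (Suc n)
 have "open U" using assms(1) by (simp add: sep_on_def)
 then have "open ((\<lambda>t. z + axis s t) -` U)"
  by (intro open_vimage) (auto intro!: continuous_intros)
 then have "\<forall>\<^sub>F u in nhds t. u \<in> (\<lambda>t. z + axis s t) -` U"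
  using Suc.prems by (intro eventually_nhds_in_open) auto
 then have "\<forall>\<^sub>F u in nhds t. (deriv ^^ n) (\<lambda>t. f (z + axis s t)) u = (pd s ^^ n) f (z + axis s u)"
  by eventually_elim (use Suc.IH in auto)
 then have "deriv ((deriv ^^ n) (\<lambda>t. f (z + axis s t))) t = deriv (\<lambda>u. (pd s ^^ n) f (z + axis s u)) t"
  by (rule deriv_cong_ev) simp
 also have "\<dots> = pd s ((pd s ^^ n) f) (z + axis s t)"
  unfolding pd_def by (subst deriv_shift_0) (simp add: o_def axis_add add.assoc)
 finally show ?case by simp
qed auto

lemma summable_multi_geometric:
 fixes x :: "'k::finite => real"
 assumes "\<And>i. 0 \<le> x i" "\<And>i. x i < 1"
 shows "(\<lambda>m. \<Prod>i\<in>UNIV. x i ^ m i) summable_on UNIV"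
proof -
 have g: "((\<lambda>n. x i ^ n) has_sum (1 / (1 - x i))) UNIV" for i
  using assms[of i] geometric_sums[of "x i"] by (intro norm_summable_imp_has_sum) (auto simp: norm_power)
 have "infsum (\<lambda>m. \<Prod>i\<in>UNIV. x i ^ m i) (PiE UNIV (\<lambda>_. UNIV)) = (\<Prod>i\<in>UNIV. infsum (\<lambda>n. x i ^ n) UNIV)"
 proof (rule infsum_prod_PiE_abs)
  show "(\<lambda>n. norm (x i ^ n)) summable_on UNIV" for i
   using g[of i] assms by (auto simp: norm_power abs_of_nonneg summable_on_def)
 qed simp
 also have "\<dots> \<noteq> 0"
  using infsumI[OF g] assms by (simp add: less_imp_neq[THEN not_sym])
 finally have "infsum (\<lambda>m. \<Prod>i\<in>UNIV. x i ^ m i) UNIV \<noteq> 0"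
  by (simp add: PiE_UNIV_domain Pi_UNIV)
 then show ?thesis using infsum_not_exists by blast
qed

lemma sep_on_zero_at:
 assumes "sep_on f (polydisc r)" shows "sep_on (\<lambda>z. f (zero_at s z)) (polydisc r)"
 unfolding sep_on_def
proof (intro conjI ballI allI)
 show "open (polydisc r :: (complex^'a) set)" by (rule open_polydisc)
 have z: "zero_at s z \<in> polydisc r" if "z \<in> polydisc r" for z
  using that by (auto dest: le_less_trans[OF norm_ge_zero])
 show "continuous_on (polydisc r) (\<lambda>z. f (zero_at s z))"
  by (rule continuous_on_compose2[of "polydisc r" f])
    (use assms z in \<open>auto simp: sep_on_def intro!: continuous_intros\<close>)
 fix z :: "complex^'a" and j assume "z \<in> polydisc r"
 then show "(\<lambda>t. f (zero_at s (z + axis j t))) field_differentiable (at 0)"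
  using z assms by (cases "j = s") (auto simp: sep_on_def)
qed

lemma monomial_upd:
 assumes "m s = 0"
 shows "monomial z (m(s := n)) = z $ s ^ n * monomial (zero_at s z) m"
proof -
 have "monomial z (m(s := n)) = z $ s ^ n * (\<Prod>i\<in>UNIV - {s}. z $ i ^ m i)"
  unfolding monomial_def by (subst prod.remove[of _ s]) (auto intro!: prod.cong)
 moreover have "monomial (zero_at s z) m = (\<Prod>i\<in>UNIV - {s}. z $ i ^ m i)"
  unfolding monomial_def using assms by (subst prod.remove[of _ s]) (auto intro!: prod.cong)
 ultimately show ?thesis by simp
qed

lemma norm_monomial: "norm (monomial z m) = (\<Prod>i\<in>UNIV. norm (z $ i) ^ m i)"
 by (simp add: monomial_def norm_power flip: prod_norm)

lemma power_series_summable: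
 fixes a :: "('k::finite => nat) => complex"
 assumes r: "r > 0" and a: "\<And>m. norm (a m) \<le> M / r ^ (sum m UNIV)" and z: "z \<in> polydisc r"
 shows "(\<lambda>m. norm (a m * monomial z m)) summable_on UNIV"
proof (rule Infinite_Sum.abs_summable_on_comparison_test')
 show "(\<lambda>m. M * (\<Prod>i\<in>UNIV. (norm (z $ i) / r) ^ m i)) summable_on UNIV"
  using r z by (intro summable_on_cmult_right summable_multi_geometric) auto
 fix m
 have "norm (a m * monomial z m) \<le> M / r ^ (sum m UNIV) * (\<Prod>i\<in>UNIV. norm (z $ i) ^ m i)"
  unfolding norm_mult norm_monomial by (intro mult_right_mono a prod_nonneg) auto
 also have "\<dots> = M * (\<Prod>i\<in>UNIV. (norm (z $ i) / r) ^ m i)"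
  by (simp add: power_divide prod_dividef power_sum)
 finally show "norm (a m * monomial z m) \<le> M * (\<Prod>i\<in>UNIV. (norm (z $ i) / r) ^ m i)" .
qed

text \<open>Osgood's lemma, by induction on the set \<open>S\<close> of variables that may differ
from zero. The coefficients of the expansion in one further variable are again separately
holomorphic, and the Cauchy inequalities give the bound \<open>M / r ^ sum m UNIV\<close> that makes
the combined family summable.\<close>

lemma sep_power_series_aux:
 fixes S :: "'k::finite set"
 assumes "r > 0" "r < r'" "finite S"
  and "sep_on f (polydisc r')" "\<And>z. z \<in> polydisc r' \<Longrightarrow> norm (f z) \<le> M"
 shows "\<exists>a. (\<forall>m. norm (a m) \<le> M / r ^ (sum m UNIV)) \<and>
   (\<forall>z\<in>polydisc r. (\<forall>i. i \<notin> S \<longrightarrow> z $ i = 0) \<longrightarrow>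
     ((\<lambda>m. a m * monomial z m) has_sum f z) {m. \<forall>i. i \<notin> S \<longrightarrow> m i = 0})"
 using assms(3-)
proof (induction S arbitrary: f M)
 case empty
 have M: "norm (f 0) \<le> M" using empty.prems(2)[of 0] assms by simp
 then have "M \<ge> 0" using norm_ge_zero order_trans by blast
 let ?a = "\<lambda>m. if m = (\<lambda>_. 0) then f 0 else 0"
 have "norm (?a m) \<le> M / r ^ (sum m UNIV)" for m
  using M \<open>M \<ge> 0\<close> assms(1) by auto
 moreover have "((\<lambda>m. ?a m * monomial z m) has_sum f z) {m. \<forall>i. i \<notin> {} \<longrightarrow> m i = 0}"
  if "\<forall>i. i \<notin> {} \<longrightarrow> z $ i = 0" for z :: "complex^'k"
 proof -
  have "z = 0" using that by (simp add: vec_eq_iff)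
  have s: "{m. \<forall>i. i \<notin> {} \<longrightarrow> m i = 0} = {\<lambda>_::'k. 0::nat}" by auto
  show ?thesis unfolding s by (rule has_sum_finiteI) (simp_all add: monomial_def \<open>z = 0\<close>)
 qed
 ultimately show ?case by (intro exI[of _ ?a]) blast
next
 case (insert s S)
 define g where "g = (\<lambda>n z. (pd s ^^ n) f (zero_at s z) / fact n)"
 have slice: "upd + axis s t \<in> polydisc r'" if "z \<in> polydisc r'" "upd = zero_at s z" "norm t < r'" for z t upd
  using that assms by (auto simp: axis_def)
 have g_bd: "norm (g n z) \<le> M / r ^ n" if z: "z \<in> polydisc r'" for n z
 proof -
  let ?h = "\<lambda>t. f (zero_at s z + axis s t)"
  have hol: "?h holomorphic_on ball 0 r'"
   by (rule sep_on_slice[OF insert.prems(1)]) (use slice[OF z] in auto)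
  have "norm ((deriv ^^ n) ?h 0) \<le> fact n * M / r ^ n"
  proof (rule Cauchy_inequality)
   show "?h holomorphic_on ball 0 r" "continuous_on (cball 0 r) ?h"
    using assms by (auto intro!: holomorphic_on_subset[OF hol] holomorphic_on_imp_continuous_on)
   show "norm (?h t) \<le> M" if "norm (0 - t) = r" for t
    using insert.prems(2)[OF slice[OF z refl]] that assms by auto
  qed (use assms in auto)
  moreover have "(deriv ^^ n) ?h 0 = (pd s ^^ n) f (zero_at s z)"
   using deriv_funpow_slice[OF insert.prems(1), of "zero_at s z" s 0 n] slice[OF z refl, of 0] assms by auto
  ultimately show ?thesis by (simp add: g_def norm_divide field_simps)
 qed
 have g_sep: "sep_on (g n) (polydisc r')" for n
 proof -
  have "sep_on (\<lambda>z. (pd s ^^ n) f (zero_at s z)) (polydisc r')"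
   by (intro sep_on_zero_at sep_on_pd_funpow insert.prems)
  then show ?thesis unfolding g_def sep_on_def
   by (auto intro!: continuous_intros derivative_intros)
 qed
 let ?Q = "\<lambda>n a. (\<forall>m. norm (a m) \<le> M / r ^ n / r ^ (sum m UNIV)) \<and>
   (\<forall>z\<in>polydisc r. (\<forall>i. i \<notin> S \<longrightarrow> z $ i = 0) \<longrightarrow>
     ((\<lambda>m. a m * monomial z m) has_sum g n z) {m. \<forall>i. i \<notin> S \<longrightarrow> m i = 0})"
 have "\<exists>a. ?Q n a" for n
  by (rule insert.IH[OF g_sep g_bd])
 then have "\<exists>a. \<forall>n. ?Q n (a n)"
  by (intro choice allI)
 then obtain a where a: "\<And>n m. norm (a n m) \<le> M / r ^ n / r ^ (sum m UNIV)"
  "\<And>n z. z \<in> polydisc r \<Longrightarrow> (\<And>i. i \<notin> S \<Longrightarrow> z $ i = 0) \<Longrightarrow>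
     ((\<lambda>m. a n m * monomial z m) has_sum g n z) {m. \<forall>i. i \<notin> S \<longrightarrow> m i = 0}"
  by blast
 define b where "b = (\<lambda>m. a (m s) (m(s := 0)))"
 have b_bd: "norm (b m) \<le> M / r ^ (sum m UNIV)" for m
 proof -
  have "sum m UNIV = m s + sum (m(s := 0)) UNIV"
   by (simp add: sum.remove[of UNIV s])
  then show ?thesis using a(1)[of "m s" "m(s := 0)"] by (simp add: b_def power_add mult.commute)
 qed
 let ?T = "\<lambda>S. {m :: 'k => nat. \<forall>i. i \<notin> S \<longrightarrow> m i = 0}"
 have "((\<lambda>m. b m * monomial z m) has_sum f z) (?T (insert s S))"
  if z: "z \<in> polydisc r" "\<And>i. i \<notin> insert s S \<Longrightarrow> z $ i = 0" for z
 proof -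
  have bij: "bij_betw (\<lambda>(n, m). m(s := n)) (UNIV \<times> ?T S) (?T (insert s S))"
   by (rule bij_betw_byWitness[where f' = "\<lambda>m. (m s, m(s := 0))"]) (use insert.hyps in auto)
  have eq: "b (m(s := n)) * monomial z (m(s := n)) = a n m * monomial (zero_at s z) m * z $ s ^ n"
   if "m \<in> ?T S" for n m
  proof -
   have "m s = 0" using that insert.hyps by auto
   then have "m(s := 0) = m" by auto
   then show ?thesis using monomial_upd[of m s z n] \<open>m s = 0\<close> by (simp add: b_def)
  qed
  have "(\<lambda>m. b m * monomial z m) summable_on ?T (insert s S)"
  proof (rule summable_on_subset_banach)
   have "(\<lambda>m. norm (b m * monomial z m)) summable_on UNIV"
    using power_series_summable[of r b M z] assms(1) b_bd z(1) by auto
   then show "(\<lambda>m. b m * monomial z m) summable_on UNIV"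
    by (rule Infinite_Sum.abs_summable_summable)
  qed simp
  then have "(\<lambda>(n, m). b (m(s := n)) * monomial z (m(s := n))) summable_on (UNIV \<times> ?T S)"
   using summable_on_reindex_bij_betw[OF bij, of "\<lambda>m. b m * monomial z m"] by (simp add: case_prod_unfold)
  moreover have "((\<lambda>m. b (m(s := n)) * monomial z (m(s := n))) has_sum (g n z * z $ s ^ n)) (?T S)" for n
  proof -
   have "zero_at s z \<in> polydisc r" using z assms by auto
   then have "((\<lambda>m. a n m * monomial (zero_at s z) m) has_sum g n (zero_at s z)) (?T S)"
    by (rule a(2)) (use z in auto)
   moreover have "g n (zero_at s z) = g n z"
    by (simp add: g_def zero_at_def if_distrib cong: if_cong)
   ultimately have "((\<lambda>m. a n m * monomial (zero_at s z) m) has_sum g n z) (?T S)" by simp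
   then have "((\<lambda>m. a n m * monomial (zero_at s z) m * z $ s ^ n) has_sum (g n z * z $ s ^ n)) (?T S)"
    by (rule has_sum_cmult_left)
   moreover have "((\<lambda>m. b (m(s := n)) * monomial z (m(s := n))) has_sum (g n z * z $ s ^ n)) (?T S) \<longleftrightarrow>
     ((\<lambda>m. a n m * monomial (zero_at s z) m * z $ s ^ n) has_sum (g n z * z $ s ^ n)) (?T S)"
    by (rule has_sum_cong) (rule eq)
   ultimately show ?thesis by blast
  qed
  moreover have "((\<lambda>n. g n z * z $ s ^ n) has_sum f z) UNIV"
  proof (rule norm_summable_imp_has_sum)
   have z': "z \<in> polydisc r'" using z assms by (auto dest: less_trans)
   have "M \<ge> 0" using insert.prems(2)[OF z'] norm_ge_zero order_trans by blast
   show "summable (\<lambda>n. norm (g n z * z $ s ^ n))"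
   proof (rule summable_comparison_test')
    show "summable (\<lambda>n. M * (norm (z $ s) / r) ^ n)"
     using z assms by (intro summable_mult summable_geometric) auto
    show "norm (norm (g n z * z $ s ^ n)) \<le> M * (norm (z $ s) / r) ^ n" if "n \<ge> 0" for n
     using mult_right_mono[OF g_bd[OF z', of n], of "norm (z $ s) ^ n"]
     by (simp add: norm_mult norm_power power_divide)
   qed
   let ?h = "\<lambda>t. f (zero_at s z + axis s t)"
   have hol: "?h holomorphic_on ball 0 r"
    by (rule sep_on_slice[OF insert.prems(1)]) (use slice[OF z'] assms in auto)
   have "(\<lambda>n. (deriv ^^ n) ?h 0 / fact n * (z $ s - 0) ^ n) sums ?h (z $ s)"
    by (rule holomorphic_power_series[OF hol]) (use z in auto)
   moreover have "(deriv ^^ n) ?h 0 = (pd s ^^ n) f (zero_at s z)" for n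
    using deriv_funpow_slice[OF insert.prems(1), of "zero_at s z" s 0 n] slice[OF z' refl, of 0] assms by auto
   ultimately show "(\<lambda>n. g n z * z $ s ^ n) sums f z"
    using zero_at_split[of z s] by (simp add: g_def)
  qed
  ultimately have "((\<lambda>(n, m). b (m(s := n)) * monomial z (m(s := n))) has_sum f z) (UNIV \<times> ?T S)"
   by (intro has_sum_SigmaI[where g = "\<lambda>n. g n z * z $ s ^ n"]) auto
  then show ?thesis
   using has_sum_reindex_bij_betw[OF bij, of "\<lambda>m. b m * monomial z m"] by (simp add: case_prod_unfold)
 qed
 then show ?case using b_bd by blast
qed

lemma sep_on_translate:
 assumes "sep_on f U" shows "sep_on (\<lambda>z. f (p + z)) ((+) (-p) ` U)"
proof -
 have c: "continuous_on U f" and opn: "open U" using assms by (auto simp: sep_on_def)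
 show ?thesis unfolding sep_on_def
 proof (intro conjI ballI allI)
  show "open ((+) (- p) ` U)" using opn by (rule open_translation)
  show "continuous_on ((+) (- p) ` U) (\<lambda>z. f (p + z))"
   by (rule continuous_on_compose2[OF c]) (auto intro!: continuous_intros)
  fix z j assume "z \<in> (+) (- p) ` U"
  then show "(\<lambda>t. f (p + (z + axis j t))) field_differentiable at 0"
   using assms unfolding sep_on_def by (auto simp: add.assoc[symmetric])
 qed
qed

lemma polydisc_subset_ball:
 assumes "r > 0" shows "polydisc (r / CARD('k)) \<subseteq> ball (0 :: complex^'k) r"
proof
 fix z :: "complex^'k" assume z: "z \<in> polydisc (r / CARD('k))"
 have "norm z \<le> (\<Sum>i\<in>UNIV. norm (z $ i))"
  unfolding norm_vec_def by (rule L2_set_le_sum) auto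
 also have "\<dots> < (\<Sum>i\<in>(UNIV::'k set). r / CARD('k))" using z by (intro sum_strict_mono) auto
 finally show "z \<in> ball 0 r" by simp
qed

lemma ball_subset_polydisc: "ball (0 :: complex^'k) r \<subseteq> polydisc r"
 by (auto intro: le_less_trans[OF Finite_Cartesian_Product.norm_nth_le])

proposition sep_on_imp_holomorphic_at:
 fixes f :: "complex^'k => complex"
 assumes "sep_on f U" "p \<in> U" shows "holomorphic_at f p"
proof -
 let ?f = "\<lambda>z. f (p + z)"
 have sp: "sep_on ?f ((+) (-p) ` U)" by (rule sep_on_translate[OF assms(1)])
 then have "open ((+) (-p) ` U)" by (simp add: sep_on_def)
 moreover have "0 \<in> (+) (-p) ` U" using assms by force
 ultimately obtain R where R: "R > 0" "cball 0 R \<subseteq> (+) (-p) ` U"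
  by (meson open_contains_cball)
 define r' where "r' = R / CARD('k)"
 define r where "r = r' / 2"
 have r: "r > 0" "r < r'" using R by (auto simp: r_def r'_def field_simps)
 have sub: "polydisc r' \<subseteq> ball (0::complex^'k) R"
  unfolding r'_def by (rule polydisc_subset_ball[OF R(1)])
 have sep: "sep_on ?f (polydisc r')"
 proof -
  have "polydisc r' \<subseteq> (+) (-p) ` U"
   by (rule order_trans[OF sub order_trans[OF ball_subset_cball R(2)]])
  then show ?thesis
   using sp open_polydisc[of r'] unfolding sep_on_def by (blast intro: continuous_on_subset)
 qed
 have "compact (?f ` cball 0 R)"
  using sp R by (intro compact_continuous_image) (auto intro: continuous_on_subset simp: sep_on_def)
 then obtain M where M: "\<And>z. z \<in> cball 0 R \<Longrightarrow> norm (?f z) \<le> M"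
  by (meson bounded_iff compact_imp_bounded imageI)
 have "\<exists>a. (\<forall>m. norm (a m) \<le> M / r ^ (sum m UNIV)) \<and>
   (\<forall>z\<in>polydisc r. (\<forall>i. i \<notin> UNIV \<longrightarrow> z $ i = 0) \<longrightarrow>
     ((\<lambda>m. a m * monomial z m) has_sum ?f z) {m. \<forall>i. i \<notin> UNIV \<longrightarrow> m i = 0})"
  by (rule sep_power_series_aux[OF r finite sep]) (use M sub in force)
 then obtain a where a: "\<And>z. z \<in> polydisc r \<Longrightarrow> ((\<lambda>m. a m * monomial z m) has_sum ?f z) UNIV" by auto
 have "((\<lambda>m. a m * monomial (z - p) m) has_sum f z) UNIV" if "z \<in> ball p r" for z
 proof -
  have "z - p \<in> ball 0 r" using that by (simp add: dist_norm norm_minus_commute)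
  then have "z - p \<in> polydisc r" using ball_subset_polydisc by blast
  from a[OF this] show ?thesis by simp
 qed
 then show ?thesis unfolding holomorphic_at_def using r by blast
qed

definition cdiff :: "(complex^'k => complex) => complex^'k => bool" where
 "cdiff f z \<longleftrightarrow> (\<exists>D. (f has_derivative D) (at z) \<and> (\<forall>c v. D (c *s v) = c * D v))"

text \<open>The terms of degree at least two are dominated by a multiple of \<open>norm z ^
2\<close>. The radius at which the coefficients are absolutely summable is recorded for later
estimates.\<close>

lemma has_derivative_power_series:
 fixes f :: "complex^'k => complex"
 assumes "r > 0" and hs: "\<And>z. z \<in> ball 0 r \<Longrightarrow> ((\<lambda>m. a m * monomial z m) has_sum f z) UNIV"
 obtains R where "0 < R" "R < r" "(\<lambda>m. norm (a m) * R ^ sum m UNIV) summable_on UNIV"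
  "(f has_derivative (\<lambda>v. \<Sum>j\<in>UNIV. a (\<lambda>i. if i = j then 1 else 0) * v $ j)) (at 0)"
proof -
 define R where "R = r / CARD('k) / 2"
 have C1: "real CARD('k) \<ge> 1" by (simp add: Suc_leI)
 have R: "R > 0" "R < r / CARD('k)" using assms(1) by (auto simp: R_def field_simps)
 have "r / CARD('k) \<le> r" using C1 assms(1) by (simp add: field_simps)
 then have Rr: "R < r" using R by linarith
 let ?z = "(\<chi> i. of_real R) :: complex^'k"
 have "?z \<in> polydisc (r / CARD('k))" using R by simp
 then have "?z \<in> ball 0 r" using polydisc_subset_ball[OF assms(1)] by blast
 from hs[OF this] have "(\<lambda>m. norm (a m * monomial ?z m)) summable_on UNIV"
  by (intro summable_on_iff_abs_summable_on_complex[THEN iffD1] has_sum_imp_summable)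
 moreover have "norm (a m * monomial ?z m) = norm (a m) * R ^ sum m UNIV" for m
  using R by (simp add: norm_mult norm_monomial power_sum)
 ultimately have sm: "(\<lambda>m. norm (a m) * R ^ sum m UNIV) summable_on UNIV" by simp
 define e :: "'k => 'k => nat" where "e = (\<lambda>j i. if i = j then 1 else 0)"
 define S where "S = insert (\<lambda>_. 0) (range e)"
 have e_inj: "inj e" unfolding inj_def e_def by (metis zero_neq_one)
 have e0: "(\<lambda>_. 0) \<notin> range e" unfolding e_def by (auto dest!: fun_cong simp: if_split_eq1 split: if_splits)
 have mono_e: "monomial z (e j) = z $ j" for z :: "complex^'k" and j
  unfolding monomial_def e_def by (simp add: prod.delta if_distrib[where f = "\<lambda>n. _ ^ n"] cong: if_cong)
 have Ssum: "(\<Sum>m\<in>S. a m * monomial z m) = a (\<lambda>_. 0) + (\<Sum>j\<in>UNIV. a (e j) * z $ j)" for z :: "complex^'k"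
 proof -
  have "(\<Sum>m\<in>S. a m * monomial z m) = a (\<lambda>_. 0) * monomial z (\<lambda>_. 0) + (\<Sum>m\<in>range e. a m * monomial z m)"
   unfolding S_def using e0 by (subst sum.insert) auto
  also have "(\<Sum>m\<in>range e. a m * monomial z m) = (\<Sum>j\<in>UNIV. a (e j) * monomial z (e j))"
   using e_inj by (subst sum.reindex) (auto simp: o_def)
  finally show ?thesis unfolding mono_e by (simp add: monomial_def)
 qed
 have deg: "sum m UNIV \<ge> 2" if "m \<notin> S" for m :: "'k => nat"
 proof (rule ccontr)
  assume "\<not> sum m UNIV \<ge> 2"
  then consider "sum m UNIV = 0" | "sum m UNIV = Suc 0" by linarith
  then show False
  proof cases
   case 1
   then have "m = (\<lambda>_. 0)" by auto
   then show ?thesis using that by (simp add: S_def)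
  next
   case 2
   then obtain j where "m j = Suc 0" "\<forall>i. j \<noteq> i \<longrightarrow> m i = 0"
    using sum_eq_Suc0_iff[of UNIV m] by auto
   then have "m = e j" unfolding e_def by (intro ext) auto
   then show ?thesis using that by (simp add: S_def)
  qed
 qed
 define T where "T = infsum (\<lambda>m. norm (a m) * R ^ sum m UNIV) (UNIV - S)"
 have smT: "((\<lambda>m. norm (a m) * R ^ sum m UNIV) has_sum T) (UNIV - S)"
  unfolding T_def by (rule has_sum_infsum, rule summable_on_subset_banach[OF sm]) simp
 have f0: "f 0 = a (\<lambda>_. 0)"
 proof -
  have "((\<lambda>m. a m * monomial (0::complex^'k) m) has_sum a (\<lambda>_. 0)) UNIV"
  proof (rule has_sum_finite_neutralI[of "{\<lambda>_. 0}"])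
   show "a m * monomial (0::complex^'k) m = 0" if "m \<in> UNIV - {\<lambda>_. 0}" for m
    using that by (auto simp: monomial_def prod_zero_iff fun_eq_iff)
  qed (auto simp: monomial_def)
  moreover have "((\<lambda>m. a m * monomial (0::complex^'k) m) has_sum f 0) UNIV" using hs[of 0] assms(1) by simp
  ultimately show ?thesis using has_sum_unique by blast
 qed
 have est: "norm (f z - f 0 - (\<Sum>j\<in>UNIV. a (e j) * z $ j)) \<le> (T / R\<^sup>2) * norm z ^ 2"
  if z: "norm z \<le> R" for z
 proof -
  have "z \<in> ball 0 r" using z Rr by simp
  then have "((\<lambda>m. a m * monomial z m) has_sum (f z - (\<Sum>m\<in>S. a m * monomial z m))) (UNIV - S)"
   by (intro has_sum_Diff hs has_sum_finite) (auto simp: S_def)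
  moreover have "((\<lambda>m. (norm z / R)\<^sup>2 * (norm (a m) * R ^ sum m UNIV)) has_sum ((norm z / R)\<^sup>2 * T)) (UNIV - S)"
   by (rule has_sum_cmult_right[OF smT])
  moreover have "norm (a m * monomial z m) \<le> (norm z / R)\<^sup>2 * (norm (a m) * R ^ sum m UNIV)" if "m \<in> UNIV - S" for m
  proof -
   obtain n where n: "sum m UNIV = 2 + n" using deg[of m] \<open>m \<in> UNIV - S\<close> le_Suc_ex by blast
   have "norm (monomial z m) \<le> (\<Prod>i\<in>UNIV. norm z ^ m i)"
    unfolding norm_monomial by (intro prod_mono conjI power_mono Finite_Cartesian_Product.norm_nth_le) auto
   also have "\<dots> = norm z ^ 2 * norm z ^ n" using n by (simp add: power2_eq_square flip: power_sum)
   also have "\<dots> \<le> norm z ^ 2 * R ^ n" using z by (intro mult_left_mono power_mono) auto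
   also have "\<dots> = (norm z / R)\<^sup>2 * R ^ sum m UNIV" unfolding n using R by (simp add: power2_eq_square)
   finally show ?thesis unfolding norm_mult using mult_left_mono[of "norm (monomial z m)" _ "norm (a m)"]
    by (metis (no_types, lifting) mult.left_commute norm_ge_zero)
  qed
  ultimately have "norm (f z - (\<Sum>m\<in>S. a m * monomial z m)) \<le> (norm z / R)\<^sup>2 * T"
   by (rule norm_infsum_le)
  then show ?thesis unfolding Ssum f0 by (simp add: power_divide diff_diff_eq mult.commute)
 qed
 have "(f has_derivative (\<lambda>v. \<Sum>j\<in>UNIV. a (e j) * v $ j)) (at 0)"
  unfolding has_derivative_at
 proof
  show "bounded_linear (\<lambda>v::complex^'k. \<Sum>j\<in>UNIV. a (e j) * v $ j)"
   by (intro bounded_linear_sum bounded_linear_mult_const bounded_linear_const_mult bounded_linear_vec_nth)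
  show "(\<lambda>h. norm (f (0 + h) - f 0 - (\<Sum>j\<in>UNIV. a (e j) * h $ j)) / norm h) \<midarrow>0\<rightarrow> 0"
  proof (rule Lim_null_comparison)
   show "\<forall>\<^sub>F h in at 0. norm (norm (f (0 + h) - f 0 - (\<Sum>j\<in>UNIV. a (e j) * h $ j)) / norm h) \<le> (T / R\<^sup>2) * norm h"
    unfolding eventually_at
   proof (intro exI[of _ R] conjI ballI impI)
    fix h :: "complex^'k" assume "h \<noteq> 0 \<and> dist h 0 < R"
    then have "norm (f h - f 0 - (\<Sum>j\<in>UNIV. a (e j) * h $ j)) \<le> (T / R\<^sup>2) * norm h ^ 2" "norm h > 0"
     using est[of h] by auto
    then show "norm (norm (f (0 + h) - f 0 - (\<Sum>j\<in>UNIV. a (e j) * h $ j)) / norm h) \<le> (T / R\<^sup>2) * norm h"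
     by (simp add: divide_le_eq power2_eq_square mult.assoc)
   qed (use R in auto)
   show "(\<lambda>h::complex^'k. (T / R\<^sup>2) * norm h) \<midarrow>0\<rightarrow> 0"
    by (intro tendsto_mult_right_zero tendsto_norm_zero tendsto_ident_at)
  qed
 qed
 then show thesis using that[of R] R Rr sm unfolding e_def by blast
qed

lemma holomorphic_at_imp_cdiff:
 fixes f :: "complex^'k => complex"
 assumes "holomorphic_at f p" shows "cdiff f p"
proof -
 obtain a r where r: "r > 0" and hs: "\<And>z. z \<in> ball p r \<Longrightarrow> ((\<lambda>m. a m * monomial (z - p) m) has_sum f z) UNIV"
  using assms unfolding holomorphic_at_def by blast
 have "((\<lambda>m. a m * monomial z m) has_sum f (p + z)) UNIV" if "z \<in> ball 0 r" for z
  using hs[of "p + z"] that by (simp add: dist_norm)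
 from has_derivative_power_series[OF r this]
 have "((\<lambda>z. f (p + z)) has_derivative (\<lambda>v. \<Sum>j\<in>UNIV. a (\<lambda>i. if i = j then 1 else 0) * v $ j)) (at 0)"
  by metis
 then have "(f has_derivative (\<lambda>v. \<Sum>j\<in>UNIV. a (\<lambda>i. if i = j then 1 else 0) * v $ j)) (at p)"
  unfolding has_derivative_at by simp
 then show ?thesis unfolding cdiff_def
  by (intro exI conjI) (auto simp: sum_distrib_left mult_ac)
qed

lemma sep_on_imp_hol_on: "sep_on f U \<Longrightarrow> hol_on f U"
 using holomorphic_at_imp_cdiff sep_on_imp_holomorphic_at
 unfolding hol_on_def cdiff_def by (metis sep_on_def)

text \<open>On a small polydisc the finite partial sums, which are polynomials, converge uniformly
by the Weierstrass test.\<close>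

lemma holomorphic_at_imp_sep_on:
 fixes f :: "complex^'k => complex"
 assumes "holomorphic_at f p" shows "\<exists>U. p \<in> U \<and> sep_on f U"
proof -
 obtain a r where r: "r > 0" and hs: "\<And>z. z \<in> ball p r \<Longrightarrow> ((\<lambda>m. a m * monomial (z - p) m) has_sum f z) UNIV"
  using assms unfolding holomorphic_at_def by blast
 define g where "g = (\<lambda>z. f (p + z))"
 have hsg: "((\<lambda>m. a m * monomial z m) has_sum g z) UNIV" if "z \<in> ball 0 r" for z
  using hs[of "p + z"] that by (simp add: dist_norm g_def)
 obtain R0 where R0: "0 < R0" "R0 < r" "(\<lambda>m. norm (a m) * R0 ^ sum m UNIV) summable_on UNIV"
  by (rule has_derivative_power_series[OF r hsg])
 define R where "R = R0 / CARD('k)"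
 have C1: "real CARD('k) \<ge> 1" by (simp add: Suc_leI)
 have R: "0 < R" "R \<le> R0" using R0 C1 by (auto simp: R_def field_simps)
 let ?U = "polydisc R :: (complex^'k) set"
 have Ub: "z \<in> ball 0 r" if "z \<in> ?U" for z
  using polydisc_subset_ball[OF R0(1)] that R0(2) unfolding R_def by force
 have ul: "uniform_limit ?U (\<lambda>X z. \<Sum>m\<in>X. a m * monomial z m) g (finite_subsets_at_top UNIV)"
 proof (rule Weierstrass_m_test_general')
  fix m :: "'k => nat" and z assume "z \<in> ?U"
  then have "norm (monomial z m) \<le> (\<Prod>i\<in>UNIV. R0 ^ m i)"
   unfolding norm_monomial using R by (intro prod_mono conjI power_mono) (auto intro: less_imp_le less_le_trans)
  then show "norm (a m * monomial z m) \<le> norm (a m) * R0 ^ sum m UNIV"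
   unfolding norm_mult by (simp add: mult_left_mono power_sum)
 qed (use Ub hsg R0 in auto)
 have cm: "continuous_on A (\<lambda>z. \<Sum>m\<in>X. a m * monomial z m)" for A X
  unfolding monomial_def by (intro continuous_intros)
 have cont: "continuous_on ?U g"
  by (rule uniform_limit_theorem[OF _ ul]) (auto simp: cm)
 have "sep_on g ?U" unfolding sep_on_def
 proof (intro conjI ballI allI)
  fix z j assume z: "z \<in> ?U"
  define V where "V = (\<lambda>t. z + axis j t) -` ?U"
  have "open V" unfolding V_def
   by (intro open_vimage open_polydisc) (auto intro!: continuous_intros)
  moreover have "0 \<in> V" using z by (simp add: V_def)
  ultimately obtain \<epsilon> where \<epsilon>: "\<epsilon> > 0" "cball 0 \<epsilon> \<subseteq> V" by (meson open_contains_cball)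
  have "(\<lambda>t. g (z + axis j t)) holomorphic_on ball 0 \<epsilon>"
  proof (rule holomorphic_uniform_limit)
   show "uniform_limit (cball 0 \<epsilon>) (\<lambda>X t. \<Sum>m\<in>X. a m * monomial (z + axis j t) m) (\<lambda>t. g (z + axis j t)) (finite_subsets_at_top UNIV)"
    by (rule uniform_limit_compose'[OF ul]) (use \<epsilon> in \<open>auto simp: V_def\<close>)
   have "(\<lambda>t. (z + axis j t) $ i) holomorphic_on A" for i A
    by (cases "i = j") (auto simp: axis_def intro!: holomorphic_intros)
   then have "(\<lambda>t. \<Sum>m\<in>X. a m * monomial (z + axis j t) m) holomorphic_on A" for X A
    unfolding monomial_def by (intro holomorphic_intros)
   then show "\<forall>\<^sub>F X in finite_subsets_at_top UNIV. continuous_on (cball 0 \<epsilon>) (\<lambda>t. \<Sum>m\<in>X. a m * monomial (z + axis j t) m)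
     \<and> (\<lambda>t. \<Sum>m\<in>X. a m * monomial (z + axis j t) m) holomorphic_on ball 0 \<epsilon>"
    by (intro always_eventually allI conjI holomorphic_on_imp_continuous_on)
  qed auto
  then show "(\<lambda>t. g (z + axis j t)) field_differentiable (at 0)"
   using \<epsilon> by (simp add: holomorphic_on_imp_differentiable_at)
 qed (auto simp: cont open_polydisc)
 then have "sep_on (\<lambda>z. g ((-p) + z)) ((+) (- (-p)) ` ?U)" by (rule sep_on_translate)
 then have "sep_on f ((+) p ` ?U)" by (simp add: g_def)
 moreover have "p + 0 \<in> (+) p ` ?U" by (rule imageI) (use R in simp)
 ultimately show ?thesis by (intro exI[of _ "(+) p ` ?U"] conjI) simp_all
qed

text \<open>This turns the definition by power series into calculus: closure properties of
holomorphy become closure properties of complex differentiability.\<close>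

proposition holomorphic_at_iff_cdiff: "holomorphic_at f p \<longleftrightarrow> (\<forall>\<^sub>F z in nhds p. cdiff f z)"
proof
 assume "holomorphic_at f p"
 then obtain U where "p \<in> U" "sep_on f U" using holomorphic_at_imp_sep_on by blast
 then have "hol_on f U" by (simp add: sep_on_imp_hol_on)
 then show "\<forall>\<^sub>F z in nhds p. cdiff f z"
  using \<open>p \<in> U\<close> unfolding eventually_nhds cdiff_def hol_on_def by blast
next
 assume "\<forall>\<^sub>F z in nhds p. cdiff f z"
 then obtain U where "open U" "p \<in> U" "\<forall>z\<in>U. cdiff f z" unfolding eventually_nhds by blast
 then have "hol_on f U" by (auto simp: hol_on_def cdiff_def)
 then show "holomorphic_at f p" using \<open>p \<in> U\<close> hol_on_imp_sep_on sep_on_imp_holomorphic_at by blast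
qed

lemma holomorphic_at_eventually:
 "holomorphic_at f p \<Longrightarrow> \<forall>\<^sub>F z in nhds p. holomorphic_at f z"
 unfolding holomorphic_at_iff_cdiff by (simp add: eventually_eventually)

lemma holomorphic_at_cong:
 assumes "\<forall>\<^sub>F z in nhds p. f z = g z" shows "holomorphic_at f p \<longleftrightarrow> holomorphic_at g p"
proof -
 have "holomorphic_at g p" if fg: "\<forall>\<^sub>F z in nhds p. f z = g z" and f: "holomorphic_at f p" for f g :: "complex^'a => complex"
 proof -
  have "\<forall>\<^sub>F z in nhds p. \<forall>\<^sub>F w in nhds z. f w = g w" using fg by (simp add: eventually_eventually)
  moreover have "\<forall>\<^sub>F z in nhds p. cdiff f z" using f by (simp add: holomorphic_at_iff_cdiff)
  ultimately have "\<forall>\<^sub>F z in nhds p. cdiff g z"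
  proof eventually_elim
   case (elim z)
   then have "f z = g z" using eventually_nhds_x_imp_x by blast
   obtain D where D: "(f has_derivative D) (at z)" "\<forall>c v. D (c *s v) = c * D v"
    using elim unfolding cdiff_def by blast
   have "(g has_derivative D) (at z)"
    by (rule has_derivative_transform_eventually[OF D(1)])
      (use elim(1) \<open>f z = g z\<close> in \<open>auto simp: eventually_nhds_conv_at\<close>)
   then show ?case using D(2) unfolding cdiff_def by blast
  qed
  then show ?thesis by (simp add: holomorphic_at_iff_cdiff)
 qed
 from this[of f g] this[of g f] show ?thesis using assms by (auto simp: eq_commute)
qed

subsection \<open>Calculus of partial derivatives\<close>

lemma d_dz_eq:
 assumes "(f has_derivative D) (at p)" "\<And>c v. D (c *s v) = c * D v"
 shows "d_dz j f p = D (axis j 1)" "d_dzbar j f p = 0"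
proof -
 have "frechet_derivative f (at p) = D" using assms(1) frechet_derivative_at by metis
 moreover have "D (axis j \<i>) = \<i> * D (axis j 1)" using assms(2)[of \<i> "axis j 1"] by (simp add: vec_scale_axis)
 ultimately show "d_dz j f p = D (axis j 1)" "d_dzbar j f p = 0"
  unfolding d_dz_def d_dzbar_def by (auto simp: algebra_simps)
qed

lemma clinear_expand:
 assumes "linear D" "\<And>c v. D (c *s v) = c * (D v :: complex)"
 shows "D v = (\<Sum>j\<in>UNIV. D (axis j 1) * (v :: complex^'k) $ j)"
proof -
 have "v = (\<Sum>j\<in>UNIV. v $ j *s axis j 1)" using basis_expansion[of v] by simp
 then have "D v = (\<Sum>j\<in>UNIV. D (v $ j *s axis j 1))" using linear_sum[OF assms(1)] by metis
 then show ?thesis by (simp add: assms(2) mult.commute)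
qed

lemma cdiff_has_derivative:
 assumes "cdiff f p"
 shows "(f has_derivative (\<lambda>v. \<Sum>j\<in>UNIV. d_dz j f p * v $ j)) (at p)"
proof -
 obtain D where D: "(f has_derivative D) (at p)" "\<And>c v. D (c *s v) = c * D v"
  using assms by (auto simp: cdiff_def)
 have "D = (\<lambda>v. \<Sum>j\<in>UNIV. d_dz j f p * v $ j)"
  unfolding d_dz_eq(1)[OF D]
  by (intro ext clinear_expand[OF has_derivative_linear[OF D(1)] D(2)])
 then show ?thesis using D by simp
qed

lemma cdiffI:
 assumes "(f has_derivative (\<lambda>v. \<Sum>j\<in>UNIV. c j * v $ j)) (at p)"
 shows "cdiff f p" "d_dz j f p = c j" "d_dzbar j f p = 0"
proof -
 have l: "(\<Sum>j\<in>UNIV. c j * (a *s v) $ j) = a * (\<Sum>j\<in>UNIV. c j * v $ j)" for a v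
  by (simp add: sum_distrib_left mult_ac)
 show "cdiff f p" unfolding cdiff_def using assms l by blast
 show "d_dz j f p = c j" "d_dzbar j f p = 0"
  using d_dz_eq[OF assms l, of j] by (simp_all add: axis_def if_distrib cong: if_cong)
qed

lemma cdiff_d_dzbar: "cdiff f p \<Longrightarrow> d_dzbar j f p = 0"
 by (rule cdiffI(3)[OF cdiff_has_derivative])

lemma cdiff_const: "cdiff (\<lambda>z. c) p"
 and cdiff_nth: "cdiff (\<lambda>z. z $ i) p"
 unfolding cdiff_def
 by (rule exI[of _ "\<lambda>_. 0"], simp) (rule exI[of _ "\<lambda>v. v $ i"], simp add: bounded_linear.has_derivative[OF bounded_linear_vec_nth has_derivative_ident])

lemma cdiff_add: "cdiff f p \<Longrightarrow> cdiff g p \<Longrightarrow> cdiff (\<lambda>z. f z + g z) p"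
 unfolding cdiff_def
proof (elim exE conjE)
 fix D E assume "(f has_derivative D) (at p)" "\<forall>c v. D (c *s v) = c * D v"
  "(g has_derivative E) (at p)" "\<forall>c v. E (c *s v) = c * E v"
 then show "\<exists>D. ((\<lambda>z. f z + g z) has_derivative D) (at p) \<and> (\<forall>c v. D (c *s v) = c * D v)"
  by (intro exI[of _ "\<lambda>v. D v + E v"]) (auto intro!: has_derivative_add simp: algebra_simps)
qed

lemma cdiff_mult: "cdiff f p \<Longrightarrow> cdiff g p \<Longrightarrow> cdiff (\<lambda>z. f z * g z) p"
 unfolding cdiff_def
proof (elim exE conjE)
 fix D E assume "(f has_derivative D) (at p)" "\<forall>c v. D (c *s v) = c * D v"
  "(g has_derivative E) (at p)" "\<forall>c v. E (c *s v) = c * E v"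
 then show "\<exists>D. ((\<lambda>z. f z * g z) has_derivative D) (at p) \<and> (\<forall>c v. D (c *s v) = c * D v)"
  by (intro exI[of _ "\<lambda>v. f p * E v + D v * g p"] conjI has_derivative_mult) (simp_all add: algebra_simps)
qed

lemma cdiff_inverse: "cdiff f p \<Longrightarrow> f p \<noteq> 0 \<Longrightarrow> cdiff (\<lambda>z. inverse (f z)) p"
 unfolding cdiff_def
proof (elim exE conjE)
 fix D assume "(f has_derivative D) (at p)" "\<forall>c v. D (c *s v) = c * D v" "f p \<noteq> 0"
 then show "\<exists>D. ((\<lambda>z. inverse (f z)) has_derivative D) (at p) \<and> (\<forall>c v. D (c *s v) = c * D v)"
  by (intro exI[of _ "\<lambda>v. - (inverse (f p) * D v * inverse (f p))"] conjI Deriv.has_derivative_inverse) (simp_all add: algebra_simps)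
qed

lemma has_derivative_vecI:
 fixes F :: "'a::real_normed_vector => complex^'k"
 assumes "\<And>i. ((\<lambda>z. F z $ i) has_derivative (\<lambda>v. D v $ i)) (at p)"
 shows "(F has_derivative D) (at p)"
proof -
 have "\<forall>b\<in>Basis. ((\<lambda>x. F x \<bullet> b) has_derivative (\<lambda>v. D v \<bullet> b)) (at p)"
 proof
  fix b :: "complex^'k" assume "b \<in> Basis"
  then obtain i u where b: "b = axis i u" by (auto simp: Basis_vec_def)
  show "((\<lambda>x. F x \<bullet> b) has_derivative (\<lambda>v. D v \<bullet> b)) (at p)"
   unfolding b inner_axis by (intro has_derivative_inner_left assms)
 qed
 then show ?thesis using has_derivative_componentwise_within by blast
qed

lemma cdiff_compose:
 assumes F: "\<And>k. cdiff (\<lambda>z. F z $ k) p" and g: "cdiff g (F p)"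
 shows "cdiff (\<lambda>z. g (F z)) p"
  "d_dz j (\<lambda>z. g (F z)) p = (\<Sum>k\<in>UNIV. d_dz k g (F p) * d_dz j (\<lambda>z. F z $ k) p)"
proof -
 have "(F has_derivative (\<lambda>v. \<chi> k. \<Sum>j\<in>UNIV. d_dz j (\<lambda>z. F z $ k) p * v $ j)) (at p)"
  by (rule has_derivative_vecI) (simp add: cdiff_has_derivative[OF F])
 from has_derivative_compose[OF this cdiff_has_derivative[OF g]]
 have "((\<lambda>z. g (F z)) has_derivative
   (\<lambda>v. \<Sum>j\<in>UNIV. (\<Sum>k\<in>UNIV. d_dz k g (F p) * d_dz j (\<lambda>z. F z $ k) p) * v $ j)) (at p)"
  by (rule has_derivative_eq_rhs)
    (auto simp: sum_distrib_left sum_distrib_right mult.assoc intro: sum.swap)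
 from cdiffI[OF this] show "cdiff (\<lambda>z. g (F z)) p"
  "d_dz j (\<lambda>z. g (F z)) p = (\<Sum>k\<in>UNIV. d_dz k g (F p) * d_dz j (\<lambda>z. F z $ k) p)" by auto
qed

named_theorems hol_intros

lemma holomorphic_at_const [hol_intros]: "holomorphic_at (\<lambda>z. c) p"
 and holomorphic_at_nth [hol_intros]: "holomorphic_at (\<lambda>z. z $ i) p"
 by (simp_all add: holomorphic_at_iff_cdiff cdiff_const cdiff_nth)

lemma holomorphic_at_add [hol_intros]: "holomorphic_at f p \<Longrightarrow> holomorphic_at g p \<Longrightarrow> holomorphic_at (\<lambda>z. f z + g z) p"
 unfolding holomorphic_at_iff_cdiff by (erule (1) eventually_elim2) (rule cdiff_add)

lemma holomorphic_at_mult [hol_intros]: "holomorphic_at f p \<Longrightarrow> holomorphic_at g p \<Longrightarrow> holomorphic_at (\<lambda>z. f z * g z) p"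
 unfolding holomorphic_at_iff_cdiff by (erule (1) eventually_elim2) (rule cdiff_mult)

lemma holomorphic_at_minus [hol_intros]: "holomorphic_at f p \<Longrightarrow> holomorphic_at (\<lambda>z. - f z) p"
 using holomorphic_at_mult[OF holomorphic_at_const[of "-1"], of f p] by simp

lemma holomorphic_at_diff [hol_intros]: "holomorphic_at f p \<Longrightarrow> holomorphic_at g p \<Longrightarrow> holomorphic_at (\<lambda>z. f z - g z) p"
 using holomorphic_at_add[OF _ holomorphic_at_minus, of f p g] by simp

lemma holomorphic_at_sum [hol_intros]: "(\<And>i. i \<in> I \<Longrightarrow> holomorphic_at (f i) p) \<Longrightarrow> holomorphic_at (\<lambda>z. \<Sum>i\<in>I. f i z) p"
 by (induction I rule: infinite_finite_induct) (auto intro: hol_intros)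

lemma holomorphic_at_prod [hol_intros]: "(\<And>i. i \<in> I \<Longrightarrow> holomorphic_at (f i) p) \<Longrightarrow> holomorphic_at (\<lambda>z. \<Prod>i\<in>I. f i z) p"
 by (induction I rule: infinite_finite_induct) (auto intro: hol_intros)

lemma holomorphic_at_det [hol_intros]:
 "(\<And>i j. holomorphic_at (\<lambda>z. A z $ i $ j) p) \<Longrightarrow> holomorphic_at (\<lambda>z. det (A z)) p"
 unfolding det_def by (intro hol_intros)

lemma holomorphic_at_continuous: "holomorphic_at f p \<Longrightarrow> isCont f p"
 by (meson cdiff_has_derivative has_derivative_continuous holomorphic_at_imp_cdiff)

lemma holomorphic_at_inverse [hol_intros]:
 assumes "holomorphic_at f p" "f p \<noteq> 0" shows "holomorphic_at (\<lambda>z. inverse (f z)) p"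
proof -
 have "\<forall>\<^sub>F z in nhds p. f z \<noteq> 0"
  using tendsto_imp_eventually_ne[of f "f p" "nhds p" 0] holomorphic_at_continuous[OF assms(1)] assms(2)
  by (simp add: isCont_def tendsto_at_iff_tendsto_nhds)
 moreover have "\<forall>\<^sub>F z in nhds p. cdiff f z" using assms(1) by (simp add: holomorphic_at_iff_cdiff)
 ultimately show ?thesis unfolding holomorphic_at_iff_cdiff
  by eventually_elim (rule cdiff_inverse)
qed

lemma holomorphic_at_divide [hol_intros]:
 "holomorphic_at f p \<Longrightarrow> holomorphic_at g p \<Longrightarrow> g p \<noteq> 0 \<Longrightarrow> holomorphic_at (\<lambda>z. f z / g z) p"
 unfolding divide_inverse by (intro hol_intros)

lemma holomorphic_map_at_tendsto:
 assumes "holomorphic_map_at F p" shows "(F \<longlongrightarrow> F p) (nhds p)"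
proof -
 have "((\<lambda>z. F z $ i) \<longlongrightarrow> F p $ i) (nhds p)" for i
  using assms holomorphic_at_continuous unfolding holomorphic_map_at_def isCont_def tendsto_at_iff_tendsto_nhds by blast
 then show ?thesis by (rule vec_tendstoI)
qed

lemma holomorphic_at_compose:
 assumes "holomorphic_map_at F p" "holomorphic_at g (F p)"
 shows "holomorphic_at (\<lambda>z. g (F z)) p"
proof -
 have "\<forall>\<^sub>F z in nhds p. cdiff g (F z)"
  using holomorphic_map_at_tendsto[OF assms(1)] assms(2)
  by (auto simp: holomorphic_at_iff_cdiff filterlim_iff)
 moreover have "\<forall>\<^sub>F z in nhds p. \<forall>k\<in>UNIV. cdiff (\<lambda>z. F z $ k) z"
  using assms(1) by (intro eventually_ball_finite) (auto simp: holomorphic_map_at_def holomorphic_at_iff_cdiff)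
 ultimately show ?thesis unfolding holomorphic_at_iff_cdiff
  by eventually_elim (rule cdiff_compose(1), auto)
qed

lemma holomorphic_at_d_dz [hol_intros]:
 assumes "holomorphic_at f p" shows "holomorphic_at (d_dz j f) p"
proof -
 obtain U where U: "p \<in> U" "sep_on f U" using holomorphic_at_imp_sep_on[OF assms] by blast
 have pd: "pd j f z = d_dz j f z" if "cdiff f z" for z
 proof -
  have "((\<lambda>t. z + axis j t) has_derivative axis j) (at 0)"
   by (rule has_derivative_eq_rhs[OF has_derivative_add[OF has_derivative_const
      bounded_linear.has_derivative[OF bounded_linear_axis has_derivative_ident]]]) auto
  moreover have "(f has_derivative (\<lambda>v. \<Sum>j\<in>UNIV. d_dz j f z * v $ j)) (at (z + axis j 0))"
   using cdiff_has_derivative[OF that] by simp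
  ultimately have "((\<lambda>t. f (z + axis j t)) has_derivative (\<lambda>t. \<Sum>k\<in>UNIV. d_dz k f z * axis j t $ k)) (at 0)"
   by (rule has_derivative_compose)
  moreover have "(\<lambda>t. \<Sum>k\<in>UNIV. d_dz k f z * axis j t $ k) = (*) (d_dz j f z)"
   by (simp add: axis_def if_distrib cong: if_cong)
  ultimately show ?thesis unfolding pd_def by (intro DERIV_imp_deriv) (simp add: has_field_derivative_def)
 qed
 have "\<forall>\<^sub>F z in nhds p. cdiff f z" using assms by (simp add: holomorphic_at_iff_cdiff)
 then have "\<forall>\<^sub>F z in nhds p. pd j f z = d_dz j f z" by eventually_elim (rule pd)
 moreover have "holomorphic_at (pd j f) p"
  using sep_on_pd[OF U(2)] U(1) sep_on_imp_holomorphic_at by blast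
 ultimately show ?thesis using holomorphic_at_cong by blast
qed

subsection \<open>Local inverses\<close>

lemma C1_local_inverse:
 fixes f :: "'a::euclidean_space => 'a"
 assumes "open U" "x0 \<in> U" and der: "\<And>x. x \<in> U \<Longrightarrow> (f has_derivative D x) (at x)"
  and cont: "\<And>v. continuous_on U (\<lambda>x. D x v)" and inj: "inj (D x0)"
 shows "\<exists>U' V g. open U' \<and> U' \<subseteq> U \<and> x0 \<in> U' \<and> open V \<and> f x0 \<in> V \<and> homeomorphism U' V f g \<and>
  (\<forall>y\<in>V. bij (D (g y)) \<and> (g has_derivative inv (D (g y))) (at y))"
proof -
 define f' where "f' = (\<lambda>x. Blinfun (D x))"
 have f': "blinfun_apply (f' x) = D x" if "x \<in> U" for x
  unfolding f'_def by (rule bounded_linear_Blinfun_apply) (use der[OF that] has_derivative_bounded_linear in blast)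
 have "linear (D x0)" using der assms(2) has_derivative_linear by blast
 then obtain h where h: "linear h" "h \<circ> D x0 = id" using linear_injective_left_inverse inj by blast
 then have "bounded_linear h" using linear_conv_bounded_linear by blast
 then have invf: "Blinfun h o\<^sub>L f' x0 = id_blinfun"
  using h(2) f'[OF assms(2)] by (intro blinfun_eqI) (simp add: bounded_linear_Blinfun_apply, metis comp_apply id_apply)
 have c: "continuous_on U f'"
  by (rule continuous_on_blinfun_componentwise)
    (rule continuous_on_eq[OF cont], simp add: f')
 have der': "(f has_derivative blinfun_apply (f' x)) (at x)" if "x \<in> U" for x
  using der[OF that] f'[OF that] by simp
 obtain U' V g g' where *: "open U'" "U' \<subseteq> U" "x0 \<in> U'" "open V" "f x0 \<in> V" "homeomorphism U' V f g"
  "\<And>y. y \<in> V \<Longrightarrow> (g has_derivative (g' y)) (at y)"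
  "\<And>y. y \<in> V \<Longrightarrow> g' y = inv (blinfun_apply (f'(g y)))"
  "\<And>y. y \<in> V \<Longrightarrow> bij (blinfun_apply (f'(g y)))"
  by (rule inverse_function_theorem[OF assms(1) der' c assms(2) invf]) blast+
 have gU: "g y \<in> U" if "y \<in> V" for y
  using that *(2,6) unfolding homeomorphism_def by blast
 have "bij (D (g y)) \<and> (g has_derivative inv (D (g y))) (at y)" if "y \<in> V" for y
  using *(7,8,9)[OF that] f'[OF gU[OF that]] by simp
 then show ?thesis using *(1-6) by blast
qed

definition jac :: "(complex^'k => complex^'l) => complex^'k => complex^'k => complex^'l" where
 "jac F z v = (\<chi> i. \<Sum>j\<in>UNIV. d_dz j (\<lambda>z. F z $ i) z * v $ j)"

lemma jac_add: "jac F z (v + w) = jac F z v + jac F z w"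
 and jac_scale: "jac F z (c *s v) = c *s jac F z v"
proof -
 show "jac F z (v + w) = jac F z v + jac F z w"
  by (simp add: jac_def vec_eq_iff sum.distrib[symmetric] distrib_left)
 show "jac F z (c *s v) = c *s jac F z v"
  by (simp add: jac_def vec_eq_iff sum_distrib_left mult_ac)
qed

lemma jac_has_derivative:
 assumes "holomorphic_map_at F z" shows "(F has_derivative jac F z) (at z)"
proof (rule has_derivative_vecI)
 fix i
 have "cdiff (\<lambda>z. F z $ i) z"
  using assms by (simp add: holomorphic_map_at_def holomorphic_at_imp_cdiff)
 then show "((\<lambda>z. F z $ i) has_derivative (\<lambda>v. jac F z v $ i)) (at z)"
  using cdiff_has_derivative by (simp add: jac_def)
qed

lemma holomorphic_map_at_open:
 assumes "holomorphic_map_at F p"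
 shows "\<exists>U. open U \<and> p \<in> U \<and> (\<forall>z\<in>U. holomorphic_map_at F z)"
proof -
 have "\<forall>\<^sub>F z in nhds p. \<forall>k\<in>UNIV. holomorphic_at (\<lambda>z. F z $ k) z"
  using assms by (intro eventually_ball_finite) (auto simp: holomorphic_map_at_def holomorphic_at_eventually)
 then show ?thesis unfolding eventually_nhds holomorphic_map_at_def by simp
qed

text \<open>The inverse of a complex linear bijection is complex linear, so the inverse map of real
analysis is holomorphic.\<close>

lemma holomorphic_local_inverse:
 fixes F :: "complex^'k => complex^'k"
 assumes F: "holomorphic_map_at F p" and inj: "inj (jac F p)" and W: "open W" "p \<in> W"
 shows "\<exists>U V G. open U \<and> U \<subseteq> W \<and> p \<in> U \<and> open V \<and> F p \<in> V \<and> homeomorphism U V F G \<and>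
  (\<forall>z\<in>U. holomorphic_map_at F z) \<and> (\<forall>w\<in>V. holomorphic_map_at G w)"
proof -
 obtain U0 where U0: "open U0" "p \<in> U0" "\<And>z. z \<in> U0 \<Longrightarrow> holomorphic_map_at F z"
  using holomorphic_map_at_open[OF F] by blast
 have c: "continuous_on (U0 \<inter> W) (\<lambda>z. jac F z v)" for v
  unfolding jac_def
 proof (intro continuous_on_vec_lambda continuous_intros)
  fix i j
  have "isCont (d_dz j (\<lambda>z. F z $ i)) z" if "z \<in> U0 \<inter> W" for z
   using U0(3)[of z] that by (auto simp: holomorphic_map_at_def intro!: holomorphic_at_continuous holomorphic_at_d_dz)
  then show "continuous_on (U0 \<inter> W) (d_dz j (\<lambda>z. F z $ i))" by (simp add: continuous_at_imp_continuous_on)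
 qed
 have der: "(F has_derivative jac F z) (at z)" if "z \<in> U0 \<inter> W" for z
  using U0(3) that jac_has_derivative by blast
 have "open (U0 \<inter> W)" "p \<in> U0 \<inter> W" using U0 W by auto
 from C1_local_inverse[OF this der c inj]
 obtain U V G where *: "open U" "U \<subseteq> U0 \<inter> W" "p \<in> U" "open V" "F p \<in> V" "homeomorphism U V F G"
  and inv: "\<forall>y\<in>V. bij (jac F (G y)) \<and> (G has_derivative inv (jac F (G y))) (at y)"
  by blast
 have "cdiff (\<lambda>w. G w $ i) w" if w: "w \<in> V" for w i
 proof -
  let ?D = "inv (jac F (G w))"
  have b: "bij (jac F (G w))" using inv w by blast
  have "jac F (G w) (c *s ?D v) = c *s v" for c v
   using bij_is_surj[OF b] by (simp add: jac_scale surj_f_inv_f)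
  then have D: "?D (c *s v) = c *s ?D v" for c v
   using inv_f_eq[OF bij_is_inj[OF b]] by blast
  have "((\<lambda>w. G w $ i) has_derivative (\<lambda>v. ?D v $ i)) (at w)"
   using inv w by (intro bounded_linear.has_derivative[OF bounded_linear_vec_nth]) blast
  then show ?thesis unfolding cdiff_def
   by (intro exI[of _ "\<lambda>v. ?D v $ i"] conjI) (simp_all add: D)
 qed
 then have hG: "holomorphic_map_at G w" if "w \<in> V" for w
  using eventually_nhds_in_open[OF *(4) \<open>w \<in> V\<close>]
  unfolding holomorphic_map_at_def holomorphic_at_iff_cdiff by (auto elim: eventually_mono)
 have "U \<subseteq> W" and hF: "\<And>z. z \<in> U \<Longrightarrow> holomorphic_map_at F z" using *(2) U0(3) by auto
 then show ?thesis using * hG by blast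
qed

subsection \<open>Division by coordinates\<close>

text \<open>The terms of the power series that contain the coordinate \<open>y $ s\<close>, divided
by it, form a convergent series.\<close>

lemma holomorphic_divide_coordinate:
 fixes f :: "complex^'k => complex"
 assumes "holomorphic_at f 0"
 shows "\<exists>u. holomorphic_at u 0 \<and> (\<forall>\<^sub>F y in nhds 0. f y = f (zero_at s y) + y $ s * u y)"
proof -
 obtain a r where r: "r > 0" and hs0: "\<forall>z\<in>ball 0 r. ((\<lambda>m. a m * monomial (z - 0) m) has_sum f z) UNIV"
  using assms unfolding holomorphic_at_def by blast
 have hs: "((\<lambda>m. a m * monomial z m) has_sum f z) UNIV" if "z \<in> ball 0 r" for z
  using hs0[rule_format, OF that] by simp
 obtain \<rho> where \<rho>: "0 < \<rho>" "\<rho> < r" "(\<lambda>m. norm (a m) * \<rho> ^ sum m UNIV) summable_on UNIV"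
  by (rule has_derivative_power_series[OF r hs])
 define T where "T = (\<lambda>m :: 'k => nat. m(s := Suc (m s)))"
 have bij: "bij_betw T UNIV {m. m s > 0}"
  by (rule bij_betw_byWitness[where f' = "\<lambda>m. m(s := m s - 1)"]) (auto simp: T_def)
 have mono_T: "monomial y (T m) = y $ s * monomial y m" for y :: "complex^'k" and m
 proof -
  have "monomial y (T m) = y $ s ^ Suc (m s) * (\<Prod>i\<in>UNIV - {s}. y $ i ^ m i)"
   unfolding monomial_def T_def by (subst prod.remove[of _ s]) (auto intro!: prod.cong)
  moreover have "monomial y m = y $ s ^ m s * (\<Prod>i\<in>UNIV - {s}. y $ i ^ m i)"
   unfolding monomial_def by (subst prod.remove[of _ s]) auto
  ultimately show ?thesis by simp
 qed
 have sum_T: "sum (T m) UNIV = Suc (sum m UNIV)" for m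
  unfolding T_def by (simp add: sum.remove[of UNIV s])
 have "(\<lambda>m. norm (a m) * \<rho> ^ sum m UNIV) summable_on {m. m s > 0}"
  by (rule summable_on_subset_banach[OF \<rho>(3)]) simp
 then have "(\<lambda>m. norm (a (T m)) * \<rho> ^ sum (T m) UNIV) summable_on UNIV"
  using summable_on_reindex_bij_betw[OF bij, of "\<lambda>m. norm (a m) * \<rho> ^ sum m UNIV"] by simp
 then have sm: "(\<lambda>m. (1 / \<rho>) * (norm (a (T m)) * \<rho> ^ sum (T m) UNIV)) summable_on UNIV"
  by (rule summable_on_cmult_right)
 define u where "u = (\<lambda>y. infsum (\<lambda>m. a (T m) * monomial y m) UNIV)"
 have hu: "((\<lambda>m. a (T m) * monomial y m) has_sum u y) UNIV" if y: "y \<in> ball 0 \<rho>" for y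
 proof -
  have "(\<lambda>m. norm (a (T m) * monomial y m)) summable_on UNIV"
  proof (rule Infinite_Sum.abs_summable_on_comparison_test'[OF sm])
   fix m
   have "norm (y $ i) \<le> \<rho>" for i
    using y order_trans[OF Finite_Cartesian_Product.norm_nth_le[of y i], of \<rho>] by simp
   then have "norm (monomial y m) \<le> (\<Prod>i\<in>UNIV. \<rho> ^ m i)"
    unfolding norm_monomial by (intro prod_mono conjI power_mono) auto
   then show "norm (a (T m) * monomial y m) \<le> (1 / \<rho>) * (norm (a (T m)) * \<rho> ^ sum (T m) UNIV)"
    unfolding norm_mult sum_T using \<rho>(1) by (simp add: mult_left_mono power_sum)
  qed
  then show ?thesis unfolding u_def by (rule has_sum_infsum[OF Infinite_Sum.abs_summable_summable])
 qed
 have "holomorphic_at u 0" unfolding holomorphic_at_def using hu \<rho>(1)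
  by (intro exI[of _ "\<lambda>m. a (T m)"] exI[of _ \<rho>]) simp
 moreover have "f y = f (zero_at s y) + y $ s * u y" if y: "y \<in> ball 0 \<rho>" for y
 proof -
  have zb: "zero_at s y \<in> ball 0 r" "y \<in> ball 0 r"
  proof -
   have "norm (zero_at s y) \<le> norm y"
    unfolding norm_vec_def by (rule L2_set_mono) auto
   then show "zero_at s y \<in> ball 0 r" "y \<in> ball 0 r" using y \<rho> by auto
  qed
  have mz: "monomial (zero_at s y) m = (if m s = 0 then monomial y m else 0)" for m
  proof (cases "m s = 0")
   case True
   then have "monomial (zero_at s y) m = monomial y m" unfolding monomial_def by (intro prod.cong) auto
   then show ?thesis using True by simp
  next
   case False
   then have "monomial (zero_at s y) m = 0" unfolding monomial_def by (intro prod_zero bexI[of _ s]) auto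
   then show ?thesis using False by simp
  qed
  have "((\<lambda>m. a m * monomial y m - a m * monomial (zero_at s y) m) has_sum (f y - f (zero_at s y))) UNIV"
   using has_sum_add[OF hs[OF zb(2)] has_sum_cmult_right[OF hs[OF zb(1)], of "-1"]] by simp
  moreover have "((\<lambda>m. a m * monomial y m - a m * monomial (zero_at s y) m) has_sum (f y - f (zero_at s y))) UNIV
    \<longleftrightarrow> ((\<lambda>m. a m * monomial y m) has_sum (f y - f (zero_at s y))) {m. m s > 0}"
   by (rule has_sum_cong_neutral) (auto simp: mz)
  ultimately have "((\<lambda>m. a m * monomial y m) has_sum (f y - f (zero_at s y))) {m. m s > 0}" by blast
  then have "((\<lambda>m. a (T m) * monomial y (T m)) has_sum (f y - f (zero_at s y))) UNIV"
   using has_sum_reindex_bij_betw[OF bij, of "\<lambda>m. a m * monomial y m"] by simp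
  moreover have "((\<lambda>m. y $ s * (a (T m) * monomial y m)) has_sum (y $ s * u y)) UNIV"
   by (rule has_sum_cmult_right[OF hu[OF y]])
  moreover have "(\<lambda>m. a (T m) * monomial y (T m)) = (\<lambda>m. y $ s * (a (T m) * monomial y m))"
   unfolding mono_T by (simp add: mult_ac)
  ultimately have "f y - f (zero_at s y) = y $ s * u y"
   using has_sum_unique by metis
  then show ?thesis by (simp add: algebra_simps)
 qed
 moreover have "\<forall>\<^sub>F y in nhds (0::complex^'k). y \<in> ball 0 \<rho>"
  using \<rho>(1) by (intro eventually_nhds_in_open) auto
 ultimately show ?thesis by (metis (mono_tags, lifting) eventually_mono)
qed

definition zero_on :: "'k set => complex^'k => complex^'k" where
 "zero_on S z = (\<chi> i. if i \<in> S then 0 else z $ i)"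

lemma zero_on_nth [simp]: "zero_on S z $ i = (if i \<in> S then 0 else z $ i)"
 by (simp add: zero_on_def)

lemma holomorphic_map_at_zero_at: "holomorphic_map_at (zero_at s) p"
proof -
 have "holomorphic_at (\<lambda>z. if i = s then 0 else z $ i) p" for i
  by (cases "i = s") (auto intro: hol_intros)
 then show ?thesis by (simp add: holomorphic_map_at_def)
qed

lemma zero_at_0 [simp]: "zero_at s 0 = 0" and zero_on_0 [simp]: "zero_on S 0 = 0"
 by (simp_all add: vec_eq_iff)

lemma hadamard_zero:
 fixes f :: "complex^'k => complex"
 assumes "finite S" "holomorphic_at f 0"
 shows "\<exists>u. (\<forall>s. holomorphic_at (u s) 0) \<and> (\<forall>\<^sub>F y in nhds 0. f y = f (zero_on S y) + (\<Sum>s\<in>S. y $ s * u s y))"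
 using assms(1)
proof induction
 case empty
 have "zero_on {} y = y" for y :: "complex^'k" by (simp add: vec_eq_iff)
 then show ?case by (intro exI[of _ "\<lambda>_ _. 0"]) (auto intro: hol_intros)
next
 case (insert s S)
 then obtain u where u: "\<And>s. holomorphic_at (u s) 0"
  "\<forall>\<^sub>F y in nhds 0. f y = f (zero_on S y) + (\<Sum>s\<in>S. y $ s * u s y)" by blast
 obtain v where v: "holomorphic_at v 0" "\<forall>\<^sub>F y in nhds 0. f y = f (zero_at s y) + y $ s * v y"
  using holomorphic_divide_coordinate[OF assms(2)] by blast
 define w where "w = (\<lambda>i. if i = s then v else (\<lambda>y. u i (zero_at s y)))"
 have "holomorphic_at (w i) 0" for i
  unfolding w_def using holomorphic_at_compose[OF holomorphic_map_at_zero_at, of "u i" s 0] u(1) v(1) by simp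
 moreover have "filterlim (zero_at s) (nhds 0) (nhds (0::complex^'k))"
  using holomorphic_map_at_tendsto[OF holomorphic_map_at_zero_at[of s 0]] by simp
 then have "\<forall>\<^sub>F y in nhds 0. f (zero_at s y) = f (zero_on S (zero_at s y)) + (\<Sum>i\<in>S. zero_at s y $ i * u i (zero_at s y))"
  by (rule eventually_compose_filterlim[OF u(2)])
 with v(2) have "\<forall>\<^sub>F y in nhds 0. f y = f (zero_on (insert s S) y) + (\<Sum>i\<in>insert s S. y $ i * w i y)"
 proof eventually_elim
  case (elim y)
  have "zero_on S (zero_at s y) = zero_on (insert s S) y" by (auto simp: vec_eq_iff)
  moreover have "(\<Sum>i\<in>S. zero_at s y $ i * u i (zero_at s y)) = (\<Sum>i\<in>S. y $ i * w i y)"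
   using insert.hyps by (intro sum.cong) (auto simp: w_def)
  moreover have "w s y = v y" by (simp add: w_def)
  ultimately show ?case using elim insert.hyps by (simp add: algebra_simps)
 qed
 ultimately show ?case by blast
qed

lemma filterlim_translate: "filterlim (\<lambda>z. z - q) (nhds 0) (nhds (q::'a::real_normed_vector))"
 using tendsto_diff[OF tendsto_ident_at[of q UNIV] tendsto_const[of q]]
 by (auto intro!: tendsto_eq_intros simp: filterlim_ident)

lemma hadamard_point:
 fixes g :: "complex^'k => complex"
 assumes "holomorphic_at g q"
 shows "\<exists>u. (\<forall>s. holomorphic_at (u s) q) \<and> (\<forall>\<^sub>F y in nhds q. g y = g q + (\<Sum>s\<in>UNIV. (y $ s - q $ s) * u s y))"
proof -
 have t: "holomorphic_map_at (\<lambda>z. z + q) 0" "holomorphic_map_at (\<lambda>z. z - q) q"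
  unfolding holomorphic_map_at_def by (auto intro!: hol_intros)
 have "holomorphic_at (\<lambda>z. g (z + q)) 0"
  using holomorphic_at_compose[OF t(1)] assms by simp
 then obtain u where u: "\<And>s. holomorphic_at (u s) 0"
  "\<forall>\<^sub>F y in nhds 0. g (y + q) = g (zero_on UNIV y + q) + (\<Sum>s\<in>UNIV. y $ s * u s y)"
  using hadamard_zero[of UNIV "\<lambda>z. g (z + q)"] by auto
 have "\<forall>\<^sub>F y in nhds q. g (y - q + q) = g (zero_on UNIV (y - q) + q) + (\<Sum>s\<in>UNIV. (y - q) $ s * u s (y - q))"
  by (rule eventually_compose_filterlim[OF u(2) filterlim_translate])
 moreover have "zero_on UNIV y = 0" for y :: "complex^'k" by (simp add: vec_eq_iff)
 ultimately have "\<forall>\<^sub>F y in nhds q. g y = g q + (\<Sum>s\<in>UNIV. (y $ s - q $ s) * u s (y - q))" by simp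
 moreover have "holomorphic_at (\<lambda>y. u s (y - q)) q" for s
  using holomorphic_at_compose[OF t(2)] u(1) by simp
 ultimately show ?thesis by (intro exI[of _ "\<lambda>s y. u s (y - q)"]) blast
qed

subsection \<open>Codimension\<close>

definition fsub :: "('a => complex) set => bool" where
 "fsub W \<longleftrightarrow> (\<lambda>_. 0) \<in> W \<and> (\<forall>f\<in>W. \<forall>g\<in>W. (\<lambda>z. f z + g z) \<in> W) \<and> (\<forall>c. \<forall>f\<in>W. (\<lambda>z. c * f z) \<in> W)"

lemma fsub_add: "fsub W \<Longrightarrow> f \<in> W \<Longrightarrow> g \<in> W \<Longrightarrow> (\<lambda>z. f z + g z) \<in> W"
 and fsub_scale: "fsub W \<Longrightarrow> f \<in> W \<Longrightarrow> (\<lambda>z. c * f z) \<in> W"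
 and fsub_0: "fsub W \<Longrightarrow> (\<lambda>_. 0) \<in> W"
 by (auto simp: fsub_def)

lemma fsub_sum:
 assumes "fsub W" "\<And>i. i \<in> I \<Longrightarrow> f i \<in> W" shows "(\<lambda>z. \<Sum>i\<in>I. f i z) \<in> W"
 using assms(2) by (induction I rule: infinite_finite_induct) (auto intro: fsub_0 fsub_add assms(1))

lemma fsub_diff: "fsub W \<Longrightarrow> f \<in> W \<Longrightarrow> g \<in> W \<Longrightarrow> (\<lambda>z. f z - g z) \<in> W"
 using fsub_add[of W f "\<lambda>z. (-1) * g z"] fsub_scale[of W g "-1"] by simp

text \<open>Families indexed by \<open>i < k\<close> can be transported along maps under which
elements of a set of functions might be identified.\<close>

lemma has_codim_iff:
 assumes "fsub W"
 shows "has_codim V W k \<longleftrightarrow>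
  (\<exists>b. (\<forall>i<k. b i \<in> V) \<and> (\<forall>g\<in>V. \<exists>c. (\<lambda>z. g z - (\<Sum>i<k. c i * b i z)) \<in> W) \<and>
    (\<forall>c. (\<lambda>z. \<Sum>i<k. c i * b i z) \<in> W \<longrightarrow> (\<forall>i<k. c i = 0)))" (is "_ \<longleftrightarrow> (\<exists>b. ?P b)")
proof
 assume "has_codim V W k"
 then obtain B where B: "finite B" "card B = k" "B \<subseteq> V"
  "\<And>g. g \<in> V \<Longrightarrow> \<exists>c. (\<lambda>z. g z - (\<Sum>b\<in>B. c b * b z)) \<in> W"
  "\<And>c. (\<lambda>z. \<Sum>b\<in>B. c b * b z) \<in> W \<Longrightarrow> \<forall>b\<in>B. c b = 0"
  unfolding has_codim_def by blast
 obtain b where b: "bij_betw b {..<k} B"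
  using ex_bij_betw_nat_finite[OF B(1)] B(2) by (auto simp: lessThan_atLeast0)
 have re: "(\<Sum>x\<in>B. c x * x z) = (\<Sum>i<k. c (b i) * b i z)" for c z
  using sum.reindex_bij_betw[OF b, of "\<lambda>x. c x * x z"] by simp
 have "?P b"
 proof (intro conjI ballI allI impI)
  show "b i \<in> V" if "i < k" for i using b B(3) that by (auto simp: bij_betw_def)
  show "\<exists>c. (\<lambda>z. g z - (\<Sum>i<k. c i * b i z)) \<in> W" if "g \<in> V" for g
  proof -
   obtain c where "(\<lambda>z. g z - (\<Sum>b\<in>B. c b * b z)) \<in> W" using B(4)[OF \<open>g \<in> V\<close>] by blast
   then show ?thesis unfolding re by (intro exI[of _ "\<lambda>i. c (b i)"])
  qed
  fix c i assume c: "(\<lambda>z. \<Sum>i<k. c i * b i z) \<in> W" and "i < k"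
  define c' where "c' = (\<lambda>x. c (inv_into {..<k} b x))"
  have inv: "c' (b i) = c i" if "i < k" for i
   using b that by (simp add: c'_def bij_betw_def inv_into_f_f)
  have "(\<Sum>i<k. c' (b i) * b i z) = (\<Sum>i<k. c i * b i z)" for z
   by (rule sum.cong) (simp_all add: inv)
  then have "(\<lambda>z. \<Sum>x\<in>B. c' x * x z) \<in> W" unfolding re using c by simp
  from B(5)[OF this] have "c' (b i) = 0" using b \<open>i < k\<close> by (auto simp: bij_betw_def)
  then show "c i = 0" using inv[OF \<open>i < k\<close>] by simp
 qed
 then show "\<exists>b. ?P b" by (rule exI[of ?P b])
next
 assume "\<exists>b. ?P b"
 then obtain b where b: "\<And>i. i < k \<Longrightarrow> b i \<in> V" "\<And>g. g \<in> V \<Longrightarrow> \<exists>c. (\<lambda>z. g z - (\<Sum>i<k. c i * b i z)) \<in> W"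
  "\<And>c. (\<lambda>z. \<Sum>i<k. c i * b i z) \<in> W \<Longrightarrow> (\<forall>i<k. c i = 0)" by blast
 have inj: "inj_on b {..<k}"
 proof (rule inj_onI, rule ccontr)
  fix i j assume ij: "i \<in> {..<k}" "j \<in> {..<k}" "b i = b j" "i \<noteq> j"
  let ?c = "\<lambda>l. if l = i then 1 else if l = j then -1 else (0::complex)"
  have "(\<Sum>l<k. ?c l * b l z) = 0" for z
  proof -
   have "(\<Sum>l<k. ?c l * b l z) = (\<Sum>l\<in>{i, j}. ?c l * b l z)"
    using ij by (intro sum.mono_neutral_right) auto
   then show ?thesis using ij by simp
  qed
  then have "(\<lambda>z. \<Sum>l<k. ?c l * b l z) \<in> W" using fsub_0[OF assms] by simp
  then have "?c i = 0" using b(3)[of ?c] ij(1) by blast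
  then show False by simp
 qed
 have re: "(\<Sum>x\<in>b ` {..<k}. c x * x z) = (\<Sum>i<k. c (b i) * b i z)" for c z
  using inj by (simp add: sum.reindex)
 show "has_codim V W k" unfolding has_codim_def
 proof (intro exI[of _ "b ` {..<k}"] conjI ballI allI impI)
  show "card (b ` {..<k}) = k" using card_image[OF inj] by simp
  show "\<exists>c. (\<lambda>z. g z - (\<Sum>x\<in>b ` {..<k}. c x * x z)) \<in> W" if g: "g \<in> V" for g
  proof -
   obtain c where c: "(\<lambda>z. g z - (\<Sum>i<k. c i * b i z)) \<in> W" using b(2)[OF g] by blast
   have "(\<Sum>x\<in>b ` {..<k}. c (inv_into {..<k} b x) * x z) = (\<Sum>i<k. c i * b i z)" for z
    unfolding re using inj by (intro sum.cong) (auto simp: inv_into_f_f)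
   then show ?thesis using c by (intro exI[of _ "\<lambda>x. c (inv_into {..<k} b x)"]) simp
  qed
  show "c x = 0" if "(\<lambda>z. \<Sum>x\<in>b ` {..<k}. c x * x z) \<in> W" "x \<in> b ` {..<k}" for c x
   using b(3)[of "\<lambda>i. c (b i)"] that unfolding re by auto
 qed (use b in auto)
qed

lemma has_codim_transfer:
 fixes \<phi> :: "'b => 'a"
 assumes sub: "fsub W" "fsub W'"
  and maps: "\<And>g. g \<in> V \<Longrightarrow> (\<lambda>w. g (\<phi> w)) \<in> V'"
  and iff: "\<And>g. g \<in> V \<Longrightarrow> (\<lambda>w. g (\<phi> w)) \<in> W' \<longleftrightarrow> g \<in> W"
  and surj: "\<And>u. u \<in> V' \<Longrightarrow> \<exists>g\<in>V. (\<lambda>w. u w - g (\<phi> w)) \<in> W'"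
  and subV: "fsub V"
 shows "has_codim V W k \<longleftrightarrow> has_codim V' W' k"
proof
 assume "has_codim V W k"
 then obtain b where b: "\<And>i. i < k \<Longrightarrow> b i \<in> V" "\<And>g. g \<in> V \<Longrightarrow> \<exists>c. (\<lambda>z. g z - (\<Sum>i<k. c i * b i z)) \<in> W"
  "\<And>c. (\<lambda>z. \<Sum>i<k. c i * b i z) \<in> W \<Longrightarrow> (\<forall>i<k. c i = 0)" unfolding has_codim_iff[OF sub(1)] by blast
 have bV: "(\<lambda>z. \<Sum>i<k. c i * b i z) \<in> V" for c
  by (rule fsub_sum[OF subV]) (auto intro: fsub_scale[OF subV] b(1))
 show "has_codim V' W' k" unfolding has_codim_iff[OF sub(2)]
 proof (intro exI[of _ "\<lambda>i w. b i (\<phi> w)"] conjI ballI allI)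
  show "i < k \<longrightarrow> (\<lambda>w. b i (\<phi> w)) \<in> V'" for i using b(1) maps by blast
  show "\<exists>c. (\<lambda>z. u z - (\<Sum>i<k. c i * b i (\<phi> z))) \<in> W'" if "u \<in> V'" for u
  proof -
   obtain g where g: "g \<in> V" "(\<lambda>w. u w - g (\<phi> w)) \<in> W'" using surj[OF \<open>u \<in> V'\<close>] by blast
   obtain c where c: "(\<lambda>z. g z - (\<Sum>i<k. c i * b i z)) \<in> W" using b(2)[OF g(1)] by blast
   have "(\<lambda>z. g z - (\<Sum>i<k. c i * b i z)) \<in> V" by (rule fsub_diff[OF subV g(1) bV])
   from iff[OF this] c have "(\<lambda>w. g (\<phi> w) - (\<Sum>i<k. c i * b i (\<phi> w))) \<in> W'" by simp
   from fsub_add[OF sub(2) g(2) this] show ?thesis by (intro exI[of _ c]) simp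
  qed
  show "(\<lambda>z. \<Sum>i<k. c i * b i (\<phi> z)) \<in> W' \<longrightarrow> (\<forall>i<k. c i = 0)" for c
   using iff[OF bV[of c]] b(3)[of c] by blast
 qed
next
 assume "has_codim V' W' k"
 then obtain b where b: "\<And>i. i < k \<Longrightarrow> b i \<in> V'" "\<And>g. g \<in> V' \<Longrightarrow> \<exists>c. (\<lambda>z. g z - (\<Sum>i<k. c i * b i z)) \<in> W'"
  "\<And>c. (\<lambda>z. \<Sum>i<k. c i * b i z) \<in> W' \<Longrightarrow> (\<forall>i<k. c i = 0)" unfolding has_codim_iff[OF sub(2)] by blast
 have "\<forall>i. \<exists>g. i < k \<longrightarrow> g \<in> V \<and> (\<lambda>w. b i w - g (\<phi> w)) \<in> W'" using surj b(1) by blast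
 then obtain l where l: "\<And>i. i < k \<Longrightarrow> l i \<in> V" "\<And>i. i < k \<Longrightarrow> (\<lambda>w. b i w - l i (\<phi> w)) \<in> W'"
  using choice[of "\<lambda>i g. i < k \<longrightarrow> g \<in> V \<and> (\<lambda>w. b i w - g (\<phi> w)) \<in> W'"] by blast
 have d: "(\<lambda>w. \<Sum>i<k. c i * (b i w - l i (\<phi> w))) \<in> W'" for c
  by (rule fsub_sum[OF sub(2)]) (auto intro: fsub_scale[OF sub(2)] l(2))
 have lV: "(\<lambda>z. \<Sum>i<k. c i * l i z) \<in> V" for c
  by (rule fsub_sum[OF subV]) (auto intro: fsub_scale[OF subV] l(1))
 show "has_codim V W k" unfolding has_codim_iff[OF sub(1)]
 proof (intro exI[of _ l] conjI ballI allI)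
  show "i < k \<longrightarrow> l i \<in> V" for i using l by blast
  show "\<exists>c. (\<lambda>z. g z - (\<Sum>i<k. c i * l i z)) \<in> W" if g: "g \<in> V" for g
  proof -
   obtain c where c: "(\<lambda>w. g (\<phi> w) - (\<Sum>i<k. c i * b i w)) \<in> W'" using b(2)[OF maps[OF g]] by blast
   have "(\<lambda>w. g (\<phi> w) - (\<Sum>i<k. c i * l i (\<phi> w))) \<in> W'"
    using fsub_add[OF sub(2) c d[of c]] by (simp add: right_diff_distrib sum_subtractf)
   then show ?thesis using iff[OF fsub_diff[OF subV g lV[of c]]] by blast
  qed
  show "(\<lambda>z. \<Sum>i<k. c i * l i z) \<in> W \<longrightarrow> (\<forall>i<k. c i = 0)" for c
  proof
   assume "(\<lambda>z. \<Sum>i<k. c i * l i z) \<in> W"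
   then have "(\<lambda>w. \<Sum>i<k. c i * l i (\<phi> w)) \<in> W'" using iff[OF lV[of c]] by simp
   from fsub_add[OF sub(2) this d[of c]] have "(\<lambda>w. \<Sum>i<k. c i * b i w) \<in> W'"
    by (simp add: right_diff_distrib sum_subtractf)
   then show "\<forall>i<k. c i = 0" using b(3) by blast
  qed
 qed
qed

lemma fsub_conv_series: "fsub (conv_series x)"
 unfolding fsub_def conv_series_def by (auto intro: hol_intros)

lemma comp_idealI:
 assumes "holomorphic_at g x" "\<And>j. holomorphic_at (u j) x"
  "\<forall>\<^sub>F z in nhds x. g z = (\<Sum>j\<in>UNIV. u j z * (f z $ j - f x $ j))"
 shows "g \<in> comp_ideal f x"
 using assms unfolding comp_ideal_def conv_series_def by blast

lemma comp_ideal_mult_add: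
 assumes "g \<in> comp_ideal f x" "holomorphic_at a x" "h \<in> comp_ideal f x"
 shows "(\<lambda>z. a z * g z + h z) \<in> comp_ideal f x"
proof -
 obtain u v where uv: "\<And>j. holomorphic_at (u j) x" "\<forall>\<^sub>F z in nhds x. g z = (\<Sum>j\<in>UNIV. u j z * (f z $ j - f x $ j))"
  "\<And>j. holomorphic_at (v j) x" "\<forall>\<^sub>F z in nhds x. h z = (\<Sum>j\<in>UNIV. v j z * (f z $ j - f x $ j))"
  and gh: "holomorphic_at g x" "holomorphic_at h x"
  using assms(1,3) unfolding comp_ideal_def conv_series_def by blast
 show ?thesis
 proof (rule comp_idealI[where u = "\<lambda>j z. a z * u j z + v j z"])
  show "\<forall>\<^sub>F z in nhds x. a z * g z + h z = (\<Sum>j\<in>UNIV. (a z * u j z + v j z) * (f z $ j - f x $ j))"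
   using uv(2,4) by eventually_elim (simp only: distrib_right sum.distrib sum_distrib_left mult.assoc)
 qed (intro hol_intros gh uv assms)+
qed

lemma zero_in_comp_ideal: "(\<lambda>_. 0) \<in> comp_ideal f x"
 by (rule comp_idealI[where u = "\<lambda>_ _. 0"]) (auto intro: hol_intros)

lemma fsub_comp_ideal: "fsub (comp_ideal f x)"
 unfolding fsub_def
 using comp_ideal_mult_add[OF _ holomorphic_at_const, of _ f x] zero_in_comp_ideal[of f x]
  comp_ideal_mult_add[OF _ holomorphic_at_const[of 1], of _ f x] by fastforce

lemma comp_ideal_sum:
 assumes "\<And>i. i \<in> I \<Longrightarrow> g i \<in> comp_ideal f x" "\<And>i. i \<in> I \<Longrightarrow> holomorphic_at (a i) x"
 shows "(\<lambda>z. \<Sum>i\<in>I. a i z * g i z) \<in> comp_ideal f x"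
 using assms
proof (induction I rule: infinite_finite_induct)
 case (insert i I)
 then show ?case using comp_ideal_mult_add[of "g i" f x "a i" "\<lambda>z. \<Sum>i\<in>I. a i z * g i z"] by simp
qed (auto intro: zero_in_comp_ideal)

lemma comp_ideal_cong:
 assumes "g \<in> comp_ideal f x" "\<forall>\<^sub>F z in nhds x. g z = h z" shows "h \<in> comp_ideal f x"
proof -
 obtain u where u: "\<And>j. holomorphic_at (u j) x" "\<forall>\<^sub>F z in nhds x. g z = (\<Sum>j\<in>UNIV. u j z * (f z $ j - f x $ j))"
  and g: "holomorphic_at g x" using assms(1) unfolding comp_ideal_def conv_series_def by blast
 show ?thesis
 proof (rule comp_idealI[where u = u])
  show "holomorphic_at h x" using g holomorphic_at_cong[OF assms(2)] by blast
  show "\<forall>\<^sub>F z in nhds x. h z = (\<Sum>j\<in>UNIV. u j z * (f z $ j - f x $ j))"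
   using assms(2) u(2) by eventually_elim simp
 qed (rule u)
qed

lemma holomorphic_at_power [hol_intros]: "holomorphic_at f p \<Longrightarrow> holomorphic_at (\<lambda>z. f z ^ n) p"
 by (induction n) (auto intro: hol_intros)

subsection \<open>Finite germs have nondegenerate points\<close>

lemma linear_dependence:
 fixes M :: "'a => 'b => complex"
 assumes "finite B" "finite A" "card B < card A"
 shows "\<exists>d. (\<exists>a\<in>A. d a \<noteq> 0) \<and> (\<forall>b\<in>B. (\<Sum>a\<in>A. d a * M a b) = 0)"
 using assms
proof (induction B arbitrary: A M)
 case empty
 then have "A \<noteq> {}" by auto
 then show ?case by (intro exI[of _ "\<lambda>_. 1"]) auto
next
 case (insert b B)
 show ?case
 proof (cases "\<forall>a\<in>A. M a b = 0")
  case True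
  have "card B < card A" using insert by simp
  then obtain d where "\<exists>a\<in>A. d a \<noteq> 0" "\<forall>b\<in>B. (\<Sum>a\<in>A. d a * M a b) = 0"
   using insert.IH[OF insert.prems(1), of M] by blast
  then show ?thesis using True by (intro exI[of _ d]) auto
 next
  case False
  then obtain a0 where a0: "a0 \<in> A" "M a0 b \<noteq> 0" by blast
  define M' where "M' = (\<lambda>a c. M a c - M a b / M a0 b * M a0 c)"
  have "card B < card (A - {a0})" using insert a0 by simp
  then obtain d' where d': "\<exists>a\<in>A - {a0}. d' a \<noteq> 0" "\<forall>c\<in>B. (\<Sum>a\<in>A - {a0}. d' a * M' a c) = 0"
   using insert.IH[of "A - {a0}" M'] insert.prems(1) by blast
  define s where "s = - (\<Sum>a\<in>A - {a0}. d' a * M a b) / M a0 b"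
  define d where "d = (\<lambda>a. if a = a0 then s else d' a)"
  have split: "(\<Sum>a\<in>A. d a * M a c) = s * M a0 c + (\<Sum>a\<in>A - {a0}. d' a * M a c)" for c
   by (subst sum.remove[OF insert.prems(1) a0(1)]) (auto simp: d_def intro!: sum.cong)
  have "(\<Sum>a\<in>A. d a * M a c) = 0" if c: "c \<in> insert b B" for c
  proof (cases "c = b")
   case True
   then show ?thesis unfolding split s_def using a0 by simp
  next
   case False
   then have "(\<Sum>a\<in>A - {a0}. d' a * M' a c) = 0" using d'(2) c by blast
   moreover have "(\<Sum>a\<in>A - {a0}. d' a * M' a c) = (\<Sum>a\<in>A - {a0}. d' a * M a c) - (\<Sum>a\<in>A - {a0}. d' a * M a b) * (M a0 c / M a0 b)"
    unfolding M'_def by (simp add: right_diff_distrib sum_subtractf sum_distrib_right mult.assoc sum_divide_distrib)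
   ultimately show ?thesis unfolding split s_def by (simp add: field_simps)
  qed
  moreover have "\<exists>a\<in>A. d a \<noteq> 0" using d'(1) by (auto simp: d_def)
  ultimately show ?thesis by blast
 qed
qed

text \<open>The powers of a coordinate up to the exponent \<open>k\<close> satisfy a linear relation
modulo the ideal. The lowest power that occurs, times a unit, therefore lies in the ideal.\<close>

lemma power_in_comp_ideal:
 fixes f :: "complex^'k => complex^'k"
 assumes "has_codim (conv_series 0) (comp_ideal f 0) k"
 shows "(\<lambda>z. z $ i ^ k) \<in> comp_ideal f 0"
proof -
 let ?W = "comp_ideal f 0"
 obtain b where b: "\<And>g. g \<in> conv_series 0 \<Longrightarrow> \<exists>c. (\<lambda>z. g z - (\<Sum>i<k. c i * b i z)) \<in> ?W"
  using assms unfolding has_codim_iff[OF fsub_comp_ideal] by blast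
 have hp: "holomorphic_at (\<lambda>z. z $ i ^ a) 0" for a
  by (intro hol_intros)
 have "\<forall>a. \<exists>c. (\<lambda>z. z $ i ^ a - (\<Sum>j<k. c j * b j z)) \<in> ?W"
  using b hp unfolding conv_series_def by blast
 then obtain c where c: "\<And>a. (\<lambda>z. z $ i ^ a - (\<Sum>j<k. c a j * b j z)) \<in> ?W"
  using choice[of "\<lambda>a c. (\<lambda>z. z $ i ^ a - (\<Sum>j<k. c j * b j z)) \<in> ?W"] by blast
 obtain d where d: "\<exists>a\<in>{..k}. d a \<noteq> 0" "\<forall>j\<in>{..<k}. (\<Sum>a\<in>{..k}. d a * c a j) = 0"
  using linear_dependence[of "{..<k}" "{..k}" c] by auto
 have "(\<lambda>z. \<Sum>a\<le>k. d a * (z $ i ^ a - (\<Sum>j<k. c a j * b j z))) \<in> ?W"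
  by (rule fsub_sum[OF fsub_comp_ideal]) (auto intro!: fsub_scale[OF fsub_comp_ideal] c)
 moreover have "(\<Sum>a\<le>k. d a * (z $ i ^ a - (\<Sum>j<k. c a j * b j z))) = (\<Sum>a\<le>k. d a * z $ i ^ a)" for z
 proof -
  have "(\<Sum>a\<le>k. d a * (\<Sum>j<k. c a j * b j z)) = (\<Sum>j<k. (\<Sum>a\<le>k. d a * c a j) * b j z)"
   unfolding sum_distrib_left sum_distrib_right by (subst sum.swap) (simp add: mult.assoc)
  also have "\<dots> = 0" using d(2) by simp
  finally show ?thesis by (simp add: right_diff_distrib sum_subtractf)
 qed
 ultimately have W: "(\<lambda>z. \<Sum>a\<le>k. d a * z $ i ^ a) \<in> ?W" by simp
 define a0 where "a0 = (LEAST a. d a \<noteq> 0)"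
 obtain a1 where a1: "a1 \<le> k" "d a1 \<noteq> 0" using d(1) by auto
 have "d a0 \<noteq> 0" unfolding a0_def by (rule LeastI[of "\<lambda>a. d a \<noteq> 0", OF a1(2)])
 moreover have "a0 \<le> a1" unfolding a0_def by (rule Least_le[of "\<lambda>a. d a \<noteq> 0", OF a1(2)])
 moreover have "d a = 0" if "a < a0" for a
  using not_less_Least[of a "\<lambda>a. d a \<noteq> 0"] that unfolding a0_def by blast
 ultimately have a0: "d a0 \<noteq> 0" "a0 \<le> k" "\<And>a. a < a0 \<Longrightarrow> d a = 0"
  using a1(1) by auto
 define v where "v = (\<lambda>z::complex^'k. \<Sum>a=a0..k. d a * z $ i ^ (a - a0))"
 have v_hol: "holomorphic_at v 0" unfolding v_def by (intro hol_intros hp)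
 have v0: "v 0 = d a0"
 proof -
  have "v 0 = (\<Sum>a=a0..k. if a = a0 then d a0 else 0)" unfolding v_def by (intro sum.cong) (auto simp: power_0_left)
  then show ?thesis using a0(2) by simp
 qed
 have fac: "(\<Sum>a\<le>k. d a * z $ i ^ a) = z $ i ^ a0 * v z" for z :: "complex^'k"
 proof -
  have "(\<Sum>a\<le>k. d a * z $ i ^ a) = (\<Sum>a=a0..k. d a * z $ i ^ a)"
   by (rule sum.mono_neutral_right) (use a0 in auto)
  also have "\<dots> = (\<Sum>a=a0..k. z $ i ^ a0 * (d a * z $ i ^ (a - a0)))"
   by (rule sum.cong) (auto simp flip: power_add)
  finally show ?thesis by (simp add: v_def sum_distrib_left)
 qed
 have "\<forall>\<^sub>F z in nhds 0. v z \<noteq> 0"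
 proof (rule tendsto_imp_eventually_ne)
  show "(v \<longlongrightarrow> v 0) (nhds 0)"
   using holomorphic_at_continuous[OF v_hol] unfolding isCont_def tendsto_at_iff_tendsto_nhds .
 qed (use v0 a0(1) in simp)
 then have "\<forall>\<^sub>F z in nhds 0. (z $ i ^ (k - a0) / v z) * (\<Sum>a\<le>k. d a * z $ i ^ a) + 0 = z $ i ^ k"
  by eventually_elim (use a0(2) in \<open>simp add: fac flip: power_add\<close>)
 moreover have "(\<lambda>z. (z $ i ^ (k - a0) / v z) * (\<Sum>a\<le>k. d a * z $ i ^ a) + 0) \<in> ?W"
  by (rule comp_ideal_mult_add[OF W _ zero_in_comp_ideal]) (use v0 a0 in \<open>auto intro!: hol_intros hp v_hol\<close>)
 ultimately show ?thesis by (rule comp_ideal_cong[rotated])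
qed

text \<open>The number \<open>C\<close> is the norm of the power series on the polydisc of radius
\<open>R\<close>.\<close>

definition series_at :: "(complex^'k => complex) => real => real => bool" where
 "series_at f R C \<longleftrightarrow> (\<exists>a. ((\<lambda>e. norm (a e) * R ^ sum e UNIV) has_sum C) UNIV \<and>
   (\<forall>z\<in>ball 0 R. ((\<lambda>e. a e * monomial z e) has_sum f z) UNIV))"

lemma series_at_eventually:
 fixes f :: "complex^'k => complex"
 assumes "holomorphic_at f 0"
 shows "\<forall>\<^sub>F R in at_right 0. \<exists>C. series_at f R C"
proof -
 obtain a r where r: "r > 0" and hs0: "\<forall>z\<in>ball 0 r. ((\<lambda>e. a e * monomial (z - 0) e) has_sum f z) UNIV"
  using assms unfolding holomorphic_at_def by blast
 have hs: "((\<lambda>e. a e * monomial z e) has_sum f z) UNIV" if "z \<in> ball 0 r" for z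
  using hs0[rule_format, OF that] by simp
 obtain R0 where R0: "0 < R0" "R0 < r" "(\<lambda>e. norm (a e) * R0 ^ sum e UNIV) summable_on UNIV"
  by (rule has_derivative_power_series[OF r hs])
 have "\<exists>C. series_at f R C" if R: "0 < R" "R < R0" for R
 proof -
  have "(\<lambda>e. norm (norm (a e) * R ^ sum e UNIV)) summable_on UNIV"
   by (rule Infinite_Sum.abs_summable_on_comparison_test'[OF R0(3)])
     (use R in \<open>auto intro!: mult_left_mono power_mono simp: norm_mult\<close>)
  then have "(\<lambda>e. norm (a e) * R ^ sum e UNIV) summable_on UNIV"
   by (rule Infinite_Sum.abs_summable_summable)
  then have "((\<lambda>e. norm (a e) * R ^ sum e UNIV) has_sum (\<Sum>\<^sub>\<infinity>e. norm (a e) * R ^ sum e UNIV)) UNIV"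
   by (rule has_sum_infsum)
  moreover have "\<forall>z\<in>ball 0 R. ((\<lambda>e. a e * monomial z e) has_sum f z) UNIV"
   using hs R R0(2) by simp
  ultimately show ?thesis unfolding series_at_def by blast
 qed
 then show ?thesis unfolding eventually_at_right_field using R0(1) by blast
qed

lemma has_sum_finite_sum:
 assumes "finite F" "\<And>z. z \<in> F \<Longrightarrow> ((\<lambda>\<beta>. g z \<beta>) has_sum (s z :: complex)) A"
 shows "((\<lambda>\<beta>. \<Sum>z\<in>F. g z \<beta>) has_sum (\<Sum>z\<in>F. s z)) A"
 using assms by (induction F) (auto intro!: has_sum_add)

lemma monomial_add: "monomial z (\<lambda>i. e i + \<beta> i) = monomial z e * monomial z \<beta>"
 by (simp add: monomial_def power_add prod.distrib)

text \<open>Assume that more than \<open>k\<close> points lie in one fibre, over \<open>w\<close>. Some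
functional \<open>\<mu>\<close> on functions on this set annihilates the \<open>k\<close> generators
\<open>b i\<close> of the quotient. Modulo these, every monomial is a combination of the components
of \<open>h\<close> with controlled coefficients, and on the fibre \<open>h\<close> is the small
constant \<open>w\<close>. So each bound for the values of \<open>\<mu>\<close> on monomials can be
halved, and \<open>\<mu>\<close> annihilates all polynomials, although polynomials separate
points.\<close>

lemma fiber_bound:
 fixes h :: "complex^'k => complex^'k"
 assumes codim: "has_codim (conv_series 0) (comp_ideal h 0) k" and hol: "holomorphic_map_at h 0" and h0: "h 0 = 0"
 shows "\<exists>\<delta>>0. \<forall>F w. finite F \<and> F \<subseteq> ball 0 \<delta> \<and> (\<forall>z\<in>F. h z = w) \<longrightarrow> card F \<le> k"
proof -
 let ?W = "comp_ideal h 0"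
 obtain b where b: "\<And>g. g \<in> conv_series 0 \<Longrightarrow> \<exists>c. (\<lambda>z. g z - (\<Sum>i<k. c i * b i z)) \<in> ?W"
  using codim unfolding has_codim_iff[OF fsub_comp_ideal] by blast
 have ideal: "\<exists>u. (\<forall>l. holomorphic_at (u l) 0) \<and> (\<forall>\<^sub>F z in nhds 0. g z = (\<Sum>l\<in>UNIV. u l z * h z $ l))"
  if "g \<in> ?W" for g
  using that h0 unfolding comp_ideal_def conv_series_def by auto
 define A0 where "A0 = {e :: 'k => nat. \<forall>i. e i < k}"
 have finA0: "finite A0"
 proof -
  have "A0 = PiE UNIV (\<lambda>_. {..<k})" by (auto simp: A0_def PiE_UNIV_domain)
  then show ?thesis by (simp add: finite_PiE)
 qed
 have hm: "holomorphic_at (\<lambda>z. monomial z e) 0" for e :: "'k => nat"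
  unfolding monomial_def by (intro hol_intros)
 let ?rep = "\<lambda>e c u. (\<forall>l. holomorphic_at (u l) 0) \<and>
   (\<forall>\<^sub>F z in nhds 0. monomial z e = (\<Sum>i<k. c i * b i z) + (\<Sum>l\<in>UNIV. u l z * h z $ l))"
 have "\<forall>e. \<exists>c u. ?rep e c u"
 proof
  fix e :: "'k => nat"
  obtain c where "(\<lambda>z. monomial z e - (\<Sum>i<k. c i * b i z)) \<in> ?W"
   using b[of "\<lambda>z. monomial z e"] hm by (auto simp: conv_series_def)
  from ideal[OF this] obtain u where u: "\<forall>l. holomorphic_at (u l) 0"
   "\<forall>\<^sub>F z in nhds 0. monomial z e - (\<Sum>i<k. c i * b i z) = (\<Sum>l\<in>UNIV. u l z * h z $ l)" by blast
  from u(2) have "\<forall>\<^sub>F z in nhds 0. monomial z e = (\<Sum>i<k. c i * b i z) + (\<Sum>l\<in>UNIV. u l z * h z $ l)"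
   by eventually_elim (simp add: algebra_simps)
  with u(1) show "\<exists>c u. ?rep e c u" by blast
 qed
 from choice[OF this] obtain c where
  "\<forall>e. \<exists>u. ?rep e (c e) u" by blast
 from choice[OF this] obtain u where u: "\<And>e l. holomorphic_at (u e l) 0"
  "\<And>e. \<forall>\<^sub>F z in nhds 0. monomial z e = (\<Sum>i<k. c e i * b i z) + (\<Sum>l\<in>UNIV. u e l z * h z $ l)" by blast
 have "\<forall>i. \<exists>v. (\<forall>l. holomorphic_at (v l) 0) \<and> (\<forall>\<^sub>F z in nhds 0. z $ i ^ k = (\<Sum>l\<in>UNIV. v l z * h z $ l))"
  using ideal[OF power_in_comp_ideal[OF codim]] by blast
 from choice[OF this] obtain v where v: "\<And>i l. holomorphic_at (v i l) 0"
  "\<And>i. \<forall>\<^sub>F z in nhds 0. z $ i ^ k = (\<Sum>l\<in>UNIV. v i l z * h z $ l)" by blast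
 \<comment> \<open>one radius and one bound for the finitely many quotients\<close>
 have "\<forall>\<^sub>F R in at_right 0. \<forall>p\<in>A0 \<times> UNIV. \<exists>C. series_at (u (fst p) (snd p)) R C"
  using finA0 by (intro eventually_ball_finite) (auto intro: series_at_eventually u)
 moreover have "\<forall>\<^sub>F R in at_right 0. \<forall>p\<in>UNIV \<times> UNIV. \<exists>C. series_at (v (fst p) (snd p)) R C"
  by (intro eventually_ball_finite) (auto intro: series_at_eventually v)
 moreover have "\<forall>\<^sub>F R in at_right (0::real). 0 < R \<and> R < 1"
  by (auto simp: eventually_at_right_field intro!: exI[of _ 1])
 ultimately have "\<forall>\<^sub>F R in at_right (0::real). 0 < R \<and> R < 1 \<and> (\<forall>e\<in>A0. \<forall>l. \<exists>C. series_at (u e l) R C) \<and>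
   (\<forall>i l. \<exists>C. series_at (v i l) R C)"
  by eventually_elim auto
 then obtain R where R: "0 < R" "R < 1" "\<And>e l. e \<in> A0 \<Longrightarrow> \<exists>C. series_at (u e l) R C"
   "\<And>i l. \<exists>C. series_at (v i l) R C"
  using eventually_happens'[OF trivial_limit_at_right_real[of "0::real"]] by blast
 obtain Cu where Cu: "\<And>e l. e \<in> A0 \<Longrightarrow> series_at (u e l) R (Cu e l)" using R(3) by metis
 obtain Cv where Cv: "\<And>i l. series_at (v i l) R (Cv i l)" using R(4) by metis
 define C where "C = 1 + (\<Sum>e\<in>A0. \<Sum>l\<in>UNIV. \<bar>Cu e l\<bar>) + (\<Sum>i\<in>UNIV. \<Sum>l\<in>UNIV. \<bar>Cv i l\<bar>)"
 have CuC: "Cu e l \<le> C" if "e \<in> A0" for e l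
 proof -
  have "\<bar>Cu e l\<bar> \<le> (\<Sum>l\<in>UNIV. \<bar>Cu e l\<bar>)" by (rule member_le_sum) auto
  also have "\<dots> \<le> (\<Sum>e\<in>A0. \<Sum>l\<in>UNIV. \<bar>Cu e l\<bar>)" by (rule member_le_sum) (use that finA0 in \<open>auto intro: sum_nonneg\<close>)
  moreover have "0 \<le> (\<Sum>i\<in>UNIV. \<Sum>l\<in>UNIV. \<bar>Cv i l\<bar>)" by (intro sum_nonneg) auto
  ultimately show ?thesis unfolding C_def by linarith
 qed
 have CvC: "Cv i l \<le> C" for i l
 proof -
  have "\<bar>Cv i l\<bar> \<le> (\<Sum>l\<in>UNIV. \<bar>Cv i l\<bar>)" by (rule member_le_sum) auto
  also have "\<dots> \<le> (\<Sum>i\<in>UNIV. \<Sum>l\<in>UNIV. \<bar>Cv i l\<bar>)" by (rule member_le_sum) (auto intro: sum_nonneg)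
  moreover have "0 \<le> (\<Sum>e\<in>A0. \<Sum>l\<in>UNIV. \<bar>Cu e l\<bar>)" by (intro sum_nonneg) auto
  ultimately show ?thesis unfolding C_def by linarith
 qed
 have C1: "C \<ge> 1" unfolding C_def by (simp add: sum_nonneg)
 let ?m = "CARD('k)"
 define \<eta> where "\<eta> = R ^ (k * ?m) / (2 * ?m * C)"
 have \<eta>: "\<eta> > 0" unfolding \<eta>_def using R C1 by (intro divide_pos_pos) auto
 let ?good = "\<lambda>z. z \<in> ball 0 R \<and> (\<forall>l. norm (h z $ l) < \<eta>) \<and>
   (\<forall>e\<in>A0. monomial z e = (\<Sum>i<k. c e i * b i z) + (\<Sum>l\<in>UNIV. u e l z * h z $ l)) \<and>
   (\<forall>i. z $ i ^ k = (\<Sum>l\<in>UNIV. v i l z * h z $ l))"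
 have "\<forall>\<^sub>F z in nhds 0. \<forall>l\<in>UNIV. norm (h z $ l) < \<eta>"
 proof (intro eventually_ball_finite ballI)
  fix l
  have "((\<lambda>z. norm (h z $ l)) \<longlongrightarrow> norm (h 0 $ l)) (nhds 0)"
   by (intro tendsto_intros holomorphic_map_at_tendsto[OF hol])
  then show "\<forall>\<^sub>F z in nhds 0. norm (h z $ l) < \<eta>" using \<eta> h0 by (intro order_tendstoD(2)) auto
 qed simp
 moreover have "\<forall>\<^sub>F z in nhds 0. \<forall>e\<in>A0. monomial z e = (\<Sum>i<k. c e i * b i z) + (\<Sum>l\<in>UNIV. u e l z * h z $ l)"
  using finA0 u(2) by (intro eventually_ball_finite) auto
 moreover have "\<forall>\<^sub>F z in nhds 0. \<forall>i\<in>UNIV. z $ i ^ k = (\<Sum>l\<in>UNIV. v i l z * h z $ l)"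
  using v(2) by (intro eventually_ball_finite) auto
 moreover have "\<forall>\<^sub>F z in nhds (0::complex^'k). z \<in> ball 0 R" using R by (intro eventually_nhds_in_open) auto
 ultimately have "\<forall>\<^sub>F z in nhds 0. ?good z"
  by eventually_elim auto
 then obtain \<delta> where \<delta>0: "\<delta> > 0" "\<forall>z. dist z 0 < \<delta> \<longrightarrow> ?good z"
  unfolding eventually_nhds_metric by blast
 then have \<delta>: "\<delta> > 0" "\<And>z. z \<in> ball 0 \<delta> \<Longrightarrow> ?good z"
  by (auto simp: dist_commute)
 have "card F \<le> k" if F: "finite F" "F \<subseteq> ball 0 \<delta>" "\<forall>z\<in>F. h z = w" for F w
 proof (rule ccontr)
  assume "\<not> card F \<le> k"
  then obtain \<mu> where \<mu>: "\<exists>z\<in>F. \<mu> z \<noteq> 0" "\<forall>j\<in>{..<k}. (\<Sum>z\<in>F. \<mu> z * b j z) = 0"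
   using linear_dependence[of "{..<k}" F "\<lambda>z j. b j z"] F(1) by auto
  then have "F \<noteq> {}" by auto
  then obtain z1 where "z1 \<in> F" by blast
  then have "z1 \<in> ball 0 \<delta>" "h z1 = w" using F by auto
  then have w: "norm (w $ l) \<le> \<eta>" for l using \<delta>(2)[of z1] by (auto simp: less_imp_le)
  define m where "m = (\<lambda>g. \<Sum>z\<in>F. \<mu> z * g z)"
  have m_series: "norm (m (\<lambda>z. g z * monomial z e)) \<le> t * R ^ sum e UNIV * C"
   if g: "series_at g R C'" "C' \<le> C" and t: "t \<ge> 0" "\<And>e. norm (m (\<lambda>z. monomial z e)) \<le> t * R ^ sum e UNIV" for g C' e t
  proof -
   obtain a where a: "((\<lambda>\<beta>. norm (a \<beta>) * R ^ sum \<beta> UNIV) has_sum C') UNIV"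
    "\<And>z. z \<in> ball 0 R \<Longrightarrow> ((\<lambda>\<beta>. a \<beta> * monomial z \<beta>) has_sum g z) UNIV"
    using g(1) unfolding series_at_def by blast
   have "((\<lambda>\<beta>. \<Sum>z\<in>F. \<mu> z * monomial z e * (a \<beta> * monomial z \<beta>)) has_sum (\<Sum>z\<in>F. \<mu> z * monomial z e * g z)) UNIV"
   proof (rule has_sum_finite_sum[OF F(1)])
    fix z assume "z \<in> F"
    then have "z \<in> ball 0 R" using F \<delta>(2) by blast
    then show "((\<lambda>\<beta>. \<mu> z * monomial z e * (a \<beta> * monomial z \<beta>)) has_sum (\<mu> z * monomial z e * g z)) UNIV"
     by (intro has_sum_cmult_right a(2))
   qed
   moreover have "(\<Sum>z\<in>F. \<mu> z * monomial z e * (a \<beta> * monomial z \<beta>)) = a \<beta> * m (\<lambda>z. monomial z (\<lambda>i. e i + \<beta> i))" for \<beta>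
    unfolding m_def sum_distrib_left monomial_add by (intro sum.cong) (auto simp: mult_ac)
   moreover have "(\<Sum>z\<in>F. \<mu> z * monomial z e * g z) = m (\<lambda>z. g z * monomial z e)"
    unfolding m_def by (intro sum.cong) (auto simp: mult_ac)
   ultimately have "((\<lambda>\<beta>. a \<beta> * m (\<lambda>z. monomial z (\<lambda>i. e i + \<beta> i))) has_sum m (\<lambda>z. g z * monomial z e)) UNIV" by simp
   moreover have "((\<lambda>\<beta>. (t * R ^ sum e UNIV) * (norm (a \<beta>) * R ^ sum \<beta> UNIV)) has_sum ((t * R ^ sum e UNIV) * C')) UNIV"
    by (rule has_sum_cmult_right[OF a(1)])
   moreover have "norm (a \<beta> * m (\<lambda>z. monomial z (\<lambda>i. e i + \<beta> i))) \<le> (t * R ^ sum e UNIV) * (norm (a \<beta>) * R ^ sum \<beta> UNIV)" for \<beta>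
   proof -
    have "norm (a \<beta>) * norm (m (\<lambda>z. monomial z (\<lambda>i. e i + \<beta> i))) \<le> norm (a \<beta>) * (t * R ^ sum (\<lambda>i. e i + \<beta> i) UNIV)"
     by (intro mult_left_mono t) auto
    then show ?thesis by (simp add: norm_mult sum.distrib power_add mult_ac)
   qed
   ultimately have "norm (m (\<lambda>z. g z * monomial z e)) \<le> (t * R ^ sum e UNIV) * C'"
    by (rule norm_infsum_le)
   also have "\<dots> \<le> (t * R ^ sum e UNIV) * C" using g(2) t(1) R(1) by (intro mult_left_mono) auto
   finally show ?thesis .
  qed
  \<comment> \<open>any bound for the moments of \<open>\<mu>\<close> can be halved\<close>
  have halve: "norm (m (\<lambda>z. monomial z e)) \<le> (t / 2) * R ^ sum e UNIV"
   if t: "t \<ge> 0" "\<And>e. norm (m (\<lambda>z. monomial z e)) \<le> t * R ^ sum e UNIV" for t e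
  proof -
   obtain g e' C' cc where g: "\<And>l. series_at (g l) R (C' l)" "\<And>l. C' l \<le> C"
    "\<And>z. z \<in> F \<Longrightarrow> monomial z e = (\<Sum>i<k. cc i * b i z) + (\<Sum>l\<in>UNIV. (g l z * monomial z e') * w $ l)"
    "R ^ (k * ?m) * R ^ sum e' UNIV \<le> R ^ sum e UNIV"
   proof (cases "e \<in> A0")
    case True
    have "sum e UNIV \<le> (\<Sum>i\<in>(UNIV::'k set). k)" using True by (intro sum_mono) (auto simp: A0_def less_imp_le)
    then have "R ^ (k * ?m) \<le> R ^ sum e UNIV" using R by (intro power_decreasing) (auto simp: mult.commute)
    moreover have "monomial z e = (\<Sum>i<k. c e i * b i z) + (\<Sum>l\<in>UNIV. (u e l z * monomial z (\<lambda>_. 0)) * w $ l)" if "z \<in> F" for z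
     using \<delta>(2)[of z] that F True by (auto simp: monomial_def)
    ultimately show thesis using Cu[OF True] CuC[OF True]
     by (intro that[of "u e" "Cu e" "c e" "\<lambda>_. 0"]) auto
   next
    case False
    then obtain i where i: "e i \<ge> k" by (auto simp: A0_def not_less)
    define e' where "e' = e(i := e i - k)"
    have sum': "sum e UNIV = k + sum e' UNIV"
     unfolding e'_def using i by (simp add: sum.remove[of UNIV i])
    have mono': "monomial z e = z $ i ^ k * monomial z e'" for z :: "complex^'k"
    proof -
     have "monomial z e = z $ i ^ e i * (\<Prod>j\<in>UNIV - {i}. z $ j ^ e j)"
      unfolding monomial_def by (subst prod.remove[of _ i]) auto
     moreover have "monomial z e' = z $ i ^ (e i - k) * (\<Prod>j\<in>UNIV - {i}. z $ j ^ e j)"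
      unfolding monomial_def e'_def by (subst prod.remove[of _ i]) (auto intro!: prod.cong)
     moreover have "z $ i ^ e i = z $ i ^ k * z $ i ^ (e i - k)" using i by (simp flip: power_add)
     ultimately show ?thesis by simp
    qed
    have "k \<le> k * ?m" by simp
    then have "R ^ (k * ?m) \<le> R ^ k" using R by (intro power_decreasing) auto
    then have "R ^ (k * ?m) * R ^ sum e' UNIV \<le> R ^ sum e UNIV"
     unfolding sum' power_add using R by (intro mult_right_mono) auto
    moreover have "monomial z e = (\<Sum>i<k. 0 * b i z) + (\<Sum>l\<in>UNIV. (v i l z * monomial z e') * w $ l)" if "z \<in> F" for z
    proof -
     have "z $ i ^ k = (\<Sum>l\<in>UNIV. v i l z * w $ l)" using \<delta>(2)[of z] that F by auto
     then show ?thesis unfolding mono' by (simp add: sum_distrib_left mult_ac)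
    qed
    ultimately show thesis using Cv[of i] CvC[of i]
     by (intro that[of "v i" "Cv i" "\<lambda>_. 0" e']) auto
   qed
   have "m (\<lambda>z. monomial z e) = (\<Sum>z\<in>F. \<mu> z * (\<Sum>i<k. cc i * b i z)) + (\<Sum>z\<in>F. \<mu> z * (\<Sum>l\<in>UNIV. (g l z * monomial z e') * w $ l))"
    unfolding m_def sum.distrib[symmetric] distrib_left[symmetric] by (rule sum.cong) (auto simp: g(3))
   also have "(\<Sum>z\<in>F. \<mu> z * (\<Sum>i<k. cc i * b i z)) = (\<Sum>i<k. cc i * (\<Sum>z\<in>F. \<mu> z * b i z))"
    unfolding sum_distrib_left by (subst sum.swap) (simp add: mult_ac)
   also have "\<dots> = 0" using \<mu>(2) by simp
   also have "(\<Sum>z\<in>F. \<mu> z * (\<Sum>l\<in>UNIV. (g l z * monomial z e') * w $ l)) = (\<Sum>l\<in>UNIV. w $ l * m (\<lambda>z. g l z * monomial z e'))"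
    unfolding m_def sum_distrib_left by (subst sum.swap) (simp add: mult_ac)
   finally have "norm (m (\<lambda>z. monomial z e)) \<le> (\<Sum>l\<in>UNIV. norm (w $ l * m (\<lambda>z. g l z * monomial z e')))"
    by (simp add: norm_sum)
   also have "\<dots> \<le> (\<Sum>l\<in>(UNIV::'k set). \<eta> * (t * R ^ sum e' UNIV * C))"
    unfolding norm_mult by (intro sum_mono mult_mono w m_series[OF g(1,2) t]) (use \<eta> in auto)
   also have "\<dots> = (t / 2) * (R ^ (k * ?m) * R ^ sum e' UNIV)"
    unfolding \<eta>_def using C1 by simp
   also have "\<dots> \<le> (t / 2) * R ^ sum e UNIV" using g(4) t(1) by (intro mult_left_mono) auto
   finally show ?thesis .
  qed
  define N where "N = (\<Sum>z\<in>F. norm (\<mu> z))"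
  have N0: "N \<ge> 0" by (simp add: N_def sum_nonneg)
  have bd: "norm (m (\<lambda>z. monomial z e)) \<le> (N / 2 ^ n) * R ^ sum e UNIV" for n e
  proof (induction n arbitrary: e)
   case 0
   have "norm (m (\<lambda>z. monomial z e)) \<le> (\<Sum>z\<in>F. norm (\<mu> z * monomial z e))" unfolding m_def by (rule norm_sum)
   also have "\<dots> \<le> (\<Sum>z\<in>F. norm (\<mu> z) * R ^ sum e UNIV)"
    unfolding norm_mult
   proof (intro sum_mono mult_left_mono)
    fix z assume "z \<in> F"
    then have "norm z \<le> R" using F \<delta>(2)[of z] by auto
    then have "norm (z $ i) \<le> R" for i using Finite_Cartesian_Product.norm_nth_le order_trans by blast
    then have "norm (monomial z e) \<le> (\<Prod>i\<in>UNIV. R ^ e i)"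
     unfolding norm_monomial by (intro prod_mono conjI power_mono) auto
    then show "norm (monomial z e) \<le> R ^ sum e UNIV" by (simp add: power_sum)
   qed auto
   finally show ?case by (simp add: N_def sum_distrib_right)
  next
   case (Suc n)
   have "norm (m (\<lambda>z. monomial z e)) \<le> (N / 2 ^ n / 2) * R ^ sum e UNIV"
    by (rule halve) (use N0 Suc.IH in auto)
   then show ?case by (simp add: mult.commute)
  qed
  have m0: "m (\<lambda>z. monomial z e) = 0" for e
  proof -
   have "(\<lambda>n. (N / 2 ^ n) * R ^ sum e UNIV) \<longlonglongrightarrow> 0"
    by (rule tendsto_mult_left_zero, rule LIMSEQ_divide_realpow_zero) simp
   then have "norm (m (\<lambda>z. monomial z e)) \<le> 0"
    by (rule LIMSEQ_le_const) (use bd in auto)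
   then show ?thesis by simp
  qed
  obtain z0 where z0: "z0 \<in> F" "\<mu> z0 \<noteq> 0" using \<mu>(1) by blast
  have "\<forall>s. \<exists>i. s \<noteq> z0 \<longrightarrow> z0 $ i \<noteq> s $ i" by (metis vec_eq_iff)
  then obtain i where i: "\<And>s. s \<noteq> z0 \<Longrightarrow> z0 $ i s \<noteq> s $ i s" by metis
  have "(\<Sum>z\<in>F. \<mu> z * ((\<Prod>s\<in>S. (z $ i s - s $ i s)) * monomial z e)) = 0" if "finite S" for S e
   using that
  proof (induction S arbitrary: e)
   case empty
   then show ?case using m0[of e] by (simp add: m_def)
  next
   case (insert s S)
   define e' where "e' = (\<lambda>j. e j + (if j = i s then 1 else 0))"
   have m': "monomial z e' = z $ i s * monomial z e" for z :: "complex^'k"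
   proof -
    have "monomial z (\<lambda>j. if j = i s then 1 else 0) = z $ i s"
     unfolding monomial_def by (simp add: if_distrib[where f = "\<lambda>n. _ ^ n"] cong: if_cong)
    then show ?thesis unfolding e'_def monomial_add by simp
   qed
   have "(\<Sum>z\<in>F. \<mu> z * ((\<Prod>s\<in>insert s S. (z $ i s - s $ i s)) * monomial z e)) =
     (\<Sum>z\<in>F. \<mu> z * ((\<Prod>s\<in>S. (z $ i s - s $ i s)) * monomial z e')) - s $ i s * (\<Sum>z\<in>F. \<mu> z * ((\<Prod>s\<in>S. (z $ i s - s $ i s)) * monomial z e))"
    unfolding sum_distrib_left sum_subtractf[symmetric]
    by (rule sum.cong) (use insert.hyps in \<open>auto simp: m' algebra_simps\<close>)
   then show ?case unfolding insert.IH by simp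
  qed
  from this[of "F - {z0}" "\<lambda>_. 0"] F(1)
  have "(\<Sum>z\<in>F. \<mu> z * (\<Prod>s\<in>F - {z0}. (z $ i s - s $ i s))) = 0" by (simp add: monomial_def)
  moreover have "(\<Sum>z\<in>F. \<mu> z * (\<Prod>s\<in>F - {z0}. (z $ i s - s $ i s))) = \<mu> z0 * (\<Prod>s\<in>F - {z0}. (z0 $ i s - s $ i s))"
  proof -
   have "\<mu> z * (\<Prod>s\<in>F - {z0}. (z $ i s - s $ i s)) = 0" if "z \<in> F - {z0}" for z
    using that F(1) by (simp, intro disjI2 bexI[of _ z]) auto
   then show ?thesis using F(1) z0(1) by (subst sum.remove[of _ z0]) (auto intro!: sum.neutral)
  qed
  moreover have "(\<Prod>s\<in>F - {z0}. (z0 $ i s - s $ i s)) \<noteq> 0"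
   using i F(1) by auto
  ultimately show False using z0(2) by simp
 qed
 then show ?thesis using \<delta>(1) by blast
qed

text \<open>Near a point of maximal rank the rank is constant. Adding to the projected map
coordinates along the kernel gives a local diffeomorphism \<open>\<Xi>\<close>, and \<open>f\<close>
is constant on the curves along which only the kernel coordinates vary.\<close>

lemma degenerate_fiber:
 fixes f :: "'a::euclidean_space => 'a"
 assumes "open U" "U \<noteq> {}" and der: "\<And>x. x \<in> U \<Longrightarrow> (f has_derivative D x) (at x)"
  and cont: "\<And>v. continuous_on U (\<lambda>x. D x v)" and deg: "\<And>x. x \<in> U \<Longrightarrow> \<not> inj (D x)"
 shows "\<exists>S w. infinite S \<and> S \<subseteq> U \<and> (\<forall>x\<in>S. f x = w)"
proof -
 have lin: "linear (D x)" if "x \<in> U" for x using der[OF that] has_derivative_linear by blast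
 obtain x0 where "x0 \<in> U" using assms(2) by blast
 obtain z1 where z1: "z1 \<in> U" and max: "\<And>x. x \<in> U \<Longrightarrow> dim (range (D x)) \<le> dim (range (D z1))"
 proof -
  let ?d = "\<lambda>x. dim (range (D x))"
  have "?d ` U \<subseteq> {..DIM('a)}" using dim_subset_UNIV by auto
  then have fin: "finite (?d ` U)" using finite_subset by blast
  have "Max (?d ` U) \<in> ?d ` U" using fin \<open>x0 \<in> U\<close> by (intro Max_in) auto
  then obtain z where "z \<in> U" "?d z = Max (?d ` U)" by auto
  moreover have "?d x \<le> Max (?d ` U)" if "x \<in> U" for x using fin that by (intro Max_ge) auto
  ultimately show thesis using that by metis
 qed
 define A where "A = D z1"
 have A: "linear A" unfolding A_def by (rule lin[OF z1])
 define V where "V = range A"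
 define N where "N = {v. A v = 0}"
 have subV: "subspace V" unfolding V_def by (rule linear_subspace_image[OF A subspace_UNIV])
 have subN: "subspace N" unfolding N_def by (rule linear_subspace_kernel[OF A])
 obtain g where g: "linear g" "\<And>y. y \<in> V \<Longrightarrow> A (g y) = y"
  using linear_exists_right_inverse_on[OF A subspace_UNIV] unfolding V_def by auto
 \<comment> \<open>\<open>A \<circ> g\<close> is a projection onto the range, \<open>id - g \<circ> A\<close> a projection onto the kernel of \<open>A\<close>\<close>
 define P where "P = (\<lambda>y. A (g y))"
 define Q where "Q = (\<lambda>v. v - g (A v))"
 have P: "linear P" unfolding P_def using linear_compose[OF g(1) A] by (simp add: o_def)
 have Q: "linear Q" unfolding Q_def using linear_compose_sub[OF linear_id linear_compose[OF A g(1)]] by (simp add: o_def id_def)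
 have PV: "P y = y" if "y \<in> V" for y using g(2)[OF that] by (simp add: P_def)
 have PinV: "P y \<in> V" for y by (simp add: P_def V_def)
 have QN: "Q v \<in> N" for v
  unfolding Q_def N_def using g(2)[of "A v"] by (simp add: linear_diff[OF A] V_def)
 define K where "K = {y. P y = 0}"
 have subK: "subspace K" unfolding K_def by (rule linear_subspace_kernel[OF P])
 have dNK: "dim N = dim K"
 proof -
  have "dim {x + y |x y. x \<in> N \<and> y \<in> g ` V} + dim (N \<inter> g ` V) = dim N + dim (g ` V)"
   by (rule dim_sums_Int[OF subN linear_subspace_image[OF g(1) subV]])
  moreover have "{x + y |x y. x \<in> N \<and> y \<in> g ` V} = UNIV"
  proof -
   have "v = Q v + g (A v)" for v by (simp add: Q_def)
   then show ?thesis using QN unfolding V_def by blast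
  qed
  moreover have "N \<inter> g ` V = {0}"
   using g(2) subspace_0[OF subN] subspace_0[OF subV] linear_0[OF g(1)] unfolding N_def by force
  moreover have "dim (g ` V) = dim V"
   by (rule dim_image_eq[OF g(1)]) (metis g(2) inj_onI span_eq_iff subV)
  moreover have "dim {x + y |x y. x \<in> K \<and> y \<in> V} + dim (K \<inter> V) = dim K + dim V"
   by (rule dim_sums_Int[OF subK subV])
  moreover have "{x + y |x y. x \<in> K \<and> y \<in> V} = UNIV"
  proof -
   have "v = (v - P v) + P v" "v - P v \<in> K" for v
    using PV[OF PinV[of v]] by (auto simp: K_def linear_diff[OF P])
   then show ?thesis using PinV by blast
  qed
  moreover have "K \<inter> V = {0}"
   using PV subspace_0[OF subK] subspace_0[OF subV] unfolding K_def by force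
  ultimately show ?thesis by simp
 qed
 obtain T where T: "linear T" "T ` N = K" "\<And>x. x \<in> N \<Longrightarrow> norm (T x) = norm x"
  by (rule isometry_subspaces[OF subN subK dNK]) blast
 have TK: "P (T (Q v)) = 0" for v using T(2) QN[of v] unfolding K_def by blast
 define \<Xi> where "\<Xi> = (\<lambda>x. P (f x) + T (Q x))"
 define D' where "D' = (\<lambda>x v. P (D x v) + T (Q v))"
 have bP: "bounded_linear P" and bT: "bounded_linear T" and bQ: "bounded_linear Q"
  using P T(1) Q by (auto simp: linear_conv_bounded_linear)
 have der': "(\<Xi> has_derivative D' x) (at x)" if "x \<in> U" for x
  unfolding \<Xi>_def D'_def
  by (intro has_derivative_add bounded_linear.has_derivative[OF bP] bounded_linear.has_derivative[OF bT]
    bounded_linear.has_derivative[OF bQ] has_derivative_ident der that)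
 have cont': "continuous_on U (\<lambda>x. D' x v)" for v
  unfolding D'_def by (intro continuous_intros bounded_linear.continuous_on[OF bP] cont)
 have linD': "linear (D' x)" if "x \<in> U" for x using der'[OF that] has_derivative_linear by blast
 have injD': "inj (D' z1)" unfolding linear_injective_0[OF linD'[OF z1]]
 proof (intro allI impI)
  fix v assume v: "D' z1 v = 0"
  have "P (A v) = A v" by (rule PV) (simp add: V_def)
  then have "P (D' z1 v) = A v" unfolding D'_def A_def[symmetric] linear_add[OF P] TK by simp
  then have Av: "A v = 0" using v linear_0[OF P] by simp
  then have "Q v = v" by (simp add: Q_def linear_0[OF g(1)])
  then have "T v = 0" using v Av linear_0[OF P] by (simp add: D'_def A_def)
  moreover have "v \<in> N" using Av by (simp add: N_def)
  ultimately show "v = 0" using T(3)[of v] by simp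
 qed
 from C1_local_inverse[OF assms(1) z1 der' cont' injD']
 obtain U' V' G where G0: "open U'" "U' \<subseteq> U" "z1 \<in> U'" "open V'" "\<Xi> z1 \<in> V'" "homeomorphism U' V' \<Xi> G"
  "\<forall>y\<in>V'. bij (D' (G y)) \<and> (G has_derivative inv (D' (G y))) (at y)" by blast
 then have G: "open U'" "U' \<subseteq> U" "z1 \<in> U'" "open V'" "\<Xi> z1 \<in> V'" "homeomorphism U' V' \<Xi> G"
  "\<And>y. y \<in> V' \<Longrightarrow> bij (D' (G y))" "\<And>y. y \<in> V' \<Longrightarrow> (G has_derivative inv (D' (G y))) (at y)"
  by auto
 have GU: "G y \<in> U" if "y \<in> V'" for y using G(2,6) that unfolding homeomorphism_def by blast
 \<comment> \<open>near \<open>z1\<close> the rank is constant, so \<open>P\<close> is injective on the range of the derivative\<close>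
 have Pinj: "D x v = 0" if x: "x \<in> U" "bij (D' x)" "P (D x v) = 0" for x v
 proof -
  let ?R = "range (D x)"
  have subR: "subspace ?R" by (rule linear_subspace_image[OF lin[OF x(1)] subspace_UNIV])
  have PR: "P ` ?R = V"
  proof (intro equalityI subsetI)
   fix y assume y: "y \<in> V"
   obtain u where u: "D' x u = y" using bij_is_surj[OF x(2)] by (metis surjD)
   have "P (D' x u) = P (P (D x u))" unfolding D'_def linear_add[OF P] TK by simp
   then have "y = P (D x u)" using PV[OF y] PV[OF PinV] u by simp
   then show "y \<in> P ` ?R" by blast
  qed (use PinV in auto)
  obtain g2 where g2: "linear g2" "g2 ` UNIV \<subseteq> ?R" "\<And>y. y \<in> V \<Longrightarrow> P (g2 y) = y"
   using linear_exists_right_inverse_on[OF P subR] unfolding PR by blast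
  have "dim (g2 ` V) = dim V"
   by (rule dim_image_eq[OF g2(1)]) (metis g2(3) inj_onI span_eq_iff subV)
  moreover have "dim ?R \<le> dim V" using max[OF x(1)] by (simp add: V_def A_def)
  moreover have "g2 ` V \<subseteq> ?R" using g2(2) by blast
  ultimately have "g2 ` V = ?R"
   using subspace_dim_equal[OF linear_subspace_image[OF g2(1) subV] subR] by simp
  then obtain y where "y \<in> V" "D x v = g2 y" by blast
  then show ?thesis using g2(3)[of y] x(3) linear_0[OF g2(1)] by simp
 qed
 obtain n0 where n0: "n0 \<in> N" "n0 \<noteq> 0"
  using deg[OF z1] linear_injective_0[OF A] unfolding N_def A_def by blast
 define e where "e = T n0"
 have e: "e \<noteq> 0" "P e = 0" using n0 T(2,3) unfolding e_def K_def by force+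
 obtain \<epsilon> where \<epsilon>: "\<epsilon> > 0" "ball (\<Xi> z1) \<epsilon> \<subseteq> V'" using G(4,5) open_contains_ball by blast
 define I where "I = {- (\<epsilon> / norm e) <..< \<epsilon> / norm e}"
 define y where "y = (\<lambda>s::real. \<Xi> z1 + s *\<^sub>R e)"
 have yV: "y s \<in> V'" if "s \<in> I" for s
 proof -
  have "norm (s *\<^sub>R e) < \<epsilon>" using that e(1) by (auto simp: I_def field_simps abs_if split: if_splits)
  then show ?thesis using \<epsilon>(2) by (auto simp: y_def dist_norm subset_iff)
 qed
 have "\<exists>c. \<forall>s\<in>I. f (G (y s)) = c"
 proof (rule has_derivative_zero_constant)
  show "convex I" unfolding I_def by (rule convex_real_interval)
  fix s assume s: "s \<in> I"
  have dy: "(y has_derivative (\<lambda>t. t *\<^sub>R e)) (at s)"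
   unfolding y_def by (auto intro!: derivative_eq_intros)
  have "((\<lambda>s. f (G (y s))) has_derivative (\<lambda>t. D (G (y s)) (inv (D' (G (y s))) (t *\<^sub>R e)))) (at s)"
   by (rule has_derivative_compose[OF has_derivative_compose[OF dy G(8)[OF yV[OF s]]] der[OF GU[OF yV[OF s]]]])
  moreover have "D (G (y s)) (inv (D' (G (y s))) (t *\<^sub>R e)) = 0" for t
  proof (rule Pinj[OF GU[OF yV[OF s]] G(7)[OF yV[OF s]]])
   let ?u = "inv (D' (G (y s))) (t *\<^sub>R e)"
   have "D' (G (y s)) ?u = t *\<^sub>R e" using bij_is_surj[OF G(7)[OF yV[OF s]]] by (rule surj_f_inv_f)
   then have "P (D' (G (y s)) ?u) = 0" using e(2) by (simp add: linear_scale[OF P])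
   then show "P (D (G (y s)) ?u) = 0" unfolding D'_def linear_add[OF P] TK using PV[OF PinV] by simp
  qed
  ultimately show "((\<lambda>s. f (G (y s))) has_derivative (\<lambda>h. 0)) (at s within I)"
   by (simp add: has_derivative_at_withinI)
 qed
 then obtain c where c: "\<forall>s\<in>I. f (G (y s)) = c" by blast
 have "infinite I" unfolding I_def using \<epsilon>(1) e(1) by (simp add: infinite_Ioo)
 moreover have "inj_on (\<lambda>s. G (y s)) I"
 proof (rule inj_onI)
  fix s t assume "s \<in> I" "t \<in> I" "G (y s) = G (y t)"
  then have "y s = y t" using yV G(6) unfolding homeomorphism_def by metis
  then show "s = t" using e(1) by (simp add: y_def)
 qed
 ultimately have "infinite ((\<lambda>s. G (y s)) ` I)" using finite_imageD by blast
 moreover have "(\<lambda>s. G (y s)) ` I \<subseteq> U" using GU yV by blast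
 ultimately show ?thesis using c by (intro exI[of _ "(\<lambda>s. G (y s)) ` I"] exI[of _ c]) blast
qed

proposition finite_germ_nondegenerate:
 fixes h :: "complex^'k => complex^'k"
 assumes "finite_germ h 0" and hol: "holomorphic_map_at h 0" and h0: "h 0 = 0" and "\<epsilon> > 0"
 shows "\<exists>z\<in>ball 0 \<epsilon>. inj (jac h z)"
proof (rule ccontr)
 assume deg: "\<not> (\<exists>z\<in>ball 0 \<epsilon>. inj (jac h z))"
 obtain k where codim: "has_codim (conv_series 0) (comp_ideal h 0) k" using assms(1) by (auto simp: finite_germ_def)
 obtain \<delta> where \<delta>: "\<delta> > 0" "\<forall>F w. finite F \<and> F \<subseteq> ball 0 \<delta> \<and> (\<forall>z\<in>F. h z = w) \<longrightarrow> card F \<le> k"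
  using fiber_bound[OF codim hol h0] by blast
 obtain U0 where U0: "open U0" "0 \<in> U0" "\<forall>z\<in>U0. holomorphic_map_at h z"
  using holomorphic_map_at_open[OF hol] by blast
 define U where "U = U0 \<inter> ball 0 (min \<epsilon> \<delta>)"
 have U: "open U" "U \<noteq> {}" using U0 \<delta>(1) assms(4) by (auto simp: U_def)
 have c: "continuous_on U (\<lambda>z. jac h z v)" for v
  unfolding jac_def
 proof (intro continuous_on_vec_lambda continuous_intros)
  fix i j
  have "isCont (d_dz j (\<lambda>z. h z $ i)) z" if "z \<in> U" for z
   using U0(3) that by (auto simp: U_def holomorphic_map_at_def intro!: holomorphic_at_continuous holomorphic_at_d_dz)
  then show "continuous_on U (d_dz j (\<lambda>z. h z $ i))" by (simp add: continuous_at_imp_continuous_on)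
 qed
 have "\<exists>S w. infinite S \<and> S \<subseteq> U \<and> (\<forall>x\<in>S. h x = w)"
  by (rule degenerate_fiber[OF U, of h "jac h"])
    (use U0 c deg in \<open>auto simp: U_def intro: jac_has_derivative\<close>)
 then obtain S w where S: "infinite S" "S \<subseteq> U" "\<forall>x\<in>S. h x = w" by blast
 obtain F where F: "F \<subseteq> S" "finite F" "card F = Suc k" using infinite_arbitrarily_large[OF S(1)] by blast
 have "F \<subseteq> ball 0 \<delta>" "\<forall>z\<in>F. h z = w" using F(1) S(2,3) by (auto simp: U_def)
 then have "card F \<le> k" using \<delta>(2) F(2) by blast
 then show False using F(3) by simp
qed

section \<open>Smooth functions and complex vector fields\<close>

abbreviation (input) FD :: "('a::real_normed_vector => 'b::real_normed_vector) => 'a => 'a => 'b" where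
 "FD f x \<equiv> frechet_derivative f (at x)"

lemma FD_eq: "(f has_derivative D) (at x) \<Longrightarrow> FD f x = D"
 by (metis frechet_derivative_at)

lemma FD_works: "f differentiable (at x) \<Longrightarrow> (f has_derivative FD f x) (at x)"
 using frechet_derivative_works by blast

lemma has_derivative_cong_open:
 assumes "open U" "x \<in> U" "\<And>y. y \<in> U \<Longrightarrow> f y = g y" "(f has_derivative D) (at x)"
 shows "(g has_derivative D) (at x)"
 using has_derivative_transform_within_open[OF assms(4,1,2)] assms(3) by blast

lemma FD_cong_open:
 assumes "open U" "x \<in> U" "\<And>y. y \<in> U \<Longrightarrow> f y = g y"
 shows "FD f x = FD g x" "f differentiable (at x) \<longleftrightarrow> g differentiable (at x)"
proof -
 have *: "(f has_derivative D) (at x) \<longleftrightarrow> (g has_derivative D) (at x)" for D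
  using has_derivative_cong_open[OF assms(1,2), of f g D] has_derivative_cong_open[OF assms(1,2), of g f D] assms(3) by metis
 then show "FD f x = FD g x" "f differentiable (at x) \<longleftrightarrow> g differentiable (at x)"
  unfolding frechet_derivative_def differentiable_def by auto
qed

lemma C_diff_on_cong:
 assumes "open U" "\<And>x. x \<in> U \<Longrightarrow> f x = g x" "C_diff_on k f U" shows "C_diff_on k g U"
 using assms(2,3)
proof (induction k arbitrary: f g)
 case 0
 then show ?case using continuous_on_cong[of U U f g] by simp
next
 case (Suc k)
 have "g differentiable (at x)" if "x \<in> U" for x
  using FD_cong_open(2)[OF assms(1) that, of f g] Suc.prems that by simp
 moreover have "C_diff_on k (\<lambda>x. FD g x v) U" for v
 proof (rule Suc.IH)
  show "FD f x v = FD g x v" if "x \<in> U" for x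
   using FD_cong_open(1)[OF assms(1) that, of f g] Suc.prems by simp
  show "C_diff_on k (\<lambda>x. FD f x v) U" using Suc.prems(2) by simp
 qed
 ultimately show ?case by simp
qed

lemma C_diff_on_subset: "C_diff_on k f U \<Longrightarrow> V \<subseteq> U \<Longrightarrow> C_diff_on k f V"
proof (induction k arbitrary: f)
 case 0
 then show ?case by (simp add: continuous_on_subset)
next
 case (Suc k)
 then show ?case by (simp add: subset_iff)
qed

lemma C_diff_on_Suc: "C_diff_on (Suc k) f U \<Longrightarrow> C_diff_on k f U"
proof (induction k arbitrary: f)
 case 0
 then show ?case by (simp add: continuous_at_imp_continuous_on differentiable_imp_continuous_within)
next
 case (Suc k)
 have "C_diff_on k (\<lambda>x. FD f x v) U" for v
  using Suc.IH[of "\<lambda>x. FD f x v"] Suc.prems by (simp del: C_diff_on.simps add: C_diff_on.simps(2)[of "Suc k"])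
 then show ?case using Suc.prems by simp
qed

lemma C_diff_on_const: "C_diff_on k (\<lambda>x. c) U"
proof (induction k arbitrary: c)
 case (Suc k)
 have "FD (\<lambda>x. c) x = (\<lambda>_. 0)" for x :: 'a by (intro FD_eq has_derivative_const)
 then show ?case using Suc by simp
qed simp

lemma C_diff_on_linear:
 assumes "bounded_linear L" shows "C_diff_on k L U"
proof (cases k)
 case (Suc n)
 have "FD L x = L" for x by (intro FD_eq bounded_linear_imp_has_derivative assms)
 then show ?thesis using Suc C_diff_on_const assms
  by (auto intro: bounded_linear_imp_differentiable)
qed (simp add: assms bounded_linear.linear linear_continuous_on)

lemma C_diff_on_add:
 assumes "open U" "C_diff_on k f U" "C_diff_on k g U" shows "C_diff_on k (\<lambda>x. f x + g x) U"
 using assms(2,3)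
proof (induction k arbitrary: f g)
 case (Suc k)
 have d: "((\<lambda>x. f x + g x) has_derivative (\<lambda>v. FD f x v + FD g x v)) (at x)" if "x \<in> U" for x
  using Suc.prems that by (intro has_derivative_add FD_works) auto
 have "C_diff_on k (\<lambda>x. FD (\<lambda>x. f x + g x) x v) U" for v
  by (rule C_diff_on_cong[OF assms(1) _ Suc.IH[of "\<lambda>x. FD f x v" "\<lambda>x. FD g x v"]])
    (use Suc.prems FD_eq[OF d] in auto)
 moreover have "(\<lambda>x. f x + g x) differentiable (at x)" if "x \<in> U" for x
  using d[OF that] differentiable_def by blast
 ultimately show ?case by simp
qed (auto intro: continuous_intros)

lemma C_diff_on_sum:
 assumes "open U" "\<And>i. i \<in> I \<Longrightarrow> C_diff_on k (f i) U" shows "C_diff_on k (\<lambda>x. \<Sum>i\<in>I. f i x) U"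
 using assms(2)
 by (induction I rule: infinite_finite_induct) (simp_all add: C_diff_on_const C_diff_on_add[OF assms(1)])

lemma C_diff_on_bilinear:
 assumes "bounded_bilinear prd" "open U" "C_diff_on k f U" "C_diff_on k g U"
 shows "C_diff_on k (\<lambda>x. prd (f x) (g x)) U"
 using assms(3,4)
proof (induction k arbitrary: f g)
 case 0
 then show ?case by (simp add: bounded_bilinear.continuous_on[OF assms(1)])
next
 case (Suc k)
 have d: "((\<lambda>x. prd (f x) (g x)) has_derivative (\<lambda>v. prd (f x) (FD g x v) + prd (FD f x v) (g x))) (at x)" if "x \<in> U" for x
  using Suc.prems that by (intro bounded_bilinear.FDERIV[OF assms(1)] FD_works) auto
 have "C_diff_on k (\<lambda>x. FD (\<lambda>x. prd (f x) (g x)) x v) U" for v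
 proof (rule C_diff_on_cong[OF assms(2)])
  show "C_diff_on k (\<lambda>x. prd (f x) (FD g x v) + prd (FD f x v) (g x)) U"
   using Suc.prems C_diff_on_Suc[OF Suc.prems(1)] C_diff_on_Suc[OF Suc.prems(2)]
   by (intro C_diff_on_add[OF assms(2)] Suc.IH) simp_all
  show "prd (f x) (FD g x v) + prd (FD f x v) (g x) = FD (\<lambda>x. prd (f x) (g x)) x v" if "x \<in> U" for x
   using FD_eq[OF d[OF that]] by simp
 qed
 moreover have "(\<lambda>x. prd (f x) (g x)) differentiable (at x)" if "x \<in> U" for x
  using d[OF that] differentiable_def by blast
 ultimately show ?case by simp
qed

lemma C_diff_on_compose:
 fixes g :: "'b::euclidean_space => 'c::real_normed_vector" and F :: "'a::real_normed_vector => 'b"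
 assumes "open U" "open V" "F ` U \<subseteq> V" "C_diff_on k F U" "C_diff_on k g V"
 shows "C_diff_on k (\<lambda>x. g (F x)) U"
 using assms(4,5)
proof (induction k arbitrary: g)
 case 0
 then show ?case using assms(3) by (auto intro: continuous_on_compose2)
next
 case (Suc k)
 have d: "((\<lambda>x. g (F x)) has_derivative (\<lambda>v. FD g (F x) (FD F x v))) (at x)" if "x \<in> U" for x
  by (rule has_derivative_compose[OF FD_works FD_works]) (use Suc.prems assms(3) that in auto)
 have lin: "FD g (F x) w = (\<Sum>b\<in>Basis. (w \<bullet> b) *\<^sub>R FD g (F x) b)" if "x \<in> U" for x w
 proof -
  have "g differentiable (at (F x))" using Suc.prems(2) assms(3) that by auto
  then have "linear (FD g (F x))" by (rule linear_frechet_derivative)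
  then show ?thesis by (subst euclidean_representation[of w, symmetric]) (simp add: linear_sum linear_scale)
 qed
 have "C_diff_on k (\<lambda>x. FD (\<lambda>x. g (F x)) x v) U" for v
 proof (rule C_diff_on_cong[OF assms(1)])
  show "C_diff_on k (\<lambda>x. \<Sum>b\<in>Basis. (FD F x v \<bullet> b) *\<^sub>R FD g (F x) b) U"
  proof (intro C_diff_on_sum[OF assms(1)] C_diff_on_bilinear[OF bounded_bilinear_scaleR assms(1)]
    C_diff_on_bilinear[OF bounded_bilinear_inner assms(1)] C_diff_on_const)
   show "C_diff_on k (\<lambda>x. FD F x v) U" using Suc.prems(1) by simp
   show "C_diff_on k (\<lambda>x. FD g (F x) b) U" for b
    by (rule Suc.IH) (use Suc.prems C_diff_on_Suc[OF Suc.prems(1)] in simp_all)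
  qed
  show "(\<Sum>b\<in>Basis. (FD F x v \<bullet> b) *\<^sub>R FD g (F x) b) = FD (\<lambda>x. g (F x)) x v" if "x \<in> U" for x
   using lin[OF that, of "FD F x v"] FD_eq[OF d[OF that]] by metis
 qed
 moreover have "(\<lambda>x. g (F x)) differentiable (at x)" if "x \<in> U" for x
  using d[OF that] differentiable_def by blast
 ultimately show ?case by simp
qed

lemma C_diff_on_inverse: "C_diff_on k (inverse :: complex => complex) (- {0})"
proof (induction k)
 case (Suc k)
 have d: "(inverse has_derivative (\<lambda>v. - (inverse x * v * inverse x))) (at (x::complex))" if "x \<noteq> 0" for x
  using Deriv.has_derivative_inverse[OF that has_derivative_ident] by simp
 have o: "open (- {0::complex})" by (rule open_Compl) simp
 have "C_diff_on k (\<lambda>x. FD (inverse :: complex => complex) x v) (- {0})" for v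
 proof (rule C_diff_on_cong[OF o])
  show "C_diff_on k (\<lambda>x::complex. (- v) * (inverse x * inverse x)) (- {0})"
   by (intro C_diff_on_bilinear[OF bounded_bilinear_mult o] C_diff_on_const Suc)
  show "(- v) * (inverse x * inverse x) = FD inverse x v" if "x \<in> - {0}" for x :: complex
   using FD_eq[OF d[of x]] that by (simp add: mult_ac)
 qed
 moreover have "inverse differentiable (at (x::complex))" if "x \<noteq> 0" for x
  using d[OF that] differentiable_def by blast
 ultimately show ?case by simp
qed (auto intro: continuous_intros)

lemma C_diff_on_holomorphic:
 fixes f :: "complex^'k => complex"
 assumes "open U" "\<And>z. z \<in> U \<Longrightarrow> holomorphic_at f z" shows "C_diff_on k f U"
 using assms(2)
proof (induction k arbitrary: f)
 case 0
 then show ?case by (simp add: continuous_at_imp_continuous_on holomorphic_at_continuous)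
next
 case (Suc k)
 have d: "(f has_derivative (\<lambda>v. \<Sum>j\<in>UNIV. d_dz j f x * v $ j)) (at x)" if "x \<in> U" for x
  by (rule cdiff_has_derivative[OF holomorphic_at_imp_cdiff[OF Suc.prems[OF that]]])
 have "C_diff_on k (\<lambda>x. FD f x v) U" for v
 proof (rule C_diff_on_cong[OF assms(1)])
  show "C_diff_on k (\<lambda>x. \<Sum>j\<in>UNIV. d_dz j f x * v $ j) U"
   by (intro Suc.IH hol_intros Suc.prems)
  show "(\<Sum>j\<in>UNIV. d_dz j f x * v $ j) = FD f x v" if "x \<in> U" for x
   using FD_eq[OF d[OF that]] by simp
 qed
 moreover have "f differentiable (at x)" if "x \<in> U" for x
  using d[OF that] differentiable_def by blast
 ultimately show ?case by simp
qed

subsection \<open>Germs of smooth functions\<close>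

named_theorems sm_intros

lemma smooth_at_open:
 assumes "smooth_at f p" shows "\<exists>U. open U \<and> p \<in> U \<and> (\<forall>q\<in>U. smooth_at f q \<and> f differentiable (at q))"
proof -
 obtain U where U: "open U" "p \<in> U" "\<And>k. C_diff_on k f U" using assms unfolding smooth_at_def by blast
 have "f differentiable (at q)" if "q \<in> U" for q using U(3)[of 1] that by simp
 moreover have "smooth_at f q" if "q \<in> U" for q using U that unfolding smooth_at_def by blast
 ultimately show ?thesis using U(1,2) by blast
qed

lemma smooth_at_eventually: "smooth_at f p \<Longrightarrow> \<forall>\<^sub>F q in nhds p. smooth_at f q"
 and smooth_at_eventually_diff: "smooth_at f p \<Longrightarrow> \<forall>\<^sub>F q in nhds p. f differentiable (at q)"
 using smooth_at_open[of f p] unfolding eventually_nhds by blast+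

lemma smooth_at_diff: "smooth_at f p \<Longrightarrow> f differentiable (at p)"
 using smooth_at_open by blast

lemma smooth_at_tendsto: "smooth_at f p \<Longrightarrow> (f \<longlongrightarrow> f p) (nhds p)"
 using smooth_at_diff[THEN differentiable_imp_continuous_within] unfolding isCont_def tendsto_at_iff_tendsto_nhds by blast

lemma smooth_at_cong:
 assumes "smooth_at f p" "\<forall>\<^sub>F q in nhds p. f q = g q" shows "smooth_at g p"
proof -
 obtain U where U: "open U" "p \<in> U" "\<And>k. C_diff_on k f U" using assms unfolding smooth_at_def by blast
 obtain V where V: "open V" "p \<in> V" "\<forall>q\<in>V. f q = g q" using assms(2) unfolding eventually_nhds by blast
 have "C_diff_on k g (U \<inter> V)" for k
  by (rule C_diff_on_cong[of "U \<inter> V" f g]) (use U V C_diff_on_subset[of k f U "U \<inter> V"] in auto)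
 then show ?thesis unfolding smooth_at_def using U V by (intro exI[of _ "U \<inter> V"]) auto
qed

lemma smooth_at_common:
 assumes "smooth_at f p" "smooth_at g p"
 shows "\<exists>U. open U \<and> p \<in> U \<and> (\<forall>k. C_diff_on k f U) \<and> (\<forall>k. C_diff_on k g U)"
proof -
 obtain U where U: "open U" "p \<in> U" "\<And>k. C_diff_on k f U" using assms unfolding smooth_at_def by blast
 obtain V where V: "open V" "p \<in> V" "\<And>k. C_diff_on k g V" using assms(2) unfolding smooth_at_def by blast
 have "C_diff_on k f (U \<inter> V)" "C_diff_on k g (U \<inter> V)" for k
  using C_diff_on_subset[OF U(3)] C_diff_on_subset[OF V(3)] by auto
 then show ?thesis using U V by (intro exI[of _ "U \<inter> V"]) auto
qed

lemma smooth_at_const [sm_intros]: "smooth_at (\<lambda>x. c) p"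
 unfolding smooth_at_def by (intro exI[of _ UNIV]) (simp add: C_diff_on_const)

lemma smooth_at_linear: "bounded_linear L \<Longrightarrow> smooth_at L p"
 unfolding smooth_at_def by (intro exI[of _ UNIV]) (simp add: C_diff_on_linear)

lemma smooth_at_add [sm_intros]: "smooth_at f p \<Longrightarrow> smooth_at g p \<Longrightarrow> smooth_at (\<lambda>x. f x + g x) p"
 using smooth_at_common[of f p g] C_diff_on_add unfolding smooth_at_def by metis

lemma smooth_at_bilinear: "bounded_bilinear prd \<Longrightarrow> smooth_at f p \<Longrightarrow> smooth_at g p \<Longrightarrow> smooth_at (\<lambda>x. prd (f x) (g x)) p"
 using smooth_at_common[of f p g] C_diff_on_bilinear[of prd] unfolding smooth_at_def by metis

lemma smooth_at_mult [sm_intros]: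
 fixes f :: "'a::euclidean_space => complex"
 shows "smooth_at f p \<Longrightarrow> smooth_at g p \<Longrightarrow> smooth_at (\<lambda>x. f x * g x) p"
 by (rule smooth_at_bilinear[OF bounded_bilinear_mult])

lemma smooth_at_minus [sm_intros]:
 fixes f :: "'a::euclidean_space => complex" shows "smooth_at f p \<Longrightarrow> smooth_at (\<lambda>x. - f x) p"
 using smooth_at_mult[OF smooth_at_const[of "-1" p], of f] by simp

lemma smooth_at_minus_diff [sm_intros]:
 fixes f :: "'a::euclidean_space => complex"
 shows "smooth_at f p \<Longrightarrow> smooth_at g p \<Longrightarrow> smooth_at (\<lambda>x. f x - g x) p"
 using smooth_at_add[OF _ smooth_at_minus, of f p g] by simp

lemma smooth_at_sum [sm_intros]: "(\<And>i. i \<in> I \<Longrightarrow> smooth_at (f i) p) \<Longrightarrow> smooth_at (\<lambda>x. \<Sum>i\<in>I. f i x) p"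
 by (induction I rule: infinite_finite_induct) (auto intro: sm_intros)

lemma smooth_at_prod [sm_intros]:
 fixes f :: "'i => 'a::euclidean_space => complex"
 shows "(\<And>i. i \<in> I \<Longrightarrow> smooth_at (f i) p) \<Longrightarrow> smooth_at (\<lambda>x. \<Prod>i\<in>I. f i x) p"
 by (induction I rule: infinite_finite_induct) (auto intro: sm_intros)

lemma smooth_at_det [sm_intros]:
 fixes A :: "'a::euclidean_space => complex^'k^'k"
 shows "(\<And>i j. smooth_at (\<lambda>x. A x $ i $ j) p) \<Longrightarrow> smooth_at (\<lambda>x. det (A x)) p"
 unfolding det_def by (intro sm_intros)

lemma smooth_at_compose:
 fixes g :: "'b::euclidean_space => 'c::real_normed_vector"
 assumes "smooth_at F p" "smooth_at g (F p)" shows "smooth_at (\<lambda>x. g (F x)) p"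
proof -
 obtain U where U: "open U" "p \<in> U" "\<And>k. C_diff_on k F U" using assms unfolding smooth_at_def by blast
 obtain V where V: "open V" "F p \<in> V" "\<And>k. C_diff_on k g V" using assms(2) unfolding smooth_at_def by blast
 have "continuous_on U F" using U(3)[of 0] by simp
 then have o: "open (U \<inter> F -` V)" using U(1) V(1) by (rule continuous_open_preimage)
 have "C_diff_on k (\<lambda>x. g (F x)) (U \<inter> F -` V)" for k
  by (rule C_diff_on_compose[OF o V(1) _ C_diff_on_subset[OF U(3)] V(3)]) auto
 then show ?thesis using o U(2) V(2) unfolding smooth_at_def by blast
qed

lemma smooth_at_bounded_linear: "bounded_linear L \<Longrightarrow> smooth_at f p \<Longrightarrow> smooth_at (\<lambda>x. L (f x :: 'b::euclidean_space)) p"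
 by (rule smooth_at_compose[OF _ smooth_at_linear])

lemma smooth_at_cnj [sm_intros]: "smooth_at f p \<Longrightarrow> smooth_at (\<lambda>x. cnj (f x)) p"
 by (rule smooth_at_bounded_linear[OF bounded_linear_cnj])

lemma smooth_at_inverse [sm_intros]:
 fixes f :: "'a::euclidean_space => complex"
 assumes "smooth_at f p" "f p \<noteq> 0" shows "smooth_at (\<lambda>x. inverse (f x)) p"
proof (rule smooth_at_compose[OF assms(1)])
 show "smooth_at inverse (f p)" unfolding smooth_at_def
  using C_diff_on_inverse assms(2) by (intro exI[of _ "- {0}"]) auto
qed

lemma smooth_at_holomorphic:
 fixes f :: "complex^'k => complex"
 assumes "holomorphic_at f p" shows "smooth_at f p"
proof -
 obtain U where "open U" "p \<in> U" "\<forall>z\<in>U. holomorphic_at f z"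
  using holomorphic_at_eventually[OF assms] unfolding eventually_nhds by blast
 then show ?thesis unfolding smooth_at_def by (intro exI[of _ U]) (simp add: C_diff_on_holomorphic)
qed

lemma smooth_at_nth [sm_intros]: "smooth_at f p \<Longrightarrow> smooth_at (\<lambda>x. (f x :: complex^'k) $ i) p"
 by (rule smooth_at_bounded_linear[OF bounded_linear_vec_nth])

lemma smooth_at_fst [sm_intros]: "smooth_at f p \<Longrightarrow> smooth_at (\<lambda>x. fst (f x :: 'b::euclidean_space \<times> 'c::euclidean_space)) p"
 and smooth_at_snd [sm_intros]: "smooth_at f p \<Longrightarrow> smooth_at (\<lambda>x. snd (f x :: 'b::euclidean_space \<times> 'c::euclidean_space)) p"
 by (rule smooth_at_bounded_linear[OF bounded_linear_fst], assumption)
   (rule smooth_at_bounded_linear[OF bounded_linear_snd])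

lemma smooth_at_vec:
 fixes f :: "'a::euclidean_space => complex^'k"
 assumes "\<And>i. smooth_at (\<lambda>x. f x $ i) p" shows "smooth_at f p"
proof -
 have "bounded_linear (axis i :: complex => complex^'k)" for i by (rule bounded_linear_axis)
 then have "smooth_at (\<lambda>x. \<Sum>i\<in>UNIV. (axis i (f x $ i) :: complex^'k)) p"
  by (intro smooth_at_sum smooth_at_bounded_linear[OF bounded_linear_axis] assms)
 moreover have "(\<Sum>i\<in>UNIV. (axis i (f x $ i) :: complex^'k)) = f x" for x
  by (simp add: vec_eq_iff axis_def)
 ultimately show ?thesis by simp
qed

lemma smooth_at_Pair [sm_intros]:
 fixes f :: "'a::euclidean_space => 'b::euclidean_space" and g :: "'a => 'c::euclidean_space"
 assumes "smooth_at f p" "smooth_at g p" shows "smooth_at (\<lambda>x. (f x, g x)) p"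
proof -
 have "bounded_linear (\<lambda>x::'b. (x, 0::'c))" "bounded_linear (\<lambda>x::'c. (0::'b, x))"
  by (auto intro: bounded_linear_Pair bounded_linear_ident bounded_linear_zero)
 then have "smooth_at (\<lambda>x. (f x, 0) + (0, g x)) p"
  using assms by (intro smooth_at_add smooth_at_bounded_linear[of "\<lambda>x. (x, 0)"] smooth_at_bounded_linear[of "\<lambda>x. (0, x)"])
 then show ?thesis by simp
qed

lemma smooth_at_holomorphic_map: "holomorphic_map_at F p \<Longrightarrow> smooth_at F p"
 unfolding holomorphic_map_at_def by (intro smooth_at_vec smooth_at_holomorphic) blast

lemma smooth_at_FD: "smooth_at f p \<Longrightarrow> smooth_at (\<lambda>x. FD f x v) p"
 unfolding smooth_at_def
proof (elim exE conjE)
 fix U assume "open U" "p \<in> U" "\<forall>k. C_diff_on k f U"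
 then have "C_diff_on (Suc k) f U" for k by blast
 then have "\<forall>k. C_diff_on k (\<lambda>x. FD f x v) U" by simp
 then show "\<exists>U. open U \<and> p \<in> U \<and> (\<forall>k. C_diff_on k (\<lambda>x. FD f x v) U)" using \<open>open U\<close> \<open>p \<in> U\<close> by blast
qed

lemma smooth_at_d_dz [sm_intros]: "smooth_at f p \<Longrightarrow> smooth_at (d_dz j f) p"
 and smooth_at_d_dzbar [sm_intros]: "smooth_at f p \<Longrightarrow> smooth_at (d_dzbar j f) p"
proof -
 assume f: "smooth_at f p"
 have "smooth_at (\<lambda>x. (FD f x (axis j 1) - \<i> * FD f x (axis j \<i>)) * (1 / 2)) p"
  "smooth_at (\<lambda>x. (FD f x (axis j 1) + \<i> * FD f x (axis j \<i>)) * (1 / 2)) p"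
  by (intro sm_intros smooth_at_FD f)+
 then show "smooth_at (d_dz j f) p" "smooth_at (d_dzbar j f) p" by (simp_all add: d_dz_def[abs_def] d_dzbar_def[abs_def])
qed

lemma smooth_at_ct_apply [sm_intros]:
 "smooth_at X p \<Longrightarrow> smooth_at f p \<Longrightarrow> smooth_at (\<lambda>q. ct_apply (X q) f q) p"
 unfolding ct_apply_def by (intro sm_intros)

subsection \<open>Complex tangent vectors as derivations\<close>

text \<open>The complex tangent vector \<open>V\<close> is \<open>rv1 V + \<i> rv2 V\<close> with
real tangent vectors \<open>rv1 V\<close> and \<open>rv2 V\<close>.\<close>

definition rv1 :: "'n::finite ctvec => complex^'n" where
 "rv1 V = (\<chi> j. Complex (Re ((fst V $ j + snd V $ j) / 2)) (Re (\<i> * (snd V $ j - fst V $ j) / 2)))"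

definition rv2 :: "'n::finite ctvec => complex^'n" where
 "rv2 V = (\<chi> j. Complex (Im ((fst V $ j + snd V $ j) / 2)) (Im (\<i> * (snd V $ j - fst V $ j) / 2)))"

lemma FD_expand:
 assumes "linear D"
 shows "D (v :: complex^'n) = (\<Sum>j\<in>UNIV. of_real (Re (v $ j)) * D (axis j 1) + of_real (Im (v $ j)) * (D (axis j \<i>) :: complex))"
proof -
 have "v = (\<Sum>j\<in>UNIV. Re (v $ j) *\<^sub>R axis j 1 + Im (v $ j) *\<^sub>R axis j \<i>)"
  by (simp add: vec_eq_iff axis_def if_distrib[where f = "\<lambda>x. _ *\<^sub>R x"] sum.distrib complex_eq_iff cong: if_cong)
 then have "D v = (\<Sum>j\<in>UNIV. D (Re (v $ j) *\<^sub>R axis j 1 + Im (v $ j) *\<^sub>R axis j \<i>))"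
  using linear_sum[OF assms] by metis
 then show ?thesis unfolding linear_add[OF assms] linear_scale[OF assms] by (simp add: scaleR_conv_of_real)
qed

lemma ct_apply_FD_aux:
 assumes "linear D"
 shows "(\<Sum>j\<in>UNIV. fst V $ j * ((D (axis j 1) - \<i> * D (axis j \<i>)) / 2) + snd V $ j * ((D (axis j 1) + \<i> * D (axis j \<i>)) / 2))
   = D (rv1 V) + \<i> * (D (rv2 V) :: complex)"
proof -
 have *: "of_real (Re a) * x + of_real (Re b) * y + \<i> * (of_real (Im a) * x + of_real (Im b) * y) = a * x + b * y" for a b x y
 proof -
  have ha: "a * x = of_real (Re a) * x + \<i> * (of_real (Im a) * x)"
   by (subst complex_eq[of a]) (simp add: algebra_simps)
  have hb: "b * y = of_real (Re b) * y + \<i> * (of_real (Im b) * y)"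
   by (subst complex_eq[of b]) (simp add: algebra_simps)
  show ?thesis unfolding ha hb by (simp add: algebra_simps)
 qed
 show ?thesis unfolding FD_expand[OF assms, of "rv1 V"] FD_expand[OF assms, of "rv2 V"]
  unfolding sum_distrib_left sum.distrib[symmetric]
 proof (rule sum.cong[OF refl])
  fix j
  show "fst V $ j * ((D (axis j 1) - \<i> * D (axis j \<i>)) / 2) + snd V $ j * ((D (axis j 1) + \<i> * D (axis j \<i>)) / 2) =
    of_real (Re (rv1 V $ j)) * D (axis j 1) + of_real (Im (rv1 V $ j)) * D (axis j \<i>) +
    \<i> * (of_real (Re (rv2 V $ j)) * D (axis j 1) + of_real (Im (rv2 V $ j)) * D (axis j \<i>))"
   unfolding rv1_def rv2_def vec_lambda_beta complex.sel *
   by (simp add: field_simps)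
 qed
qed

lemma ct_apply_FD:
 assumes "f differentiable (at q)"
 shows "ct_apply V f q = FD f q (rv1 V) + \<i> * FD f q (rv2 V)"
 using ct_apply_FD_aux[OF linear_frechet_derivative[OF assms], of V]
 unfolding ct_apply_def d_dz_def d_dzbar_def .

lemma ct_apply_cong:
 assumes "\<forall>\<^sub>F z in nhds q. f z = g z" shows "ct_apply V f q = ct_apply V g q"
proof -
 obtain U where "open U" "q \<in> U" "\<forall>z\<in>U. f z = g z" using assms unfolding eventually_nhds by blast
 then have "FD f q = FD g q" using FD_cong_open(1)[of U q f g] by blast
 then show ?thesis by (simp add: ct_apply_def d_dz_def d_dzbar_def)
qed

lemma d_dz_cong:
 assumes "\<forall>\<^sub>F z in nhds q. f z = g z" shows "d_dz j f q = d_dz j g q" "d_dzbar j f q = d_dzbar j g q"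
proof -
 obtain U where "open U" "q \<in> U" "\<forall>z\<in>U. f z = g z" using assms unfolding eventually_nhds by blast
 then have "FD f q = FD g q" using FD_cong_open(1)[of U q f g] by blast
 then show "d_dz j f q = d_dz j g q" "d_dzbar j f q = d_dzbar j g q" by (simp_all add: d_dz_def d_dzbar_def)
qed

lemma ct_apply_const [simp]: "ct_apply V (\<lambda>z. c) q = 0"
 by (simp add: ct_apply_def d_dz_def d_dzbar_def FD_eq[OF has_derivative_const])

lemma ct_apply_add:
 assumes "f differentiable (at q)" "g differentiable (at q)"
 shows "ct_apply V (\<lambda>z. f z + g z) q = ct_apply V f q + ct_apply V g q"
proof -
 have "FD (\<lambda>z. f z + g z) q = (\<lambda>v. FD f q v + FD g q v)"
  by (intro FD_eq has_derivative_add FD_works assms)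
 then show ?thesis using assms by (simp add: ct_apply_FD algebra_simps)
qed

lemma ct_apply_mult:
 assumes "f differentiable (at q)" "g differentiable (at q)"
 shows "ct_apply V (\<lambda>z. f z * g z) q = f q * ct_apply V g q + ct_apply V f q * g q"
proof -
 have "FD (\<lambda>z. f z * g z) q = (\<lambda>v. f q * FD g q v + FD f q v * g q)"
  by (intro FD_eq has_derivative_mult FD_works assms)
 then show ?thesis using assms by (simp add: ct_apply_FD algebra_simps)
qed

lemma ct_apply_cmult:
 assumes "f differentiable (at q)" shows "ct_apply V (\<lambda>z. c * f z) q = c * ct_apply V f q"
 using ct_apply_mult[of "\<lambda>_. c" q f V] assms by simp

lemma ct_apply_diff:
 assumes "f differentiable (at q)" "g differentiable (at q)"
 shows "ct_apply V (\<lambda>z. f z - g z) q = ct_apply V f q - ct_apply V g q"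
 using ct_apply_add[of f q "\<lambda>z. (-1) * g z" V] ct_apply_cmult[of g q V "-1"] assms by simp

lemma ct_apply_sum:
 assumes "finite I" "\<And>i. i \<in> I \<Longrightarrow> f i differentiable (at q)"
 shows "ct_apply V (\<lambda>z. \<Sum>i\<in>I. f i z) q = (\<Sum>i\<in>I. ct_apply V (f i) q)"
 using assms
proof (induction I)
 case (insert i I)
 then have "ct_apply V (\<lambda>z. f i z + (\<Sum>i\<in>I. f i z)) q = ct_apply V (f i) q + ct_apply V (\<lambda>z. \<Sum>i\<in>I. f i z) q"
  by (intro ct_apply_add differentiable_sum) auto
 then show ?case using insert by simp
qed simp

lemma d_dz_cnj:
 assumes "f differentiable (at q)"
 shows "d_dz j (\<lambda>z. cnj (f z)) q = cnj (d_dzbar j f q)" "d_dzbar j (\<lambda>z. cnj (f z)) q = cnj (d_dz j f q)"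
proof -
 have "FD (\<lambda>z. cnj (f z)) q = (\<lambda>v. cnj (FD f q v))"
  by (intro FD_eq bounded_linear.has_derivative[OF bounded_linear_cnj] FD_works assms)
 then show "d_dz j (\<lambda>z. cnj (f z)) q = cnj (d_dzbar j f q)" "d_dzbar j (\<lambda>z. cnj (f z)) q = cnj (d_dz j f q)"
  by (simp_all add: d_dz_def d_dzbar_def)
qed

lemma ct_apply_cnj:
 assumes "f differentiable (at q)"
 shows "ct_apply V (\<lambda>z. cnj (f z)) q = cnj (ct_apply (ct_cnj V) f q)"
 by (simp add: ct_apply_def d_dz_cnj[OF assms] ct_cnj_def cnj_vec_def add.commute)

lemma ct_apply_field_add: "ct_apply (V + W) f q = ct_apply V f q + ct_apply W f q"
 and ct_apply_field_scale: "ct_apply (ct_scale c V) f q = c * ct_apply V f q"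
 and ct_apply_zero: "ct_apply 0 f q = 0"
 by (simp_all add: ct_apply_def ct_scale_def algebra_simps sum.distrib[symmetric] sum_distrib_left)

lemma ct_apply_field_sum: "ct_apply (\<Sum>i\<in>I. V i) f q = (\<Sum>i\<in>I. ct_apply (V i) f q)"
 by (induction I rule: infinite_finite_induct) (simp_all add: ct_apply_field_add ct_apply_zero)

lemma FD_dz:
 assumes "f differentiable (at q)"
 shows "FD f q v = (\<Sum>j\<in>UNIV. d_dz j f q * v $ j + d_dzbar j f q * cnj (v $ j))"
proof -
 have "d_dz j f q * v $ j + d_dzbar j f q * cnj (v $ j) =
   of_real (Re (v $ j)) * FD f q (axis j 1) + of_real (Im (v $ j)) * FD f q (axis j \<i>)" for j
  unfolding d_dz_def d_dzbar_def by (cases "v $ j") (simp add: Complex_eq field_simps)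
 then show ?thesis using FD_expand[OF linear_frechet_derivative[OF assms], of v] by simp
qed

lemma has_derivative_vec_FD:
 fixes F :: "complex^'n => complex^'k"
 assumes "\<And>k. (\<lambda>z. F z $ k) differentiable (at q)"
 shows "(F has_derivative (\<lambda>v. \<chi> k. FD (\<lambda>z. F z $ k) q v)) (at q)"
 by (rule has_derivative_vecI) (simp add: FD_works[OF assms])

lemma ct_apply_chain:
 fixes F :: "complex^'n => complex^'k"
 assumes F: "\<And>k. (\<lambda>z. F z $ k) differentiable (at q)" and g: "g differentiable (at (F q))"
 shows "ct_apply V (\<lambda>z. g (F z)) q = ct_apply (pushforward F q V) g (F q)"
  "(\<lambda>z. g (F z)) differentiable (at q)"
proof -
 have d: "((\<lambda>z. g (F z)) has_derivative (\<lambda>v. FD g (F q) (\<chi> k. FD (\<lambda>z. F z $ k) q v))) (at q)"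
  by (rule has_derivative_compose[OF has_derivative_vec_FD[OF F] FD_works[OF g]])
 then show df: "(\<lambda>z. g (F z)) differentiable (at q)" using differentiable_def by blast
 have cF: "(\<lambda>z. cnj (F z $ k)) differentiable (at q)" for k
  using bounded_linear.has_derivative[OF bounded_linear_cnj FD_works[OF F]] differentiable_def by blast
 have cFD: "FD (\<lambda>z. cnj (F z $ k)) q v = cnj (FD (\<lambda>z. F z $ k) q v)" for k v
  using FD_eq[OF bounded_linear.has_derivative[OF bounded_linear_cnj FD_works[OF F]]] by metis
 have e: "FD (\<lambda>z. g (F z)) q v = (\<Sum>k\<in>UNIV. d_dz k g (F q) * FD (\<lambda>z. F z $ k) q v + d_dzbar k g (F q) * FD (\<lambda>z. cnj (F z $ k)) q v)" for v
  unfolding FD_eq[OF d] FD_dz[OF g] by (simp add: cFD)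
 show "ct_apply V (\<lambda>z. g (F z)) q = ct_apply (pushforward F q V) g (F q)"
  unfolding ct_apply_FD[OF df] e ct_apply_def[of "pushforward F q V" g "F q"]
  unfolding pushforward_def fst_conv snd_conv vec_lambda_beta
   ct_apply_FD[OF F] ct_apply_FD[OF cF] sum_distrib_left sum.distrib[symmetric]
  by (rule sum.cong) (simp_all add: algebra_simps)
qed

lemma differentiable_nth: "(\<lambda>z. (z::complex^'n) $ i) differentiable (at q)"
 using bounded_linear_imp_differentiable[OF bounded_linear_vec_nth] .

lemma d_dz_nth: "d_dz j (\<lambda>z. z $ i) q = (if i = j then 1 else 0)" "d_dzbar j (\<lambda>z. z $ i) q = 0"
proof -
 have "FD (\<lambda>z. (z::complex^'a) $ i) q = (\<lambda>v. v $ i)"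
  by (intro FD_eq bounded_linear_imp_has_derivative bounded_linear_vec_nth)
 then show "d_dz j (\<lambda>z. z $ i) q = (if i = j then 1 else 0)" "d_dzbar j (\<lambda>z. z $ i) q = 0"
  by (simp_all add: d_dz_def d_dzbar_def axis_def)
qed

lemma ct_apply_nth: "ct_apply V (\<lambda>z. z $ i) q = fst V $ i" "ct_apply V (\<lambda>z. cnj (z $ i)) q = snd V $ i"
 by (simp_all add: ct_apply_def d_dz_nth d_dz_cnj[OF differentiable_nth] if_distrib[where f = "\<lambda>x. _ * x"]
   if_distrib[where f = cnj] cong: if_cong)

subsection \<open>Symmetry of second derivatives and Lie brackets\<close>

text \<open>The mean value theorem, applied in both directions to the second difference of
\<open>f\<close>.\<close>

lemma double_mvt:
 fixes f :: "'a::real_normed_vector => real"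
 assumes "\<And>x. x \<in> ball q \<delta> \<Longrightarrow> f differentiable (at x)"
  "\<And>x. x \<in> ball q \<delta> \<Longrightarrow> (\<lambda>x. FD f x v) differentiable (at x)"
  and h: "h > 0" "h * (norm v + norm w) < \<delta>"
 shows "\<exists>x\<in>ball q \<delta>. f (q + h *\<^sub>R v + h *\<^sub>R w) - f (q + h *\<^sub>R v) - f (q + h *\<^sub>R w) + f q = h * (h * FD (\<lambda>x. FD f x v) x w)"
proof -
 have mem: "q + s *\<^sub>R v + t *\<^sub>R w \<in> ball q \<delta>" if "0 \<le> s" "s \<le> h" "0 \<le> t" "t \<le> h" for s t
 proof -
  have "norm (s *\<^sub>R v + t *\<^sub>R w) \<le> s * norm v + t * norm w"
   using norm_triangle_ineq[of "s *\<^sub>R v" "t *\<^sub>R w"] that by simp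
  also have "\<dots> \<le> h * norm v + h * norm w" using that by (intro add_mono mult_right_mono) auto
  finally have "norm (s *\<^sub>R v + t *\<^sub>R w) < \<delta>" using h(2) by (simp add: distrib_left)
  moreover have "dist q (q + s *\<^sub>R v + t *\<^sub>R w) = norm (s *\<^sub>R v + t *\<^sub>R w)"
   by (metis add.assoc add_diff_cancel_left' dist_norm norm_minus_commute)
  ultimately show ?thesis by simp
 qed
 have line: "((\<lambda>s. g (a + s *\<^sub>R u)) has_field_derivative FD g (a + s *\<^sub>R u) u) (at s)"
  if "g differentiable (at (a + s *\<^sub>R u))" for g :: "'a => real" and a u s
 proof -
  have "((\<lambda>s. a + s *\<^sub>R u) has_derivative (\<lambda>t. t *\<^sub>R u)) (at s)"
   by (auto intro!: derivative_eq_intros)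
  from has_derivative_compose[OF this FD_works[OF that]]
  have "((\<lambda>s. g (a + s *\<^sub>R u)) has_derivative (\<lambda>t. FD g (a + s *\<^sub>R u) (t *\<^sub>R u))) (at s)" .
  moreover have "(\<lambda>t. FD g (a + s *\<^sub>R u) (t *\<^sub>R u)) = (*) (FD g (a + s *\<^sub>R u) u)"
   using linear_scale[OF linear_frechet_derivative[OF that]] by (auto simp: mult.commute)
  ultimately show ?thesis by (simp add: has_field_derivative_def)
 qed
 define \<phi> where "\<phi> = (\<lambda>s. f ((q + h *\<^sub>R w) + s *\<^sub>R v) - f (q + s *\<^sub>R v))"
 have "\<exists>\<xi>>0. \<xi> < h \<and> \<phi> h - \<phi> 0 = (h - 0) * (FD f ((q + h *\<^sub>R w) + \<xi> *\<^sub>R v) v - FD f (q + \<xi> *\<^sub>R v) v)"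
 proof (rule MVT2[OF h(1)])
  fix s assume s: "0 \<le> s" "s \<le> h"
  have "(q + h *\<^sub>R w) + s *\<^sub>R v \<in> ball q \<delta>" "q + s *\<^sub>R v \<in> ball q \<delta>"
   using mem[of s h] mem[of s 0] s h(1) by (simp_all add: add_ac)
  then show "(\<phi> has_real_derivative FD f ((q + h *\<^sub>R w) + s *\<^sub>R v) v - FD f (q + s *\<^sub>R v) v) (at s)"
   unfolding \<phi>_def by (intro DERIV_diff line assms(1))
 qed
 then obtain \<xi> where \<xi>: "0 < \<xi>" "\<xi> < h" "\<phi> h - \<phi> 0 = h * (FD f ((q + h *\<^sub>R w) + \<xi> *\<^sub>R v) v - FD f (q + \<xi> *\<^sub>R v) v)" by auto
 define \<psi> where "\<psi> = (\<lambda>t. FD f ((q + \<xi> *\<^sub>R v) + t *\<^sub>R w) v)"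
 have "\<exists>\<eta>>0. \<eta> < h \<and> \<psi> h - \<psi> 0 = (h - 0) * FD (\<lambda>x. FD f x v) ((q + \<xi> *\<^sub>R v) + \<eta> *\<^sub>R w) w"
 proof (rule MVT2[OF h(1)])
  fix t assume t: "0 \<le> t" "t \<le> h"
  then show "(\<psi> has_real_derivative FD (\<lambda>x. FD f x v) ((q + \<xi> *\<^sub>R v) + t *\<^sub>R w) w) (at t)"
   unfolding \<psi>_def using mem[of \<xi> t] \<xi> by (intro line[of "\<lambda>x. FD f x v"] assms(2)) auto
 qed
 then obtain \<eta> where \<eta>: "0 < \<eta>" "\<eta> < h" "\<psi> h - \<psi> 0 = h * FD (\<lambda>x. FD f x v) ((q + \<xi> *\<^sub>R v) + \<eta> *\<^sub>R w) w" by auto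
 have "\<phi> h - \<phi> 0 = h * (\<psi> h - \<psi> 0)" unfolding \<xi>(3) \<psi>_def by (simp add: add_ac)
 then have "\<phi> h - \<phi> 0 = h * (h * FD (\<lambda>x. FD f x v) ((q + \<xi> *\<^sub>R v) + \<eta> *\<^sub>R w) w)" using \<eta>(3) by simp
 moreover have "\<phi> h - \<phi> 0 = f (q + h *\<^sub>R v + h *\<^sub>R w) - f (q + h *\<^sub>R v) - f (q + h *\<^sub>R w) + f q"
  by (simp add: \<phi>_def add_ac)
 ultimately show ?thesis using mem[of \<xi> \<eta>] \<xi> \<eta> by (intro bexI[of _ "(q + \<xi> *\<^sub>R v) + \<eta> *\<^sub>R w"]) auto
qed

lemma clairaut_real:
 fixes f :: "'a::euclidean_space => real"
 assumes "smooth_at f q"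
 shows "FD (\<lambda>x. FD f x v) q w = FD (\<lambda>x. FD f x w) q v"
proof (rule ccontr)
 define A where "A = (\<lambda>x. FD (\<lambda>x. FD f x v) x w)"
 define B where "B = (\<lambda>x. FD (\<lambda>x. FD f x w) x v)"
 assume "FD (\<lambda>x. FD f x v) q w \<noteq> FD (\<lambda>x. FD f x w) q v"
 then have e: "\<bar>A q - B q\<bar> > 0" by (simp add: A_def B_def)
 define e where "e = \<bar>A q - B q\<bar> / 2"
 have "e > 0" using e by (simp add: e_def)
 let ?good = "\<lambda>x. dist (A x) (A q) < e \<and> dist (B x) (B q) < e \<and> f differentiable (at x) \<and>
   (\<lambda>x. FD f x v) differentiable (at x) \<and> (\<lambda>x. FD f x w) differentiable (at x)"
 have "(A \<longlongrightarrow> A q) (nhds q)" "(B \<longlongrightarrow> B q) (nhds q)"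
  unfolding A_def B_def by (intro smooth_at_tendsto smooth_at_FD assms)+
 then have "\<forall>\<^sub>F x in nhds q. dist (A x) (A q) < e" "\<forall>\<^sub>F x in nhds q. dist (B x) (B q) < e"
  using \<open>e > 0\<close> by (auto simp: tendsto_iff)
 moreover have "\<forall>\<^sub>F x in nhds q. f differentiable (at x)" "\<forall>\<^sub>F x in nhds q. (\<lambda>x. FD f x v) differentiable (at x)"
  "\<forall>\<^sub>F x in nhds q. (\<lambda>x. FD f x w) differentiable (at x)"
  by (intro smooth_at_eventually_diff smooth_at_FD assms)+
 ultimately have "\<forall>\<^sub>F x in nhds q. ?good x"
  by eventually_elim simp
 then obtain \<delta> where \<delta>0: "\<delta> > 0" "\<forall>x. dist x q < \<delta> \<longrightarrow> ?good x"
  unfolding eventually_nhds_metric by blast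
 define h where "h = \<delta> / (norm v + norm w + 1)"
 have pos: "norm v + norm w + 1 > 0" by (simp add: add_nonneg_pos)
 have h: "h > 0" unfolding h_def using \<delta>0(1) pos by simp
 have h2: "h * (norm v + norm w) < \<delta>" unfolding h_def using \<delta>0(1) pos by (simp add: field_simps)
 have "\<exists>x\<in>ball q \<delta>. f (q + h *\<^sub>R v + h *\<^sub>R w) - f (q + h *\<^sub>R v) - f (q + h *\<^sub>R w) + f q = h * (h * A x)"
  unfolding A_def by (rule double_mvt) (use \<delta>0(2) h h2 in \<open>auto simp: dist_commute\<close>)
 then obtain x where x: "x \<in> ball q \<delta>" "f (q + h *\<^sub>R v + h *\<^sub>R w) - f (q + h *\<^sub>R v) - f (q + h *\<^sub>R w) + f q = h * (h * A x)"
  by blast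
 have "\<exists>y\<in>ball q \<delta>. f (q + h *\<^sub>R w + h *\<^sub>R v) - f (q + h *\<^sub>R w) - f (q + h *\<^sub>R v) + f q = h * (h * B y)"
  unfolding B_def by (rule double_mvt) (use \<delta>0(2) h h2 in \<open>auto simp: dist_commute add.commute\<close>)
 then obtain y where y: "y \<in> ball q \<delta>" "f (q + h *\<^sub>R w + h *\<^sub>R v) - f (q + h *\<^sub>R w) - f (q + h *\<^sub>R v) + f q = h * (h * B y)"
  by blast
 have "h * (h * A x) = h * (h * B y)" unfolding x(2)[symmetric] y(2)[symmetric] by (simp add: add_ac)
 then have "A x = B y" using h by simp
 moreover have "dist (A x) (A q) < e" "dist (B y) (B q) < e" using \<delta>0(2) x(1) y(1) by (auto simp: dist_commute)
 moreover have "\<bar>A q - B q\<bar> \<le> \<bar>A x - A q\<bar> + \<bar>B y - B q\<bar>"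
  using abs_triangle_ineq[of "A q - A x" "B y - B q"] \<open>A x = B y\<close> by (simp add: abs_minus_commute)
 ultimately show False unfolding e_def dist_real_def by simp
qed

lemma clairaut:
 fixes f :: "'a::euclidean_space => complex"
 assumes "smooth_at f q"
 shows "FD (\<lambda>x. FD f x v) q w = FD (\<lambda>x. FD f x w) q v"
proof -
 have part: "L (FD (\<lambda>x. FD f x v) q w) = FD (\<lambda>x. FD (\<lambda>x. L (f x)) x v) q w"
  if L: "bounded_linear L" for L :: "complex => real" and v w
 proof -
  have 1: "FD (\<lambda>x. L (f x)) x v = L (FD f x v)" if "f differentiable (at x)" for x
   using FD_eq[OF bounded_linear.has_derivative[OF L FD_works[OF that]]] by simp
  obtain U where U: "open U" "q \<in> U" "\<forall>x\<in>U. f differentiable (at x)"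
   using smooth_at_eventually_diff[OF assms] unfolding eventually_nhds by blast
  have "FD (\<lambda>x. FD (\<lambda>x. L (f x)) x v) q = FD (\<lambda>x. L (FD f x v)) q"
   by (rule FD_cong_open(1)[OF U(1,2)]) (use 1 U(3) in blast)
  also have "\<dots> = (\<lambda>w. L (FD (\<lambda>x. FD f x v) q w))"
   by (intro FD_eq bounded_linear.has_derivative[OF L] FD_works smooth_at_diff smooth_at_FD assms)
  finally show ?thesis by simp
 qed
 have "smooth_at (\<lambda>x. Re (f x)) q" "smooth_at (\<lambda>x. Im (f x)) q"
  by (intro smooth_at_bounded_linear[OF bounded_linear_Re] smooth_at_bounded_linear[OF bounded_linear_Im] assms)+
 then show ?thesis
  using part[OF bounded_linear_Re] part[OF bounded_linear_Im] clairaut_real by (metis complex_eqI)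
qed

lemma ct_apply_sym:
 assumes "smooth_at f q"
 shows "ct_apply V (\<lambda>z. ct_apply W f z) q = ct_apply W (\<lambda>z. ct_apply V f z) q"
proof -
 have *: "ct_apply V (\<lambda>z. ct_apply W f z) q =
   FD (\<lambda>z. FD f z (rv1 W)) q (rv1 V) + \<i> * FD (\<lambda>z. FD f z (rv2 W)) q (rv1 V)
   + \<i> * (FD (\<lambda>z. FD f z (rv1 W)) q (rv2 V) + \<i> * FD (\<lambda>z. FD f z (rv2 W)) q (rv2 V))" for V W
 proof -
  have ev: "\<forall>\<^sub>F z in nhds q. ct_apply W f z = FD f z (rv1 W) + \<i> * FD f z (rv2 W)"
   using smooth_at_eventually_diff[OF assms] by eventually_elim (rule ct_apply_FD)
  have d: "(\<lambda>z. FD f z v) differentiable (at q)" for v by (intro smooth_at_diff smooth_at_FD assms)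
  have "ct_apply V (\<lambda>z. ct_apply W f z) q = ct_apply V (\<lambda>z. FD f z (rv1 W) + \<i> * FD f z (rv2 W)) q"
   by (rule ct_apply_cong[OF ev])
  also have "\<dots> = ct_apply V (\<lambda>z. FD f z (rv1 W)) q + \<i> * ct_apply V (\<lambda>z. FD f z (rv2 W)) q"
   using ct_apply_add[OF d, of "\<lambda>z. \<i> * FD f z (rv2 W)" V "rv1 W"] ct_apply_cmult[OF d, of V \<i> "rv2 W"] d by simp
  finally show ?thesis by (simp add: ct_apply_FD[OF d] algebra_simps)
 qed
 show ?thesis unfolding *[of V W] *[of W V]
  using clairaut[OF assms, of "rv1 W" "rv1 V"] clairaut[OF assms, of "rv2 W" "rv1 V"]
   clairaut[OF assms, of "rv1 W" "rv2 V"] clairaut[OF assms, of "rv2 W" "rv2 V"]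
  by (simp add: algebra_simps)
qed

lemma smooth_at_lie_bracket [sm_intros]:
 assumes "smooth_at X p" "smooth_at Y p" shows "smooth_at (lie_bracket X Y) p"
proof -
 have "smooth_at (\<lambda>q. (\<chi> j. ct_apply (X q) (\<lambda>q. fst (Y q) $ j) q - ct_apply (Y q) (\<lambda>q. fst (X q) $ j) q,
   \<chi> j. ct_apply (X q) (\<lambda>q. snd (Y q) $ j) q - ct_apply (Y q) (\<lambda>q. snd (X q) $ j) q)) p"
  by (intro smooth_at_Pair smooth_at_vec; simp; intro sm_intros assms)
 then show ?thesis by (simp add: lie_bracket_def[abs_def])
qed

lemma ct_apply_variable_field:
 assumes "smooth_at Y q" "smooth_at f q"
 shows "ct_apply V (\<lambda>z. ct_apply (Y z) f z) q = ct_apply V (\<lambda>z. ct_apply (Y q) f z) q +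
  ct_apply (\<chi> j. ct_apply V (\<lambda>z. fst (Y z) $ j) q, \<chi> j. ct_apply V (\<lambda>z. snd (Y z) $ j) q) f q"
proof -
 have d: "d_dz j f differentiable (at q)" "d_dzbar j f differentiable (at q)"
  "(\<lambda>z. fst (Y z) $ j) differentiable (at q)" "(\<lambda>z. snd (Y z) $ j) differentiable (at q)" for j
  by (intro smooth_at_diff sm_intros assms)+
 have dm: "(\<lambda>z. a z * b z) differentiable (at q)" if "a differentiable (at q)" "b differentiable (at q)" for a b :: "complex^'a => complex"
  using that by (rule differentiable_mult)
 have 1: "ct_apply V (\<lambda>z. ct_apply (Y z) f z) q = (\<Sum>j\<in>UNIV.
   (fst (Y q) $ j * ct_apply V (d_dz j f) q + ct_apply V (\<lambda>z. fst (Y z) $ j) q * d_dz j f q) +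
   (snd (Y q) $ j * ct_apply V (d_dzbar j f) q + ct_apply V (\<lambda>z. snd (Y z) $ j) q * d_dzbar j f q))"
  unfolding ct_apply_def[of "Y _" f]
  by (subst ct_apply_sum) (auto intro!: differentiable_add dm d sum.cong simp: ct_apply_add[OF dm dm] ct_apply_mult d)
 have 2: "ct_apply V (\<lambda>z. ct_apply (Y q) f z) q = (\<Sum>j\<in>UNIV.
   fst (Y q) $ j * ct_apply V (d_dz j f) q + snd (Y q) $ j * ct_apply V (d_dzbar j f) q)"
  unfolding ct_apply_def[of "Y _" f]
  by (subst ct_apply_sum) (auto intro!: differentiable_add dm d sum.cong simp: ct_apply_add[OF dm dm] ct_apply_cmult d)
 show ?thesis unfolding 1 2 ct_apply_def[of "(_, _)"] fst_conv snd_conv vec_lambda_beta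
  by (simp add: sum.distrib algebra_simps)
qed

lemma lie_bracket_apply:
 assumes "smooth_at X q" "smooth_at Y q" "smooth_at f q"
 shows "ct_apply (lie_bracket X Y q) f q =
  ct_apply (X q) (\<lambda>z. ct_apply (Y z) f z) q - ct_apply (Y q) (\<lambda>z. ct_apply (X z) f z) q"
proof -
 have "lie_bracket X Y q + (\<chi> j. ct_apply (Y q) (\<lambda>z. fst (X z) $ j) q, \<chi> j. ct_apply (Y q) (\<lambda>z. snd (X z) $ j) q)
   = (\<chi> j. ct_apply (X q) (\<lambda>z. fst (Y z) $ j) q, \<chi> j. ct_apply (X q) (\<lambda>z. snd (Y z) $ j) q)"
  by (simp add: lie_bracket_def vec_eq_iff)
 from arg_cong[OF this, of "\<lambda>V. ct_apply V f q"]
 show ?thesis unfolding ct_apply_field_add ct_apply_variable_field[OF assms(2,3)] ct_apply_variable_field[OF assms(1,3)]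
  using ct_apply_sym[OF assms(3), of "X q" "Y q"] by (simp add: algebra_simps)
qed

section \<open>Prime differential ideals of germs\<close>

definition Xop :: "(complex^'n => 'n::finite ctvec) => (complex^'n => complex) => complex^'n => complex" where
 "Xop X f = (\<lambda>q. ct_apply (X q) f q)"

lemma smooth_at_Xop [sm_intros]: "smooth_at X p \<Longrightarrow> smooth_at f p \<Longrightarrow> smooth_at (Xop X f) p"
 unfolding Xop_def by (intro sm_intros)

lemma smooth_at_Xpow [sm_intros]: "smooth_at X p \<Longrightarrow> smooth_at f p \<Longrightarrow> smooth_at ((Xop X ^^ n) f) p"
 by (induction n) (auto intro: sm_intros)

lemma Xop_cong:
 assumes "\<forall>\<^sub>F z in nhds p. f z = g z" shows "\<forall>\<^sub>F z in nhds p. Xop X f z = Xop X g z"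
proof -
 have "\<forall>\<^sub>F z in nhds p. \<forall>\<^sub>F w in nhds z. f w = g w" using assms by (simp add: eventually_eventually)
 then show ?thesis unfolding Xop_def by eventually_elim (rule ct_apply_cong)
qed

lemma Xpow_cong:
 assumes "\<forall>\<^sub>F z in nhds p. f z = g z" shows "\<forall>\<^sub>F z in nhds p. (Xop X ^^ n) f z = (Xop X ^^ n) g z"
 by (induction n) (simp_all add: assms Xop_cong)

lemma Xop_rules:
 assumes "smooth_at f p" "smooth_at g p"
 shows Xop_add: "\<forall>\<^sub>F z in nhds p. Xop X (\<lambda>z. f z + g z) z = Xop X f z + Xop X g z"
  and Xop_diff: "\<forall>\<^sub>F z in nhds p. Xop X (\<lambda>z. f z - g z) z = Xop X f z - Xop X g z"
  and Xop_mult: "\<forall>\<^sub>F z in nhds p. Xop X (\<lambda>z. f z * g z) z = f z * Xop X g z + Xop X f z * g z"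
proof -
 have "\<forall>\<^sub>F z in nhds p. f differentiable (at z) \<and> g differentiable (at z)"
  using smooth_at_eventually_diff[OF assms(1)] smooth_at_eventually_diff[OF assms(2)] by eventually_elim simp
 then show "\<forall>\<^sub>F z in nhds p. Xop X (\<lambda>z. f z + g z) z = Xop X f z + Xop X g z"
  "\<forall>\<^sub>F z in nhds p. Xop X (\<lambda>z. f z - g z) z = Xop X f z - Xop X g z"
  "\<forall>\<^sub>F z in nhds p. Xop X (\<lambda>z. f z * g z) z = f z * Xop X g z + Xop X f z * g z"
  unfolding Xop_def by (auto elim!: eventually_mono simp: ct_apply_add ct_apply_diff ct_apply_mult)
qed

lemma Xop_sum:
 assumes "finite I" "\<And>i. i \<in> I \<Longrightarrow> smooth_at (f i) p"
 shows "\<forall>\<^sub>F z in nhds p. Xop X (\<lambda>z. \<Sum>i\<in>I. c i * f i z) z = (\<Sum>i\<in>I. c i * Xop X (f i) z)"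
proof -
 have "\<forall>\<^sub>F z in nhds p. \<forall>i\<in>I. f i differentiable (at z)"
  using assms by (intro eventually_ball_finite) (auto intro: smooth_at_eventually_diff)
 then show ?thesis unfolding Xop_def
 proof eventually_elim
  case (elim z)
  have cd: "(\<lambda>z. c i * f i z) differentiable (at z)" if "i \<in> I" for i
   using elim that by (intro differentiable_mult differentiable_const) auto
  have "ct_apply (X z) (\<lambda>z. \<Sum>i\<in>I. c i * f i z) z = (\<Sum>i\<in>I. ct_apply (X z) (\<lambda>z. c i * f i z) z)"
   by (rule ct_apply_sum[OF assms(1) cd])
  also have "\<dots> = (\<Sum>i\<in>I. c i * ct_apply (X z) (f i) z)"
   using elim by (intro sum.cong refl ct_apply_cmult) auto
  finally show ?case .
 qed
qed

lemma Xpow_sum: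
 assumes "smooth_at X p" "finite I" "\<And>i. i \<in> I \<Longrightarrow> smooth_at (f i) p"
 shows "\<forall>\<^sub>F z in nhds p. (Xop X ^^ n) (\<lambda>z. \<Sum>i\<in>I. c i * f i z) z = (\<Sum>i\<in>I. c i * (Xop X ^^ n) (f i) z)"
proof (induction n)
 case (Suc n)
 have "\<forall>\<^sub>F z in nhds p. Xop X ((Xop X ^^ n) (\<lambda>z. \<Sum>i\<in>I. c i * f i z)) z = Xop X (\<lambda>z. \<Sum>i\<in>I. c i * (Xop X ^^ n) (f i) z) z"
  by (rule Xop_cong[OF Suc])
 moreover have "\<forall>\<^sub>F z in nhds p. Xop X (\<lambda>z. \<Sum>i\<in>I. c i * (Xop X ^^ n) (f i) z) z = (\<Sum>i\<in>I. c i * Xop X ((Xop X ^^ n) (f i)) z)"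
  by (rule Xop_sum[OF assms(2)]) (intro sm_intros assms)
 ultimately show ?case by eventually_elim simp
qed simp

lemma leibniz_sum:
 fixes u v :: "nat => complex"
 shows "(\<Sum>k\<le>n. of_nat (n choose k) * (u k * v (Suc (n - k)) + u (Suc k) * v (n - k))) =
  (\<Sum>k\<le>Suc n. of_nat (Suc n choose k) * (u k * v (Suc n - k)))"
proof -
 have "(\<Sum>k\<le>Suc n. of_nat (Suc n choose k) * (u k * v (Suc n - k))) =
   u 0 * v (Suc n) + (\<Sum>k\<le>n. (of_nat (n choose k) + of_nat (n choose Suc k)) * (u (Suc k) * v (n - k)))"
  by (subst sum.atMost_Suc_shift) simp
 also have "\<dots> = (u 0 * v (Suc n) + (\<Sum>k\<le>n. of_nat (n choose Suc k) * (u (Suc k) * v (n - k)))) +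
   (\<Sum>k\<le>n. of_nat (n choose k) * (u (Suc k) * v (n - k)))"
  by (simp add: distrib_right sum.distrib)
 also have "u 0 * v (Suc n) + (\<Sum>k\<le>n. of_nat (n choose Suc k) * (u (Suc k) * v (n - k))) =
   (\<Sum>k\<le>Suc n. of_nat (n choose k) * (u k * v (Suc n - k)))"
  by (subst sum.atMost_Suc_shift) simp
 also have "\<dots> = (\<Sum>k\<le>n. of_nat (n choose k) * (u k * v (Suc (n - k))))"
  by (simp add: Suc_diff_le)
 finally show ?thesis by (simp add: distrib_left sum.distrib)
qed

lemma Xpow_mult:
 assumes "smooth_at X p" "smooth_at f p" "smooth_at g p"
 shows "\<forall>\<^sub>F z in nhds p. (Xop X ^^ n) (\<lambda>z. f z * g z) z =
   (\<Sum>k\<le>n. of_nat (n choose k) * ((Xop X ^^ k) f z * (Xop X ^^ (n - k)) g z))"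
proof (induction n)
 case (Suc n)
 have sm: "smooth_at (\<lambda>z. (Xop X ^^ k) f z * (Xop X ^^ l) g z) p" for k l
  by (intro sm_intros assms)
 have "\<forall>\<^sub>F z in nhds p. Xop X ((Xop X ^^ n) (\<lambda>z. f z * g z)) z =
   Xop X (\<lambda>z. \<Sum>k\<le>n. of_nat (n choose k) * ((Xop X ^^ k) f z * (Xop X ^^ (n - k)) g z)) z"
  by (rule Xop_cong[OF Suc])
 moreover have "\<forall>\<^sub>F z in nhds p. Xop X (\<lambda>z. \<Sum>k\<le>n. of_nat (n choose k) * ((Xop X ^^ k) f z * (Xop X ^^ (n - k)) g z)) z =
   (\<Sum>k\<le>n. of_nat (n choose k) * Xop X (\<lambda>z. (Xop X ^^ k) f z * (Xop X ^^ (n - k)) g z) z)"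
  by (rule Xop_sum) (auto intro: sm)
 moreover have "\<forall>\<^sub>F z in nhds p. \<forall>k\<in>{..n}. Xop X (\<lambda>z. (Xop X ^^ k) f z * (Xop X ^^ (n - k)) g z) z =
   (Xop X ^^ k) f z * (Xop X ^^ Suc (n - k)) g z + (Xop X ^^ Suc k) f z * (Xop X ^^ (n - k)) g z"
 proof (intro eventually_ball_finite ballI)
  fix k
  show "\<forall>\<^sub>F z in nhds p. Xop X (\<lambda>z. (Xop X ^^ k) f z * (Xop X ^^ (n - k)) g z) z =
   (Xop X ^^ k) f z * (Xop X ^^ Suc (n - k)) g z + (Xop X ^^ Suc k) f z * (Xop X ^^ (n - k)) g z"
   using Xop_mult[of "(Xop X ^^ k) f" p "(Xop X ^^ (n - k)) g" X] assms by (simp add: sm_intros)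
 qed simp
 ultimately show ?case
 proof eventually_elim
  case (elim z)
  then have "(Xop X ^^ Suc n) (\<lambda>z. f z * g z) z = (\<Sum>k\<le>n. of_nat (n choose k) *
   ((Xop X ^^ k) f z * (Xop X ^^ Suc (n - k)) g z + (Xop X ^^ Suc k) f z * (Xop X ^^ (n - k)) g z))" by simp
  also have "\<dots> = (\<Sum>k\<le>Suc n. of_nat (Suc n choose k) * ((Xop X ^^ k) f z * (Xop X ^^ (Suc n - k)) g z))"
   by (rule leibniz_sum[of n "\<lambda>k. (Xop X ^^ k) f z" "\<lambda>k. (Xop X ^^ k) g z"])
  finally show ?case .
 qed
qed simp

text \<open>Prime ideals of the ring of smooth germs at \<open>p\<close>, as sets of functions that
are closed under equality of germs.\<close>

definition prime_at :: "complex^'n => (complex^'n => complex) set => bool" where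
 "prime_at p P \<longleftrightarrow> (\<forall>f\<in>P. smooth_at f p \<and> f p = 0) \<and> (\<lambda>_. 0) \<in> P \<and>
   (\<forall>f\<in>P. \<forall>g\<in>P. (\<lambda>z. f z + g z) \<in> P) \<and>
   (\<forall>a f. smooth_at a p \<longrightarrow> f \<in> P \<longrightarrow> (\<lambda>z. a z * f z) \<in> P) \<and>
   (\<forall>f g. f \<in> P \<longrightarrow> (\<forall>\<^sub>F z in nhds p. f z = g z) \<longrightarrow> g \<in> P) \<and>
   (\<forall>f g. smooth_at f p \<longrightarrow> smooth_at g p \<longrightarrow> (\<lambda>z. f z * g z) \<in> P \<longrightarrow> f \<in> P \<or> g \<in> P)"

lemma prime_at_smooth: "prime_at p P \<Longrightarrow> f \<in> P \<Longrightarrow> smooth_at f p"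
 and prime_at_value: "prime_at p P \<Longrightarrow> f \<in> P \<Longrightarrow> f p = 0"
 and prime_at_zero: "prime_at p P \<Longrightarrow> (\<lambda>_. 0) \<in> P"
 and prime_at_add: "prime_at p P \<Longrightarrow> f \<in> P \<Longrightarrow> g \<in> P \<Longrightarrow> (\<lambda>z. f z + g z) \<in> P"
 and prime_at_mult: "prime_at p P \<Longrightarrow> smooth_at a p \<Longrightarrow> f \<in> P \<Longrightarrow> (\<lambda>z. a z * f z :: complex) \<in> P"
 and prime_at_ev: "prime_at p P \<Longrightarrow> f \<in> P \<Longrightarrow> \<forall>\<^sub>F z in nhds p. f z = g z \<Longrightarrow> g \<in> P"
 and prime_at_prime: "prime_at p P \<Longrightarrow> smooth_at f p \<Longrightarrow> smooth_at g p \<Longrightarrow> (\<lambda>z. f z * g z) \<in> P \<Longrightarrow> f \<in> P \<or> g \<in> P"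
 unfolding prime_at_def by blast+

lemma prime_at_diff: "prime_at p P \<Longrightarrow> f \<in> P \<Longrightarrow> g \<in> P \<Longrightarrow> (\<lambda>z. f z - g z) \<in> P"
 using prime_at_add[of p P f "\<lambda>z. (-1) * g z"] prime_at_mult[of p P "\<lambda>_. -1" g] by (simp add: smooth_at_const)

lemma prime_at_sum: "prime_at p P \<Longrightarrow> (\<And>i. i \<in> I \<Longrightarrow> f i \<in> P) \<Longrightarrow> (\<lambda>z. \<Sum>i\<in>I. f i z) \<in> P"
 by (induction I rule: infinite_finite_induct) (auto intro: prime_at_zero prime_at_add)

lemma prime_at_zero_ev: "prime_at p P \<Longrightarrow> \<forall>\<^sub>F z in nhds p. f z = 0 \<Longrightarrow> f \<in> P"
 by (rule prime_at_ev[OF _ prime_at_zero]) (auto elim: eventually_mono)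

lemma prime_at_maximal: "prime_at p {f. smooth_at f p \<and> f p = 0}"
 unfolding prime_at_def
 by (auto intro: sm_intros smooth_at_cong dest: eventually_nhds_x_imp_x)

text \<open>The germs that are flat along \<open>X\<close> modulo \<open>P\<close>.\<close>

definition dclose :: "(complex^'n => 'n::finite ctvec) => (complex^'n => complex) set => (complex^'n => complex) set" where
 "dclose X P = {f. \<forall>a. (Xop X ^^ a) f \<in> P}"

lemma dclose_subset: "dclose X P \<subseteq> P"
 unfolding dclose_def by (auto dest: spec[of _ 0])

lemma dclose_mono: "P \<subseteq> Q \<Longrightarrow> dclose X P \<subseteq> dclose X Q"
 unfolding dclose_def by blast

lemma dclose_Xop:
 assumes "f \<in> dclose X P" shows "Xop X f \<in> dclose X P"
proof -
 have "(Xop X ^^ a) (Xop X f) = (Xop X ^^ Suc a) f" for a by (simp add: funpow_swap1)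
 moreover have "(Xop X ^^ Suc a) f \<in> P" for a using assms unfolding dclose_def by blast
 ultimately show ?thesis unfolding dclose_def by simp
qed

text \<open>If \<open>X ^ a f\<close> and \<open>X ^ b g\<close> are the first derivatives outside
\<open>P\<close>, then modulo \<open>P\<close> the derivative of order \<open>a + b\<close> of the
product is a binomial coefficient times their product, by the Leibniz rule.\<close>

lemma prime_at_dclose:
 fixes p :: "complex^'n"
 assumes P: "prime_at p P" and X: "smooth_at X p" shows "prime_at p (dclose X P)"
 unfolding prime_at_def
proof (intro conjI allI ballI impI)
 fix f assume f: "f \<in> dclose X P"
 then have fP: "f \<in> P" using dclose_subset by blast
 show "smooth_at f p" "f p = 0" using prime_at_smooth[OF P fP] prime_at_value[OF P fP] by auto
next
 have "\<forall>\<^sub>F z in nhds p. (Xop X ^^ a) (\<lambda>_. 0) z = 0" for a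
  using Xpow_sum[OF X, of "{}" "\<lambda>_ _. 0" a] by simp
 then show "(\<lambda>_. 0) \<in> dclose X P" unfolding dclose_def using prime_at_zero_ev[OF P] by blast
next
 fix f g assume f: "f \<in> dclose X P" and g: "g \<in> dclose X P"
 then have sm: "smooth_at f p" "smooth_at g p" using prime_at_smooth[OF P] dclose_subset by blast+
 show "(\<lambda>z. f z + g z) \<in> dclose X P" unfolding dclose_def
 proof (intro CollectI allI)
  fix a
  have "(\<lambda>z. (Xop X ^^ a) f z + (Xop X ^^ a) g z) \<in> P" using f g by (intro prime_at_add[OF P]) (auto simp: dclose_def)
  moreover have "\<forall>\<^sub>F z in nhds p. (Xop X ^^ a) f z + (Xop X ^^ a) g z = (Xop X ^^ a) (\<lambda>z. f z + g z) z"
  proof -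
   have "\<forall>\<^sub>F z in nhds p. (Xop X ^^ a) (\<lambda>z. \<Sum>i\<in>(UNIV::bool set). 1 * (if i then f else g) z) z = (\<Sum>i\<in>(UNIV::bool set). 1 * (Xop X ^^ a) (if i then f else g) z)"
    by (rule Xpow_sum[OF X]) (auto simp: sm)
   then show ?thesis by (simp add: UNIV_bool add.commute) (auto elim: eventually_mono)
  qed
  ultimately show "(Xop X ^^ a) (\<lambda>z. f z + g z) \<in> P" by (rule prime_at_ev[OF P])
 qed
next
 fix a f :: "complex^'n => complex" assume a: "smooth_at a p" and f: "f \<in> dclose X P"
 have sm: "smooth_at f p" using f prime_at_smooth[OF P] dclose_subset by blast
 show "(\<lambda>z. a z * f z) \<in> dclose X P" unfolding dclose_def
 proof (intro CollectI allI)
  fix n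
  have "(\<lambda>z. \<Sum>k\<le>n. of_nat (n choose k) * (Xop X ^^ k) a z * (Xop X ^^ (n - k)) f z) \<in> P"
   using f by (intro prime_at_sum[OF P] prime_at_mult[OF P] sm_intros X a) (auto simp: dclose_def)
  then show "(Xop X ^^ n) (\<lambda>z. a z * f z) \<in> P"
   by (rule prime_at_ev[OF P]) (use Xpow_mult[OF X a sm, of n] in \<open>auto elim!: eventually_mono simp: mult.assoc\<close>)
 qed
next
 fix f g assume "f \<in> dclose X P" "\<forall>\<^sub>F z in nhds p. f z = g z"
 then show "g \<in> dclose X P" unfolding dclose_def using prime_at_ev[OF P] Xpow_cong by blast
next
 fix f g assume sm: "smooth_at f p" "smooth_at g p" and fg: "(\<lambda>z. f z * g z) \<in> dclose X P"
 show "f \<in> dclose X P \<or> g \<in> dclose X P"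
 proof (rule ccontr)
  assume "\<not> (f \<in> dclose X P \<or> g \<in> dclose X P)"
  then obtain i0 j0 where "(Xop X ^^ i0) f \<notin> P" "(Xop X ^^ j0) g \<notin> P" unfolding dclose_def by blast
  then obtain i j where i: "(Xop X ^^ i) f \<notin> P" "\<And>k. k < i \<Longrightarrow> (Xop X ^^ k) f \<in> P"
   and j: "(Xop X ^^ j) g \<notin> P" "\<And>k. k < j \<Longrightarrow> (Xop X ^^ k) g \<in> P"
   using exists_least_iff[of "\<lambda>i. (Xop X ^^ i) f \<notin> P"] exists_least_iff[of "\<lambda>j. (Xop X ^^ j) g \<notin> P"] by auto
  define n where "n = i + j"
  let ?t = "\<lambda>k z. of_nat (n choose k) * ((Xop X ^^ k) f z * (Xop X ^^ (n - k)) g z)"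
  have "(Xop X ^^ n) (\<lambda>z. f z * g z) \<in> P" using fg by (simp add: dclose_def)
  then have "(\<lambda>z. \<Sum>k\<le>n. ?t k z) \<in> P"
   by (rule prime_at_ev[OF P]) (rule Xpow_mult[OF X sm])
  moreover have "(\<lambda>z. \<Sum>k\<in>{..n} - {i}. ?t k z) \<in> P"
  proof (rule prime_at_sum[OF P])
   fix k assume k: "k \<in> {..n} - {i}"
   have "(\<lambda>z. (Xop X ^^ k) f z * (Xop X ^^ (n - k)) g z) \<in> P"
   proof (cases "k < i")
    case True
    have "(\<lambda>z. (Xop X ^^ (n - k)) g z * (Xop X ^^ k) f z) \<in> P"
     by (intro prime_at_mult[OF P] i(2) True sm_intros X sm)
    then show ?thesis by (simp add: mult.commute)
   next
    case False
    then have "n - k < j" using k by (auto simp: n_def)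
    then show ?thesis by (intro prime_at_mult[OF P] j(2) sm_intros X sm)
   qed
   then show "?t k \<in> P" by (rule prime_at_mult[OF P smooth_at_const])
  qed
  ultimately have "(\<lambda>z. (\<Sum>k\<le>n. ?t k z) - (\<Sum>k\<in>{..n} - {i}. ?t k z)) \<in> P" by (rule prime_at_diff[OF P])
  moreover have "(\<Sum>k\<le>n. ?t k z) - (\<Sum>k\<in>{..n} - {i}. ?t k z) = ?t i z" for z
   by (subst sum.remove[of "{..n}" i]) (auto simp: n_def)
  ultimately have "?t i \<in> P" by simp
  then have "(\<lambda>z. (1 / of_nat (n choose i)) * ?t i z) \<in> P" by (rule prime_at_mult[OF P smooth_at_const])
  moreover have "n choose i \<noteq> 0" by (simp add: n_def)
  ultimately have "(\<lambda>z. (Xop X ^^ i) f z * (Xop X ^^ (n - i)) g z) \<in> P" by simp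
  then have "(\<lambda>z. (Xop X ^^ i) f z * (Xop X ^^ j) g z) \<in> P" by (simp add: n_def)
  then show False using prime_at_prime[OF P, of "(Xop X ^^ i) f" "(Xop X ^^ j) g"] i(1) j(1) sm X by (auto intro: sm_intros)
 qed
qed

text \<open>The field at the head of the list acts first.\<close>

primrec dcl :: "(complex^'n => 'n::finite ctvec) list => (complex^'n => complex) set => (complex^'n => complex) set" where
 "dcl [] P = P"
| "dcl (X # w) P = dclose X (dcl w P)"

lemma dcl_mono: "P \<subseteq> Q \<Longrightarrow> dcl w P \<subseteq> dcl w Q"
 by (induction w) (simp_all add: dclose_mono)

lemma dcl_subset: "dcl w P \<subseteq> P"
 using dclose_subset by (induction w) force+

lemma dcl_append: "dcl (v @ w) P = dcl v (dcl w P)"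
 by (induction v) simp_all

lemma prime_at_dcl: "prime_at p P \<Longrightarrow> \<forall>X\<in>set w. smooth_at X p \<Longrightarrow> prime_at p (dcl w P)"
 by (induction w) (simp_all add: prime_at_dclose)

definition dinf :: "(complex^'n => 'n::finite ctvec) set => (complex^'n => complex) set => (complex^'n => complex) set" where
 "dinf S P = (\<Inter>w\<in>lists S. dcl w P)"

lemma dinf_subset: "dinf S P \<subseteq> P"
proof -
 have "dinf S P \<subseteq> dcl [] P" unfolding dinf_def by (rule INF_lower) simp
 then show ?thesis by simp
qed

lemma dinf_Xop:
 assumes "X \<in> S" "f \<in> dinf S P" shows "Xop X f \<in> dinf S P"
proof -
 have "Xop X f \<in> dcl w P" if "w \<in> lists S" for w
 proof -
  have "X # w \<in> lists S" using assms(1) that by simp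
  then have "f \<in> dcl (X # w) P" using INT_D[OF assms(2)[unfolded dinf_def]] by blast
  then have "Xop X f \<in> dclose X (dcl w P)" by (simp add: dclose_Xop)
  then show "Xop X f \<in> dcl w P" using dclose_subset by blast
 qed
 then show ?thesis unfolding dinf_def by blast
qed

text \<open>The intersection is prime because the family is directed: \<open>dcl (v @ w) P\<close>
is contained in both \<open>dcl v P\<close> and \<open>dcl w P\<close>.\<close>

lemma prime_at_dinf:
 fixes p :: "complex^'n"
 assumes P: "prime_at p P" and S: "\<And>X. X \<in> S \<Longrightarrow> smooth_at X p" shows "prime_at p (dinf S P)"
proof -
 have pr: "prime_at p (dcl w P)" if "w \<in> lists S" for w
  by (rule prime_at_dcl[OF P]) (use that S in auto)
 have prime: "f \<in> dinf S P \<or> g \<in> dinf S P"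
  if "smooth_at f p" "smooth_at g p" "(\<lambda>z. f z * g z) \<in> dinf S P" for f g
 proof (rule ccontr)
  assume "\<not> (f \<in> dinf S P \<or> g \<in> dinf S P)"
  then obtain v w where vw: "v \<in> lists S" "w \<in> lists S" "f \<notin> dcl v P" "g \<notin> dcl w P" unfolding dinf_def by blast
  then have "v @ w \<in> lists S" by simp
  then have "f \<in> dcl (v @ w) P \<or> g \<in> dcl (v @ w) P"
   using prime_at_prime[OF pr that(1,2)] that(3) unfolding dinf_def by blast
  moreover have "dcl (v @ w) P \<subseteq> dcl v P" unfolding dcl_append by (rule dcl_mono[OF dcl_subset])
  moreover have "dcl (v @ w) P \<subseteq> dcl w P" unfolding dcl_append by (rule dcl_subset)
  ultimately show False using vw by blast
 qed
 have P': "f \<in> P" if "f \<in> dinf S P" for f using that dinf_subset by blast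
 show ?thesis unfolding prime_at_def
 proof (intro conjI ballI allI impI)
  show "(\<lambda>_. 0) \<in> dinf S P" unfolding dinf_def by (intro INT_I prime_at_zero[OF pr])
  show "(\<lambda>z. f z + g z) \<in> dinf S P" if "f \<in> dinf S P" "g \<in> dinf S P" for f g
   using that unfolding dinf_def by (intro INT_I prime_at_add[OF pr]) auto
  show "(\<lambda>z. a z * f z) \<in> dinf S P" if "smooth_at a p" "f \<in> dinf S P" for a f :: "complex^'n => complex"
   using that unfolding dinf_def by (intro INT_I prime_at_mult[OF pr]) auto
  show "g \<in> dinf S P" if "f \<in> dinf S P" "\<forall>\<^sub>F z in nhds p. f z = g z" for f g
   using that unfolding dinf_def by (intro INT_I prime_at_ev[OF pr, of _ f g]) auto
  show "smooth_at f p" "f p = 0" if "f \<in> dinf S P" for f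
   using P'[OF that] prime_at_smooth[OF P] prime_at_value[OF P] by blast+
  show "f \<in> dinf S P \<or> g \<in> dinf S P" if "smooth_at f p" "smooth_at g p" "(\<lambda>z. f z * g z) \<in> dinf S P" for f g
   by (rule prime[OF that])
 qed
qed

text \<open>The lemma is meant for a holomorphic function \<open>J\<close> and its conjugate \<open>J'\<close>. A field of \<open>S\<close>
annihilates one of them, which therefore stays in the next ideal; the two relations pass this on to
\<open>D\<close> and from \<open>D\<close> to the other one.\<close>

lemma words_in_ideals:
 assumes P0: "prime_at p P0" and S: "\<And>X. X \<in> S \<Longrightarrow> smooth_at X p"
  and sm: "smooth_at J p" "smooth_at J' p" "smooth_at \<delta> p" "smooth_at \<delta>' p" "smooth_at D p"
   "smooth_at u p" "smooth_at u' p" "u p \<noteq> 0" "u' p \<noteq> 0"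
  and rel: "\<And>w. w \<in> lists S \<Longrightarrow> (\<lambda>z. J z * u z - \<delta> z * D z) \<in> dcl w P0"
   "\<And>w. w \<in> lists S \<Longrightarrow> (\<lambda>z. J' z * u' z - \<delta>' z * D z) \<in> dcl w P0"
  and \<delta>: "\<delta> \<notin> P0" "\<delta>' \<notin> P0" and J: "J \<in> P0"
  and kill: "\<And>X. X \<in> S \<Longrightarrow> (\<forall>\<^sub>F z in nhds p. Xop X J z = 0) \<or> (\<forall>\<^sub>F z in nhds p. Xop X J' z = 0)"
  and w: "w \<in> lists S"
 shows "J \<in> dcl w P0 \<and> J' \<in> dcl w P0"
proof -
 \<comment> \<open>in any prime ideal below \<open>P0\<close> the functions \<open>J\<close>, \<open>J'\<close> and \<open>D\<close> lie or do not lie together\<close>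
 have both: "J \<in> dcl w P0 \<and> J' \<in> dcl w P0" if w: "w \<in> lists S" and or: "J \<in> dcl w P0 \<or> J' \<in> dcl w P0" for w
 proof -
  have P: "prime_at p (dcl w P0)" by (rule prime_at_dcl[OF P0]) (use w S in auto)
  have nu: "u \<notin> dcl w P0" "u' \<notin> dcl w P0" using prime_at_value[OF P] sm by blast+
  have nd: "\<delta> \<notin> dcl w P0" "\<delta>' \<notin> dcl w P0" using \<delta> dcl_subset by blast+
  have 1: "J \<in> dcl w P0 \<longleftrightarrow> D \<in> dcl w P0" if "(\<lambda>z. J z * u z - \<delta> z * D z) \<in> dcl w P0"
   "u \<notin> dcl w P0" "\<delta> \<notin> dcl w P0" "smooth_at J p" "smooth_at u p" "smooth_at \<delta> p" for J u \<delta>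
  proof
   assume "J \<in> dcl w P0"
   from prime_at_diff[OF P prime_at_mult[OF P that(5) this] that(1)]
   have "(\<lambda>z. \<delta> z * D z) \<in> dcl w P0" by (simp add: mult.commute)
   then show "D \<in> dcl w P0" using prime_at_prime[OF P that(6) sm(5)] that(3) by blast
  next
   assume "D \<in> dcl w P0"
   from prime_at_add[OF P prime_at_mult[OF P that(6) this] that(1)]
   have "(\<lambda>z. J z * u z) \<in> dcl w P0" by simp
   then show "J \<in> dcl w P0" using prime_at_prime[OF P that(4,5)] that(2) by blast
  qed
  show ?thesis
   using 1[OF rel(1)[OF w] nu(1) nd(1) sm(1,6,3)] 1[OF rel(2)[OF w] nu(2) nd(2) sm(2,7,4)] or by blast
 qed
 have kill': "f \<in> dclose X Q" if Q: "prime_at p Q" and "f \<in> Q" "\<forall>\<^sub>F z in nhds p. Xop X f z = 0" for f X Q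
  unfolding dclose_def
 proof (intro CollectI allI)
  fix a
  show "(Xop X ^^ a) f \<in> Q"
  proof (cases a)
   case (Suc n)
   have z: "\<forall>\<^sub>F z in nhds p. Xop X (\<lambda>_. 0) z = 0" by (simp add: Xop_def)
   have "\<forall>\<^sub>F z in nhds p. (Xop X ^^ Suc m) f z = 0" for m
   proof (induction m)
    case (Suc m)
    from Xop_cong[OF Suc, of X] show ?case by (simp add: Xop_def)
   qed (use that(3) in simp)
   then show ?thesis unfolding Suc by (rule prime_at_zero_ev[OF Q])
  qed (use that(2) in simp)
 qed
 show ?thesis using w
 proof (induction w)
  case Nil
  then show ?case using both[of "[]"] J by simp
 next
  case (Cons X w)
  then have w: "w \<in> lists S" "X \<in> S" by auto
  have Q: "prime_at p (dcl w P0)" by (rule prime_at_dcl[OF P0]) (use w S in auto)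
  have "J \<in> dcl w P0 \<and> J' \<in> dcl w P0" using Cons.IH w by blast
  then have "J \<in> dcl (X # w) P0 \<or> J' \<in> dcl (X # w) P0"
   using kill[OF w(2)] kill'[OF Q, of _ X] by auto
  then show ?case using both[of "X # w"] w by simp
 qed
qed

text \<open>Assign to \<open>f\<close> the power series in \<open>t\<close> and \<open>x\<close>
with coefficients \<open>(L ^ a) (Lb ^ b) f p / (a! b!)\<close>; this is multiplicative. The series
of \<open>J\<close> does not involve \<open>x\<close>, so the lowest coefficient in \<open>t\<close>
of the left hand side is a constant times a unit in \<open>x\<close>. On the right hand side this
coefficient is a product with the series of \<open>D\<close> along \<open>Lb\<close>, which is
nonzero but has no constant term.\<close>

lemma leading_term_comparison:
 assumes L: "smooth_at L p" and Lb: "smooth_at Lb p"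
  and sm: "smooth_at J p" "smooth_at u p" "smooth_at \<delta> p" "smooth_at D p" and u: "u p \<noteq> 0" and D0: "D p = 0"
  and kill: "\<forall>\<^sub>F z in nhds p. Xop Lb J z = 0"
  and eq: "\<And>a b. (Xop L ^^ a) ((Xop Lb ^^ b) (\<lambda>z. J z * u z)) p = (Xop L ^^ a) ((Xop Lb ^^ b) (\<lambda>z. \<delta> z * D z)) p"
  and \<delta>: "\<exists>a. (Xop L ^^ a) \<delta> p \<noteq> 0" and D: "\<exists>b. (Xop Lb ^^ b) D p \<noteq> 0"
 shows False
proof -
 have prod: "(Xop L ^^ a) ((Xop Lb ^^ b) (\<lambda>z. f z * g z)) p = (\<Sum>k\<le>b. of_nat (b choose k) *
    (\<Sum>l\<le>a. of_nat (a choose l) * ((Xop L ^^ l) ((Xop Lb ^^ k) f) p * (Xop L ^^ (a - l)) ((Xop Lb ^^ (b - k)) g) p)))"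
  if fg: "smooth_at f p" "smooth_at g p" for f g a b
 proof -
  have "(Xop L ^^ a) ((Xop Lb ^^ b) (\<lambda>z. f z * g z)) p =
    (Xop L ^^ a) (\<lambda>z. \<Sum>k\<le>b. of_nat (b choose k) * ((Xop Lb ^^ k) f z * (Xop Lb ^^ (b - k)) g z)) p"
   by (rule eventually_nhds_x_imp_x[OF Xpow_cong[OF Xpow_mult[OF Lb fg]]])
  also have "\<dots> = (\<Sum>k\<le>b. of_nat (b choose k) * (Xop L ^^ a) (\<lambda>z. (Xop Lb ^^ k) f z * (Xop Lb ^^ (b - k)) g z) p)"
   by (rule eventually_nhds_x_imp_x[OF Xpow_sum[OF L]]) (auto intro: sm_intros Lb fg)
  also have "\<dots> = (\<Sum>k\<le>b. of_nat (b choose k) *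
    (\<Sum>l\<le>a. of_nat (a choose l) * ((Xop L ^^ l) ((Xop Lb ^^ k) f) p * (Xop L ^^ (a - l)) ((Xop Lb ^^ (b - k)) g) p)))"
   by (intro sum.cong refl arg_cong2[where f = "(*)"] eventually_nhds_x_imp_x[OF Xpow_mult[OF L]] sm_intros Lb fg)
  finally show ?thesis .
 qed
 define a0 where "a0 = (LEAST a. \<exists>b. (Xop L ^^ a) ((Xop Lb ^^ b) \<delta>) p \<noteq> 0)"
 have "\<exists>a b. (Xop L ^^ a) ((Xop Lb ^^ b) \<delta>) p \<noteq> 0" using \<delta> by (metis funpow_0)
 then have a0: "\<exists>b. (Xop L ^^ a0) ((Xop Lb ^^ b) \<delta>) p \<noteq> 0" unfolding a0_def by (rule LeastI_ex)
 have a0': "(Xop L ^^ a) ((Xop Lb ^^ b) \<delta>) p = 0" if "a < a0" for a b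
  using not_less_Least[of a "\<lambda>a. \<exists>b. (Xop L ^^ a) ((Xop Lb ^^ b) \<delta>) p \<noteq> 0"] that unfolding a0_def by blast
 define b0 where "b0 = (LEAST b. (Xop L ^^ a0) ((Xop Lb ^^ b) \<delta>) p \<noteq> 0)"
 have b0: "(Xop L ^^ a0) ((Xop Lb ^^ b0) \<delta>) p \<noteq> 0" unfolding b0_def by (rule LeastI_ex[OF a0])
 have b0': "(Xop L ^^ a0) ((Xop Lb ^^ b) \<delta>) p = 0" if "b < b0" for b
  using not_less_Least[of b "\<lambda>b. (Xop L ^^ a0) ((Xop Lb ^^ b) \<delta>) p \<noteq> 0"] that unfolding b0_def by blast
 define b1 where "b1 = (LEAST b. (Xop Lb ^^ b) D p \<noteq> 0)"
 have b1: "(Xop Lb ^^ b1) D p \<noteq> 0" unfolding b1_def by (rule LeastI_ex[OF D])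
 have b1': "(Xop Lb ^^ b) D p = 0" if "b < b1" for b
  using not_less_Least[of b "\<lambda>b. (Xop Lb ^^ b) D p \<noteq> 0"] that unfolding b1_def by blast
 have b1pos: "b1 > 0" using b1 D0 by (cases b1) auto
 \<comment> \<open>all orders up to \<open>a0\<close>: only the term with all of \<open>L\<close> on \<open>\<delta>\<close> survives\<close>
 have dD: "(Xop L ^^ a) ((Xop Lb ^^ b) (\<lambda>z. \<delta> z * D z)) p =
   (if a < a0 then 0 else (\<Sum>k\<le>b. of_nat (b choose k) * ((Xop L ^^ a0) ((Xop Lb ^^ k) \<delta>) p * (Xop Lb ^^ (b - k)) D p)))"
  if "a \<le> a0" for a b
 proof (cases "a < a0")
  case True
  then show ?thesis unfolding prod[OF sm(3,4)] by (auto intro!: sum.neutral a0')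
 next
  case False
  then have "a = a0" using that by simp
  have "(\<Sum>l\<le>a0. of_nat (a0 choose l) * ((Xop L ^^ l) ((Xop Lb ^^ k) \<delta>) p * (Xop L ^^ (a0 - l)) ((Xop Lb ^^ (b - k)) D) p))
    = (Xop L ^^ a0) ((Xop Lb ^^ k) \<delta>) p * (Xop Lb ^^ (b - k)) D p" for k
   by (subst sum.remove[of _ a0]) (auto intro!: sum.neutral a0')
  then show ?thesis unfolding prod[OF sm(3,4)] \<open>a = a0\<close> by simp
 qed
 have Lbpow: "\<forall>\<^sub>F z in nhds p. (Xop Lb ^^ Suc m) J z = 0" for m
 proof (induction m)
  case (Suc m)
  from Xop_cong[OF Suc, of Lb] show ?case by (simp add: Xop_def)
 qed (use kill in simp)
 have LLb: "(Xop L ^^ l) ((Xop Lb ^^ k) J) p = 0" if "k > 0" for k l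
 proof -
  obtain m where "k = Suc m" using gr0_implies_Suc[OF \<open>k > 0\<close>] by blast
  from eventually_nhds_x_imp_x[OF Xpow_cong[OF Lbpow[of m], where X = L and n = l]]
  have "(Xop L ^^ l) ((Xop Lb ^^ k) J) p = (Xop L ^^ l) (\<lambda>_. 0) p" unfolding \<open>k = Suc m\<close> .
  also have "\<dots> = 0" using eventually_nhds_x_imp_x[OF Xpow_sum[OF L, of "{}" "\<lambda>_ _. 0" l]] by simp
  finally show ?thesis .
 qed
 have Ju: "(Xop L ^^ a) ((Xop Lb ^^ b) (\<lambda>z. J z * u z)) p =
   (\<Sum>l\<le>a. of_nat (a choose l) * ((Xop L ^^ l) J p * (Xop L ^^ (a - l)) ((Xop Lb ^^ b) u) p))" for a b
  unfolding prod[OF sm(1,2)]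
  by (subst sum.remove[of "{..b}" 0]) (auto intro!: sum.neutral simp: LLb)
 have J0: "(Xop L ^^ a) J p = 0" if "a \<le> a0" for a
  using that
 proof (induction a rule: less_induct)
  case (less a)
  have "(Xop L ^^ a) ((Xop Lb ^^ 0) (\<lambda>z. J z * u z)) p = (Xop L ^^ a) J p * u p"
   unfolding Ju by (subst sum.remove[of "{..a}" a]) (use less in \<open>auto intro!: sum.neutral\<close>)
  moreover have "(Xop L ^^ a) ((Xop Lb ^^ 0) (\<lambda>z. \<delta> z * D z)) p = 0"
   unfolding dD[OF less.prems] using D0 by simp
  ultimately show ?case using eq[of a 0] u by simp
 qed
 have "(Xop L ^^ a0) ((Xop Lb ^^ (b0 + b1)) (\<lambda>z. J z * u z)) p = 0"
  unfolding Ju by (auto intro!: sum.neutral simp: J0)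
 moreover have "(Xop L ^^ a0) ((Xop Lb ^^ (b0 + b1)) (\<lambda>z. \<delta> z * D z)) p =
   of_nat ((b0 + b1) choose b0) * ((Xop L ^^ a0) ((Xop Lb ^^ b0) \<delta>) p * (Xop Lb ^^ b1) D p)"
 proof -
  have "(Xop L ^^ a0) ((Xop Lb ^^ k) \<delta>) p * (Xop Lb ^^ (b0 + b1 - k)) D p = 0" if "k \<noteq> b0" "k \<le> b0 + b1" for k
  proof (cases "k < b0")
   case False
   then have "b0 + b1 - k < b1" using that by simp
   then show ?thesis by (simp add: b1')
  qed (simp add: b0')
  then show ?thesis unfolding dD[OF order_refl]
   by (simp, subst sum.remove[of _ b0]) (simp_all add: sum.neutral)
 qed
 ultimately show False using eq[of a0 "b0 + b1"] b0 b1 by simp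
qed

section \<open>Related vector fields\<close>

lemma smooth_at_ct_scale [sm_intros]:
 assumes "smooth_at c p" "smooth_at Y p" shows "smooth_at (\<lambda>z. ct_scale (c z) (Y z :: 'n::finite ctvec)) p"
proof -
 have "smooth_at (\<lambda>z. fst (Y z) $ i) p" "smooth_at (\<lambda>z. snd (Y z) $ i) p" for i
  by (intro sm_intros assms)+
 then show ?thesis unfolding ct_scale_def
  by (intro smooth_at_Pair smooth_at_vec) (simp_all add: smooth_at_mult assms(1))
qed

lemma smooth_at_lie_alg: "X \<in> lie_alg M d \<rho> p \<Longrightarrow> smooth_at X p"
 by (induction rule: lie_alg.induct) (auto intro: sm_intros)

text \<open>Modulo \<open>P\<close> the field \<open>Y\<close> acts on functions pulled back by
\<open>H\<close> as \<open>\<delta>\<close> times \<open>X\<close>. The factor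
\<open>\<delta>\<close> clears the denominators that arise when \<open>X\<close> is lifted along the
possibly singular map \<open>H\<close>.\<close>

definition related ::
 "(complex^'n => complex) set => complex^'n => (complex^'n => complex^'n) =>
  (complex^'n => 'n::finite ctvec) => (complex^'n => complex) => (complex^'n => 'n ctvec) => bool" where
 "related P p H Y \<delta> X \<longleftrightarrow> smooth_at Y p \<and> smooth_at \<delta> p \<and> \<delta> \<notin> P \<and> (\<forall>f\<in>P. Xop Y f \<in> P) \<and>
   (\<forall>g. smooth_at g (H p) \<longrightarrow> (\<lambda>z. Xop Y (\<lambda>z. g (H z)) z - \<delta> z * Xop X g (H z)) \<in> P)"

lemma relatedD:
 assumes "related P p H Y \<delta> X"
 shows "smooth_at Y p" "smooth_at \<delta> p" "\<delta> \<notin> P" "f \<in> P \<Longrightarrow> Xop Y f \<in> P"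
  "smooth_at g (H p) \<Longrightarrow> (\<lambda>z. Xop Y (\<lambda>z. g (H z)) z - \<delta> z * Xop X g (H z)) \<in> P"
 using assms unfolding related_def by blast+

lemma Xop_field_add: "Xop (\<lambda>z. X z + Y z) f z = Xop X f z + Xop Y f z"
 and Xop_field_scale: "Xop (\<lambda>z. ct_scale (c z) (X z)) f z = c z * Xop X f z"
 by (simp_all add: Xop_def ct_apply_field_add ct_apply_field_scale)

lemma Xop_lie_bracket:
 assumes "smooth_at X p" "smooth_at Y p" "smooth_at f p"
 shows "\<forall>\<^sub>F z in nhds p. Xop (lie_bracket X Y) f z = Xop X (Xop Y f) z - Xop Y (Xop X f) z"
 using smooth_at_eventually[OF assms(1)] smooth_at_eventually[OF assms(2)] smooth_at_eventually[OF assms(3)]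
 by eventually_elim (simp add: Xop_def lie_bracket_apply)

lemma related_add:
 fixes p :: "complex^'n"
 assumes P: "prime_at p P" and r: "related P p H Y1 \<delta>1 X1" "related P p H Y2 \<delta>2 X2"
 shows "\<exists>Y \<delta>. related P p H Y \<delta> (\<lambda>q. X1 q + X2 q)"
proof -
 note r1 = relatedD[OF r(1)] and r2 = relatedD[OF r(2)]
 let ?Y = "\<lambda>z. ct_scale (\<delta>2 z) (Y1 z) + ct_scale (\<delta>1 z) (Y2 z)"
 have Y: "Xop ?Y f = (\<lambda>z. \<delta>2 z * Xop Y1 f z + \<delta>1 z * Xop Y2 f z)" for f
  by (simp add: fun_eq_iff Xop_field_add Xop_field_scale)
 have "related P p H ?Y (\<lambda>z. \<delta>1 z * \<delta>2 z) (\<lambda>q. X1 q + X2 q)"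
  unfolding related_def
 proof (intro conjI ballI allI impI)
  show "smooth_at ?Y p" "smooth_at (\<lambda>z. \<delta>1 z * \<delta>2 z) p" by (intro sm_intros r1 r2)+
  show "(\<lambda>z. \<delta>1 z * \<delta>2 z) \<notin> P" using prime_at_prime[OF P r1(2) r2(2)] r1(3) r2(3) by blast
  show "Xop ?Y f \<in> P" if "f \<in> P" for f
   unfolding Y by (intro prime_at_add[OF P] prime_at_mult[OF P] r1(2) r2(2) r1(4) r2(4) that)
  fix g :: "complex^'n => complex" assume g: "smooth_at g (H p)"
  have "(\<lambda>z. \<delta>2 z * (Xop Y1 (\<lambda>z. g (H z)) z - \<delta>1 z * Xop X1 g (H z)) + \<delta>1 z * (Xop Y2 (\<lambda>z. g (H z)) z - \<delta>2 z * Xop X2 g (H z))) \<in> P"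
   by (intro prime_at_add[OF P] prime_at_mult[OF P] r1(2) r2(2) r1(5) r2(5) g)
  moreover have "Xop (\<lambda>q. X1 q + X2 q) g (H z) = Xop X1 g (H z) + Xop X2 g (H z)" for z
   by (rule Xop_field_add)
  ultimately show "(\<lambda>z. Xop ?Y (\<lambda>z. g (H z)) z - \<delta>1 z * \<delta>2 z * Xop (\<lambda>q. X1 q + X2 q) g (H z)) \<in> P"
   unfolding Y by (simp add: algebra_simps)
 qed
 then show ?thesis by blast
qed

lemma related_scale:
 fixes p :: "complex^'n"
 assumes P: "prime_at p P" and r: "related P p H Y \<delta> X"
 shows "\<exists>Y \<delta>. related P p H Y \<delta> (\<lambda>q. ct_scale c (X q))"
proof -
 note r1 = relatedD[OF r]
 let ?Y = "\<lambda>z. ct_scale c (Y z)"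
 have Y: "Xop ?Y f = (\<lambda>z. c * Xop Y f z)" for f
  by (simp add: fun_eq_iff Xop_field_scale)
 have "related P p H ?Y \<delta> (\<lambda>q. ct_scale c (X q))"
  unfolding related_def
 proof (intro conjI ballI allI impI)
  show "smooth_at ?Y p" "smooth_at \<delta> p" by (intro sm_intros r1)+
  show "\<delta> \<notin> P" by (rule r1)
  show "Xop ?Y f \<in> P" if "f \<in> P" for f
   unfolding Y by (intro prime_at_mult[OF P] smooth_at_const r1(4) that)
  fix g :: "complex^'n => complex" assume g: "smooth_at g (H p)"
  have "(\<lambda>z. c * (Xop Y (\<lambda>z. g (H z)) z - \<delta> z * Xop X g (H z))) \<in> P"
   by (intro prime_at_mult[OF P] smooth_at_const r1(5) g)
  moreover have "Xop (\<lambda>q. ct_scale c (X q)) g (H z) = c * Xop X g (H z)" for z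
   by (rule Xop_field_scale)
  ultimately show "(\<lambda>z. Xop ?Y (\<lambda>z. g (H z)) z - \<delta> z * Xop (\<lambda>q. ct_scale c (X q)) g (H z)) \<in> P"
   unfolding Y by (simp add: algebra_simps)
 qed
 then show ?thesis by blast
qed

text \<open>The bracket of \<open>Y1\<close> and \<open>Y2\<close> differentiates the factors
\<open>\<delta>1\<close> and \<open>\<delta>2\<close>; after multiplication by \<open>\<delta>1 *
\<delta>2\<close> these terms are cancelled by multiples of \<open>Y1\<close> and
\<open>Y2\<close>.\<close>

lemma related_bracket:
 fixes p :: "complex^'n"
 assumes P: "prime_at p P" and H: "smooth_at H p" and X: "smooth_at X1 (H p)" "smooth_at X2 (H p)"
  and r: "related P p H Y1 \<delta>1 X1" "related P p H Y2 \<delta>2 X2"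
 shows "\<exists>Y \<delta>. related P p H Y \<delta> (lie_bracket X1 X2)"
proof -
 note r1 = relatedD[OF r(1)] and r2 = relatedD[OF r(2)]
 let ?d = "\<lambda>z. (\<delta>1 z * \<delta>2 z) * (\<delta>1 z * \<delta>2 z)"
 let ?Y = "\<lambda>z. ct_scale (\<delta>1 z * \<delta>2 z) (lie_bracket Y1 Y2 z) +
   (ct_scale (- (Xop Y1 \<delta>2 z * \<delta>1 z)) (Y2 z) + ct_scale (Xop Y2 \<delta>1 z * \<delta>2 z) (Y1 z))"
 have Y: "Xop ?Y f = (\<lambda>z. (\<delta>1 z * \<delta>2 z) * Xop (lie_bracket Y1 Y2) f z +
   (- (Xop Y1 \<delta>2 z * \<delta>1 z) * Xop Y2 f z + Xop Y2 \<delta>1 z * \<delta>2 z * Xop Y1 f z))" for f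
  by (simp add: fun_eq_iff Xop_field_add Xop_field_scale)
 have sm: "smooth_at (Xop Y1 \<delta>2) p" "smooth_at (Xop Y2 \<delta>1) p" by (intro sm_intros r1 r2)+
 have d12: "(\<lambda>z. \<delta>1 z * \<delta>2 z) \<notin> P" using prime_at_prime[OF P r1(2) r2(2)] r1(3) r2(3) by blast
 have sd12: "smooth_at (\<lambda>z. \<delta>1 z * \<delta>2 z) p" by (intro sm_intros r1 r2)
 have "related P p H ?Y ?d (lie_bracket X1 X2)"
  unfolding related_def
 proof (intro conjI ballI allI impI)
  show "smooth_at ?Y p" "smooth_at ?d p" by (intro sm_intros r1 r2 sm)+
  show "?d \<notin> P" using prime_at_prime[OF P sd12 sd12] d12 by blast
  show "Xop ?Y f \<in> P" if f: "f \<in> P" for f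
  proof -
   have "(\<lambda>z. Xop Y1 (Xop Y2 f) z - Xop Y2 (Xop Y1 f) z) \<in> P"
    by (intro prime_at_diff[OF P] r1(4) r2(4) f)
   then have "Xop (lie_bracket Y1 Y2) f \<in> P"
    by (rule prime_at_ev[OF P]) (use Xop_lie_bracket[OF r1(1) r2(1) prime_at_smooth[OF P f]] in \<open>auto elim: eventually_mono\<close>)
   then show ?thesis unfolding Y
    by (intro prime_at_add[OF P] prime_at_mult[OF P] r1(4) r2(4) f sm_intros sm r1(2) r2(2))
  qed
  fix g :: "complex^'n => complex" assume g: "smooth_at g (H p)"
  let ?G = "\<lambda>z. g (H z)"
  have G: "smooth_at ?G p" by (rule smooth_at_compose[OF H g])
  \<comment> \<open>iterating the relation for one field along the other\<close>
  have iter: "(\<lambda>z. Xop Ya (Xop Yb ?G) z - (\<delta>b z * \<delta>a z * Xop Xa (Xop Xb g) (H z) + Xop Ya \<delta>b z * Xop Xb g (H z))) \<in> P"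
   if ra: "related P p H Ya \<delta>a Xa" and rb: "related P p H Yb \<delta>b Xb" and Xb: "smooth_at Xb (H p)" for Ya Yb \<delta>a \<delta>b Xa Xb
  proof -
   note ra = relatedD[OF ra] and rb = relatedD[OF rb]
   have sg: "smooth_at (Xop Xb g) (H p)" by (intro sm_intros Xb g)
   have sgH: "smooth_at (\<lambda>z. Xop Xb g (H z)) p" by (rule smooth_at_compose[OF H sg])
   have s1: "smooth_at (Xop Yb ?G) p" by (intro sm_intros rb(1) G)
   have s2: "smooth_at (\<lambda>z. \<delta>b z * Xop Xb g (H z)) p" by (intro sm_intros rb(2) sgH)
   have "(\<lambda>z. Xop Ya (\<lambda>z. Xop Yb ?G z - \<delta>b z * Xop Xb g (H z)) z +
     \<delta>b z * (Xop Ya (\<lambda>z. Xop Xb g (H z)) z - \<delta>a z * Xop Xa (Xop Xb g) (H z))) \<in> P"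
    by (intro prime_at_add[OF P] prime_at_mult[OF P] rb(2) ra(4) rb(5) g ra(5) sg)
   then show ?thesis
   proof (rule prime_at_ev[OF P])
    show "\<forall>\<^sub>F z in nhds p. Xop Ya (\<lambda>z. Xop Yb ?G z - \<delta>b z * Xop Xb g (H z)) z +
     \<delta>b z * (Xop Ya (\<lambda>z. Xop Xb g (H z)) z - \<delta>a z * Xop Xa (Xop Xb g) (H z)) =
     Xop Ya (Xop Yb ?G) z - (\<delta>b z * \<delta>a z * Xop Xa (Xop Xb g) (H z) + Xop Ya \<delta>b z * Xop Xb g (H z))"
     using Xop_diff[OF s1 s2, of Ya] Xop_mult[OF rb(2) sgH, of Ya]
     by eventually_elim (simp add: algebra_simps)
   qed
  qed
  have "(\<lambda>z. (\<delta>1 z * \<delta>2 z) *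
     ((Xop Y1 (Xop Y2 ?G) z - (\<delta>2 z * \<delta>1 z * Xop X1 (Xop X2 g) (H z) + Xop Y1 \<delta>2 z * Xop X2 g (H z)))
    - (Xop Y2 (Xop Y1 ?G) z - (\<delta>1 z * \<delta>2 z * Xop X2 (Xop X1 g) (H z) + Xop Y2 \<delta>1 z * Xop X1 g (H z))))
    + (- (Xop Y1 \<delta>2 z * \<delta>1 z) * (Xop Y2 ?G z - \<delta>2 z * Xop X2 g (H z)) +
     (Xop Y2 \<delta>1 z * \<delta>2 z) * (Xop Y1 ?G z - \<delta>1 z * Xop X1 g (H z)))) \<in> P"
   by (intro prime_at_add[OF P] prime_at_mult[OF P] prime_at_diff[OF P] iter[OF r X(2)] iter[OF r(2,1) X(1)]
     r1(5) r2(5) g sm_intros sm r1(2) r2(2))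
  then show "(\<lambda>z. Xop ?Y ?G z - ?d z * Xop (lie_bracket X1 X2) g (H z)) \<in> P"
  proof (rule prime_at_ev[OF P])
   have "\<forall>\<^sub>F z in nhds p. Xop (lie_bracket X1 X2) g (H z) = Xop X1 (Xop X2 g) (H z) - Xop X2 (Xop X1 g) (H z)"
    by (rule eventually_compose_filterlim[OF Xop_lie_bracket[OF X g] smooth_at_tendsto[OF H]])
   then show "\<forall>\<^sub>F z in nhds p. (\<delta>1 z * \<delta>2 z) *
     ((Xop Y1 (Xop Y2 ?G) z - (\<delta>2 z * \<delta>1 z * Xop X1 (Xop X2 g) (H z) + Xop Y1 \<delta>2 z * Xop X2 g (H z)))
    - (Xop Y2 (Xop Y1 ?G) z - (\<delta>1 z * \<delta>2 z * Xop X2 (Xop X1 g) (H z) + Xop Y2 \<delta>1 z * Xop X1 g (H z))))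
    + (- (Xop Y1 \<delta>2 z * \<delta>1 z) * (Xop Y2 ?G z - \<delta>2 z * Xop X2 g (H z)) +
     (Xop Y2 \<delta>1 z * \<delta>2 z) * (Xop Y1 ?G z - \<delta>1 z * Xop X1 g (H z)))
    = Xop ?Y ?G z - ?d z * Xop (lie_bracket X1 X2) g (H z)"
    using Xop_lie_bracket[OF r1(1) r2(1) G]
   proof eventually_elim
    case (elim z)
    show ?case unfolding Y elim by (simp add: algebra_simps)
   qed
  qed
 qed
 then show ?thesis by blast
qed

lemma related_lie_alg:
 fixes p :: "complex^'n"
 assumes P: "prime_at p P" and H: "smooth_at H p"
  and base: "\<And>X. smooth_at X (H p) \<Longrightarrow> (\<forall>\<^sub>F q in nhds (H p). q \<in> M \<longrightarrow> X q \<in> T10 d \<rho> q) \<or>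
   (\<forall>\<^sub>F q in nhds (H p). q \<in> M \<longrightarrow> X q \<in> T01 d \<rho> q) \<Longrightarrow> \<exists>Y \<delta>. related P p H Y \<delta> X"
  and X: "X \<in> lie_alg M d \<rho> (H p)"
 shows "\<exists>Y \<delta>. related P p H Y \<delta> X"
 using X
proof induction
 case (bracket X Y)
 then show ?case using related_bracket[OF P H smooth_at_lie_alg smooth_at_lie_alg] by blast
qed (use base related_add[OF P] related_scale[OF P] in blast)+

lemma prime_at_prod_cong:
 fixes A B :: "'i => complex^'n => complex"
 assumes P: "prime_at p P" and "finite I" "\<And>i. i \<in> I \<Longrightarrow> smooth_at (A i) p" "\<And>i. i \<in> I \<Longrightarrow> smooth_at (B i) p"
  "\<And>i. i \<in> I \<Longrightarrow> (\<lambda>z. A i z - B i z) \<in> P"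
 shows "(\<lambda>z. (\<Prod>i\<in>I. A i z) - (\<Prod>i\<in>I. B i z)) \<in> P"
 using assms(2-)
proof (induction I)
 case empty
 then show ?case using prime_at_zero[OF P] by simp
next
 case (insert i I)
 have "(\<lambda>z. A i z * ((\<Prod>i\<in>I. A i z) - (\<Prod>i\<in>I. B i z)) + (\<Prod>i\<in>I. B i z) * (A i z - B i z)) \<in> P"
  by (intro prime_at_add[OF P] prime_at_mult[OF P] insert.IH insert.prems smooth_at_prod) auto
 then show ?case using insert.hyps by (simp add: algebra_simps)
qed

lemma prime_at_det_cong:
 fixes A B :: "complex^'n => complex^'k^'k"
 assumes P: "prime_at p P" and "\<And>i j. smooth_at (\<lambda>z. A z $ i $ j) p" "\<And>i j. smooth_at (\<lambda>z. B z $ i $ j) p"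
  "\<And>i j. (\<lambda>z. A z $ i $ j - B z $ i $ j) \<in> P"
 shows "(\<lambda>z. det (A z) - det (B z)) \<in> P"
proof -
 have "(\<lambda>z. \<Sum>\<pi> | \<pi> permutes UNIV. of_int (sign \<pi>) * ((\<Prod>i\<in>UNIV. A z $ i $ \<pi> i) - (\<Prod>i\<in>UNIV. B z $ i $ \<pi> i))) \<in> P"
  by (intro prime_at_sum[OF P] prime_at_mult[OF P] smooth_at_const prime_at_prod_cong[OF P] assms(2-)) auto
 then show ?thesis unfolding det_def by (simp add: right_diff_distrib sum_subtractf)
qed

lemma prime_at_prod:
 fixes f :: "'i => complex^'n => complex"
 assumes P: "prime_at p P" and "finite I" "\<And>i. i \<in> I \<Longrightarrow> smooth_at (f i) p" "\<And>i. i \<in> I \<Longrightarrow> f i \<notin> P"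
 shows "(\<lambda>z. \<Prod>i\<in>I. f i z) \<notin> P"
 using assms(2-)
proof (induction I)
 case empty
 then show ?case using prime_at_value[OF P, of "\<lambda>_. 1"] by auto
next
 case (insert i I)
 have "(\<lambda>z. f i z * (\<Prod>i\<in>I. f i z)) \<notin> P"
  using prime_at_prime[OF P, of "f i" "\<lambda>z. \<Prod>i\<in>I. f i z"] insert by (auto intro: smooth_at_prod)
 then show ?case using insert.hyps by simp
qed

text \<open>Related fields for a spanning set of fields show that the Jacobian determinant divides,
modulo \<open>P\<close>, a product of the factors \<open>\<delta>\<close> with a determinant that
does not vanish at \<open>p\<close>; none of these lies in \<open>P\<close>.\<close>

lemma jacobian_notin_prime:
 fixes H :: "complex^'n => complex^'n"
 assumes P: "prime_at p P" and H: "holomorphic_map_at H p"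
  and rel: "\<And>X. X \<in> \<X> \<Longrightarrow> \<exists>Y \<delta>. related P p H Y \<delta> X" and smX: "\<And>X. X \<in> \<X> \<Longrightarrow> smooth_at X (H p)"
  and span: "\<And>w. \<exists>X\<in>\<X>. fst (X (H p)) = w"
 shows "(\<lambda>z. det (\<chi> k j. d_dz k (\<lambda>z. H z $ j) z)) \<notin> P"
proof
 assume J: "(\<lambda>z. det (\<chi> k j. d_dz k (\<lambda>z. H z $ j) z)) \<in> P"
 have sH: "smooth_at H p" by (rule smooth_at_holomorphic_map[OF H])
 have "\<forall>s. \<exists>X. X \<in> \<X> \<and> fst (X (H p)) = axis s (1::complex)" using span by blast
 then obtain X where X: "\<And>s. X s \<in> \<X>" "\<And>s. fst (X s (H p)) = axis s (1::complex)"
  using choice[of "\<lambda>s X. X \<in> \<X> \<and> fst (X (H p)) = axis s (1::complex)"] by blast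
 have "\<forall>s. \<exists>Y. \<exists>\<delta>. related P p H Y \<delta> (X s)" using rel X(1) by blast
 then obtain Y where "\<forall>s. \<exists>\<delta>. related P p H (Y s) \<delta> (X s)"
  using choice[of "\<lambda>s Y. \<exists>\<delta>. related P p H Y \<delta> (X s)"] by blast
 then obtain \<delta> where r: "\<And>s. related P p H (Y s) (\<delta> s) (X s)"
  using choice[of "\<lambda>s \<delta>. related P p H (Y s) \<delta> (X s)"] by blast
 note r = relatedD[OF r]
 have Hj: "holomorphic_at (\<lambda>z. H z $ j) p" for j using H by (simp add: holomorphic_map_at_def)
 let ?A = "\<lambda>z. (\<chi> s k. fst (Y s z) $ k) ** (\<chi> k j. d_dz k (\<lambda>z. H z $ j) z)"
 let ?B = "\<lambda>z. \<chi> s j. \<delta> s z * fst (X s (H z)) $ j"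
 have smXH: "smooth_at (\<lambda>z. X s (H z)) p" for s by (rule smooth_at_compose[OF sH smX[OF X(1)]])
 have smA: "smooth_at (\<lambda>z. ?A z $ s $ j) p" for s j
  unfolding matrix_matrix_mult_def by simp (intro sm_intros r(1) smooth_at_holomorphic Hj)
 have smB: "smooth_at (\<lambda>z. ?B z $ s $ j) p" for s j
  by simp (intro sm_intros r(2) smXH)
 have "(\<lambda>z. ?A z $ s $ j - ?B z $ s $ j) \<in> P" for s j
 proof -
  have "smooth_at (\<lambda>z. z $ j) (H p)" by (intro smooth_at_linear bounded_linear_vec_nth)
  from r(5)[OF this] have "(\<lambda>z. Xop (Y s) (\<lambda>z. H z $ j) z - \<delta> s z * fst (X s (H z)) $ j) \<in> P"
   by (simp add: Xop_def ct_apply_nth)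
  then show ?thesis
  proof (rule prime_at_ev[OF P])
   have "\<forall>\<^sub>F z in nhds p. cdiff (\<lambda>z. H z $ j) z" using Hj[of j] by (simp add: holomorphic_at_iff_cdiff)
   then show "\<forall>\<^sub>F z in nhds p. Xop (Y s) (\<lambda>z. H z $ j) z - \<delta> s z * fst (X s (H z)) $ j = ?A z $ s $ j - ?B z $ s $ j"
    by eventually_elim (simp add: Xop_def ct_apply_def cdiff_d_dzbar matrix_matrix_mult_def)
  qed
 qed
 then have dAB: "(\<lambda>z. det (?A z) - det (?B z)) \<in> P" by (rule prime_at_det_cong[OF P smA smB])
 have "(\<lambda>z. det (\<chi> s k. fst (Y s z) $ k) * det (\<chi> k j. d_dz k (\<lambda>z. H z $ j) z)) \<in> P"
  by (rule prime_at_mult[OF P _ J]) (intro smooth_at_det; simp; intro sm_intros r(1))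
 then have "(\<lambda>z. det (?A z)) \<in> P" by (simp add: det_mul)
 from prime_at_diff[OF P this dAB] have "(\<lambda>z. det (?B z)) \<in> P" by simp
 moreover have "det (?B z) = (\<Prod>s\<in>UNIV. \<delta> s z) * det (\<chi> s j. fst (X s (H z)) $ j)" for z
  using det_rows_mul[of "\<lambda>s. \<delta> s z" "\<lambda>s. fst (X s (H z))"] by (simp add: vector_scalar_mult_def)
 ultimately have PB: "(\<lambda>z. (\<Prod>s\<in>UNIV. \<delta> s z) * det (\<chi> s j. fst (X s (H z)) $ j)) \<in> P" by simp
 have smd: "smooth_at (\<lambda>z. det (\<chi> s j. fst (X s (H z)) $ j)) p"
  by (intro smooth_at_det; simp; intro sm_intros smXH)
 have "(\<lambda>z. \<Prod>s\<in>UNIV. \<delta> s z) \<notin> P" by (rule prime_at_prod[OF P]) (simp_all add: r(2,3))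
 moreover have "(\<lambda>z. det (\<chi> s j. fst (X s (H z)) $ j)) \<notin> P"
 proof
  assume "(\<lambda>z. det (\<chi> s j. fst (X s (H z)) $ j)) \<in> P"
  from prime_at_value[OF P this] have "det (\<chi> s j. fst (X s (H p)) $ j) = 0" .
  moreover have "(\<chi> s j. fst (X s (H p)) $ j) = mat 1" by (simp add: X(2) mat_def axis_def vec_eq_iff)
  ultimately show False by simp
 qed
 ultimately show False using prime_at_prime[OF P _ smd PB] r(2) by (auto intro: smooth_at_prod)
qed

section \<open>Comparison of multiplicities\<close>

text \<open>Cramer's formula, whose entries are visibly holomorphic in those of
\<open>A\<close>.\<close>

definition cramer_inv :: "complex^'k^'k => complex^'k^'k" where
 "cramer_inv A = (\<chi> k j. det (\<chi> i l. if l = k then axis j 1 $ i else A $ i $ l) / det A)"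

lemma cramer_inv:
 assumes "det A \<noteq> 0" shows "A ** cramer_inv A = mat 1" "cramer_inv A ** A = mat 1"
proof -
 have "A *v (\<chi> k. cramer_inv A $ k $ j) = axis j 1" for j
  unfolding cramer[OF assms] by (simp add: cramer_inv_def)
 then have "(\<Sum>k\<in>UNIV. A $ i $ k * cramer_inv A $ k $ j) = axis j 1 $ i" for i j
  by (simp add: matrix_vector_mult_def vec_eq_iff)
 then show "A ** cramer_inv A = mat 1"
  by (simp add: matrix_matrix_mult_def mat_def vec_eq_iff axis_def)
 then show "cramer_inv A ** A = mat 1" using matrix_left_right_inverse by blast
qed

lemma holomorphic_at_cramer_inv [hol_intros]:
 assumes "\<And>i j. holomorphic_at (\<lambda>z. A z $ i $ j) p" "det (A p) \<noteq> 0"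
 shows "holomorphic_at (\<lambda>z. cramer_inv (A z) $ k $ j) p"
 unfolding cramer_inv_def vec_lambda_beta
proof (intro holomorphic_at_divide holomorphic_at_det)
 show "holomorphic_at (\<lambda>z. (\<chi> i l. if l = k then axis j 1 $ i else A z $ i $ l) $ i $ l) p" for i l
  by (cases "l = k") (auto intro: hol_intros assms)
qed (use assms in auto)

lemma holomorphic_map_at_compose:
 "holomorphic_map_at F p \<Longrightarrow> holomorphic_map_at G (F p) \<Longrightarrow> holomorphic_map_at (\<lambda>z. G (F z)) p"
 unfolding holomorphic_map_at_def using holomorphic_at_compose[of F p] unfolding holomorphic_map_at_def by blast

lemma eventually_compose_hol:
 assumes "holomorphic_map_at F p" "\<forall>\<^sub>F w in nhds (F p). Q w" shows "\<forall>\<^sub>F z in nhds p. Q (F z)"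
 by (rule eventually_compose_filterlim[OF assms(2) holomorphic_map_at_tendsto[OF assms(1)]])

lemma comp_ideal_compose:
 assumes F: "holomorphic_map_at F x" and g: "holomorphic_at g (F x)"
 shows "(\<lambda>z. g (F z) - g (F x)) \<in> comp_ideal F x"
proof -
 obtain u where u: "\<And>s. holomorphic_at (u s) (F x)"
  "\<forall>\<^sub>F y in nhds (F x). g y = g (F x) + (\<Sum>s\<in>UNIV. (y $ s - F x $ s) * u s y)"
  using hadamard_point[OF g] by blast
 show ?thesis
 proof (rule comp_idealI[where u = "\<lambda>s z. u s (F z)"])
  show "holomorphic_at (\<lambda>z. g (F z) - g (F x)) x" by (intro hol_intros holomorphic_at_compose[OF F g])
  show "holomorphic_at (\<lambda>z. u s (F z)) x" for s by (rule holomorphic_at_compose[OF F u(1)])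
  show "\<forall>\<^sub>F z in nhds x. g (F z) - g (F x) = (\<Sum>j\<in>UNIV. u j (F z) * (F z $ j - F x $ j))"
   using eventually_compose_hol[OF F u(2)] by eventually_elim (simp add: mult.commute)
 qed
qed

lemma comp_ideal_subset:
 assumes "\<And>i. (\<lambda>z. k z $ i - k x $ i) \<in> comp_ideal f x" shows "comp_ideal k x \<subseteq> comp_ideal f x"
proof
 fix g assume "g \<in> comp_ideal k x"
 then obtain u where u: "\<And>j. holomorphic_at (u j) x" "\<forall>\<^sub>F z in nhds x. g z = (\<Sum>j\<in>UNIV. u j z * (k z $ j - k x $ j))"
  unfolding comp_ideal_def conv_series_def by blast
 have "(\<lambda>z. \<Sum>j\<in>UNIV. u j z * (k z $ j - k x $ j)) \<in> comp_ideal f x"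
  by (rule comp_ideal_sum) (auto intro: assms u)
 then show "g \<in> comp_ideal f x" by (rule comp_ideal_cong) (use u(2) in \<open>auto elim: eventually_mono\<close>)
qed

lemma comp_ideal_pullback:
 assumes \<Phi>: "holomorphic_map_at \<Phi> w" and u: "u \<in> comp_ideal f (\<Phi> w)"
 shows "(\<lambda>z. u (\<Phi> z)) \<in> comp_ideal (\<lambda>z. f (\<Phi> z)) w"
proof -
 obtain v where v: "\<And>j. holomorphic_at (v j) (\<Phi> w)" "\<forall>\<^sub>F z in nhds (\<Phi> w). u z = (\<Sum>j\<in>UNIV. v j z * (f z $ j - f (\<Phi> w) $ j))"
  and "holomorphic_at u (\<Phi> w)" using u unfolding comp_ideal_def conv_series_def by blast
 show ?thesis
 proof (rule comp_idealI[where u = "\<lambda>j z. v j (\<Phi> z)"])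
  show "holomorphic_at (\<lambda>z. u (\<Phi> z)) w" "holomorphic_at (\<lambda>z. v j (\<Phi> z)) w" for j
   by (intro holomorphic_at_compose[OF \<Phi>] \<open>holomorphic_at u (\<Phi> w)\<close> v)+
  show "\<forall>\<^sub>F z in nhds w. u (\<Phi> z) = (\<Sum>j\<in>UNIV. v j (\<Phi> z) * (f (\<Phi> z) $ j - f (\<Phi> w) $ j))"
   by (rule eventually_compose_hol[OF \<Phi> v(2)])
 qed
qed

lemma comp_ideal_germ_cong:
 assumes "\<forall>\<^sub>F z in nhds x. f z = f' z" shows "comp_ideal f x = comp_ideal f' x"
proof -
 have x: "f x = f' x" by (rule eventually_nhds_x_imp_x[OF assms])
 have "(\<forall>\<^sub>F z in nhds x. g z = (\<Sum>j\<in>UNIV. u j z * (f z $ j - f x $ j))) \<longleftrightarrow>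
   (\<forall>\<^sub>F z in nhds x. g z = (\<Sum>j\<in>UNIV. u j z * (f' z $ j - f' x $ j)))" for g u
  by (rule eventually_subst) (use assms x in \<open>auto elim: eventually_mono\<close>)
 then show ?thesis unfolding comp_ideal_def by simp
qed

lemma has_codim_biholomorphic:
 fixes f \<Phi> \<Gamma> \<Psi> \<Lambda> g :: "complex^'k => complex^'k"
 assumes f: "holomorphic_map_at f (\<Phi> w)"
  and \<Phi>: "holomorphic_map_at \<Phi> w" and \<Gamma>: "holomorphic_map_at \<Gamma> (\<Phi> w)" "\<Gamma> (\<Phi> w) = w"
   "\<forall>\<^sub>F z in nhds (\<Phi> w). \<Phi> (\<Gamma> z) = z" "\<forall>\<^sub>F v in nhds w. \<Gamma> (\<Phi> v) = v"
  and \<Psi>: "holomorphic_map_at \<Psi> (f (\<Phi> w))" and \<Lambda>: "holomorphic_map_at \<Lambda> (\<Psi> (f (\<Phi> w)))"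
   "\<forall>\<^sub>F y in nhds (f (\<Phi> w)). \<Lambda> (\<Psi> y) = y"
  and g: "\<forall>\<^sub>F v in nhds w. g v = \<Psi> (f (\<Phi> v))"
 shows "has_codim (conv_series (\<Phi> w)) (comp_ideal f (\<Phi> w)) q \<longleftrightarrow> has_codim (conv_series w) (comp_ideal g w) q"
proof (rule has_codim_transfer[where \<phi> = \<Phi>])
 let ?x = "\<Phi> w"
 have gw: "g w = \<Psi> (f ?x)" by (rule eventually_nhds_x_imp_x[OF g])
 have f\<Phi>: "holomorphic_map_at (\<lambda>v. f (\<Phi> v)) w" by (rule holomorphic_map_at_compose[OF \<Phi> f])
 have \<Psi>f: "holomorphic_map_at (\<lambda>z. \<Psi> (f z)) ?x" by (rule holomorphic_map_at_compose[OF f \<Psi>])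
 show "(\<lambda>v. u (\<Phi> v)) \<in> conv_series w" if "u \<in> conv_series ?x" for u
  using that holomorphic_at_compose[OF \<Phi>] by (simp add: conv_series_def)
 show "\<exists>u\<in>conv_series ?x. (\<lambda>v. h v - u (\<Phi> v)) \<in> comp_ideal g w" if "h \<in> conv_series w" for h
 proof (rule bexI[of _ "\<lambda>z. h (\<Gamma> z)"])
  show "(\<lambda>z. h (\<Gamma> z)) \<in> conv_series ?x"
   using that holomorphic_at_compose[OF \<Gamma>(1)] \<Gamma>(2) by (simp add: conv_series_def)
  show "(\<lambda>v. h v - h (\<Gamma> (\<Phi> v))) \<in> comp_ideal g w"
   by (rule comp_ideal_cong[OF zero_in_comp_ideal]) (use \<Gamma>(4) in \<open>auto elim: eventually_mono\<close>)
 qed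
 show "(\<lambda>v. u (\<Phi> v)) \<in> comp_ideal g w \<longleftrightarrow> u \<in> comp_ideal f ?x" if "u \<in> conv_series ?x" for u
 proof
  assume "u \<in> comp_ideal f ?x"
  then have 1: "(\<lambda>v. u (\<Phi> v)) \<in> comp_ideal (\<lambda>v. f (\<Phi> v)) w" by (rule comp_ideal_pullback[OF \<Phi>])
  let ?g = "\<lambda>v. \<Psi> (f (\<Phi> v))"
  have hg: "holomorphic_map_at ?g w" by (rule holomorphic_map_at_compose[OF \<Phi> \<Psi>f])
  have "comp_ideal (\<lambda>v. f (\<Phi> v)) w \<subseteq> comp_ideal ?g w"
  proof (rule comp_ideal_subset)
   fix i
   have "holomorphic_at (\<lambda>y. \<Lambda> y $ i) (?g w)" using \<Lambda>(1) by (simp add: holomorphic_map_at_def)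
   from comp_ideal_compose[OF hg this]
   show "(\<lambda>v. f (\<Phi> v) $ i - f (\<Phi> w) $ i) \<in> comp_ideal ?g w"
   proof (rule comp_ideal_cong)
    have "\<Lambda> (?g w) = f (\<Phi> w)" by (rule eventually_nhds_x_imp_x[OF \<Lambda>(2)])
    moreover have "\<forall>\<^sub>F v in nhds w. \<Lambda> (?g v) = f (\<Phi> v)" by (rule eventually_compose_hol[OF f\<Phi> \<Lambda>(2)])
    ultimately show "\<forall>\<^sub>F v in nhds w. \<Lambda> (?g v) $ i - \<Lambda> (?g w) $ i = f (\<Phi> v) $ i - f (\<Phi> w) $ i"
     by (auto elim: eventually_mono)
   qed
  qed
  also have "comp_ideal ?g w = comp_ideal g w"
   by (rule comp_ideal_germ_cong) (use g in \<open>auto elim: eventually_mono\<close>)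
  finally show "(\<lambda>v. u (\<Phi> v)) \<in> comp_ideal g w" using 1 by blast
 next
  assume "(\<lambda>v. u (\<Phi> v)) \<in> comp_ideal g w"
  then have "(\<lambda>z. u (\<Phi> (\<Gamma> z))) \<in> comp_ideal (\<lambda>z. g (\<Gamma> z)) ?x"
   using comp_ideal_pullback[OF \<Gamma>(1), of "\<lambda>v. u (\<Phi> v)" g] \<Gamma>(2) by simp
  then have "u \<in> comp_ideal (\<lambda>z. g (\<Gamma> z)) ?x"
   by (rule comp_ideal_cong) (use \<Gamma>(3) in \<open>auto elim: eventually_mono\<close>)
  also have "comp_ideal (\<lambda>z. g (\<Gamma> z)) ?x = comp_ideal (\<lambda>z. \<Psi> (f z)) ?x"
  proof (rule comp_ideal_germ_cong)
   have "\<forall>\<^sub>F z in nhds ?x. g (\<Gamma> z) = \<Psi> (f (\<Phi> (\<Gamma> z)))"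
    by (rule eventually_compose_hol[OF \<Gamma>(1)]) (use g \<Gamma>(2) in simp)
   with \<Gamma>(3) show "\<forall>\<^sub>F z in nhds ?x. g (\<Gamma> z) = \<Psi> (f z)" by eventually_elim simp
  qed
  also have "\<dots> \<subseteq> comp_ideal f ?x"
   by (rule comp_ideal_subset) (rule comp_ideal_compose[OF f], use \<Psi> in \<open>simp add: holomorphic_map_at_def\<close>)
  finally show "u \<in> comp_ideal f ?x" .
 qed
qed (rule fsub_comp_ideal fsub_conv_series)+

definition emb :: "('m::finite => 'n::finite) => complex^'m => complex^'n" where
 "emb \<sigma> z = (\<chi> j. if j \<in> range \<sigma> then z $ inv \<sigma> j else 0)"

definition prj :: "('m::finite => 'n::finite) => complex^'n => complex^'m" where
 "prj \<sigma> y = (\<chi> i. y $ \<sigma> i)"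

lemma prj_nth [simp]: "prj \<sigma> y $ i = y $ \<sigma> i" by (simp add: prj_def)

lemma emb_0 [simp]: "emb \<sigma> 0 = 0" and prj_0 [simp]: "prj \<sigma> 0 = 0"
 by (simp_all add: emb_def prj_def vec_eq_iff)

lemma emb_nth: "inj \<sigma> \<Longrightarrow> emb \<sigma> z $ \<sigma> i = z $ i" and emb_nth_out: "j \<notin> range \<sigma> \<Longrightarrow> emb \<sigma> z $ j = 0"
 by (simp_all add: emb_def)

lemma prj_emb: "inj \<sigma> \<Longrightarrow> prj \<sigma> (emb \<sigma> z) = z"
 by (simp add: vec_eq_iff emb_nth)

lemma emb_prj: "inj \<sigma> \<Longrightarrow> emb \<sigma> (prj \<sigma> y) = zero_on (- range \<sigma>) y"
 by (auto simp: vec_eq_iff emb_def)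

lemma holomorphic_map_at_emb: "holomorphic_map_at (emb \<sigma>) p"
 unfolding holomorphic_map_at_def
proof
 show "holomorphic_at (\<lambda>z. emb \<sigma> z $ j) p" for j
  by (cases "j \<in> range \<sigma>") (auto simp: emb_def intro: hol_intros)
qed

lemma holomorphic_map_at_prj: "holomorphic_map_at (prj \<sigma>) p"
 unfolding holomorphic_map_at_def prj_def by (auto intro: hol_intros)

lemma d_dz_ct: "d_dz s f q = ct_apply (axis s 1, 0) f q"
proof -
 have "(\<Sum>j\<in>UNIV. axis s (1::complex) $ j * d_dz j f q) = d_dz s f q"
  by (simp add: axis_def if_distrib[where f = "\<lambda>x. x * _"] cong: if_cong)
 then show ?thesis by (simp add: ct_apply_def)
qed

text \<open>If a map is block triangular along the coordinate subspace \<open>range (emb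
\<sigma>)\<close>, with invertible complementary block, then by Hadamard's lemma and inversion of
this block its ideal contains the complementary coordinates. Restriction to the subspace then does
not change the quotient.\<close>

lemma has_codim_slice:
 fixes F :: "complex^'n => complex^'n" and \<sigma> :: "'m::finite => 'n"
 assumes \<sigma>: "inj \<sigma>" and F: "holomorphic_map_at F 0" and F0: "F 0 = 0"
  and van: "\<And>l. l \<notin> range \<sigma> \<Longrightarrow> \<forall>\<^sub>F z in nhds 0. F (emb \<sigma> z) $ l = 0"
  and nondeg: "\<And>v :: complex^'n. (\<And>j. j \<in> range \<sigma> \<Longrightarrow> v $ j = 0) \<Longrightarrow>
    (\<And>l. l \<notin> range \<sigma> \<Longrightarrow> (\<Sum>s\<in>UNIV. d_dz s (\<lambda>z. F z $ l) 0 * v $ s) = 0) \<Longrightarrow> v = 0"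
 shows "has_codim (conv_series 0) (comp_ideal F 0) q \<longleftrightarrow>
  has_codim (conv_series 0) (comp_ideal (\<lambda>z. prj \<sigma> (F (emb \<sigma> z))) 0) q"
proof (rule has_codim_transfer[where \<phi> = "emb \<sigma>"])
 let ?k = "\<lambda>z. prj \<sigma> (F (emb \<sigma> z))"
 define K where "K = - range \<sigma>"
 have hF: "holomorphic_at (\<lambda>z. F z $ j) 0" for j using F by (simp add: holomorphic_map_at_def)
 have he: "holomorphic_at g 0 \<Longrightarrow> holomorphic_at (\<lambda>z. g (emb \<sigma> z)) 0" for g
  using holomorphic_at_compose[OF holomorphic_map_at_emb[of \<sigma> 0], of g] by simp
 have hp: "holomorphic_at g 0 \<Longrightarrow> holomorphic_at (\<lambda>y. g (prj \<sigma> y)) 0" for g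
  using holomorphic_at_compose[OF holomorphic_map_at_prj[of \<sigma> 0], of g] by simp
 have k0: "?k 0 = 0" using F0 by simp
 have ev_prj: "\<forall>\<^sub>F y in nhds 0. Q (prj \<sigma> y)" if "\<forall>\<^sub>F z in nhds 0. Q z" for Q
  using eventually_compose_hol[OF holomorphic_map_at_prj[of \<sigma> 0], of Q] that by simp
 have ev_emb: "\<forall>\<^sub>F y in nhds 0. Q (emb \<sigma> y)" if "\<forall>\<^sub>F z in nhds 0. Q z" for Q
  using eventually_compose_hol[OF holomorphic_map_at_emb[of \<sigma> 0], of Q] that by simp
 \<comment> \<open>the complementary coordinates lie in the ideal\<close>
 have coord: "(\<lambda>y. y $ s) \<in> comp_ideal F 0" if s: "s \<in> K" for s
 proof -
  have "\<forall>l. \<exists>a. l \<in> K \<longrightarrow> (\<forall>s. holomorphic_at (a s) 0) \<and> (\<forall>\<^sub>F y in nhds 0. F y $ l = (\<Sum>s\<in>K. y $ s * a s y))"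
  proof (intro allI)
   fix l
   show "\<exists>a. l \<in> K \<longrightarrow> (\<forall>s. holomorphic_at (a s) 0) \<and> (\<forall>\<^sub>F y in nhds 0. F y $ l = (\<Sum>s\<in>K. y $ s * a s y))"
   proof (cases "l \<in> K")
    case True
    obtain a where a: "\<And>s. holomorphic_at (a s) 0" "\<forall>\<^sub>F y in nhds 0. F y $ l = F (zero_on K y) $ l + (\<Sum>s\<in>K. y $ s * a s y)"
     using hadamard_zero[OF finite hF] by blast
    have "\<forall>\<^sub>F y in nhds 0. F (emb \<sigma> (prj \<sigma> y)) $ l = 0" using ev_prj[OF van] True by (simp add: K_def)
    with a(2) have "\<forall>\<^sub>F y in nhds 0. F y $ l = (\<Sum>s\<in>K. y $ s * a s y)"
     by eventually_elim (simp add: emb_prj[OF \<sigma>] K_def)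
    then show ?thesis using a(1) by blast
   qed auto
  qed
  from choice[OF this] obtain a where a: "\<And>l s. l \<in> K \<Longrightarrow> holomorphic_at (a l s) 0"
   "\<And>l. l \<in> K \<Longrightarrow> \<forall>\<^sub>F y in nhds 0. F y $ l = (\<Sum>s\<in>K. y $ s * a l s y)" by blast
  define A where "A = (\<lambda>y. \<chi> l s. if l \<in> K \<and> s \<in> K then a l s y else if l = s then 1 else (0::complex))"
  have hA: "holomorphic_at (\<lambda>y. A y $ l $ s) 0" for l s
   by (cases "l \<in> K \<and> s \<in> K"; cases "l = s") (auto simp: A_def intro: a hol_intros)
  have a0: "d_dz s (\<lambda>z. F z $ l) 0 = a l s 0" if l: "l \<in> K" and s: "s \<in> K" for l s
  proof -
   have d: "a l t differentiable (at 0)" for t using a(1)[OF l] smooth_at_diff smooth_at_holomorphic by blast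
   have dm: "(\<lambda>y. y $ t * a l t y) differentiable (at 0)" for t
    by (intro differentiable_mult differentiable_nth d)
   have "d_dz s (\<lambda>z. F z $ l) 0 = d_dz s (\<lambda>y. \<Sum>t\<in>K. y $ t * a l t y) 0"
    by (rule d_dz_cong(1)[OF a(2)[OF l]])
   also have "\<dots> = (\<Sum>t\<in>K. ct_apply (axis s 1, 0) (\<lambda>y. y $ t * a l t y) 0)"
    unfolding d_dz_ct by (rule ct_apply_sum) (auto intro: dm)
   also have "\<dots> = (\<Sum>t\<in>K. if t = s then a l s 0 else 0)"
    by (intro sum.cong refl) (simp add: ct_apply_mult[OF differentiable_nth d] ct_apply_nth axis_def)
   also have "\<dots> = a l s 0" using s by simp
   finally show ?thesis .
  qed
  have "det (A 0) \<noteq> 0"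
  proof -
   have "v = 0" if v: "A 0 *v v = 0" for v
   proof (rule nondeg)
    have vl: "(\<Sum>s\<in>UNIV. A 0 $ l $ s * v $ s) = 0" for l using v by (simp add: matrix_vector_mult_def vec_eq_iff)
    show vj: "v $ j = 0" if "j \<in> range \<sigma>" for j
    proof -
     have "(\<Sum>s\<in>UNIV. A 0 $ j $ s * v $ s) = (\<Sum>s\<in>UNIV. if s = j then v $ j else 0)"
      using that by (intro sum.cong) (auto simp: A_def K_def)
     then show ?thesis using vl[of j] by simp
    qed
    show "(\<Sum>s\<in>UNIV. d_dz s (\<lambda>z. F z $ l) 0 * v $ s) = 0" if l: "l \<notin> range \<sigma>" for l
    proof -
     have "d_dz s (\<lambda>z. F z $ l) 0 * v $ s = A 0 $ l $ s * v $ s" for s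
      using a0[of l s] l vj[of s] by (cases "s \<in> K") (auto simp: A_def K_def)
     then have "(\<Sum>s\<in>UNIV. d_dz s (\<lambda>z. F z $ l) 0 * v $ s) = (\<Sum>s\<in>UNIV. A 0 $ l $ s * v $ s)"
      by (intro sum.cong refl)
     then show ?thesis using vl[of l] by simp
    qed
   qed
   then show ?thesis using matrix_left_invertible_ker[of "A 0"] invertible_det_nz[of "A 0"] invertible_left_inverse[of "A 0"] by blast
  qed
  let ?B = "\<lambda>y. cramer_inv (A y)"
  have hB: "holomorphic_at (\<lambda>y. ?B y $ i $ j) 0" for i j
   by (rule holomorphic_at_cramer_inv[OF hA \<open>det (A 0) \<noteq> 0\<close>])
  have detA: "\<forall>\<^sub>F y in nhds 0. det (A y) \<noteq> 0"
  proof (rule tendsto_imp_eventually_ne[OF _ \<open>det (A 0) \<noteq> 0\<close>])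
   have "holomorphic_at (\<lambda>y. det (A y)) 0" by (intro hol_intros hA)
   then show "((\<lambda>y. det (A y)) \<longlongrightarrow> det (A 0)) (nhds 0)"
    using smooth_at_tendsto smooth_at_holomorphic by blast
  qed
  have "\<forall>\<^sub>F y in nhds 0. \<forall>l\<in>K. F y $ l = (\<Sum>s\<in>K. y $ s * a l s y)"
   using a(2) by (intro eventually_ball_finite) auto
  with detA have ev: "\<forall>\<^sub>F y in nhds 0. (\<Sum>l\<in>K. ?B y $ s $ l * F y $ l) = y $ s"
  proof eventually_elim
   case (elim y)
   define y' where "y' = zero_on (range \<sigma>) y"
   have Ay': "(A y *v y') $ l = (if l \<in> K then F y $ l else 0)" for l
   proof (cases "l \<in> K")
    case True
    have "(\<Sum>s\<in>UNIV. A y $ l $ s * y' $ s) = (\<Sum>s\<in>K. y $ s * a l s y)"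
     by (rule sum.mono_neutral_cong_right) (use True in \<open>auto simp: A_def K_def y'_def\<close>)
    then show ?thesis using elim(2) True by (simp add: matrix_vector_mult_def)
   next
    case False
    then have "(\<Sum>s\<in>UNIV. A y $ l $ s * y' $ s) = 0"
     by (intro sum.neutral) (auto simp: A_def K_def y'_def)
    then show ?thesis using False by (simp add: matrix_vector_mult_def)
   qed
   have "?B y *v (A y *v y') = y'"
    by (simp add: matrix_vector_mul_assoc cramer_inv(2)[OF elim(1)])
   then have "(\<Sum>l\<in>UNIV. ?B y $ s $ l * (A y *v y') $ l) = y' $ s"
    by (simp add: matrix_vector_mult_def[of "?B y"] vec_eq_iff)
   moreover have "(\<Sum>l\<in>UNIV. ?B y $ s $ l * (A y *v y') $ l) = (\<Sum>l\<in>K. ?B y $ s $ l * F y $ l)"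
    by (rule sum.mono_neutral_cong_right) (auto simp: Ay')
   ultimately show ?case using s by (simp add: y'_def K_def)
  qed
  have Fl: "(\<lambda>y. F y $ l) \<in> comp_ideal F 0" for l
  proof (rule comp_idealI[where u = "\<lambda>j _. if j = l then 1 else 0"])
   show "\<forall>\<^sub>F z in nhds 0. F z $ l = (\<Sum>j\<in>UNIV. (if j = l then 1 else 0) * (F z $ j - F 0 $ j))"
    using F0 by (simp add: if_distrib[where f = "\<lambda>x. x * _"] cong: if_cong)
  qed (auto intro: hF hol_intros)
  have "(\<lambda>y. \<Sum>l\<in>K. ?B y $ s $ l * F y $ l) \<in> comp_ideal F 0"
   by (rule comp_ideal_sum[OF Fl hB])
  then show ?thesis by (rule comp_ideal_cong[OF _ ev])
 qed
 show "(\<lambda>z. u (emb \<sigma> z)) \<in> conv_series 0" if "u \<in> conv_series 0" for u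
  using that he by (simp add: conv_series_def)
 show "\<exists>u\<in>conv_series 0. (\<lambda>z. h z - u (emb \<sigma> z)) \<in> comp_ideal ?k 0" if "h \<in> conv_series 0" for h
  using that hp by (intro bexI[of _ "\<lambda>y. h (prj \<sigma> y)"]) (auto simp: conv_series_def prj_emb[OF \<sigma>] zero_in_comp_ideal)
 show "(\<lambda>z. u (emb \<sigma> z)) \<in> comp_ideal ?k 0 \<longleftrightarrow> u \<in> comp_ideal F 0" if u: "u \<in> conv_series 0" for u
 proof
  assume "u \<in> comp_ideal F 0"
  then obtain w where w: "\<And>j. holomorphic_at (w j) 0" "\<forall>\<^sub>F y in nhds 0. u y = (\<Sum>j\<in>UNIV. w j y * (F y $ j - F 0 $ j))"
   unfolding comp_ideal_def conv_series_def by blast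
  show "(\<lambda>z. u (emb \<sigma> z)) \<in> comp_ideal ?k 0"
  proof (rule comp_idealI[where u = "\<lambda>i z. w (\<sigma> i) (emb \<sigma> z)"])
   show "holomorphic_at (\<lambda>z. u (emb \<sigma> z)) 0" "holomorphic_at (\<lambda>z. w (\<sigma> i) (emb \<sigma> z)) 0" for i
    using u by (auto intro!: he w simp: conv_series_def)
   have "\<forall>\<^sub>F z in nhds 0. \<forall>l\<in>K. F (emb \<sigma> z) $ l = 0"
    using van by (intro eventually_ball_finite) (auto simp: K_def)
   with ev_emb[OF w(2)] show "\<forall>\<^sub>F z in nhds 0. u (emb \<sigma> z) = (\<Sum>i\<in>UNIV. w (\<sigma> i) (emb \<sigma> z) * (?k z $ i - ?k 0 $ i))"
   proof eventually_elim
    case (elim z)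
    have "u (emb \<sigma> z) = (\<Sum>j\<in>range \<sigma>. w j (emb \<sigma> z) * F (emb \<sigma> z) $ j)"
     unfolding elim(1) F0 by (rule sum.mono_neutral_cong_right) (use elim(2) in \<open>auto simp: K_def\<close>)
    also have "\<dots> = (\<Sum>i\<in>UNIV. w (\<sigma> i) (emb \<sigma> z) * F (emb \<sigma> z) $ \<sigma> i)"
     using \<sigma> by (simp add: sum.reindex)
    finally show ?case using k0 by simp
   qed
  qed
 next
  assume "(\<lambda>z. u (emb \<sigma> z)) \<in> comp_ideal ?k 0"
  then obtain w where w: "\<And>i. holomorphic_at (w i) 0" "\<forall>\<^sub>F z in nhds 0. u (emb \<sigma> z) = (\<Sum>i\<in>UNIV. w i z * (?k z $ i - ?k 0 $ i))"
   unfolding comp_ideal_def conv_series_def by blast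
  define D where "D = (\<lambda>y. u y - (\<Sum>i\<in>UNIV. w i (prj \<sigma> y) * F y $ \<sigma> i))"
  have hD: "holomorphic_at D 0" unfolding D_def using u by (intro hol_intros hp w hF) (simp add: conv_series_def)
  obtain v where v: "\<And>s. holomorphic_at (v s) 0" "\<forall>\<^sub>F y in nhds 0. D y = D (zero_on K y) + (\<Sum>s\<in>K. y $ s * v s y)"
   using hadamard_zero[OF finite hD] by blast
  have "(\<lambda>y. (\<Sum>s\<in>K. v s y * y $ s) + (\<Sum>i\<in>UNIV. w i (prj \<sigma> y) * F y $ \<sigma> i)) \<in> comp_ideal F 0"
  proof (rule fsub_add[OF fsub_comp_ideal])
   show "(\<lambda>y. \<Sum>s\<in>K. v s y * y $ s) \<in> comp_ideal F 0" by (rule comp_ideal_sum[OF coord v(1)])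
   have Fl: "(\<lambda>y. F y $ l) \<in> comp_ideal F 0" for l
   proof (rule comp_idealI[where u = "\<lambda>j _. if j = l then 1 else 0"])
    show "\<forall>\<^sub>F z in nhds 0. F z $ l = (\<Sum>j\<in>UNIV. (if j = l then 1 else 0) * (F z $ j - F 0 $ j))"
     using F0 by (simp add: if_distrib[where f = "\<lambda>x. x * _"] cong: if_cong)
   qed (auto intro: hF hol_intros)
   show "(\<lambda>y. \<Sum>i\<in>UNIV. w i (prj \<sigma> y) * F y $ \<sigma> i) \<in> comp_ideal F 0"
    by (rule comp_ideal_sum) (auto intro: Fl hp w)
  qed
  moreover have "\<forall>\<^sub>F y in nhds 0. (\<Sum>s\<in>K. v s y * y $ s) + (\<Sum>i\<in>UNIV. w i (prj \<sigma> y) * F y $ \<sigma> i) = u y"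
   using v(2) ev_prj[OF w(2)]
  proof eventually_elim
   case (elim y)
   have "D (zero_on K y) = 0"
    using elim(2) F0 by (simp add: D_def K_def emb_prj[OF \<sigma>, symmetric] prj_emb[OF \<sigma>])
   then have "(\<Sum>s\<in>K. v s y * y $ s) = D y" using elim(1) by (simp add: mult.commute)
   then show ?case by (simp add: D_def)
  qed
  ultimately show "u \<in> comp_ideal F 0" by (rule comp_ideal_cong)
 qed
qed (rule fsub_comp_ideal fsub_conv_series)+

section \<open>Polarisation\<close>

definition pair :: "complex^'n => complex^'n => complex^('n::finite + 'n)" where
 "pair Z \<zeta> = (\<chi> i. case i of Inl j => Z $ j | Inr j => \<zeta> $ j)"

definition lft :: "complex^('n::finite + 'n) => complex^'n" where "lft w = (\<chi> j. w $ Inl j)"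
definition rgt :: "complex^('n::finite + 'n) => complex^'n" where "rgt w = (\<chi> j. w $ Inr j)"

abbreviation diag :: "complex^'n => complex^('n::finite + 'n)" where
 "diag Z \<equiv> pair Z (cnj_vec Z)"

lemma pair_nth [simp]: "pair Z \<zeta> $ Inl j = Z $ j" "pair Z \<zeta> $ Inr j = \<zeta> $ j"
 and lft_nth [simp]: "lft w $ j = w $ Inl j" and rgt_nth [simp]: "rgt w $ j = w $ Inr j"
 and cnj_vec_nth [simp]: "cnj_vec v $ j = cnj (v $ j)"
 by (simp_all add: pair_def lft_def rgt_def cnj_vec_def)

lemma lft_pair [simp]: "lft (pair Z \<zeta>) = Z" and rgt_pair [simp]: "rgt (pair Z \<zeta>) = \<zeta>"
 and pair_lft_rgt [simp]: "pair (lft w) (rgt w) = w"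
 by (auto simp: vec_eq_iff pair_def split: sum.split)

lemma sum_UNIV_Plus: "(\<Sum>i\<in>(UNIV :: ('n::finite + 'n) set). f i) = (\<Sum>j\<in>UNIV. f (Inl j)) + (\<Sum>j\<in>UNIV. f (Inr j))"
 using sum.Plus[of "UNIV :: 'n set" "UNIV :: 'n set" f] by simp

lemma prod_UNIV_Plus: "(\<Prod>i\<in>(UNIV :: ('n::finite + 'n) set). f i) = (\<Prod>j\<in>UNIV. f (Inl j)) * (\<Prod>j\<in>UNIV. f (Inr j))"
 using prod.Plus[of "UNIV :: 'n set" "UNIV :: 'n set" f] by simp

lemma holomorphic_map_at_lft: "holomorphic_map_at lft w" and holomorphic_map_at_rgt: "holomorphic_map_at rgt w"
 unfolding holomorphic_map_at_def by (simp_all add: holomorphic_at_nth)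

lemma holomorphic_map_at_pair:
 assumes "holomorphic_map_at f p" "holomorphic_map_at g p"
 shows "holomorphic_map_at (\<lambda>z. pair (f z) (g z)) p"
 unfolding holomorphic_map_at_def
proof
 show "holomorphic_at (\<lambda>z. pair (f z) (g z) $ i) p" for i
  using assms by (cases i) (simp_all add: holomorphic_map_at_def)
qed

lemma bounded_linear_diag: "bounded_linear (diag :: complex^'n => _)"
proof -
 have "linear (diag :: complex^'n => _)"
  by (rule linearI) (auto simp: vec_eq_iff pair_def split: sum.split)
 then show ?thesis by (simp add: linear_conv_bounded_linear)
qed

lemma diag_tendsto: "(diag \<longlongrightarrow> diag p) (nhds p)"
 using linear_continuous_at[OF bounded_linear_diag, of p] unfolding isCont_def tendsto_at_iff_tendsto_nhds[of diag p] .

lemma smooth_at_diag: "holomorphic_at F (diag p) \<Longrightarrow> smooth_at (\<lambda>Z. F (diag Z)) p"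
 by (rule smooth_at_compose[OF smooth_at_linear[OF bounded_linear_diag] smooth_at_holomorphic])

lemma d_dz_diag:
 assumes "cdiff F (diag p)"
 shows "d_dz j (\<lambda>Z. F (diag Z)) p = d_dz (Inl j) F (diag p)"
  "d_dzbar j (\<lambda>Z. F (diag Z)) p = d_dz (Inr j) F (diag p)"
proof -
 have "((\<lambda>Z. F (diag Z)) has_derivative (\<lambda>v. \<Sum>i\<in>UNIV. d_dz i F (diag p) * diag v $ i)) (at p)"
  by (rule has_derivative_compose[OF bounded_linear_imp_has_derivative[OF bounded_linear_diag] cdiff_has_derivative[OF assms]])
 then have FD: "FD (\<lambda>Z. F (diag Z)) p = (\<lambda>v. (\<Sum>j\<in>UNIV. d_dz (Inl j) F (diag p) * v $ j) + (\<Sum>j\<in>UNIV. d_dz (Inr j) F (diag p) * cnj (v $ j)))"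
  by (subst FD_eq) (auto simp: sum_UNIV_Plus)
 show "d_dz j (\<lambda>Z. F (diag Z)) p = d_dz (Inl j) F (diag p)"
  "d_dzbar j (\<lambda>Z. F (diag Z)) p = d_dz (Inr j) F (diag p)"
  unfolding d_dz_def[of j "\<lambda>Z. F (diag Z)"] d_dzbar_def FD
  by (simp_all add: axis_def if_distrib[where f = "\<lambda>x. _ * x"] if_distrib[where f = cnj] ring_distribs mult.left_commute[of \<i>] mult.assoc[of \<i> \<i>, symmetric] cong: if_cong)
qed

lemma complexification_holomorphic:
 assumes "complexification_at f p R"
 shows "holomorphic_at (\<lambda>w. R (lft w) (rgt w)) (diag p)" "\<forall>\<^sub>F Z in nhds p. R Z (cnj_vec Z) = of_real (f Z)"
proof -
 obtain a r where r: "r > 0" and hs: "\<forall>Z\<in>ball p r. \<forall>\<zeta>\<in>ball (cnj_vec p) r.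
      ((\<lambda>(\<alpha>, \<beta>). a (\<alpha>, \<beta>) * monomial (Z - p) \<alpha> * monomial (\<zeta> - cnj_vec p) \<beta>) has_sum R Z \<zeta>) UNIV"
  and eq: "\<forall>Z\<in>ball p r. R Z (cnj_vec Z) = complex_of_real (f Z)"
  using assms unfolding complexification_at_def by blast
 have "\<forall>\<^sub>F Z in nhds p. Z \<in> ball p r" using r by (intro eventually_nhds_in_open) auto
 then show "\<forall>\<^sub>F Z in nhds p. R Z (cnj_vec Z) = of_real (f Z)" by eventually_elim (use eq in blast)
 define S where "S = (\<lambda>\<gamma> :: 'a + 'a => nat. (\<lambda>j. \<gamma> (Inl j), \<lambda>j. \<gamma> (Inr j)))"
 have bij: "bij_betw S UNIV UNIV"
  by (rule bij_betw_byWitness[where f' = "\<lambda>(\<alpha>, \<beta>). case_sum \<alpha> \<beta>"]) (auto simp: S_def fun_eq_iff split: sum.split)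
 have mono: "monomial w \<gamma> = monomial (lft w) (fst (S \<gamma>)) * monomial (rgt w) (snd (S \<gamma>))" for w :: "complex^('a + 'a)" and \<gamma>
  unfolding monomial_def prod_UNIV_Plus by (simp add: S_def)
 have "((\<lambda>\<gamma>. a (S \<gamma>) * monomial (w - diag p) \<gamma>) has_sum R (lft w) (rgt w)) UNIV" if w: "w \<in> ball (diag p) r" for w
 proof -
  have le: "norm (lft v) \<le> norm v" "norm (rgt v) \<le> norm v" for v :: "complex^('a + 'a)"
  proof -
   have "norm v ^ 2 = (\<Sum>j\<in>UNIV. norm (v $ Inl j) ^ 2) + (\<Sum>j\<in>UNIV. norm (v $ Inr j) ^ 2)"
    by (simp add: norm_vec_def L2_set_def sum_UNIV_Plus sum_nonneg)
   moreover have "norm (lft v) ^ 2 = (\<Sum>j\<in>UNIV. norm (v $ Inl j) ^ 2)" "norm (rgt v) ^ 2 = (\<Sum>j\<in>UNIV. norm (v $ Inr j) ^ 2)"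
    by (simp_all add: norm_vec_def L2_set_def sum_nonneg)
   ultimately have "norm (lft v) ^ 2 \<le> norm v ^ 2" "norm (rgt v) ^ 2 \<le> norm v ^ 2" by (simp_all add: sum_nonneg)
   then show "norm (lft v) \<le> norm v" "norm (rgt v) \<le> norm v" by (auto intro: power2_le_imp_le)
  qed
  have d: "lft w - p = lft (w - diag p)" "rgt w - cnj_vec p = rgt (w - diag p)" by (simp_all add: vec_eq_iff)
  have "norm (w - diag p) < r" using w by (simp add: dist_norm norm_minus_commute)
  then have "norm (lft w - p) < r" "norm (rgt w - cnj_vec p) < r" unfolding d using le le_less_trans by blast+
  then have "lft w \<in> ball p r" "rgt w \<in> ball (cnj_vec p) r" by (simp_all add: dist_norm norm_minus_commute)
  with hs have "((\<lambda>(\<alpha>, \<beta>). a (\<alpha>, \<beta>) * monomial (lft w - p) \<alpha> * monomial (rgt w - cnj_vec p) \<beta>) has_sum R (lft w) (rgt w)) UNIV" by blast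
  then have "((\<lambda>x. a x * monomial (lft (w - diag p)) (fst x) * monomial (rgt (w - diag p)) (snd x)) has_sum R (lft w) (rgt w)) UNIV"
   unfolding d by (simp add: case_prod_unfold)
  then have "((\<lambda>\<gamma>. a (S \<gamma>) * monomial (lft (w - diag p)) (fst (S \<gamma>)) * monomial (rgt (w - diag p)) (snd (S \<gamma>))) has_sum R (lft w) (rgt w)) UNIV"
   by (subst has_sum_reindex_bij_betw[OF bij])
  then show ?thesis by (simp add: mono mult.assoc)
 qed
 then show "holomorphic_at (\<lambda>w. R (lft w) (rgt w)) (diag p)"
  unfolding holomorphic_at_def using r by (intro exI[of _ "\<lambda>\<gamma>. a (S \<gamma>)"] exI[of _ r]) auto
qed

section \<open>Linear algebra of defining functions\<close>

text \<open>Substituting a linear relation into the alternating form leaves only terms with a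
repeated factor, and these cancel in pairs.\<close>

lemma wedge_independent:
 fixes w :: "nat => 'v => complex"
 assumes "wedge d w v \<noteq> 0" and dep: "\<And>x. (\<Sum>k<d. c k * w k x) = 0" and "k0 < d"
 shows "c k0 = 0"
proof (rule ccontr)
 assume c: "c k0 \<noteq> 0"
 define e where "e = (\<lambda>k. - c k / c k0)"
 have w0: "w k0 x = (\<Sum>k\<in>{..<d} - {k0}. e k * w k x)" for x
 proof -
  have "c k0 * w k0 x + (\<Sum>k\<in>{..<d} - {k0}. c k * w k x) = 0"
   using dep[of x] assms(3) by (subst (asm) sum.remove[of _ k0]) auto
  then have "c k0 * w k0 x = - (\<Sum>k\<in>{..<d} - {k0}. c k * w k x)" by (simp add: eq_neg_iff_add_eq_0)
  then have "w k0 x = - (\<Sum>k\<in>{..<d} - {k0}. c k * w k x) / c k0" using c by (simp add: field_simps)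
  also have "\<dots> = (\<Sum>k\<in>{..<d} - {k0}. e k * w k x)"
   by (simp add: e_def sum_divide_distrib sum_negf[symmetric])
  finally show ?thesis .
 qed
 let ?P = "{\<pi>. \<pi> permutes {..<d}}"
 have fin: "finite ?P" by (rule finite_permutations) simp
 have "wedge d w v = (\<Sum>\<pi>\<in>?P. \<Sum>k\<in>{..<d} - {k0}. e k * (of_int (sign \<pi>) * (w k (v (\<pi> k0)) * (\<Prod>i\<in>{..<d} - {k0}. w i (v (\<pi> i))))))"
  unfolding wedge_def
 proof (intro sum.cong refl)
  fix \<pi>
  have "(\<Prod>i<d. w i (v (\<pi> i))) = w k0 (v (\<pi> k0)) * (\<Prod>i\<in>{..<d} - {k0}. w i (v (\<pi> i)))"
   using assms(3) by (subst prod.remove[of _ k0]) auto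
  then show "of_int (sign \<pi>) * (\<Prod>i<d. w i (v (\<pi> i))) = (\<Sum>k\<in>{..<d} - {k0}. e k * (of_int (sign \<pi>) * (w k (v (\<pi> k0)) * (\<Prod>i\<in>{..<d} - {k0}. w i (v (\<pi> i))))))"
   unfolding w0[of "v (\<pi> k0)"] by (simp add: sum_distrib_left sum_distrib_right mult_ac)
 qed
 also have "\<dots> = (\<Sum>k\<in>{..<d} - {k0}. e k * (\<Sum>\<pi>\<in>?P. of_int (sign \<pi>) * (w k (v (\<pi> k0)) * (\<Prod>i\<in>{..<d} - {k0}. w i (v (\<pi> i))))))"
  by (subst sum.swap) (simp add: sum_distrib_left)
 also have "\<dots> = 0"
 proof (rule sum.neutral, rule ballI)
  fix k assume k: "k \<in> {..<d} - {k0}"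
  \<comment> \<open>a form with a repeated factor changes sign under the transposition of the two places\<close>
  let ?t = "Transposition.transpose k0 k"
  let ?f = "\<lambda>\<pi>. of_int (sign \<pi>) * (w k (v (\<pi> k0)) * (\<Prod>i\<in>{..<d} - {k0}. w i (v (\<pi> i)))) :: complex"
  have tp: "?t permutes {..<d}" using k assms(3) by (intro permutes_swap_id) auto
  have f: "?f (\<pi> \<circ> ?t) = - ?f \<pi>" if "\<pi> permutes {..<d}" for \<pi>
  proof -
   have "sign (\<pi> \<circ> ?t) = - sign \<pi>"
    using k that tp by (subst sign_compose) (auto simp: permutation_permutes sign_swap_id intro: permutation_permutes[THEN iffD2])
   moreover have "w k (v (\<pi> k0)) * (\<Prod>i\<in>{..<d} - {k0}. w i (v (\<pi> i))) = w k (v (\<pi> k0)) * (w k (v (\<pi> k)) * (\<Prod>i\<in>{..<d} - {k0} - {k}. w i (v (\<pi> i))))" for \<pi>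
    using k by (subst prod.remove[of "{..<d} - {k0}" k]) auto
   note A = calculation(1) and B = this
   have "(\<Prod>i\<in>{..<d} - {k0} - {k}. w i (v ((\<pi> \<circ> ?t) i))) = (\<Prod>i\<in>{..<d} - {k0} - {k}. w i (v (\<pi> i)))"
    by (rule prod.cong) (auto simp: Transposition.transpose_def)
   then show ?thesis unfolding B A by (simp add: mult_ac)
  qed
  have "(\<Sum>\<pi>\<in>?P. ?f \<pi>) = (\<Sum>\<pi>\<in>?P. ?f (\<pi> \<circ> ?t))"
  proof (rule sum.reindex_bij_witness[where i = "\<lambda>\<pi>. \<pi> \<circ> ?t" and j = "\<lambda>\<pi>. \<pi> \<circ> ?t"])
   show "\<pi> \<circ> ?t \<in> ?P" "\<pi> \<circ> ?t \<in> ?P" if "\<pi> \<in> ?P" for \<pi>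
    using permutes_compose[OF tp, of \<pi>] that unfolding mem_Collect_eq by -
  qed (simp_all add: comp_assoc)
  also have "\<dots> = - (\<Sum>\<pi>\<in>?P. ?f \<pi>)" using f by (simp add: sum_negf[symmetric])
  finally show "e k * (\<Sum>\<pi>\<in>?P. ?f \<pi>) = 0" by simp
 qed
 finally show False using assms(1) by simp
qed

lemma extend_rows:
 fixes w :: "nat => complex^'n"
 assumes ind: "\<And>c k. (\<Sum>k<d. c k *s w k) = 0 \<Longrightarrow> k < d \<Longrightarrow> c k = 0"
 shows "d \<le> CARD('n)" and "\<And>\<tau> :: nat => 'n. inj_on \<tau> {..<d} \<Longrightarrow> \<exists>L :: complex^'n^'n. (\<forall>k<d. L $ \<tau> k = w k) \<and> det L \<noteq> 0"
proof -
 have inj: "inj_on w {..<d}"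
 proof (rule inj_onI, rule ccontr)
  fix i j assume ij: "i \<in> {..<d}" "j \<in> {..<d}" "w i = w j" "i \<noteq> j"
  let ?c = "\<lambda>l. if l = i then 1 else if l = j then -1 else (0::complex)"
  have "(\<Sum>l<d. ?c l *s w l) = (\<Sum>l\<in>{i, j}. ?c l *s w l)"
   using ij by (intro sum.mono_neutral_right) auto
  also have "\<dots> = 0" using ij by (simp add: vec_eq_iff)
  finally have "?c i = 0" using ind[of ?c i] ij(1) by blast
  then show False by simp
 qed
 define W where "W = w ` {..<d}"
 have cardW: "card W = d" unfolding W_def using card_image[OF inj] by simp
 have finW: "finite W" by (simp add: W_def)
 have indW: "vec.independent W"
 proof
  assume "vec.dependent W"
  then obtain u where u: "\<exists>v\<in>W. u v \<noteq> 0" "(\<Sum>v\<in>W. u v *s v) = 0" unfolding vec.dependent_finite[OF finW] by blast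
  have "(\<Sum>k<d. u (w k) *s w k) = 0" using u(2) unfolding W_def by (simp add: sum.reindex[OF inj])
  then have "u (w k) = 0" if "k < d" for k using ind[of "\<lambda>k. u (w k)"] that by blast
  then show False using u(1) by (auto simp: W_def)
 qed
 define Bs where "Bs = vec.extend_basis W"
 have Bs: "W \<subseteq> Bs" "vec.independent Bs" "vec.span Bs = UNIV"
  unfolding Bs_def using vec.extend_basis_superset[OF indW] vec.independent_extend_basis[OF indW] vec.span_extend_basis[OF indW] by auto
 have finB: "finite Bs" using Bs(2) vec.finiteI_independent by blast
 have cardB: "card Bs = CARD('n)"
  using vec.dim_eq_card_independent[OF Bs(2)] vec.dim_span[of Bs] vec.dim_UNIV Bs(3) by (metis vec_dim_card)
 show dn: "d \<le> CARD('n)" using card_mono[OF finB Bs(1)] cardW cardB by simp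
 fix \<tau> :: "nat => 'n" assume \<tau>: "inj_on \<tau> {..<d}"
 define K where "K = \<tau> ` {..<d}"
 have "card (- K) = card (Bs - W)"
 proof -
  have "card K = d" unfolding K_def using card_image[OF \<tau>] by simp
  then have "card (- K) = CARD('n) - d" by (simp add: Compl_eq_Diff_UNIV card_Diff_subset)
  moreover have "card (Bs - W) = CARD('n) - d" using card_Diff_subset[OF finW Bs(1)] cardW cardB by simp
  ultimately show ?thesis by simp
 qed
 then obtain b where b: "bij_betw b (- K) (Bs - W)"
  using finite_same_card_bij[of "- K" "Bs - W"] finB by auto
 define L where "L = (\<chi> i. if i \<in> K then w (inv_into {..<d} \<tau> i) else b i)"
 have LK: "L $ \<tau> k = w k" if "k < d" for k
  using that \<tau> by (simp add: L_def K_def inv_into_f_f)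
 have "Bs \<subseteq> rows L"
 proof
  fix x assume "x \<in> Bs"
  show "x \<in> rows L"
  proof (cases "x \<in> W")
   case True
   then obtain k where "k < d" "x = w k" by (auto simp: W_def)
   then have "x = L $ \<tau> k" using LK by simp
   then show ?thesis by (auto simp: rows_def row_def vec_lambda_eta)
  next
   case False
   then obtain i where "i \<in> - K" "x = b i" using b \<open>x \<in> Bs\<close> by (auto simp: bij_betw_def)
   then have "x = L $ i" by (simp add: L_def)
   then show ?thesis by (auto simp: rows_def row_def vec_lambda_eta)
  qed
 qed
 then have "vec.span (rows L) = UNIV" using Bs(3) vec.span_mono by blast
 then have "det L \<noteq> 0"
  using matrix_left_invertible_span_rows_gen[of L] invertible_det_nz[of L] invertible_left_inverse[of L] by blast
 then show "\<exists>L :: complex^'n^'n. (\<forall>k<d. L $ \<tau> k = w k) \<and> det L \<noteq> 0" using LK by blast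
qed

section \<open>Frames adapted to a generic submanifold\<close>

definition vanishing :: "(complex^'n) set => complex^'n => (complex^'n => complex) set" where
 "vanishing M p = {f. smooth_at f p \<and> (\<forall>\<^sub>F Z in nhds p. Z \<in> M \<longrightarrow> f Z = 0)}"

lemma vanishingI: "smooth_at f p \<Longrightarrow> \<forall>\<^sub>F Z in nhds p. Z \<in> M \<longrightarrow> f Z = 0 \<Longrightarrow> f \<in> vanishing M p"
 and vanishing_smooth: "f \<in> vanishing M p \<Longrightarrow> smooth_at f p"
 and vanishing_ev: "f \<in> vanishing M p \<Longrightarrow> \<forall>\<^sub>F Z in nhds p. Z \<in> M \<longrightarrow> f Z = 0"
 by (simp_all add: vanishing_def)

lemma vanishing_value: "f \<in> vanishing M p \<Longrightarrow> p \<in> M \<Longrightarrow> f p = 0"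
 using eventually_nhds_x_imp_x[OF vanishing_ev] by blast

lemma vanishing_cong:
 assumes "f \<in> vanishing M p" "\<forall>\<^sub>F z in nhds p. f z = g z" shows "g \<in> vanishing M p"
proof (rule vanishingI)
 show "smooth_at g p" by (rule smooth_at_cong[OF vanishing_smooth[OF assms(1)] assms(2)])
 show "\<forall>\<^sub>F z in nhds p. z \<in> M \<longrightarrow> g z = 0" using vanishing_ev[OF assms(1)] assms(2) by eventually_elim simp
qed

lemma vanishing_zero: "(\<lambda>_. 0) \<in> vanishing M p"
 by (rule vanishingI) (auto intro: sm_intros)

lemma vanishing_add: assumes "f \<in> vanishing M p" "g \<in> vanishing M p" shows "(\<lambda>z. f z + g z) \<in> vanishing M p"
proof (rule vanishingI)
 show "smooth_at (\<lambda>z. f z + g z) p" by (intro sm_intros vanishing_smooth[OF assms(1)] vanishing_smooth[OF assms(2)])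
 show "\<forall>\<^sub>F z in nhds p. z \<in> M \<longrightarrow> f z + g z = 0"
  using vanishing_ev[OF assms(1)] vanishing_ev[OF assms(2)] by eventually_elim simp
qed

lemma vanishing_mult: assumes "smooth_at a p" "f \<in> vanishing M p" shows "(\<lambda>z. a z * f z) \<in> vanishing M p"
proof (rule vanishingI)
 show "smooth_at (\<lambda>z. a z * f z) p" by (intro sm_intros assms(1) vanishing_smooth[OF assms(2)])
 show "\<forall>\<^sub>F z in nhds p. z \<in> M \<longrightarrow> a z * f z = 0" using vanishing_ev[OF assms(2)] by eventually_elim simp
qed

lemma vanishing_sum: "(\<And>i. i \<in> I \<Longrightarrow> f i \<in> vanishing M p) \<Longrightarrow> (\<lambda>z. \<Sum>i\<in>I. f i z) \<in> vanishing M p"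
 by (induction I rule: infinite_finite_induct) (auto intro: vanishing_zero vanishing_add)

lemma vanishing_cnj: assumes "f \<in> vanishing M p" shows "(\<lambda>z. cnj (f z)) \<in> vanishing M p"
proof (rule vanishingI)
 show "smooth_at (\<lambda>z. cnj (f z)) p" by (intro sm_intros vanishing_smooth[OF assms])
 show "\<forall>\<^sub>F z in nhds p. z \<in> M \<longrightarrow> cnj (f z) = 0" using vanishing_ev[OF assms] by eventually_elim simp
qed

lemma d_dz_pair:
 assumes "cdiff G (pair Z \<zeta>)"
 shows "cdiff (\<lambda>z. G (pair z \<zeta>)) Z" "d_dz j (\<lambda>z. G (pair z \<zeta>)) Z = d_dz (Inl j) G (pair Z \<zeta>)"
proof -
 have c: "cdiff (\<lambda>z. pair z \<zeta> $ k) Z" for k by (cases k) (simp_all add: cdiff_nth cdiff_const)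
 show "cdiff (\<lambda>z. G (pair z \<zeta>)) Z" by (rule cdiff_compose(1)[OF c assms])
 have z: "d_dz j (\<lambda>z. \<zeta> $ k) Z = 0" for k by (simp add: d_dz_ct)
 show "d_dz j (\<lambda>z. G (pair z \<zeta>)) Z = d_dz (Inl j) G (pair Z \<zeta>)"
  unfolding cdiff_compose(2)[OF c assms] sum_UNIV_Plus
  by (simp add: z d_dz_nth if_distrib[where f = "\<lambda>x. _ * x"] cong: if_cong)
qed

lemma holomorphic_map_at_slice: "holomorphic_map_at (\<lambda>z. pair z \<zeta>) p"
 by (rule holomorphic_map_at_pair) (simp_all add: holomorphic_map_at_def hol_intros)

lemma has_field_derivative_line:
 fixes g :: "complex^'n => complex"
 assumes "cdiff g (t *s c)"
 shows "((\<lambda>t. g (t *s c)) has_field_derivative (\<Sum>j\<in>UNIV. c $ j * d_dz j g (t *s c))) (at t)"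
proof -
 have "bounded_linear (\<lambda>t::complex. t *s c)"
  by (simp add: linear_conv_bounded_linear[symmetric]) (rule linearI, simp_all add: vec_eq_iff ring_distribs)
 then have "((\<lambda>t. g (t *s c)) has_derivative (\<lambda>v. \<Sum>j\<in>UNIV. d_dz j g (t *s c) * (v *s c) $ j)) (at t)"
  by (rule has_derivative_compose[where f = "\<lambda>t. t *s c" and g = g, OF bounded_linear_imp_has_derivative cdiff_has_derivative[OF assms]])
 moreover have "(\<lambda>v. \<Sum>j\<in>UNIV. d_dz j g (t *s c) * (v *s c) $ j) = (*) (\<Sum>j\<in>UNIV. c $ j * d_dz j g (t *s c))"
  by (simp add: fun_eq_iff sum_distrib_left mult_ac)
 ultimately show ?thesis unfolding has_field_derivative_def by simp
qed

text \<open>The function \<open>F k\<close> is the polarisation of \<open>\<rho> k\<close>. The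
invertible matrix \<open>\<omega>\<close> has the covector \<open>\<partial>\<rho> k\<close> at
\<open>p\<close> as its row \<open>\<tau> k\<close>; the indices of these rows are the normal
directions. The placement \<open>\<tau>\<close> is a parameter in order that source and target of a
map can use the same normal indices.\<close>

locale segre_frame =
 fixes M :: "(complex^'n) set" and p :: "complex^'n" and d :: nat and \<rho> :: "nat => complex^'n => real"
  and F :: "nat => complex^('n + 'n) => complex" and \<tau> :: "nat => 'n" and \<omega> :: "complex^'n^'n"
 assumes hol: "k < d \<Longrightarrow> holomorphic_at (F k) (diag p)"
  and polar: "k < d \<Longrightarrow> \<forall>\<^sub>F Z in nhds p. F k (diag Z) = of_real (\<rho> k Z)"
  and M: "\<forall>\<^sub>F Z in nhds p. Z \<in> M \<longleftrightarrow> (\<forall>k<d. \<rho> k Z = 0)"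
  and pM: "p \<in> M"
  and inj_\<tau>: "inj_on \<tau> {..<d}"
  and \<omega>: "k < d \<Longrightarrow> \<omega> $ \<tau> k $ j = d_dz j (\<lambda>z. of_real (\<rho> k z)) p"
  and det_\<omega>: "det \<omega> \<noteq> 0"
begin

definition K :: "'n set" where "K = \<tau> ` {..<d}"
definition idx :: "'n => nat" where "idx = inv_into {..<d} \<tau>"

lemma idx_less: "i \<in> K \<Longrightarrow> idx i < d" and \<tau>_idx: "i \<in> K \<Longrightarrow> \<tau> (idx i) = i"
 and idx_\<tau>: "k < d \<Longrightarrow> idx (\<tau> k) = k" and \<tau>_K: "k < d \<Longrightarrow> \<tau> k \<in> K"
 unfolding K_def idx_def using inv_into_into[of i \<tau> "{..<d}"] f_inv_into_f[of i \<tau> "{..<d}"] inv_into_f_f[OF inj_\<tau>]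
 by auto

lemma ball_K: "(\<forall>i\<in>K. Q (idx i)) \<longleftrightarrow> (\<forall>k<d. Q k)"
 using idx_less idx_\<tau> \<tau>_K by metis

text \<open>Near \<open>p\<close> and for fixed second variable these functions are holomorphic
coordinates in the first variable.\<close>

definition \<Theta> :: "'n => complex^('n + 'n) => complex" where
 "\<Theta> i w = (if i \<in> K then F (idx i) w else \<Sum>j\<in>UNIV. \<omega> $ i $ j * (w $ Inl j - p $ j))"

definition A :: "complex^('n + 'n) => complex^'n^'n" where "A w = (\<chi> i j. d_dz (Inl j) (\<Theta> i) w)"
definition B :: "complex^('n + 'n) => complex^'n^'n" where "B w = cramer_inv (A w)"
text \<open>The (1,0) fields dual to the functions \<open>\<Theta> i\<close> on the
diagonal.\<close>

definition E :: "'n => complex^'n => 'n ctvec" where "E j Z = (\<chi> k. B (diag Z) $ k $ j, 0)"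
definition Eb :: "'n => complex^'n => 'n ctvec" where "Eb j Z = ct_cnj (E j Z)"
text \<open>The action of the field \<open>E j\<close>, continued holomorphically from the diagonal
to independent variables.\<close>

definition pol_E :: "'n => (complex^('n + 'n) => complex) => complex^('n + 'n) => complex" where
 "pol_E j G w = (\<Sum>k\<in>UNIV. B w $ k $ j * d_dz (Inl k) G w)"

lemma holomorphic_\<Theta>: "holomorphic_at (\<Theta> i) (diag p)"
proof (cases "i \<in> K")
 case True
 then have "\<Theta> i = F (idx i)" by (simp add: \<Theta>_def fun_eq_iff)
 then show ?thesis using hol[OF idx_less[OF True]] by simp
next
 case False
 then have "\<Theta> i = (\<lambda>w. \<Sum>j\<in>UNIV. \<omega> $ i $ j * (w $ Inl j - p $ j))" by (simp add: \<Theta>_def fun_eq_iff)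
 then show ?thesis by (auto intro!: hol_intros)
qed

lemma \<Theta>_real: "i \<in> K \<Longrightarrow> \<forall>\<^sub>F Z in nhds p. \<Theta> i (diag Z) = of_real (\<rho> (idx i) Z)"
 using polar[OF idx_less] by (simp add: \<Theta>_def)

lemma A_base: "A (diag p) = \<omega>"
proof -
 have "d_dz (Inl j) (\<Theta> i) (diag p) = \<omega> $ i $ j" for i j
 proof (cases "i \<in> K")
  case True
  have "d_dz (Inl j) (\<Theta> i) (diag p) = d_dz j (\<lambda>Z. \<Theta> i (diag Z)) p"
   by (rule d_dz_diag(1)[OF holomorphic_at_imp_cdiff[OF holomorphic_\<Theta>], symmetric])
  also have "\<dots> = d_dz j (\<lambda>Z. of_real (\<rho> (idx i) Z)) p" by (rule d_dz_cong(1)[OF \<Theta>_real[OF True]])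
  also have "\<dots> = \<omega> $ i $ j" using \<omega>[OF idx_less[OF True]] \<tau>_idx[OF True] by simp
  finally show ?thesis .
 next
  case False
  then have e: "\<Theta> i = (\<lambda>w. \<Sum>k\<in>UNIV. \<omega> $ i $ k * (w $ Inl k - p $ k))" by (simp add: \<Theta>_def fun_eq_iff)
  have df: "(\<lambda>w. w $ Inl k - p $ k) differentiable (at w)" for w :: "complex^('n + 'n)" and k
   by (intro differentiable_diff differentiable_nth) simp
  show ?thesis unfolding e d_dz_ct
   by (simp add: ct_apply_sum differentiable_mult df ct_apply_cmult ct_apply_diff differentiable_nth ct_apply_nth axis_def
     if_distrib[where f = "\<lambda>x. _ * x"] cong: if_cong)
 qed
 then show ?thesis by (simp add: A_def vec_eq_iff)
qed

lemma holomorphic_A: "holomorphic_at (\<lambda>w. A w $ i $ j) (diag p)"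
 unfolding A_def using holomorphic_at_d_dz[OF holomorphic_\<Theta>] by simp

lemma holomorphic_B: "holomorphic_at (\<lambda>w. B w $ i $ j) (diag p)"
 unfolding B_def by (rule holomorphic_at_cramer_inv[OF holomorphic_A]) (simp add: A_base det_\<omega>)

lemma det_A_nz: "\<forall>\<^sub>F w in nhds (diag p). det (A w) \<noteq> 0"
proof (rule tendsto_imp_eventually_ne)
 have "holomorphic_at (\<lambda>w. det (A w)) (diag p)" by (intro holomorphic_at_det holomorphic_A)
 then show "((\<lambda>w. det (A w)) \<longlongrightarrow> det (A (diag p))) (nhds (diag p))"
  using smooth_at_tendsto smooth_at_holomorphic by blast
qed (simp add: A_base det_\<omega>)

lemma AB: "det (A w) \<noteq> 0 \<Longrightarrow> A w ** B w = mat 1" and BA: "det (A w) \<noteq> 0 \<Longrightarrow> B w ** A w = mat 1"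
 unfolding B_def using cramer_inv[of "A w"] by blast+

lemma smooth_E: "smooth_at (E j) p" and smooth_Eb: "smooth_at (Eb j) p"
proof -
 have 1: "smooth_at (\<lambda>Z. \<chi> k. B (diag Z) $ k $ j) p"
  by (rule smooth_at_vec) (simp add: smooth_at_diag[OF holomorphic_B])
 have 2: "smooth_at (\<lambda>Z. cnj_vec (\<chi> k. B (diag Z) $ k $ j)) p"
  by (rule smooth_at_vec) (simp add: smooth_at_cnj smooth_at_diag[OF holomorphic_B])
 have e: "E j = (\<lambda>Z. (\<chi> k. B (diag Z) $ k $ j, 0))" "Eb j = (\<lambda>Z. (0, cnj_vec (\<chi> k. B (diag Z) $ k $ j)))"
  by (auto simp: fun_eq_iff E_def Eb_def ct_cnj_def vec_eq_iff)
 show "smooth_at (E j) p" unfolding e by (intro smooth_at_Pair 1 smooth_at_const)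
 show "smooth_at (Eb j) p" unfolding e by (intro smooth_at_Pair 2 smooth_at_const)
qed

lemma Xop_Eb:
 assumes "f differentiable (at z)" shows "Xop (Eb j) f z = cnj (Xop (E j) (\<lambda>z. cnj (f z)) z)"
 unfolding Xop_def Eb_def ct_apply_cnj[OF assms] by simp

lemma holomorphic_pol_E: "holomorphic_at G (diag p) \<Longrightarrow> holomorphic_at (pol_E j G) (diag p)"
 unfolding pol_E_def[abs_def] by (intro hol_intros holomorphic_B)

lemma eventually_diag: "\<forall>\<^sub>F w in nhds (diag p). Q w \<Longrightarrow> \<forall>\<^sub>F Z in nhds p. Q (diag Z)"
 by (rule eventually_compose_filterlim[OF _ diag_tendsto])

lemma Xop_E_diag:
 assumes "holomorphic_at G (diag p)" shows "\<forall>\<^sub>F Z in nhds p. Xop (E j) (\<lambda>Z. G (diag Z)) Z = pol_E j G (diag Z)"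
 using eventually_diag[OF holomorphic_at_eventually[OF assms]]
proof eventually_elim
 case (elim Z)
 then show ?case
  by (simp add: Xop_def ct_apply_def E_def pol_E_def d_dz_diag[OF holomorphic_at_imp_cdiff])
qed

lemma pol_E_\<Theta>: "det (A w) \<noteq> 0 \<Longrightarrow> pol_E j (\<Theta> i) w = (if i = j then 1 else 0)"
proof -
 assume "det (A w) \<noteq> 0"
 have "(A w ** B w) $ i $ j = pol_E j (\<Theta> i) w"
  by (simp add: matrix_matrix_mult_def pol_E_def A_def mult.commute)
 then show ?thesis using AB[OF \<open>det (A w) \<noteq> 0\<close>] by (simp add: mat_def)
qed

lemma frame_dual: "\<forall>\<^sub>F Z in nhds p. Xop (E j) (\<lambda>Z. \<Theta> i (diag Z)) Z = (if i = j then 1 else 0)"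
 using Xop_E_diag[OF holomorphic_\<Theta>, of j i] eventually_diag[OF det_A_nz] by eventually_elim (simp add: pol_E_\<Theta>)

subsection \<open>Tangential derivatives\<close>

text \<open>The functions \<open>\<rho> k\<close> are the real parts of \<open>d\<close> of the
coordinates in a smooth chart \<open>T\<close>. In this chart \<open>M\<close> is flat, so each real
tangent vector is the velocity of a line in \<open>M\<close>.\<close>

lemma tangent_vanishing:
 assumes f: "f \<in> vanishing M p"
 shows "\<forall>\<^sub>F q in nhds p. q \<in> M \<longrightarrow> (\<forall>V\<in>CT d \<rho> q. ct_apply V f q = 0)"
proof -
 define lin where "lin = (\<lambda>i Z. \<Sum>j\<in>UNIV. \<omega> $ i $ j * (Z $ j - p $ j))"
 define T where "T = (\<lambda>Z. \<chi> i. if i \<in> K then \<Theta> i (diag Z) + (lin i Z - cnj (lin i Z)) else lin i Z)"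
 have nth: "smooth_at (\<lambda>Z. Z $ j) q" for j and q :: "complex^'n" by (intro smooth_at_holomorphic holomorphic_at_nth)
 have smlin: "smooth_at (lin i) q" for i q unfolding lin_def by (intro sm_intros nth)
 have smT: "smooth_at T p"
 proof (rule smooth_at_vec)
  show "smooth_at (\<lambda>Z. T Z $ i) p" for i
   by (cases "i \<in> K") (simp_all add: T_def smooth_at_add smooth_at_minus_diff smooth_at_cnj smlin smooth_at_diag[OF holomorphic_\<Theta>])
 qed
 have dlin: "FD (lin i) q v = (\<omega> *v v) $ i" for i q v
 proof -
  have "(lin i has_derivative (\<lambda>v. \<Sum>j\<in>UNIV. \<omega> $ i $ j * v $ j)) (at q)"
   unfolding lin_def by (auto intro!: derivative_eq_intros bounded_linear_imp_has_derivative bounded_linear_vec_nth)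
  then show ?thesis by (simp add: FD_eq matrix_vector_mult_def)
 qed
 define h where "h = (\<lambda>k Z. complex_of_real (\<rho> k Z))"
 have smh: "smooth_at (h k) p" if "k < d" for k
  unfolding h_def by (rule smooth_at_cong[OF smooth_at_diag[OF hol[OF that]] polar[OF that]])
 have real: "FD (h k) q v = cnj (FD (h k) q v)" if "h k differentiable (at q)" for k q v
 proof -
  have "((\<lambda>z. cnj (h k z)) has_derivative (\<lambda>v. cnj (FD (h k) q v))) (at q)"
   by (rule has_derivative_cnj[OF FD_works[OF that]])
  moreover have "(\<lambda>z. cnj (h k z)) = h k" by (simp add: h_def fun_eq_iff)
  ultimately show ?thesis using FD_eq[of "h k"] by metis
 qed
 let ?reg = "\<lambda>i q. h (idx i) differentiable (at q) \<and> (\<forall>\<^sub>F Z in nhds q. \<Theta> i (diag Z) = h (idx i) Z)"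
 have FT: "FD T q v $ i = (if i \<in> K then FD (h (idx i)) q v + ((\<omega> *v v) $ i - cnj ((\<omega> *v v) $ i)) else (\<omega> *v v) $ i)"
  if q: "\<forall>i\<in>K. ?reg i q" and T: "T differentiable (at q)" for q v i
 proof -
  have hl: "(lin i has_derivative (\<lambda>v. (\<omega> *v v) $ i)) (at q)"
   using FD_works[OF smooth_at_diff[OF smlin[of i q]]] unfolding ext[of "FD (lin i) q", OF dlin[of i q]] .
  have d1: "((\<lambda>Z. T Z $ i) has_derivative (\<lambda>v. FD T q v $ i)) (at q)"
   by (rule bounded_linear.has_derivative[OF bounded_linear_vec_nth FD_works[OF T]])
  have d2: "((\<lambda>Z. T Z $ i) has_derivative (\<lambda>v. if i \<in> K then FD (h (idx i)) q v + ((\<omega> *v v) $ i - cnj ((\<omega> *v v) $ i)) else (\<omega> *v v) $ i)) (at q)"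
  proof (cases "i \<in> K")
   case True
   then have "((\<lambda>Z. h (idx i) Z + (lin i Z - cnj (lin i Z))) has_derivative (\<lambda>v. FD (h (idx i)) q v + ((\<omega> *v v) $ i - cnj ((\<omega> *v v) $ i)))) (at q)"
    using q by (intro has_derivative_add has_derivative_diff has_derivative_cnj hl FD_works) blast
   moreover obtain S where "open S" "q \<in> S" "\<forall>Z\<in>S. \<Theta> i (diag Z) = h (idx i) Z"
    using q True unfolding eventually_nhds by blast
   ultimately show ?thesis using True
    by (simp add: T_def) (rule has_derivative_cong_open[of S], auto)
  next
   case False
   then show ?thesis using hl by (simp add: T_def)
  qed
  show ?thesis using has_derivative_unique[OF d1 d2] unfolding fun_eq_iff by blast
 qed
 have ev1: "\<forall>\<^sub>F q in nhds p. \<forall>i\<in>K. ?reg i q"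
 proof (intro eventually_ball_finite ballI)
  fix i assume i: "i \<in> K"
  have "\<forall>\<^sub>F q in nhds p. \<forall>\<^sub>F Z in nhds q. \<Theta> i (diag Z) = h (idx i) Z"
   using \<Theta>_real[OF i] by (simp add: eventually_eventually h_def)
  then show "\<forall>\<^sub>F q in nhds p. ?reg i q"
   using smooth_at_eventually_diff[OF smh[OF idx_less[OF i]]] by eventually_elim simp
 qed simp
 have inj: "inj (FD T p)"
 proof -
  have Td: "T differentiable (at p)" by (rule smooth_at_diff[OF smT])
  have FTp: "FD T p v $ i = (if i \<in> K then 2 else 1) * (\<omega> *v v) $ i" for v i
  proof (cases "i \<in> K")
   case True
   let ?h = "h (idx i)"
   have hd: "?h differentiable (at p)" by (rule smooth_at_diff[OF smh[OF idx_less[OF True]]])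
   have c: "(\<lambda>z. cnj (?h z)) = ?h" by (simp add: h_def fun_eq_iff)
   have l: "d_dz j ?h p = \<omega> $ i $ j" for j using \<omega>[OF idx_less[OF True]] \<tau>_idx[OF True] by (simp add: h_def)
   have lb: "d_dzbar j ?h p = cnj (\<omega> $ i $ j)" for j using d_dz_cnj(2)[OF hd, of j] unfolding c l .
   have "FD ?h p v = (\<omega> *v v) $ i + cnj ((\<omega> *v v) $ i)"
    unfolding FD_dz[OF hd] l lb by (simp add: sum.distrib matrix_vector_mult_def)
   then show ?thesis using True FT[OF eventually_nhds_x_imp_x[OF ev1] Td, of v i] by simp
  next
   case False
   then show ?thesis using FT[OF eventually_nhds_x_imp_x[OF ev1] Td, of v i] by simp
  qed
  have lin: "linear (FD T p)" by (rule has_derivative_linear[OF FD_works[OF Td]])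
  have "v = 0" if v: "FD T p v = 0" for v
  proof -
   have "(\<omega> *v v) $ i = 0" for i using FTp[of v i] v by (auto split: if_splits)
   then have "\<omega> *v v = 0" by (simp add: vec_eq_iff)
   then show ?thesis using cramer[OF det_\<omega>, of v 0] cramer[OF det_\<omega>, of 0 0] by simp
  qed
  then show ?thesis using linear_injective_0[OF lin] by blast
 qed
 obtain U0 where U0: "open U0" "p \<in> U0" "\<And>k. C_diff_on k T U0" using smT unfolding smooth_at_def by blast
 have TU0: "T differentiable (at x)" "continuous_on U0 (\<lambda>x. FD T x v)" if "x \<in> U0" for x v
  using U0(3)[of "Suc 0"] that by auto
 let ?good = "\<lambda>q. (\<forall>i\<in>K. ?reg i q) \<and>
   (q \<in> M \<longleftrightarrow> (\<forall>k<d. \<rho> k q = 0)) \<and> (q \<in> M \<longrightarrow> f q = 0) \<and> f differentiable (at q)"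
 have "\<forall>\<^sub>F q in nhds p. ?good q"
  using ev1 M vanishing_ev[OF f] smooth_at_eventually_diff[OF vanishing_smooth[OF f]] by eventually_elim simp
 then obtain W where W: "open W" "p \<in> W" and WW: "\<And>q. q \<in> W \<Longrightarrow> ?good q"
  unfolding eventually_nhds by blast
 have "\<exists>U' V g. open U' \<and> U' \<subseteq> U0 \<inter> W \<and> p \<in> U' \<and> open V \<and> T p \<in> V \<and> homeomorphism U' V T g \<and>
  (\<forall>y\<in>V. bij (FD T (g y)) \<and> (g has_derivative inv (FD T (g y))) (at y))"
 proof (rule C1_local_inverse[where D = "FD T"])
  show "(T has_derivative FD T x) (at x)" if "x \<in> U0 \<inter> W" for x using FD_works TU0(1) that by blast
  show "continuous_on (U0 \<inter> W) (\<lambda>x. FD T x v)" for v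
   using TU0(2)[OF U0(2), of v] continuous_on_subset by blast
 qed (use U0 W inj in auto)
 then obtain U' V g where U': "open U'" "U' \<subseteq> U0 \<inter> W" "p \<in> U'" and V: "open V" and hom: "homeomorphism U' V T g"
  and g: "\<And>y. y \<in> V \<Longrightarrow> bij (FD T (g y)) \<and> (g has_derivative inv (FD T (g y))) (at y)" by blast
 have RT: "Re (T z $ i) = \<rho> (idx i) z" if "z \<in> U'" "i \<in> K" for z i
 proof -
  have "\<forall>\<^sub>F Z in nhds z. \<Theta> i (diag Z) = h (idx i) Z" using WW[of z] U'(2) that by blast
  then have "\<Theta> i (diag z) = h (idx i) z" by (rule eventually_nhds_x_imp_x)
  then show ?thesis using that(2) by (simp add: T_def h_def)
 qed
 have main: "FD f q v = 0" if q: "q \<in> U'" "q \<in> M" and v: "\<forall>k<d. FD (h k) q v = 0" for q v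
 proof -
  have qW: "q \<in> W" "q \<in> U0" using q U'(2) by auto
  have Tq: "T q \<in> V" and gT: "g (T q) = q" using hom q(1) unfolding homeomorphism_def by auto
  define w where "w = FD T q v"
  have Rw: "Re (w $ i) = 0" if i: "i \<in> K" for i
   using FT[of q v i] WW[OF qW(1)] TU0(1)[OF qW(2)] v idx_less[OF i] i by (simp add: w_def)
  have lineT: "((\<lambda>t::real. T q + t *\<^sub>R w) has_derivative (\<lambda>t. t *\<^sub>R w)) (at 0)"
   by (auto intro!: derivative_eq_intros)
  have g0: "(g has_derivative inv (FD T q)) (at (T q + 0 *\<^sub>R w))" using g[OF Tq] gT by simp
  have gd: "((\<lambda>t::real. g (T q + t *\<^sub>R w)) has_derivative (\<lambda>t. inv (FD T q) (t *\<^sub>R w))) (at 0)"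
   by (rule has_derivative_compose[OF lineT g0])
  have f0: "(f has_derivative FD f q) (at (g (T q + 0 *\<^sub>R w)))" using FD_works[of f q] WW[OF qW(1)] gT by simp
  have fd: "((\<lambda>t::real. f (g (T q + t *\<^sub>R w))) has_derivative (\<lambda>t. FD f q (inv (FD T q) (t *\<^sub>R w)))) (at 0)"
   by (rule has_derivative_compose[OF gd f0])
  have "\<forall>\<^sub>F t in nhds (0::real). T q + t *\<^sub>R w \<in> V"
  proof -
   have "continuous (at 0) (\<lambda>t::real. T q + t *\<^sub>R w)" by (intro continuous_intros)
   then have "filterlim (\<lambda>t::real. T q + t *\<^sub>R w) (nhds (T q)) (nhds 0)"
    unfolding isCont_def tendsto_at_iff_tendsto_nhds[of "\<lambda>t::real. T q + t *\<^sub>R w"] by simp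
   then show ?thesis using V Tq by (metis topological_tendstoD)
  qed
  then obtain S where S: "open S" "(0::real) \<in> S" "\<forall>t\<in>S. T q + t *\<^sub>R w \<in> V" unfolding eventually_nhds by blast
  have z: "f (g (T q + t *\<^sub>R w)) = 0" if "t \<in> S" for t
  proof -
   let ?y = "T q + t *\<^sub>R w"
   have yV: "?y \<in> V" using S(3) that by blast
   have gy: "g ?y \<in> U'" "T (g ?y) = ?y" using hom yV unfolding homeomorphism_def by auto
   have "\<rho> (idx i) (g ?y) = 0" if i: "i \<in> K" for i
   proof -
    have "\<rho> (idx i) q = 0" using WW[OF qW(1)] q(2) idx_less[OF i] by blast
    then show ?thesis using RT[OF gy(1) i] RT[OF q(1) i] Rw[OF i] unfolding gy(2) by simp
   qed
   then have "\<forall>k<d. \<rho> k (g ?y) = 0" using ball_K[of "\<lambda>k. \<rho> k (g ?y) = 0"] by blast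
   then show ?thesis using WW[of "g ?y"] gy(1) U'(2) by blast
  qed
  have "((\<lambda>t::real. f (g (T q + t *\<^sub>R w))) has_derivative (\<lambda>t. 0)) (at 0)"
   by (rule has_derivative_cong_open[OF S(1,2), of "\<lambda>_. 0"]) (simp_all add: z)
  from has_derivative_unique[OF this fd] have "FD f q (inv (FD T q) (1 *\<^sub>R w)) = 0" by metis
  then show ?thesis using g[OF Tq] gT by (simp add: w_def bij_is_inj inv_f_f)
 qed
 have "\<forall>\<^sub>F q in nhds p. q \<in> U'" using U' by (intro eventually_nhds_in_open) auto
 then show ?thesis
 proof eventually_elim
  case (elim q)
  show ?case
  proof (intro impI ballI)
   fix V assume q: "q \<in> M" and V: "V \<in> CT d \<rho> q"
   have qW: "q \<in> W" using elim U' by blast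
   have hd: "h k differentiable (at q)" if "k < d" for k
    using WW[OF qW] \<tau>_K[OF that] idx_\<tau>[OF that] by metis
   have "FD (h k) q (rv1 V) = 0 \<and> FD (h k) q (rv2 V) = 0" if k: "k < d" for k
   proof -
    have "FD (h k) q (rv1 V) + \<i> * FD (h k) q (rv2 V) = 0"
     using V k ct_apply_FD[OF hd[OF k], of V] by (simp add: CT_def h_def)
    moreover have "Im (FD (h k) q v) = 0" for v using real[OF hd[OF k], of v] by (simp add: complex_eq_iff)
    ultimately show ?thesis by (simp add: complex_eq_iff)
   qed
   then show "ct_apply V f q = 0"
    using main[OF elim q] ct_apply_FD[of f q V] WW[OF qW] by simp
  qed
 qed
qed

lemma frame_\<rho>: "\<forall>\<^sub>F q in nhds p. \<forall>i\<in>K. ct_apply (E j q) (\<lambda>z. of_real (\<rho> (idx i) z)) q = (if i = j then 1 else 0) \<and>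
  ct_apply (Eb j q) (\<lambda>z. of_real (\<rho> (idx i) z)) q = (if i = j then 1 else 0)"
proof (intro eventually_ball_finite ballI)
 fix i assume i: "i \<in> K"
 have "\<forall>\<^sub>F q in nhds p. \<forall>\<^sub>F Z in nhds q. \<Theta> i (diag Z) = of_real (\<rho> (idx i) Z)"
  using \<Theta>_real[OF i] by (simp add: eventually_eventually)
 moreover have "\<forall>\<^sub>F q in nhds p. (\<lambda>Z. \<Theta> i (diag Z)) differentiable (at q)"
  by (rule smooth_at_eventually_diff[OF smooth_at_diag[OF holomorphic_\<Theta>]])
 ultimately show "\<forall>\<^sub>F q in nhds p. ct_apply (E j q) (\<lambda>z. of_real (\<rho> (idx i) z)) q = (if i = j then 1 else 0) \<and>
   ct_apply (Eb j q) (\<lambda>z. of_real (\<rho> (idx i) z)) q = (if i = j then 1 else 0)"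
  using frame_dual[of j i]
 proof eventually_elim
  case (elim q)
  let ?h = "\<lambda>z. complex_of_real (\<rho> (idx i) z)"
  have 1: "ct_apply (E j q) ?h q = (if i = j then 1 else 0)"
   using elim(3) ct_apply_cong[OF elim(1)] by (simp add: Xop_def)
  have c: "(\<lambda>Z. cnj (\<Theta> i (diag Z))) differentiable (at q)"
   using has_derivative_cnj[OF FD_works[OF elim(2)]] unfolding differentiable_def by blast
  have "ct_apply (Eb j q) ?h q = ct_apply (Eb j q) (\<lambda>Z. \<Theta> i (diag Z)) q"
   using ct_apply_cong[OF elim(1)] by simp
  also have "\<dots> = cnj (ct_apply (E j q) (\<lambda>Z. cnj (\<Theta> i (diag Z))) q)"
   unfolding Eb_def ct_apply_cnj[OF elim(2)] by simp
  also have "ct_apply (E j q) (\<lambda>Z. cnj (\<Theta> i (diag Z))) q = ct_apply (E j q) ?h q"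
   by (rule ct_apply_cong) (use elim(1) in \<open>auto elim: eventually_mono\<close>)
  finally show ?case using 1 by simp
 qed
qed simp

lemma vanishing_E:
 assumes f: "f \<in> vanishing M p" and j: "j \<notin> K"
 shows "Xop (E j) f \<in> vanishing M p" "Xop (Eb j) f \<in> vanishing M p"
proof -
 have "\<forall>\<^sub>F q in nhds p. q \<in> M \<longrightarrow> Xop (E j) f q = 0 \<and> Xop (Eb j) f q = 0"
  using tangent_vanishing[OF f] frame_\<rho>[of j]
 proof eventually_elim
  case (elim q)
  have "E j q \<in> CT d \<rho> q" "Eb j q \<in> CT d \<rho> q"
   unfolding CT_def mem_Collect_eq using elim(2) j \<tau>_K idx_\<tau> by metis+
  then show ?case using elim(1) by (simp add: Xop_def)
 qed
 then have "\<forall>\<^sub>F q in nhds p. q \<in> M \<longrightarrow> Xop (E j) f q = 0" "\<forall>\<^sub>F q in nhds p. q \<in> M \<longrightarrow> Xop (Eb j) f q = 0"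
  by (auto elim: eventually_mono)
 then show "Xop (E j) f \<in> vanishing M p" "Xop (Eb j) f \<in> vanishing M p"
  using vanishing_smooth[OF f] smooth_E smooth_Eb by (auto intro: vanishingI smooth_at_Xop)
qed

lemma vanishing_E_diff:
 assumes f: "f \<in> vanishing M p"
 shows "(\<lambda>z. Xop (E j) f z - Xop (Eb j) f z) \<in> vanishing M p"
proof (rule vanishingI)
 show "smooth_at (\<lambda>z. Xop (E j) f z - Xop (Eb j) f z) p"
  by (intro sm_intros smooth_E smooth_Eb vanishing_smooth[OF f])
 show "\<forall>\<^sub>F q in nhds p. q \<in> M \<longrightarrow> Xop (E j) f q - Xop (Eb j) f q = 0"
  using tangent_vanishing[OF f] frame_\<rho>[of j]
 proof eventually_elim
  case (elim q)
  let ?V = "E j q + ct_scale (-1) (Eb j q)"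
  have "?V \<in> CT d \<rho> q"
   unfolding CT_def mem_Collect_eq ct_apply_field_add ct_apply_field_scale using elim(2) \<tau>_K idx_\<tau>
   by (metis add.right_inverse mult_minus1)
  then have "q \<in> M \<Longrightarrow> ct_apply ?V f q = 0" using elim(1) by blast
  then show ?case by (simp add: Xop_def ct_apply_field_add ct_apply_field_scale)
 qed
qed

subsection \<open>The Segre variety in adapted coordinates\<close>

definition G0 :: "complex^'n => complex^'n" where "G0 z = (\<chi> i. \<Theta> i (pair z (cnj_vec p)))"

lemma G0_K: "i \<in> K \<Longrightarrow> G0 z $ i = F (idx i) (pair z (cnj_vec p))"
 by (simp add: G0_def \<Theta>_def)

lemma \<Theta>_base: "\<Theta> i (diag p) = 0"
proof (cases "i \<in> K")
 case True
 have "\<rho> (idx i) p = 0" using eventually_nhds_x_imp_x[OF M] pM idx_less[OF True] by blast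
 then show ?thesis using eventually_nhds_x_imp_x[OF \<Theta>_real[OF True]] by simp
qed (simp add: \<Theta>_def)

lemma G0_base: "G0 p = 0" by (simp add: G0_def vec_eq_iff \<Theta>_base)

lemma holomorphic_G0: "holomorphic_map_at G0 p"
 unfolding holomorphic_map_at_def G0_def
 using holomorphic_at_compose[OF holomorphic_map_at_slice holomorphic_\<Theta>] by simp

lemma jac_G0: "jac G0 p v = \<omega> *v v"
proof -
 have "d_dz j (\<lambda>z. G0 z $ i) p = \<omega> $ i $ j" for i j
  using d_dz_pair(2)[OF holomorphic_at_imp_cdiff[OF holomorphic_\<Theta>], of j i] A_base by (simp add: G0_def A_def vec_eq_iff)
 then show ?thesis by (simp add: jac_def matrix_vector_mult_def)
qed

lemma inj_\<omega>: "\<omega> *v v = \<omega> *v w \<Longrightarrow> v = w"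
 using cramer[OF det_\<omega>, of v "\<omega> *v w"] cramer[OF det_\<omega>, of w "\<omega> *v w"] by simp

lemma chart_exists: "\<exists>\<Gamma>. holomorphic_map_at \<Gamma> 0 \<and> \<Gamma> 0 = p \<and> (\<forall>\<^sub>F z in nhds p. \<Gamma> (G0 z) = z) \<and> (\<forall>\<^sub>F y in nhds 0. G0 (\<Gamma> y) = y)"
proof -
 have "inj (jac G0 p)" unfolding jac_G0 using inj_\<omega> by (auto intro: injI)
 from holomorphic_local_inverse[OF holomorphic_G0 this open_UNIV UNIV_I]
 obtain U V \<Gamma> where U: "open U" "p \<in> U" and V: "open V" "G0 p \<in> V" and hom: "homeomorphism U V G0 \<Gamma>" and h: "\<forall>w\<in>V. holomorphic_map_at \<Gamma> w" by blast
 have "\<forall>\<^sub>F z in nhds p. z \<in> U" "\<forall>\<^sub>F y in nhds 0. y \<in> V"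
  using U V G0_base by (auto intro: eventually_nhds_in_open)
 moreover have "\<Gamma> (G0 z) = z" if "z \<in> U" for z using hom that by (simp add: homeomorphism_def)
 moreover have "G0 (\<Gamma> z) = z" if "z \<in> V" for z using hom that by (simp add: homeomorphism_def)
 moreover have "\<Gamma> 0 = p" using hom U(2) G0_base unfolding homeomorphism_def by metis
 moreover have "holomorphic_map_at \<Gamma> 0" using h V(2) G0_base by simp
 ultimately show ?thesis by (intro exI[of _ \<Gamma>]) (auto elim: eventually_mono)
qed

definition \<Gamma> :: "complex^'n => complex^'n" where
 "\<Gamma> = (SOME \<Gamma>. holomorphic_map_at \<Gamma> 0 \<and> \<Gamma> 0 = p \<and> (\<forall>\<^sub>F z in nhds p. \<Gamma> (G0 z) = z) \<and> (\<forall>\<^sub>F y in nhds 0. G0 (\<Gamma> y) = y))"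

lemma holomorphic_\<Gamma>: "holomorphic_map_at \<Gamma> 0" and \<Gamma>_0: "\<Gamma> 0 = p"
 and \<Gamma>_G0: "\<forall>\<^sub>F z in nhds p. \<Gamma> (G0 z) = z" and G0_\<Gamma>: "\<forall>\<^sub>F y in nhds 0. G0 (\<Gamma> y) = y"
 using someI_ex[OF chart_exists] unfolding \<Gamma>_def[symmetric] by blast+

definition slice :: "complex^'n => complex^('n + 'n)" where "slice y = pair (\<Gamma> y) (cnj_vec p)"

lemma slice_0: "slice 0 = diag p" by (simp add: slice_def \<Gamma>_0)

lemma holomorphic_slice: "holomorphic_map_at slice 0"
 unfolding slice_def[abs_def] by (rule holomorphic_map_at_compose[OF holomorphic_\<Gamma> holomorphic_map_at_slice])

lemma eventually_slice: "\<forall>\<^sub>F w in nhds (diag p). Q w \<Longrightarrow> \<forall>\<^sub>F y in nhds 0. Q (slice y)"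
 by (rule eventually_compose_hol[OF holomorphic_slice]) (simp add: slice_0)

lemma holomorphic_on_slice: "holomorphic_at G (diag p) \<Longrightarrow> holomorphic_at (\<lambda>y. G (slice y)) 0"
 by (rule holomorphic_at_compose[OF holomorphic_slice]) (simp add: slice_0)

text \<open>As \<open>\<Gamma>\<close> inverts the coordinates \<open>G0\<close>, the partial
derivatives in these coordinates are dual to the functions \<open>\<Theta> i\<close>, as are the
fields \<open>E j\<close>.\<close>

lemma d_dz_slice:
 assumes G: "holomorphic_at G (diag p)"
 shows "\<forall>\<^sub>F y in nhds 0. d_dz j (\<lambda>y. G (slice y)) y = pol_E j G (slice y)"
proof -
 have chain: "\<forall>\<^sub>F y in nhds 0. d_dz j (\<lambda>y. G (slice y)) y = (\<Sum>k\<in>UNIV. d_dz (Inl k) G (slice y) * d_dz j (\<lambda>y. \<Gamma> y $ k) y)"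
  if "holomorphic_at G (diag p)" for G
 proof -
  have "\<forall>\<^sub>F y in nhds 0. \<forall>k. holomorphic_at (\<lambda>y. slice y $ k) y"
   using holomorphic_slice holomorphic_at_eventually unfolding holomorphic_map_at_def by (intro eventually_all_finite) blast
  then show ?thesis using eventually_slice[OF holomorphic_at_eventually[OF that]]
  proof eventually_elim
   case (elim y)
   have c: "cdiff (\<lambda>y. slice y $ k) y" for k using elim(1) holomorphic_at_imp_cdiff by blast
   have z: "d_dz j (\<lambda>y. cnj (p $ k)) y = 0" for k by (simp add: d_dz_ct)
   show ?case
    using cdiff_compose(2)[OF c holomorphic_at_imp_cdiff[OF elim(2)], of j]
    unfolding sum_UNIV_Plus by (simp add: slice_def z)
  qed
 qed
 have "\<forall>\<^sub>F y in nhds 0. \<forall>i. d_dz j (\<lambda>y. \<Theta> i (slice y)) y = (\<Sum>k\<in>UNIV. d_dz (Inl k) (\<Theta> i) (slice y) * d_dz j (\<lambda>y. \<Gamma> y $ k) y)"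
  by (intro eventually_all_finite chain holomorphic_\<Theta>)
 moreover have "\<forall>\<^sub>F y in nhds 0. \<forall>\<^sub>F y' in nhds y. G0 (\<Gamma> y') = y'" using G0_\<Gamma> by (simp add: eventually_eventually)
 ultimately show ?thesis using chain[OF G] eventually_slice[OF det_A_nz]
 proof eventually_elim
  case (elim y)
  let ?X = "\<chi> k. d_dz j (\<lambda>y. \<Gamma> y $ k) y"
  have "(A (slice y) *v ?X) $ i = axis j 1 $ i" for i
  proof -
   have "\<forall>\<^sub>F y' in nhds y. \<Theta> i (slice y') = y' $ i"
    using elim(2) by eventually_elim (simp add: slice_def G0_def vec_eq_iff)
   then have "d_dz j (\<lambda>y. \<Theta> i (slice y)) y = (if i = j then 1 else 0)" using d_dz_cong(1) d_dz_nth(1) by metis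
   then show ?thesis using elim(1) by (simp add: matrix_vector_mult_def A_def axis_def)
  qed
  then have "A (slice y) *v ?X = axis j 1" by (simp add: vec_eq_iff)
  then have "B (slice y) *v (A (slice y) *v ?X) = B (slice y) *v axis j 1" by simp
  then have "?X = B (slice y) *v axis j 1" by (simp add: matrix_vector_mul_assoc BA[OF elim(4)])
  then have "d_dz j (\<lambda>y. \<Gamma> y $ k) y = B (slice y) $ k $ j" for k
   by (simp add: vec_eq_iff matrix_vector_mult_def axis_def if_distrib[where f = "\<lambda>x. _ * x"] cong: if_cong)
  then show ?case using elim(3) by (simp add: pol_E_def mult.commute)
 qed
qed

definition Lc :: "complex^'n => complex^'n => 'n ctvec" where "Lc c Z = (\<Sum>j\<in>UNIV. ct_scale (c $ j) (E j Z))"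
definition dir :: "complex^'n => (complex^('n + 'n) => complex) => complex^('n + 'n) => complex" where
 "dir c G w = (\<Sum>j\<in>UNIV. c $ j * pol_E j G w)"

lemma Xop_Lc: "Xop (Lc c) f Z = (\<Sum>j\<in>UNIV. c $ j * Xop (E j) f Z)"
 by (simp add: Xop_def Lc_def ct_apply_field_sum ct_apply_field_scale)

lemma smooth_Lc: "smooth_at (Lc c) p"
 unfolding Lc_def[abs_def] by (intro sm_intros smooth_E)

lemma holomorphic_dir: "holomorphic_at G (diag p) \<Longrightarrow> holomorphic_at ((dir c ^^ a) G) (diag p)"
proof (induction a)
 case (Suc a)
 then show ?case by (simp add: dir_def[abs_def]) (intro hol_intros holomorphic_pol_E)
qed simp

lemma Xpow_Lc_diag:
 assumes G: "holomorphic_at G (diag p)"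
 shows "\<forall>\<^sub>F Z in nhds p. (Xop (Lc c) ^^ a) (\<lambda>Z. G (diag Z)) Z = (dir c ^^ a) G (diag Z)"
proof (induction a)
 case (Suc a)
 have "\<forall>\<^sub>F Z in nhds p. \<forall>j. Xop (E j) (\<lambda>Z. (dir c ^^ a) G (diag Z)) Z = pol_E j ((dir c ^^ a) G) (diag Z)"
  by (intro eventually_all_finite Xop_E_diag holomorphic_dir G)
 with Xop_cong[OF Suc, of "Lc c"] show ?case
  by eventually_elim (simp add: Xop_Lc dir_def[of c "(dir c ^^ a) G"])
qed simp

lemma line_tendsto: "((\<lambda>t::complex. t *s c) \<longlongrightarrow> 0) (nhds 0)"
proof -
 have "isCont (\<lambda>t::complex. t *s c) 0"
  by (rule linear_continuous_at) (simp add: linear_conv_bounded_linear[symmetric], rule linearI, simp_all add: vec_eq_iff ring_distribs)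
 then show ?thesis unfolding isCont_def tendsto_at_iff_tendsto_nhds[of "\<lambda>t::complex. t *s c"] by simp
qed

lemma deriv_pow_slice:
 assumes G: "holomorphic_at G (diag p)"
 shows "\<forall>\<^sub>F t in nhds 0. (deriv ^^ a) (\<lambda>t. G (slice (t *s c))) t = (dir c ^^ a) G (slice (t *s c))"
proof (induction a)
 case (Suc a)
 let ?G = "(dir c ^^ a) G"
 have hG: "holomorphic_at ?G (diag p)" by (rule holomorphic_dir[OF G])
 have "\<forall>\<^sub>F y in nhds 0. \<forall>j. d_dz j (\<lambda>y. ?G (slice y)) y = pol_E j ?G (slice y)"
  by (intro eventually_all_finite d_dz_slice hG)
 from eventually_compose_filterlim[OF this line_tendsto]
 have 1: "\<forall>\<^sub>F t in nhds 0. \<forall>j. d_dz j (\<lambda>y. ?G (slice y)) (t *s c) = pol_E j ?G (slice (t *s c))" .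
 have 2: "\<forall>\<^sub>F t in nhds 0. holomorphic_at (\<lambda>y. ?G (slice y)) (t *s c)"
  by (rule eventually_compose_filterlim[OF holomorphic_at_eventually[OF holomorphic_on_slice[OF hG]] line_tendsto])
 have 3: "\<forall>\<^sub>F t in nhds 0. \<forall>\<^sub>F t' in nhds t. (deriv ^^ a) (\<lambda>t. G (slice (t *s c))) t' = ?G (slice (t' *s c))"
  using Suc by (simp add: eventually_eventually)
 show ?case using 1 2 3
 proof eventually_elim
  case (elim t)
  have "deriv ((deriv ^^ a) (\<lambda>t. G (slice (t *s c)))) t = deriv (\<lambda>t. ?G (slice (t *s c))) t"
   by (rule deriv_cong_ev[OF elim(3) refl])
  also have "\<dots> = (\<Sum>j\<in>UNIV. c $ j * d_dz j (\<lambda>y. ?G (slice y)) (t *s c))"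
   by (rule DERIV_imp_deriv[OF has_field_derivative_line[OF holomorphic_at_imp_cdiff[OF elim(2)]]])
  also have "\<dots> = dir c ?G (slice (t *s c))" unfolding dir_def[of c "(dir c ^^ a) G"] using elim(1) by simp
  finally show ?case by simp
 qed
qed simp

text \<open>Along the complex line through \<open>c\<close>, the iterated derivatives in the
direction of the field \<open>Lc c\<close> are the Taylor coefficients of the restriction to the
line.\<close>

lemma flat_imp_zero:
 assumes G: "holomorphic_at G (diag p)"
 shows "\<exists>r>0. \<forall>c. (\<forall>a. (Xop (Lc c) ^^ a) (\<lambda>Z. G (diag Z)) p = 0) \<longrightarrow> norm c < r \<longrightarrow> G (slice c) = 0"
proof -
 obtain U where U: "open U" "0 \<in> U" "\<And>y. y \<in> U \<Longrightarrow> holomorphic_at (\<lambda>y. G (slice y)) y"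
  using holomorphic_at_eventually[OF holomorphic_on_slice[OF G]] unfolding eventually_nhds by blast
 obtain r where r: "r > 0" "ball 0 r \<subseteq> U" using openE[OF U(1,2)] by blast
 show ?thesis
 proof (intro exI[of _ "r / 2"] conjI allI impI)
  fix c assume flat: "\<forall>a. (Xop (Lc c) ^^ a) (\<lambda>Z. G (diag Z)) p = 0" and c: "norm c < r / 2"
  let ?g = "\<lambda>t. G (slice (t *s c))"
  have "?g holomorphic_on ball 0 2"
  proof (rule holomorphic_onI)
   fix t :: complex assume t: "t \<in> ball 0 2"
   have "norm (t *s c) = norm t * norm c"
    by (simp add: norm_vec_def L2_set_def norm_mult power_mult_distrib sum_distrib_left[symmetric] real_sqrt_mult)
   also have "\<dots> \<le> 2 * norm c" using t by (intro mult_right_mono) auto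
   also have "\<dots> < r" using c by simp
   finally have "t *s c \<in> U" using r by (auto simp: dist_norm)
   from has_field_derivative_line[OF holomorphic_at_imp_cdiff[OF U(3)[OF this]]]
   show "?g field_differentiable (at t within ball 0 2)"
    unfolding field_differentiable_def using has_field_derivative_at_within by blast
  qed
  moreover have "(deriv ^^ a) ?g 0 = 0" for a
  proof -
   have "(deriv ^^ a) ?g 0 = (dir c ^^ a) G (slice (0 *s c))" by (rule eventually_nhds_x_imp_x[OF deriv_pow_slice[OF G]])
   also have "\<dots> = (dir c ^^ a) G (diag p)" by (simp add: slice_0)
   also have "\<dots> = (Xop (Lc c) ^^ a) (\<lambda>Z. G (diag Z)) p" by (rule eventually_nhds_x_imp_x[OF Xpow_Lc_diag[OF G], symmetric])
   finally show ?thesis using flat by simp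
  qed
  ultimately have "?g 1 = 0" by (intro holomorphic_fun_eq_0_on_ball[of ?g 0 2 1]) auto
  then show "G (slice c) = 0" by simp
 qed (use r in simp)
qed

lemma vanishing_Lc:
 assumes "f \<in> vanishing M p" "\<forall>i\<in>K. c $ i = 0" shows "(Xop (Lc c) ^^ a) f \<in> vanishing M p"
proof (induction a)
 case (Suc a)
 have "Xop (Lc c) ((Xop (Lc c) ^^ a) f) = (\<lambda>Z. \<Sum>j\<in>UNIV. c $ j * Xop (E j) ((Xop (Lc c) ^^ a) f) Z)"
  by (simp add: fun_eq_iff Xop_Lc)
 moreover have "(\<lambda>Z. \<Sum>j\<in>UNIV. c $ j * Xop (E j) ((Xop (Lc c) ^^ a) f) Z) \<in> vanishing M p"
 proof (rule vanishing_sum)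
  show "(\<lambda>Z. c $ j * Xop (E j) ((Xop (Lc c) ^^ a) f) Z) \<in> vanishing M p" for j
  proof (cases "j \<in> K")
   case True
   then show ?thesis using assms(2) by (simp add: vanishing_zero)
  next
   case False
   then show ?thesis by (intro vanishing_mult[OF smooth_at_const] vanishing_E(1)[OF Suc])
  qed
 qed
 ultimately show ?case by simp
qed (simp add: assms(1))

text \<open>For \<open>c\<close> without normal components the field \<open>Lc c\<close> is tangent
to \<open>M\<close>, hence a function that vanishes on \<open>M\<close> is flat along it.\<close>

lemma vanishing_slice:
 assumes G: "holomorphic_at G (diag p)" and N: "(\<lambda>Z. G (diag Z)) \<in> vanishing M p"
 shows "\<forall>\<^sub>F y in nhds 0. (\<forall>i\<in>K. y $ i = 0) \<longrightarrow> G (slice y) = 0"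
proof -
 obtain r where r: "r > 0" "\<forall>c. (\<forall>a. (Xop (Lc c) ^^ a) (\<lambda>Z. G (diag Z)) p = 0) \<longrightarrow> norm c < r \<longrightarrow> G (slice c) = 0"
  using flat_imp_zero[OF G] by blast
 have "\<forall>\<^sub>F y in nhds (0::complex^'n). y \<in> ball 0 r" using r by (intro eventually_nhds_in_open) auto
 then show ?thesis
 proof eventually_elim
  case (elim y)
  show ?case
  proof
   assume "\<forall>i\<in>K. y $ i = 0"
   then have "\<forall>a. (Xop (Lc y) ^^ a) (\<lambda>Z. G (diag Z)) p = 0"
    using vanishing_value[OF vanishing_Lc[OF N] pM] by blast
   then show "G (slice y) = 0" using r(2) elim by simp
  qed
 qed
qed

end

section \<open>Block triangular matrices\<close>

text \<open>A diagonal block, completed by the identity; so blocks of any size have the same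
type.\<close>

definition blk :: "'k set => complex^'k^'k => complex^'k^'k" where
 "blk S X = (\<chi> i j. if i \<in> S \<and> j \<in> S then X $ i $ j else if i = j then 1 else 0)"

lemma matrix_vector_blk:
 "(blk S X *v v) $ i = (if i \<in> S then \<Sum>j\<in>S. X $ i $ j * v $ j else v $ i)"
proof (cases "i \<in> S")
 case True
 have "(\<Sum>j\<in>UNIV. blk S X $ i $ j * v $ j) = (\<Sum>j\<in>S. X $ i $ j * v $ j)"
  by (rule sum.mono_neutral_cong_right) (use True in \<open>auto simp: blk_def\<close>)
 then show ?thesis using True by (simp add: matrix_vector_mult_def)
next
 case False
 have "(\<Sum>j\<in>UNIV. blk S X $ i $ j * v $ j) = (\<Sum>j\<in>UNIV. if j = i then v $ i else 0)"
  by (rule sum.cong) (use False in \<open>auto simp: blk_def\<close>)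
 then show ?thesis using False by (simp add: matrix_vector_mult_def)
qed

lemma det_nz_iff_kernel: "det (X :: complex^'k^'k) \<noteq> 0 \<longleftrightarrow> (\<forall>v. X *v v = 0 \<longrightarrow> v = 0)"
 using matrix_left_invertible_ker[of X] invertible_det_nz[of X] invertible_left_inverse[of X] by blast

lemma det_blk_nz:
 assumes "\<And>v. (\<And>j. j \<notin> S \<Longrightarrow> v $ j = 0) \<Longrightarrow> (\<And>i. i \<in> S \<Longrightarrow> (\<Sum>j\<in>UNIV. X $ i $ j * v $ j) = 0) \<Longrightarrow> v = 0"
 shows "det (blk S X) \<noteq> 0"
 unfolding det_nz_iff_kernel
proof (intro allI impI)
 fix v assume v: "blk S X *v v = 0"
 have v0: "v $ j = 0" if "j \<notin> S" for j using matrix_vector_blk[of S X v j] v that by simp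
 have "(\<Sum>j\<in>UNIV. X $ i $ j * v $ j) = 0" if "i \<in> S" for i
 proof -
  have "(\<Sum>j\<in>UNIV. X $ i $ j * v $ j) = (\<Sum>j\<in>S. X $ i $ j * v $ j)"
   by (rule sum.mono_neutral_right) (auto simp: v0)
  then show ?thesis using matrix_vector_blk[of S X v i] v that by simp
 qed
 then show "v = 0" using v0 by (intro assms)
qed

lemma blk_solve:
 assumes "det (blk S X) \<noteq> 0"
 shows "\<exists>v. (\<forall>j. j \<notin> S \<longrightarrow> v $ j = 0) \<and> (\<forall>i\<in>S. (\<Sum>j\<in>UNIV. X $ i $ j * v $ j) = b i)"
proof -
 let ?v = "cramer_inv (blk S X) *v (\<chi> i. if i \<in> S then b i else 0)"
 have e: "blk S X *v ?v = (\<chi> i. if i \<in> S then b i else 0)"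
  by (simp add: matrix_vector_mul_assoc cramer_inv[OF assms])
 have v0: "?v $ j = 0" if "j \<notin> S" for j using matrix_vector_blk[of S X ?v j] that unfolding e by simp
 have "(\<Sum>j\<in>UNIV. X $ i $ j * ?v $ j) = b i" if "i \<in> S" for i
 proof -
  have "(\<Sum>j\<in>UNIV. X $ i $ j * ?v $ j) = (\<Sum>j\<in>S. X $ i $ j * ?v $ j)"
   by (rule sum.mono_neutral_right) (auto simp: v0)
  then show ?thesis using matrix_vector_blk[of S X ?v i] that unfolding e by simp
 qed
 then show ?thesis using v0 by (intro exI[of _ ?v]) simp
qed

text \<open>Conjugation by \<open>C 2\<close> doubles the off-diagonal block, which turns \<open>U
1\<close> into \<open>U 2\<close>, the square of \<open>U 1\<close>. Hence the nonzero determinant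
of \<open>U 1\<close> is its own square.\<close>

lemma det_unipotent:
 fixes Y :: "complex^'k^'k" and S :: "'k set"
 defines "U \<equiv> \<lambda>t. (\<chi> i j. (if i = j then 1 else 0) + (if i \<notin> S \<and> j \<in> S then t * Y $ i $ j else 0)) :: complex^'k^'k"
 shows "det (U 1) = 1"
proof -
 define N where "N = (\<lambda>t. (\<chi> i j. if i \<notin> S \<and> j \<in> S then t * Y $ i $ j else 0) :: complex^'k^'k)"
 define C where "C = (\<lambda>c::complex. (\<chi> i j. if i = j then if i \<in> S then 1 else c else 0) :: complex^'k^'k)"
 have U: "U t = mat 1 + N t" for t by (simp add: U_def N_def mat_def vec_eq_iff)
 have NN: "N s ** N t = 0" for s t by (auto simp: N_def matrix_matrix_mult_def vec_eq_iff intro!: sum.neutral)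
 have N_add: "N s + N t = N (s + t)" for s t by (auto simp: N_def vec_eq_iff ring_distribs)
 have UU: "U s ** U t = U (s + t)" for s t
 proof -
  have "U s ** U t = mat 1 + (N s + N t)"
   unfolding U using NN by (simp add: matrix_add_ldistrib matrix_matrix_mult_def vec_eq_iff sum.distrib ring_distribs mat_def
    if_distrib[where f = "\<lambda>x. x * _"] if_distrib[where f = "\<lambda>x. _ * x"] cong: if_cong)
  then show ?thesis unfolding N_add U .
 qed
 have CC: "C c ** C c' = C (c * c')" for c c'
  by (auto simp: C_def matrix_matrix_mult_def vec_eq_iff if_distrib[where f = "\<lambda>x. x * _"] cong: if_cong)
 have CU: "C 2 ** U 1 = U 2 ** C 2"
  by (simp add: C_def U_def matrix_matrix_mult_def vec_eq_iff if_distrib[where f = "\<lambda>x. x * _"] if_distrib[where f = "\<lambda>x. _ * x"] cong: if_cong)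
 have "C 2 ** C (1/2) = C 1" by (simp add: CC)
 moreover have "C 1 = mat 1" by (auto simp: C_def mat_def vec_eq_iff)
 ultimately have "det (C 2) * det (C (1/2)) = 1" by (metis det_mul det_I)
 then have C: "det (C 2) \<noteq> 0" by auto
 have "det (C 2) * det (U 1) = det (U 2) * det (C 2)" using CU by (metis det_mul)
 then have "det (U 1) = det (U 2)" using C by simp
 also have "\<dots> = det (U 1) * det (U 1)" using UU[of 1 1] by (metis det_mul one_add_one)
 finally have e: "det (U 1) = det (U 1) * det (U 1)" .
 have "U 1 ** U (-1) = mat 1" unfolding UU by (simp add: U N_def vec_eq_iff)
 then have "det (U 1) * det (U (-1)) = 1" by (metis det_mul det_I)
 then have "det (U 1) \<noteq> 0" by auto
 then show ?thesis using e by simp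
qed

lemma det_block_triangular:
 fixes X :: "complex^'k^'k"
 assumes "\<And>i j. i \<in> S \<Longrightarrow> j \<notin> S \<Longrightarrow> X $ i $ j = 0"
 shows "det X = det (blk (- S) X) * det (blk S X)"
proof -
 define U where "U = (\<chi> i j. (if i = j then 1 else 0) + (if i \<notin> S \<and> j \<in> S then 1 * X $ i $ j else 0))"
 have "det U = 1" unfolding U_def by (rule det_unipotent)
 moreover have "X *v v = blk S X *v (U *v (blk (- S) X *v v))" for v
 proof -
  let ?w = "blk (- S) X *v v"
  have w: "?w $ i = (if i \<in> S then v $ i else \<Sum>j\<in>-S. X $ i $ j * v $ j)" for i
   using matrix_vector_blk[of "- S" X v i] by simp
  have Uw: "(U *v ?w) $ i = ?w $ i + (if i \<in> S then 0 else \<Sum>j\<in>S. X $ i $ j * v $ j)" for i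
  proof -
   have "(U *v ?w) $ i = (\<Sum>j\<in>UNIV. (if i = j then 1 else 0) * ?w $ j) + (\<Sum>j\<in>UNIV. (if i \<notin> S \<and> j \<in> S then X $ i $ j else 0) * ?w $ j)"
    unfolding matrix_vector_mult_def[of U] vec_lambda_beta sum.distrib[symmetric]
    by (intro sum.cong refl) (simp add: U_def ring_distribs)
   moreover have "(\<Sum>j\<in>UNIV. (if i = j then 1 else 0) * ?w $ j) = ?w $ i"
    by (simp add: if_distrib[where f = "\<lambda>x. x * _"] cong: if_cong)
   moreover have "(\<Sum>j\<in>UNIV. (if i \<notin> S \<and> j \<in> S then X $ i $ j else 0) * ?w $ j) = (if i \<in> S then 0 else \<Sum>j\<in>S. X $ i $ j * v $ j)"
   proof (cases "i \<in> S")
    case False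
    have "(\<Sum>j\<in>UNIV. (if i \<notin> S \<and> j \<in> S then X $ i $ j else 0) * ?w $ j) = (\<Sum>j\<in>S. X $ i $ j * v $ j)"
     by (rule sum.mono_neutral_cong_right) (use False in \<open>auto simp: w\<close>)
    then show ?thesis using False by simp
   qed (simp add: sum.neutral)
   ultimately show ?thesis by simp
  qed
  have "(X *v v) $ i = (blk S X *v (U *v ?w)) $ i" for i
  proof -
   have split: "(X *v v) $ i = (\<Sum>j\<in>S. X $ i $ j * v $ j) + (\<Sum>j\<in>-S. X $ i $ j * v $ j)"
    unfolding matrix_vector_mult_def by (simp add: sum.subset_diff[of S UNIV] Compl_eq_Diff_UNIV add.commute)
   show ?thesis
   proof (cases "i \<in> S")
    case True
    then show ?thesis unfolding split matrix_vector_blk[of S] using assms by (simp add: Uw w)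
   next
    case False
    then show ?thesis unfolding split matrix_vector_blk[of S] by (simp add: Uw w)
   qed
  qed
  then show ?thesis unfolding vec_eq_iff by blast
 qed
 then have "X = blk S X ** (U ** blk (- S) X)" by (simp add: matrix_eq matrix_vector_mul_assoc)
 ultimately show ?thesis by (metis det_mul mult.commute mult_1)
qed

lemma holomorphic_at_blk_det:
 assumes "\<And>i j. holomorphic_at (\<lambda>w. X w $ i $ j) q" shows "holomorphic_at (\<lambda>w. det (blk S (X w))) q"
proof (rule holomorphic_at_det)
 show "holomorphic_at (\<lambda>w. blk S (X w) $ i $ j) q" for i j
  by (cases "i \<in> S \<and> j \<in> S") (auto simp: blk_def intro: assms hol_intros)
qed

lemma det_cnj: "cnj (det X) = det (\<chi> i j. cnj (X $ i $ j))"
 unfolding det_def by simp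

section \<open>Mappings between generic submanifolds\<close>

lemma monomial_cnj: "monomial (cnj_vec z) \<alpha> = cnj (monomial z \<alpha>)"
 by (simp add: monomial_def)

lemma cnj_vec_cnj_vec [simp]: "cnj_vec (cnj_vec z) = z" by (simp add: vec_eq_iff)

lemma norm_cnj_vec [simp]: "norm (cnj_vec z) = norm z" by (simp add: norm_vec_def)

lemma holomorphic_at_cnj:
 assumes "holomorphic_at f p" shows "holomorphic_at (\<lambda>z. cnj (f (cnj_vec z))) (cnj_vec p)"
proof -
 obtain a r where r: "r > 0" and hs: "\<And>z. z \<in> ball p r \<Longrightarrow> ((\<lambda>\<alpha>. a \<alpha> * monomial (z - p) \<alpha>) has_sum f z) UNIV"
  using assms unfolding holomorphic_at_def by blast
 have "((\<lambda>\<alpha>. cnj (a \<alpha>) * monomial (z - cnj_vec p) \<alpha>) has_sum cnj (f (cnj_vec z))) UNIV" if z: "z \<in> ball (cnj_vec p) r" for z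
 proof -
  have d: "cnj_vec z - p = cnj_vec (z - cnj_vec p)" by (simp add: vec_eq_iff)
  have "norm (cnj_vec z - p) < r" unfolding d norm_cnj_vec using z by (simp add: dist_norm norm_minus_commute)
  then have "cnj_vec z \<in> ball p r" by (simp add: dist_norm norm_minus_commute)
  from has_sum_cnj_iff[THEN iffD2, OF hs[OF this]] show ?thesis unfolding d monomial_cnj by simp
 qed
 then show ?thesis unfolding holomorphic_at_def using r
  by (intro exI[of _ "\<lambda>\<alpha>. cnj (a \<alpha>)"] exI[of _ r] conjI ballI)
qed

lemma ct_apply_hol_chain:
 fixes H :: "complex^'n => complex^'k"
 assumes H: "holomorphic_map_at H z" and g: "g differentiable (at (H z))" and V: "snd V = 0"
 shows "ct_apply V (\<lambda>z. g (H z)) z = (\<Sum>k\<in>UNIV. ct_apply V (\<lambda>z. H z $ k) z * d_dz k g (H z))"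
  "(\<lambda>z. g (H z)) differentiable (at z)"
proof -
 have c: "cdiff (\<lambda>z. H z $ k) z" for k using H holomorphic_at_imp_cdiff unfolding holomorphic_map_at_def by blast
 have df: "(\<lambda>z. H z $ k) differentiable (at z)" for k using cdiff_has_derivative[OF c] unfolding differentiable_def by blast
 have "ct_apply V (\<lambda>z. cnj (H z $ k)) z = 0" for k
  unfolding ct_apply_def d_dz_cnj[OF df] V using cdiff_d_dzbar[OF c] by simp
 then show "ct_apply V (\<lambda>z. g (H z)) z = (\<Sum>k\<in>UNIV. ct_apply V (\<lambda>z. H z $ k) z * d_dz k g (H z))"
  unfolding ct_apply_chain(1)[OF df g] by (simp add: pushforward_def ct_apply_def[of "(_, _)"])
 show "(\<lambda>z. g (H z)) differentiable (at z)" by (rule ct_apply_chain(2)[OF df g])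
qed

lemma d_dz_emb:
 fixes g :: "complex^'n => complex" and \<sigma> :: "'m::finite => 'n"
 assumes "inj \<sigma>" "cdiff g (emb \<sigma> z)" shows "d_dz i (\<lambda>z. g (emb \<sigma> z)) z = d_dz (\<sigma> i) g (emb \<sigma> z)"
proof -
 have c: "cdiff (\<lambda>z. emb \<sigma> z $ k) z" for k
  using holomorphic_map_at_emb[of \<sigma> z] holomorphic_at_imp_cdiff unfolding holomorphic_map_at_def by blast
 have e: "d_dz i (\<lambda>z. emb \<sigma> z $ k) z = (if k = \<sigma> i then 1 else 0)" for k
 proof (cases "k \<in> range \<sigma>")
  case True
  then obtain l where "k = \<sigma> l" by blast
  then show ?thesis using assms(1) by (simp add: emb_nth d_dz_nth inj_eq)
 next
  case False
  then show ?thesis by (auto simp: emb_nth_out d_dz_ct)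
 qed
 show ?thesis unfolding cdiff_compose(2)[OF c assms(2)] e
  by (simp add: if_distrib[where f = "\<lambda>x. _ * x"] cong: if_cong)
qed

locale segre_map =
 s: segre_frame M p d \<rho> F \<tau> \<omega> + t: segre_frame M' p' d \<rho>' F' \<tau> \<omega>'
 for M M' :: "(complex^'n) set" and p p' d \<rho> \<rho>' F F' \<tau> \<omega> \<omega>' +
 fixes H :: "complex^'n => complex^'n"
 assumes holH: "holomorphic_map_at H p" and Hp: "H p = p'"
  and HM: "\<forall>\<^sub>F Z in nhds p. Z \<in> M \<longrightarrow> H Z \<in> M'"
begin

abbreviation "K \<equiv> s.K"
abbreviation "N \<equiv> vanishing M p"

definition polH :: "complex^('n + 'n) => complex^('n + 'n)" where
 "polH w = pair (H (lft w)) (cnj_vec (H (cnj_vec (rgt w))))"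

lemma polH_diag: "polH (diag Z) = diag (H Z)" by (simp add: polH_def)

lemma holomorphic_polH: "holomorphic_map_at polH (diag p)"
 unfolding polH_def[abs_def]
proof (rule holomorphic_map_at_pair)
 show "holomorphic_map_at (\<lambda>w. H (lft w)) (diag p)"
  by (rule holomorphic_map_at_compose[OF holomorphic_map_at_lft]) (simp add: holH)
 show "holomorphic_map_at (\<lambda>w. cnj_vec (H (cnj_vec (rgt w)))) (diag p)"
  unfolding holomorphic_map_at_def
 proof
  fix k
  have "holomorphic_at (\<lambda>z. cnj (H (cnj_vec z) $ k)) (cnj_vec p)"
   using holomorphic_at_cnj[of "\<lambda>z. H z $ k" p] holH unfolding holomorphic_map_at_def by blast
  then have "holomorphic_at (\<lambda>z. cnj (H (cnj_vec z) $ k)) (rgt (diag p))" by simp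
  from holomorphic_at_compose[OF holomorphic_map_at_rgt this]
  show "holomorphic_at (\<lambda>w. cnj_vec (H (cnj_vec (rgt w))) $ k) (diag p)" by simp
 qed
qed

definition \<Phi> :: "'n => complex^('n + 'n) => complex" where "\<Phi> i w = t.\<Theta> i (polH w)"

lemma holomorphic_\<Phi>: "holomorphic_at (\<Phi> i) (diag p)"
 unfolding \<Phi>_def[abs_def] by (rule holomorphic_at_compose[OF holomorphic_polH]) (simp add: polH_diag Hp t.holomorphic_\<Theta>)

lemma \<Phi>_diag: "\<Phi> i (diag Z) = t.\<Theta> i (diag (H Z))" by (simp add: \<Phi>_def polH_diag)

text \<open>On the diagonal this is the matrix of the differential of \<open>H\<close> in the frames
of \<open>M\<close> and \<open>M'\<close>.\<close>

definition X :: "complex^('n + 'n) => complex^'n^'n" where "X w = (\<chi> i j. s.pol_E j (\<Phi> i) w)"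

lemma holomorphic_X: "holomorphic_at (\<lambda>w. X w $ i $ j) (diag p)"
 unfolding X_def using s.holomorphic_pol_E[OF holomorphic_\<Phi>, of j i] by simp

lemma Xop_\<Phi>: "\<forall>\<^sub>F Z in nhds p. Xop (s.E j) (\<lambda>Z. \<Phi> i (diag Z)) Z = X (diag Z) $ i $ j"
 using s.Xop_E_diag[OF holomorphic_\<Phi>, of j i] by (simp add: X_def)

lemma \<Phi>_vanishing: assumes "i \<in> K" shows "(\<lambda>Z. \<Phi> i (diag Z)) \<in> N"
proof (rule vanishingI[OF smooth_at_diag[OF holomorphic_\<Phi>]])
 have "\<forall>\<^sub>F Z in nhds p. t.\<Theta> i (diag (H Z)) = of_real (\<rho>' (s.idx i) (H Z)) \<and> (H Z \<in> M' \<longleftrightarrow> (\<forall>k<d. \<rho>' k (H Z) = 0))"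
  using eventually_compose_hol[OF holH, unfolded Hp, OF t.\<Theta>_real[OF assms]] eventually_compose_hol[OF holH, unfolded Hp, OF t.M]
  by eventually_elim simp
 then show "\<forall>\<^sub>F Z in nhds p. Z \<in> M \<longrightarrow> \<Phi> i (diag Z) = 0"
  using HM by eventually_elim (simp add: \<Phi>_diag s.idx_less[OF assms])
qed

lemma X_vanishing: assumes "i \<in> K" "j \<notin> K" shows "(\<lambda>Z. X (diag Z) $ i $ j) \<in> N"
 by (rule vanishing_cong[OF s.vanishing_E(1)[OF \<Phi>_vanishing[OF assms(1)] assms(2)] Xop_\<Phi>])

definition Jt :: "complex^'n => complex^'n^'n" where "Jt Z = (\<chi> k l. d_dz l (\<lambda>z. H z $ k) Z)"

lemma X_factor: "\<forall>\<^sub>F Z in nhds p. X (diag Z) = t.A (diag (H Z)) ** Jt Z ** s.B (diag Z)"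
proof -
 have "\<forall>\<^sub>F Z in nhds p. \<forall>i. holomorphic_at (t.\<Theta> i) (diag (H Z))"
  by (intro eventually_all_finite eventually_compose_hol[OF holH, unfolded Hp]
     t.eventually_diag holomorphic_at_eventually t.holomorphic_\<Theta>)
 moreover have "\<forall>\<^sub>F Z in nhds p. \<forall>i. holomorphic_at (\<Phi> i) (diag Z)"
  by (intro eventually_all_finite s.eventually_diag holomorphic_at_eventually holomorphic_\<Phi>)
 moreover have "\<forall>\<^sub>F Z in nhds p. holomorphic_map_at H Z"
  using holomorphic_map_at_open[OF holH] unfolding eventually_nhds by blast
 ultimately show ?thesis
 proof eventually_elim
  case (elim Z)
  have d: "d_dz (Inl l) (\<Phi> i) (diag Z) = (\<Sum>k\<in>UNIV. t.A (diag (H Z)) $ i $ k * Jt Z $ k $ l)" for i l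
  proof -
   have c: "cdiff (t.\<Theta> i) (diag (H Z))" using elim(1) holomorphic_at_imp_cdiff by blast
   have df: "(\<lambda>Z. t.\<Theta> i (diag Z)) differentiable (at (H Z))"
    using elim(1) by (intro smooth_at_diff smooth_at_diag) blast
   have "d_dz (Inl l) (\<Phi> i) (diag Z) = d_dz l (\<lambda>Z. t.\<Theta> i (diag (H Z))) Z"
    using d_dz_diag(1)[OF holomorphic_at_imp_cdiff, of "\<Phi> i" Z l] elim(2) by (simp add: \<Phi>_diag)
   also have "\<dots> = (\<Sum>k\<in>UNIV. ct_apply (axis l 1, 0) (\<lambda>z. H z $ k) Z * d_dz k (\<lambda>Z. t.\<Theta> i (diag Z)) (H Z))"
    unfolding d_dz_ct[of l] by (rule ct_apply_hol_chain(1)[OF elim(3) df]) simp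
   finally show ?thesis by (simp add: d_dz_diag[OF c] t.A_def Jt_def d_dz_ct[of l] mult.commute)
  qed
  show ?case
   by (simp add: vec_eq_iff X_def s.pol_E_def d matrix_matrix_mult_def mult.commute)
 qed
qed

definition J :: "complex^'n => complex" where "J Z = det (\<chi> k j. d_dz k (\<lambda>z. H z $ j) Z)"
definition u :: "complex^'n => complex" where "u Z = det (t.A (diag (H Z))) * det (s.B (diag Z))"
definition \<Delta> :: "complex^('n + 'n) => complex" where "\<Delta> w = det (blk (- K) (X w))"
definition \<delta> :: "complex^'n => complex" where "\<delta> Z = \<Delta> (diag Z)"
definition D :: "complex^'n => complex" where "D Z = det (blk K (X (diag Z)))"

lemma J_Jt: "J Z = det (Jt Z)"
proof -
 have "(\<chi> k j. d_dz k (\<lambda>z. H z $ j) Z) = transpose (Jt Z)" by (simp add: Jt_def transpose_def vec_eq_iff)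
 then show ?thesis by (simp add: J_def det_transpose)
qed

lemma holomorphic_J: "holomorphic_at J p"
proof -
 have "holomorphic_at (\<lambda>Z. (\<chi> k j. d_dz k (\<lambda>z. H z $ j) Z) $ k $ j) p" for k j
  using holH holomorphic_at_d_dz[of "\<lambda>z. H z $ j" p k] by (simp add: holomorphic_map_at_def)
 then show ?thesis unfolding J_def[abs_def] by (rule holomorphic_at_det)
qed

lemma smooth_J: "smooth_at J p" by (rule smooth_at_holomorphic[OF holomorphic_J])

lemma holomorphic_\<Delta>: "holomorphic_at \<Delta> (diag p)"
 unfolding \<Delta>_def[abs_def] by (rule holomorphic_at_blk_det[OF holomorphic_X])

lemma smooth_\<delta>: "smooth_at \<delta> p"
 unfolding \<delta>_def[abs_def] by (rule smooth_at_diag[OF holomorphic_\<Delta>])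

lemma smooth_D: "smooth_at D p"
 unfolding D_def[abs_def] by (rule smooth_at_diag[OF holomorphic_at_blk_det[OF holomorphic_X]])

lemma smooth_A': "smooth_at (\<lambda>Z. t.A (diag (H Z)) $ i $ j) p"
 by (rule smooth_at_compose[OF smooth_at_holomorphic_map[OF holH], unfolded Hp]) (rule smooth_at_diag[OF t.holomorphic_A])

lemma smooth_B': "smooth_at (\<lambda>Z. t.B (diag (H Z)) $ i $ j) p"
 by (rule smooth_at_compose[OF smooth_at_holomorphic_map[OF holH], unfolded Hp]) (rule smooth_at_diag[OF t.holomorphic_B])

lemma smooth_u: "smooth_at u p"
 unfolding u_def[abs_def]
 by (intro smooth_at_mult smooth_at_det smooth_A') (rule smooth_at_diag[OF s.holomorphic_B])

lemma u_p: "u p \<noteq> 0"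
proof -
 have "det (s.A (diag p)) * det (s.B (diag p)) = 1"
  using s.AB[of "diag p"] s.A_base s.det_\<omega> by (metis det_mul det_I)
 then show ?thesis using t.A_base t.det_\<omega> by (auto simp: u_def Hp)
qed

lemma kill_J: "\<forall>\<^sub>F Z in nhds p. Xop (s.Eb j) J Z = 0"
 using holomorphic_at_eventually[OF holomorphic_J]
proof eventually_elim
 case (elim Z)
 then show ?case
  using cdiff_d_dzbar[OF holomorphic_at_imp_cdiff[OF elim]] by (simp add: Xop_def ct_apply_def s.Eb_def s.E_def ct_cnj_def)
qed

text \<open>For normal indices the functions \<open>\<Phi> i\<close> are real on the diagonal and
vanish on \<open>M\<close>, and \<open>E k - Eb k\<close> is tangent to \<open>M\<close>; so
\<open>E k\<close> and \<open>Eb k\<close> give them the same, hence real, derivatives on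
\<open>M\<close>.\<close>

lemma cnj_D: "(\<lambda>Z. cnj (D Z) - D Z) \<in> N"
proof (rule vanishingI)
 show "smooth_at (\<lambda>Z. cnj (D Z) - D Z) p" by (intro sm_intros smooth_D)
 have "\<forall>\<^sub>F Z in nhds p. Z \<in> M \<longrightarrow> cnj (X (diag Z) $ i $ j) = X (diag Z) $ i $ j" if i: "i \<in> K" for i j
 proof -
  let ?f = "\<lambda>Z. \<Phi> i (diag Z)"
  have ev: "\<forall>\<^sub>F Z in nhds p. cnj (?f Z) = ?f Z"
   using eventually_compose_hol[OF holH, unfolded Hp, OF t.\<Theta>_real[OF i]] by eventually_elim (simp add: \<Phi>_diag)
  show ?thesis
   using vanishing_ev[OF s.vanishing_E_diff[OF \<Phi>_vanishing[OF i], of j]] Xop_\<Phi>[of j i] Xop_cong[OF ev, of "s.E j"]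
    smooth_at_eventually_diff[OF smooth_at_diag[OF holomorphic_\<Phi>[of i]]]
   by eventually_elim (simp add: s.Xop_Eb)
 qed
 then have "\<forall>\<^sub>F Z in nhds p. \<forall>i\<in>K. \<forall>j. Z \<in> M \<longrightarrow> cnj (X (diag Z) $ i $ j) = X (diag Z) $ i $ j"
  by (intro eventually_ball_finite eventually_all_finite ballI) auto
 then show "\<forall>\<^sub>F Z in nhds p. Z \<in> M \<longrightarrow> cnj (D Z) - D Z = 0"
 proof eventually_elim
  case (elim Z)
  show ?case
  proof
   assume "Z \<in> M"
   then have "(\<chi> i j. cnj (blk K (X (diag Z)) $ i $ j)) = blk K (X (diag Z))"
    using elim by (simp add: blk_def vec_eq_iff)
   then show "cnj (D Z) - D Z = 0" by (simp add: D_def det_cnj)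
  qed
 qed
qed

text \<open>On \<open>M\<close> the matrix \<open>X\<close> is block triangular, because
\<open>H\<close> maps \<open>M\<close> into \<open>M'\<close>.\<close>

lemma jacobian_relation: "(\<lambda>Z. J Z * u Z - \<delta> Z * D Z) \<in> N"
proof (rule vanishingI)
 show "smooth_at (\<lambda>Z. J Z * u Z - \<delta> Z * D Z) p" by (intro sm_intros smooth_J smooth_u smooth_\<delta> smooth_D)
 have "\<forall>\<^sub>F Z in nhds p. \<forall>i\<in>K. \<forall>j\<in>-K. Z \<in> M \<longrightarrow> X (diag Z) $ i $ j = 0"
  using vanishing_ev[OF X_vanishing] by (intro eventually_ball_finite ballI) auto
 with X_factor show "\<forall>\<^sub>F Z in nhds p. Z \<in> M \<longrightarrow> J Z * u Z - \<delta> Z * D Z = 0"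
 proof eventually_elim
  case (elim Z)
  show ?case
  proof
   assume Z: "Z \<in> M"
   have "J Z * u Z = det (X (diag Z))" unfolding elim(1) by (simp add: J_Jt u_def det_mul)
   also have "\<dots> = \<delta> Z * D Z"
    unfolding \<delta>_def D_def \<Delta>_def by (rule det_block_triangular) (use elim(2) Z in auto)
   finally show "J Z * u Z - \<delta> Z * D Z = 0" by simp
  qed
 qed
qed

lemma jacobian_relation_cnj: "(\<lambda>Z. cnj (J Z) * cnj (u Z) - cnj (\<delta> Z) * D Z) \<in> N"
proof -
 have "(\<lambda>Z. cnj (J Z * u Z - \<delta> Z * D Z) + cnj (\<delta> Z) * (cnj (D Z) - D Z)) \<in> N"
  by (intro vanishing_add vanishing_cnj jacobian_relation vanishing_mult cnj_D smooth_at_cnj smooth_\<delta>)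
 then show ?thesis by (simp add: algebra_simps)
qed

definition Ht :: "complex^'n => complex^'n" where "Ht y = t.G0 (H (s.\<Gamma> y))"

lemma \<Phi>_slice: "\<Phi> i (s.slice y) = Ht y $ i"
 by (simp add: \<Phi>_def polH_def s.slice_def Ht_def t.G0_def Hp)

lemma holomorphic_Ht: "holomorphic_map_at Ht 0"
proof -
 have "holomorphic_map_at (\<lambda>y. H (s.\<Gamma> y)) 0"
  by (rule holomorphic_map_at_compose[OF s.holomorphic_\<Gamma>]) (simp add: s.\<Gamma>_0 holH)
 then show ?thesis unfolding Ht_def[abs_def]
  by (rule holomorphic_map_at_compose) (simp add: s.\<Gamma>_0 Hp t.holomorphic_G0)
qed

lemma Ht_0: "Ht 0 = 0" by (simp add: Ht_def s.\<Gamma>_0 Hp t.G0_base)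

lemma X_slice: "\<forall>\<^sub>F y in nhds 0. X (s.slice y) $ i $ j = d_dz j (\<lambda>y. Ht y $ i) y"
 using s.d_dz_slice[OF holomorphic_\<Phi>, of j i] unfolding \<Phi>_slice by eventually_elim (simp add: X_def)

lemma Ht_K: "i \<in> K \<Longrightarrow> \<forall>\<^sub>F y in nhds 0. (\<forall>j\<in>K. y $ j = 0) \<longrightarrow> Ht y $ i = 0"
 using s.vanishing_slice[OF holomorphic_\<Phi> \<Phi>_vanishing] unfolding \<Phi>_slice by blast

text \<open>The tangential block restricts on the Segre variety to the Jacobian matrix of the induced map,
which is nonsingular at points arbitrarily near to the centre.\<close>

lemma \<delta>_not_flat:
 fixes \<sigma> :: "'m::finite => 'n"
 assumes \<sigma>: "inj \<sigma>" "range \<sigma> = - K" and fin: "finite_germ (\<lambda>z. prj \<sigma> (Ht (emb \<sigma> z))) 0"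
 shows "\<exists>c. (\<forall>i\<in>K. c $ i = 0) \<and> (\<exists>a. (Xop (s.Lc c) ^^ a) \<delta> p \<noteq> 0)"
proof (rule ccontr)
 let ?k = "\<lambda>z. prj \<sigma> (Ht (emb \<sigma> z))"
 assume neg: "\<not> ?thesis"
 obtain r where r: "r > 0" "\<forall>c. (\<forall>a. (Xop (s.Lc c) ^^ a) (\<lambda>Z. \<Delta> (diag Z)) p = 0) \<longrightarrow> norm c < r \<longrightarrow> \<Delta> (s.slice c) = 0"
  using s.flat_imp_zero[OF holomorphic_\<Delta>] by blast
 have hk: "holomorphic_map_at ?k 0"
 proof (rule holomorphic_map_at_compose[OF _ holomorphic_map_at_prj])
  show "holomorphic_map_at (\<lambda>z. Ht (emb \<sigma> z)) 0"
   by (rule holomorphic_map_at_compose[OF holomorphic_map_at_emb]) (simp add: holomorphic_Ht)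
 qed
 let ?good = "\<lambda>y. norm y < r \<and> (\<forall>i j. X (s.slice y) $ i $ j = d_dz j (\<lambda>y. Ht y $ i) y) \<and> (\<forall>i. holomorphic_at (\<lambda>y. Ht y $ i) y)"
 have "\<forall>\<^sub>F y in nhds (0::complex^'n). y \<in> ball 0 r" using r(1) by (intro eventually_nhds_in_open) auto
 moreover have "\<forall>\<^sub>F y in nhds 0. \<forall>i j. X (s.slice y) $ i $ j = d_dz j (\<lambda>y. Ht y $ i) y"
  by (intro eventually_all_finite X_slice)
 moreover have "\<forall>\<^sub>F y in nhds 0. \<forall>i. holomorphic_at (\<lambda>y. Ht y $ i) y"
  using holomorphic_Ht holomorphic_at_eventually unfolding holomorphic_map_at_def by (intro eventually_all_finite) blast
 ultimately have "\<forall>\<^sub>F y in nhds 0. ?good y"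
  by eventually_elim simp
 then have "\<forall>\<^sub>F z in nhds 0. ?good (emb \<sigma> z)"
  by (intro eventually_compose_hol[OF holomorphic_map_at_emb]) simp
 then obtain \<epsilon> where \<epsilon>: "\<epsilon> > 0" "\<And>z. z \<in> ball 0 \<epsilon> \<Longrightarrow> ?good (emb \<sigma> z)"
  unfolding eventually_nhds_metric by (auto simp: dist_commute)
 have "?k 0 = 0" by (simp add: Ht_0)
 from finite_germ_nondegenerate[OF fin hk this \<epsilon>(1)]
 obtain z where z: "z \<in> ball 0 \<epsilon>" and inj: "inj (jac ?k z)" by blast
 note z3 = \<epsilon>(2)[OF z]
 have jk: "jac ?k z w $ l = (\<Sum>i\<in>UNIV. X (s.slice (emb \<sigma> z)) $ \<sigma> l $ \<sigma> i * w $ i)" for w l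
 proof -
  have "d_dz i (\<lambda>z. Ht (emb \<sigma> z) $ \<sigma> l) z = X (s.slice (emb \<sigma> z)) $ \<sigma> l $ \<sigma> i" for i
   using d_dz_emb[OF \<sigma>(1) holomorphic_at_imp_cdiff, of "\<lambda>y. Ht y $ \<sigma> l" z i] z3 by simp
  then show ?thesis by (simp add: jac_def)
 qed
 have "det (blk (- K) (X (s.slice (emb \<sigma> z)))) \<noteq> 0"
 proof (rule det_blk_nz)
  fix v :: "complex^'n"
  assume v0: "\<And>j. j \<notin> - K \<Longrightarrow> v $ j = 0" and v: "\<And>i. i \<in> - K \<Longrightarrow> (\<Sum>j\<in>UNIV. X (s.slice (emb \<sigma> z)) $ i $ j * v $ j) = 0"
  have "jac ?k z (prj \<sigma> v) $ l = 0" for l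
  proof -
   have "\<sigma> l \<in> - K" using \<sigma>(2) by blast
   from v[OF this] have "(\<Sum>j\<in>range \<sigma>. X (s.slice (emb \<sigma> z)) $ \<sigma> l $ j * v $ j) = 0"
    using sum.mono_neutral_left[of UNIV "range \<sigma>" "\<lambda>j. X (s.slice (emb \<sigma> z)) $ \<sigma> l $ j * v $ j"] v0 \<sigma>(2) by simp
   then show ?thesis unfolding jk by (simp add: sum.reindex[OF \<sigma>(1)])
  qed
  then have "jac ?k z (prj \<sigma> v) = jac ?k z 0" by (simp add: vec_eq_iff jac_def)
  then have "prj \<sigma> v = 0" using inj by (simp add: inj_eq)
  then have "v $ j = 0" if "j \<in> range \<sigma>" for j using that by (auto simp: vec_eq_iff)
  then show "v = 0" using v0 \<sigma>(2) by (metis vec_eq_iff zero_index)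
 qed
 moreover have "\<Delta> (s.slice (emb \<sigma> z)) = 0"
 proof -
  have "\<forall>i\<in>K. emb \<sigma> z $ i = 0" using \<sigma>(2) emb_nth_out by blast
  then have "\<forall>a. (Xop (s.Lc (emb \<sigma> z)) ^^ a) (\<lambda>Z. \<Delta> (diag Z)) p = 0" using neg unfolding \<delta>_def[abs_def] by blast
  then show ?thesis using r(2) z3 by blast
 qed
 ultimately show False by (simp add: \<Delta>_def)
qed

end

section \<open>Transversality\<close>

lemma ct_cnj_ct_cnj [simp]: "ct_cnj (ct_cnj V) = V" by (simp add: ct_cnj_def)

lemma ct_apply_ct_cnj:
 "f differentiable (at q) \<Longrightarrow> ct_apply (ct_cnj V) f q = cnj (ct_apply V (\<lambda>z. cnj (f z)) q)"
 by (simp add: ct_apply_cnj)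

lemma smooth_at_ct_cnj [sm_intros]:
 fixes Y :: "complex^'n => 'n::finite ctvec"
 assumes "smooth_at Y p" shows "smooth_at (\<lambda>z. ct_cnj (Y z)) p"
 unfolding ct_cnj_def
proof (intro smooth_at_Pair)
 show "smooth_at (\<lambda>z. cnj_vec (snd (Y z))) p"
  by (rule smooth_at_vec) (simp add: smooth_at_cnj smooth_at_nth smooth_at_snd assms)
 show "smooth_at (\<lambda>z. cnj_vec (fst (Y z))) p"
  by (rule smooth_at_vec) (simp add: smooth_at_cnj smooth_at_nth smooth_at_fst assms)
qed

lemma Xop_ct_cnj:
 fixes p :: "complex^'n" and f :: "complex^'n => complex"
 shows
 "smooth_at f p \<Longrightarrow> \<forall>\<^sub>F z in nhds p. Xop (\<lambda>z. ct_cnj (Y z)) f z = cnj (Xop Y (\<lambda>z. cnj (f z)) z)"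
 using smooth_at_eventually_diff[of f p] by (auto simp: Xop_def intro: ct_apply_ct_cnj elim: eventually_mono)

lemma Xpow_ct_cnj:
 fixes p :: "complex^'n"
 assumes Y: "smooth_at Y p" and f: "smooth_at f p"
 shows "\<forall>\<^sub>F z in nhds p. (Xop (\<lambda>z. ct_cnj (Y z)) ^^ n) f z = cnj ((Xop Y ^^ n) (\<lambda>z. cnj (f z)) z)"
proof (induction n)
 case (Suc n)
 have sm: "smooth_at (\<lambda>z. cnj ((Xop Y ^^ n) (\<lambda>z. cnj (f z)) z)) p" by (intro sm_intros Y f)
 show ?case using Xop_cong[OF Suc, of "\<lambda>z. ct_cnj (Y z)"] Xop_ct_cnj[OF sm, of Y] by eventually_elim simp
qed simp

lemma Xpow_diff:
 fixes p :: "complex^'n"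
 assumes X: "smooth_at X p" and f: "smooth_at f p" and g: "smooth_at g p"
 shows "\<forall>\<^sub>F z in nhds p. (Xop X ^^ n) (\<lambda>z. f z - g z) z = (Xop X ^^ n) f z - (Xop X ^^ n) g z"
proof (induction n)
 case (Suc n)
 have "smooth_at ((Xop X ^^ n) f) p" "smooth_at ((Xop X ^^ n) g) p" by (intro sm_intros X f g)+
 from Xop_cong[OF Suc, of X] Xop_diff[OF this, of X] show ?case by eventually_elim simp
qed simp

lemma prime_at_cnj:
 assumes "prime_at p P" shows "prime_at p {f. (\<lambda>z. cnj (f z)) \<in> P}"
proof -
 have sm: "smooth_at f p" if "(\<lambda>z. cnj (f z)) \<in> P" for f
  using smooth_at_cnj[OF prime_at_smooth[OF assms that]] by simp
 have v: "f p = 0" if "(\<lambda>z. cnj (f z)) \<in> P" for f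
  using prime_at_value[OF assms that] by simp
 have m: "(\<lambda>z. cnj (a z * f z)) \<in> P" if "smooth_at a p" "(\<lambda>z. cnj (f z)) \<in> P" for a f
  using prime_at_mult[OF assms smooth_at_cnj[OF that(1)] that(2)] by simp
 have e: "(\<lambda>z. cnj (g z)) \<in> P" if "(\<lambda>z. cnj (f z)) \<in> P" "\<forall>\<^sub>F z in nhds p. f z = g z" for f g
  by (rule prime_at_ev[OF assms that(1)]) (use that(2) in \<open>auto elim: eventually_mono\<close>)
 have pr: "(\<lambda>z. cnj (f z)) \<in> P \<or> (\<lambda>z. cnj (g z)) \<in> P"
  if "smooth_at f p" "smooth_at g p" "(\<lambda>z. cnj (f z * g z)) \<in> P" for f g
  using prime_at_prime[OF assms smooth_at_cnj[OF that(1)] smooth_at_cnj[OF that(2)]] that(3) by simp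
 have a: "(\<lambda>z. cnj (f z + g z)) \<in> P" if "(\<lambda>z. cnj (f z)) \<in> P" "(\<lambda>z. cnj (g z)) \<in> P" for f g
  using prime_at_add[OF assms that] by simp
 show ?thesis
  unfolding prime_at_def mem_Collect_eq using sm v m e pr a prime_at_zero[OF assms] by simp
qed

lemma related_ct_cnj:
 fixes p :: "complex^'n"
 assumes P: "prime_at p P" and H: "holomorphic_map_at H p"
  and r: "related {f. (\<lambda>z. cnj (f z)) \<in> P} p H Y \<delta> (\<lambda>q. ct_cnj (V q))"
 shows "related P p H (\<lambda>z. ct_cnj (Y z)) (\<lambda>z. cnj (\<delta> z)) V"
 unfolding related_def
proof (intro conjI ballI allI impI)
 show "smooth_at (\<lambda>z. ct_cnj (Y z)) p" "smooth_at (\<lambda>z. cnj (\<delta> z)) p" by (intro sm_intros relatedD[OF r])+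
 show "(\<lambda>z. cnj (\<delta> z)) \<notin> P" using relatedD(3)[OF r] by simp
next
 fix f assume f: "f \<in> P"
 then have "(\<lambda>z. cnj (f z)) \<in> {f. (\<lambda>z. cnj (f z)) \<in> P}" by simp
 from relatedD(4)[OF r this] have "(\<lambda>z. cnj (Xop Y (\<lambda>z. cnj (f z)) z)) \<in> P" by simp
 then show "Xop (\<lambda>z. ct_cnj (Y z)) f \<in> P"
  by (rule prime_at_ev[OF P]) (use Xop_ct_cnj[OF prime_at_smooth[OF P f], of Y] in eventually_elim, simp)
next
 fix g :: "complex^'n => complex" assume g: "smooth_at g (H p)"
 have gH: "smooth_at (\<lambda>z. g (H z)) p" by (rule smooth_at_compose[OF smooth_at_holomorphic_map[OF H] g])
 from relatedD(5)[OF r smooth_at_cnj[OF g]]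
 have "(\<lambda>z. cnj (Xop Y (\<lambda>z. cnj (g (H z))) z - \<delta> z * Xop (\<lambda>q. ct_cnj (V q)) (\<lambda>q. cnj (g q)) (H z))) \<in> P" by simp
 then show "(\<lambda>z. Xop (\<lambda>z. ct_cnj (Y z)) (\<lambda>z. g (H z)) z - cnj (\<delta> z) * Xop V g (H z)) \<in> P"
 proof (rule prime_at_ev[OF P])
  have "\<forall>\<^sub>F q in nhds (H p). Xop (\<lambda>q. ct_cnj (ct_cnj (V q))) g q = cnj (Xop (\<lambda>q. ct_cnj (V q)) (\<lambda>q. cnj (g q)) q)"
   by (rule Xop_ct_cnj[OF g])
  from Xop_ct_cnj[OF gH, of Y] eventually_compose_hol[OF H this]
  show "\<forall>\<^sub>F z in nhds p. cnj (Xop Y (\<lambda>z. cnj (g (H z))) z - \<delta> z * Xop (\<lambda>q. ct_cnj (V q)) (\<lambda>q. cnj (g q)) (H z))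
    = Xop (\<lambda>z. ct_cnj (Y z)) (\<lambda>z. g (H z)) z - cnj (\<delta> z) * Xop V g (H z)"
   by eventually_elim simp
 qed
qed

context segre_frame begin

lemma T10_frame: "\<forall>\<^sub>F q in nhds p. \<forall>V. V \<in> T10 d \<rho> q \<longleftrightarrow> snd V = 0 \<and> (\<forall>i\<in>K. (\<Sum>l\<in>UNIV. A (diag q) $ i $ l * fst V $ l) = 0)"
proof -
 have "\<forall>\<^sub>F q in nhds p. \<forall>i\<in>K. (\<forall>\<^sub>F Z in nhds q. \<Theta> i (diag Z) = of_real (\<rho> (idx i) Z)) \<and> holomorphic_at (\<Theta> i) (diag q)"
 proof (intro eventually_ball_finite ballI)
  fix i assume "i \<in> K"
  from \<Theta>_real[OF this] have "\<forall>\<^sub>F q in nhds p. \<forall>\<^sub>F Z in nhds q. \<Theta> i (diag Z) = of_real (\<rho> (idx i) Z)"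
   by (simp add: eventually_eventually)
  with eventually_diag[OF holomorphic_at_eventually[OF holomorphic_\<Theta>]]
  show "\<forall>\<^sub>F q in nhds p. (\<forall>\<^sub>F Z in nhds q. \<Theta> i (diag Z) = of_real (\<rho> (idx i) Z)) \<and> holomorphic_at (\<Theta> i) (diag q)"
   by eventually_elim simp
 qed simp
 then show ?thesis
 proof eventually_elim
  case (elim q)
  show ?case
  proof
   fix V :: "'n ctvec"
   let ?R = "snd V = 0 \<and> (\<forall>i\<in>K. (\<Sum>l\<in>UNIV. A (diag q) $ i $ l * fst V $ l) = 0)"
   let ?h = "\<lambda>i z. complex_of_real (\<rho> (idx i) z)"
   have ap: "ct_apply (ct_cnj V) (?h i) q = cnj (\<Sum>l\<in>UNIV. A (diag q) $ i $ l * fst V $ l)" if i: "i \<in> K" and V: "snd V = 0" for i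
   proof -
    have ev: "\<forall>\<^sub>F Z in nhds q. \<Theta> i (diag Z) = ?h i Z" and hol: "holomorphic_at (\<Theta> i) (diag q)" using elim i by blast+
    have df: "?h i differentiable (at q)" by (rule smooth_at_diff[OF smooth_at_cong[OF smooth_at_diag[OF hol] ev]])
    have "ct_apply V (?h i) q = ct_apply V (\<lambda>Z. \<Theta> i (diag Z)) q" using ct_apply_cong[OF ev] by simp
    also have "\<dots> = (\<Sum>l\<in>UNIV. A (diag q) $ i $ l * fst V $ l)"
     using d_dz_diag[OF holomorphic_at_imp_cdiff[OF hol]] V by (simp add: ct_apply_def A_def mult.commute)
    finally show ?thesis unfolding ct_apply_ct_cnj[OF df] by simp
   qed
   have "V \<in> T10 d \<rho> q \<longleftrightarrow> ct_cnj V \<in> T01 d \<rho> q"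
    unfolding T10_def by (auto intro!: image_eqI[of V ct_cnj "ct_cnj V"])
   also have "\<dots> \<longleftrightarrow> snd V = 0 \<and> (\<forall>i\<in>K. ct_apply (ct_cnj V) (?h i) q = 0)"
   proof -
    have "fst (ct_cnj V) = 0 \<longleftrightarrow> snd V = 0" by (simp add: ct_cnj_def vec_eq_iff)
    moreover have "ct_cnj V \<in> CT d \<rho> q \<longleftrightarrow> (\<forall>i\<in>K. ct_apply (ct_cnj V) (?h i) q = 0)"
     unfolding CT_def mem_Collect_eq using ball_K[of "\<lambda>k. ct_apply (ct_cnj V) (\<lambda>z. complex_of_real (\<rho> k z)) q = 0"] by blast
    ultimately show ?thesis unfolding T01_def T01_space_def by blast
   qed
   also have "\<dots> \<longleftrightarrow> ?R"
    by (cases "snd V = 0") (simp_all add: ap del: cnj_sum complex_cnj_mult)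
   finally show "V \<in> T10 d \<rho> q \<longleftrightarrow> ?R" .
  qed
 qed
qed

lemma CT_fst: "\<exists>V\<in>CT d \<rho> p. fst V = w"
proof -
 define v where "v = cramer_inv \<omega> *v cnj_vec (- (\<omega> *v w))"
 have v: "\<omega> *v v = cnj_vec (- (\<omega> *v w))" by (simp add: v_def matrix_vector_mul_assoc cramer_inv[OF det_\<omega>])
 have "ct_apply (w, cnj_vec v) (\<lambda>z. of_real (\<rho> k z)) p = 0" if k: "k < d" for k
 proof -
  let ?h = "\<lambda>z. complex_of_real (\<rho> k z)"
  have df: "?h differentiable (at p)" by (rule smooth_at_diff[OF smooth_at_cong[OF smooth_at_diag[OF hol[OF k]] polar[OF k]]])
  have l: "d_dz j ?h p = \<omega> $ \<tau> k $ j" for j using \<omega>[OF k] by simp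
  have lb: "d_dzbar j ?h p = cnj (\<omega> $ \<tau> k $ j)" for j using d_dz_cnj(2)[OF df, of j] l by simp
  have "ct_apply (w, cnj_vec v) ?h p = (\<omega> *v w) $ \<tau> k + cnj ((\<omega> *v v) $ \<tau> k)"
   unfolding ct_apply_def l lb by (simp add: matrix_vector_mult_def sum.distrib mult.commute)
  also have "\<dots> = 0" unfolding v by simp
  finally show ?thesis .
 qed
 then show ?thesis by (intro bexI[of _ "(w, cnj_vec v)"]) (auto simp: CT_def)
qed

end

context segre_map begin

text \<open>In the frame of \<open>M'\<close> the field \<open>V\<close> has on \<open>M'\<close>
only tangential components. Cramer's rule for the tangential block expresses \<open>\<delta>\<close>
times these components through the fields \<open>E j\<close> with \<open>j\<close> tangential, and
these preserve \<open>P\<close>.\<close>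

lemma transported_field10:
 assumes P: "prime_at p P" and closed: "\<And>j f. j \<notin> K \<Longrightarrow> f \<in> P \<Longrightarrow> Xop (s.E j) f \<in> P"
  and NP: "N \<subseteq> P" and \<delta>P: "\<delta> \<notin> P"
  and V: "smooth_at V p'" "\<forall>\<^sub>F q in nhds p'. q \<in> M' \<longrightarrow> V q \<in> T10 d \<rho>' q"
 shows "\<exists>Y. related P p H Y \<delta> V"
proof -
 have smH: "smooth_at H p" by (rule smooth_at_holomorphic_map[OF holH])
 have smV: "smooth_at (\<lambda>Z. V (H Z)) p" by (rule smooth_at_compose[OF smH]) (simp add: Hp V(1))
 have smX: "smooth_at (\<lambda>Z. X (diag Z) $ i $ j) p" for i j by (rule smooth_at_diag[OF holomorphic_X])
 define x where "x = (\<lambda>i Z. \<Sum>l\<in>UNIV. t.A (diag (H Z)) $ i $ l * fst (V (H Z)) $ l)"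
 have smx: "smooth_at (x i) p" for i unfolding x_def by (intro sm_intros smooth_A' smV)
 have evV: "\<forall>\<^sub>F Z in nhds p. Z \<in> M \<longrightarrow> snd (V (H Z)) = 0 \<and> (\<forall>i\<in>K. x i Z = 0)"
  using HM eventually_compose_hol[OF holH, unfolded Hp, OF t.T10_frame] eventually_compose_hol[OF holH, unfolded Hp, OF V(2)]
  by eventually_elim (unfold x_def, blast)
 have xP: "x i \<in> P" if "i \<in> K" for i
 proof -
  have "x i \<in> N" by (rule vanishingI[OF smx]) (use evV that in \<open>auto elim: eventually_mono\<close>)
  then show ?thesis using NP by blast
 qed
 have sndP: "(\<lambda>Z. snd (V (H Z)) $ l) \<in> P" for l
 proof -
  have "(\<lambda>Z. snd (V (H Z)) $ l) \<in> N"
  proof (rule vanishingI)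
   show "smooth_at (\<lambda>Z. snd (V (H Z)) $ l) p" by (intro sm_intros smV)
   show "\<forall>\<^sub>F Z in nhds p. Z \<in> M \<longrightarrow> snd (V (H Z)) $ l = 0" using evV by eventually_elim simp
  qed
  then show ?thesis using NP by blast
 qed
 define b where "b = (\<lambda>Z. \<chi> i. if i \<in> K then 0 else x i Z)"
 define c where "c = (\<lambda>j Z. if j \<in> K then 0 else det (\<chi> i l. if l = j then b Z $ i else blk (- K) (X (diag Z)) $ i $ l))"
 have smb: "smooth_at (\<lambda>Z. b Z $ i) p" for i
  by (cases "i \<in> K") (simp_all add: b_def smooth_at_const smx)
 have smblk: "smooth_at (\<lambda>Z. blk (- K) (X (diag Z)) $ i $ l) p" for i l
  by (cases "i \<notin> K \<and> l \<notin> K") (auto simp: blk_def smX smooth_at_const)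
 have smc: "smooth_at (c j) p" for j
 proof (cases "j \<in> K")
  case True
  then have "c j = (\<lambda>_. 0)" by (simp add: c_def fun_eq_iff)
  then show ?thesis by (simp add: smooth_at_const)
 next
  case False
  have "smooth_at (\<lambda>Z. (\<chi> i l. if l = j then b Z $ i else blk (- K) (X (diag Z)) $ i $ l) $ i $ l) p" for i l
   by (cases "l = j") (simp_all add: smb smblk)
  then have "smooth_at (\<lambda>Z. det (\<chi> i l. if l = j then b Z $ i else blk (- K) (X (diag Z)) $ i $ l)) p"
   by (rule smooth_at_det)
  then show ?thesis using False by (simp add: c_def)
 qed
 define r where "r = (\<lambda>i Z. (\<Sum>j\<in>UNIV. c j Z * X (diag Z) $ i $ j) - \<delta> Z * x i Z)"
 have smr: "smooth_at (r i) p" for i unfolding r_def by (intro sm_intros smc smX smooth_\<delta> smx)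
 have rP: "r i \<in> P" for i
 proof (cases "i \<in> K")
  case True
  have "(\<lambda>Z. c j Z * X (diag Z) $ i $ j) \<in> P" for j
  proof (cases "j \<in> K")
   case True
   then show ?thesis using prime_at_zero[OF P] by (simp add: c_def)
  next
   case False
   then show ?thesis using X_vanishing[OF True False] NP by (intro prime_at_mult[OF P smc]) blast
  qed
  then show ?thesis unfolding r_def by (intro prime_at_diff[OF P] prime_at_sum[OF P] prime_at_mult[OF P smooth_\<delta>] xP True)
 next
  case False
  \<comment> \<open>Cramer's rule, away from the zeros of \<open>\<delta>\<close>\<close>
  have "\<delta> Z * r i Z = 0" for Z
  proof (cases "\<delta> Z = 0")
   case nz: False
   let ?T = "blk (- K) (X (diag Z))"
   have det: "det ?T = \<delta> Z" by (simp add: \<delta>_def \<Delta>_def)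
   define v where "v = (\<chi> k. det (\<chi> i l. if l = k then b Z $ i else ?T $ i $ l) / det ?T)"
   have Tv: "?T *v v = b Z" using cramer[of ?T v "b Z"] nz det by (simp add: v_def)
   have cv: "c j Z = \<delta> Z * v $ j" for j
   proof (cases "j \<in> K")
    case True
    then have "v $ j = 0" using matrix_vector_blk[of "- K" "X (diag Z)" v j] Tv by (simp add: b_def)
    then show ?thesis using True by (simp add: c_def)
   qed (use nz det in \<open>simp add: c_def v_def\<close>)
   have "(\<Sum>j\<in>UNIV. c j Z * X (diag Z) $ i $ j) = (\<Sum>j\<in>-K. c j Z * X (diag Z) $ i $ j)"
    by (rule sum.mono_neutral_right) (auto simp: c_def)
   also have "\<dots> = \<delta> Z * (\<Sum>j\<in>-K. X (diag Z) $ i $ j * v $ j)"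
    by (simp add: cv sum_distrib_left mult_ac)
   also have "(\<Sum>j\<in>-K. X (diag Z) $ i $ j * v $ j) = x i Z"
    using matrix_vector_blk[of "- K" "X (diag Z)" v i] False Tv by (simp add: b_def)
   finally show ?thesis by (simp add: r_def)
  qed simp
  then have "(\<lambda>Z. \<delta> Z * r i Z) \<in> P" by (intro prime_at_zero_ev[OF P] always_eventually allI)
  then show ?thesis using prime_at_prime[OF P smooth_\<delta> smr] \<delta>P by blast
 qed
 define Y where "Y = (\<lambda>Z. \<Sum>j\<in>UNIV. ct_scale (c j Z) (s.E j Z))"
 have smY: "smooth_at Y p" unfolding Y_def by (intro sm_intros smc s.smooth_E)
 have XopY: "Xop Y f Z = (\<Sum>j\<in>UNIV. c j Z * Xop (s.E j) f Z)" for f Z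
  by (simp add: Xop_def Y_def ct_apply_field_sum ct_apply_field_scale)
 have sndY: "snd (Y Z) = 0" for Z
 proof -
  have "snd (Y Z) = (\<Sum>j\<in>UNIV. snd (ct_scale (c j Z) (s.E j Z)))" unfolding Y_def by (simp add: snd_sum)
  then show ?thesis by (simp add: ct_scale_def s.E_def)
 qed
 have evH: "\<forall>\<^sub>F Z in nhds p. holomorphic_map_at H Z"
  using holomorphic_map_at_open[OF holH] unfolding eventually_nhds by blast
 have chain: "\<forall>\<^sub>F Z in nhds p. Xop Y (\<lambda>z. g (H z)) Z = (\<Sum>l\<in>UNIV. Xop Y (\<lambda>z. H z $ l) Z * d_dz l g (H Z))"
  if g: "smooth_at g p'" for g :: "complex^'n => complex"
  using evH eventually_compose_hol[OF holH, unfolded Hp, OF smooth_at_eventually_diff[OF g]]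
  by eventually_elim (simp add: Xop_def ct_apply_hol_chain(1) sndY)
 define e where "e = (\<lambda>l Z. Xop Y (\<lambda>z. H z $ l) Z - \<delta> Z * fst (V (H Z)) $ l)"
 have eP: "e l \<in> P" for l
 proof -
  have "\<forall>\<^sub>F Z in nhds p. \<forall>i. (\<Sum>l\<in>UNIV. t.A (diag (H Z)) $ i $ l * e l Z) = r i Z"
  proof (intro eventually_all_finite)
   fix i
   have g: "smooth_at (\<lambda>Z. t.\<Theta> i (diag Z)) p'" by (rule smooth_at_diag[OF t.holomorphic_\<Theta>])
   have "\<forall>\<^sub>F Z in nhds p. \<forall>j. Xop (s.E j) (\<lambda>Z. \<Phi> i (diag Z)) Z = X (diag Z) $ i $ j"
    by (intro eventually_all_finite Xop_\<Phi>)
   then show "\<forall>\<^sub>F Z in nhds p. (\<Sum>l\<in>UNIV. t.A (diag (H Z)) $ i $ l * e l Z) = r i Z"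
    using chain[OF g] eventually_compose_hol[OF holH, unfolded Hp, OF t.eventually_diag[OF holomorphic_at_eventually[OF t.holomorphic_\<Theta>[of i]]]]
   proof eventually_elim
    case (elim Z)
    have "(\<Sum>l\<in>UNIV. t.A (diag (H Z)) $ i $ l * Xop Y (\<lambda>z. H z $ l) Z) = Xop Y (\<lambda>Z. \<Phi> i (diag Z)) Z"
     unfolding \<Phi>_diag elim(2) using d_dz_diag(1)[OF holomorphic_at_imp_cdiff[OF elim(3)]] by (simp add: t.A_def mult.commute)
    also have "\<dots> = (\<Sum>j\<in>UNIV. c j Z * X (diag Z) $ i $ j)" unfolding XopY using elim(1) by simp
    finally have 1: "(\<Sum>l\<in>UNIV. t.A (diag (H Z)) $ i $ l * Xop Y (\<lambda>z. H z $ l) Z) = (\<Sum>j\<in>UNIV. c j Z * X (diag Z) $ i $ j)" .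
    have "(\<Sum>l\<in>UNIV. t.A (diag (H Z)) $ i $ l * e l Z) = (\<Sum>l\<in>UNIV. t.A (diag (H Z)) $ i $ l * Xop Y (\<lambda>z. H z $ l) Z) - \<delta> Z * x i Z"
     by (simp add: e_def x_def right_diff_distrib sum_subtractf sum_distrib_left mult_ac)
    then show ?case unfolding 1 by (simp add: r_def)
   qed
  qed
  then have "\<forall>\<^sub>F Z in nhds p. (\<Sum>i\<in>UNIV. t.B (diag (H Z)) $ l $ i * r i Z) = e l Z"
   using eventually_compose_hol[OF holH, unfolded Hp, OF t.eventually_diag[OF t.det_A_nz]]
  proof eventually_elim
   case (elim Z)
   have "t.A (diag (H Z)) *v (\<chi> l. e l Z) = (\<chi> i. r i Z)"
    using elim(1) by (simp add: matrix_vector_mult_def vec_eq_iff)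
   then have "(\<chi> l. e l Z) = t.B (diag (H Z)) *v (\<chi> i. r i Z)"
    using t.BA[OF elim(2)] by (metis matrix_vector_mul_assoc matrix_vector_mul_lid)
   then show ?case by (simp add: matrix_vector_mult_def vec_eq_iff)
  qed
  moreover have "(\<lambda>Z. \<Sum>i\<in>UNIV. t.B (diag (H Z)) $ l $ i * r i Z) \<in> P"
   by (intro prime_at_sum[OF P] prime_at_mult[OF P smooth_B'] rP)
  ultimately show ?thesis using prime_at_ev[OF P] by blast
 qed
 have "related P p H Y \<delta> V"
  unfolding related_def
 proof (intro conjI ballI allI impI smY smooth_\<delta> \<delta>P)
  fix f assume f: "f \<in> P"
  have "(\<lambda>Z. c j Z * Xop (s.E j) f Z) \<in> P" for j
  proof (cases "j \<in> K")
   case True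
   then show ?thesis using prime_at_zero[OF P] by (simp add: c_def)
  next
   case False
   then show ?thesis by (intro prime_at_mult[OF P smc] closed f)
  qed
  then have "(\<lambda>Z. \<Sum>j\<in>UNIV. c j Z * Xop (s.E j) f Z) \<in> P" by (intro prime_at_sum[OF P])
  moreover have "Xop Y f = (\<lambda>Z. \<Sum>j\<in>UNIV. c j Z * Xop (s.E j) f Z)" by (simp add: fun_eq_iff XopY)
  ultimately show "Xop Y f \<in> P" by simp
 next
  fix g :: "complex^'n => complex" assume g: "smooth_at g (H p)"
  have sg: "smooth_at (\<lambda>Z. d_dz l g (H Z)) p" "smooth_at (\<lambda>Z. d_dzbar l g (H Z)) p" for l
   by (rule smooth_at_compose[OF smH], intro sm_intros g)+
  have "(\<lambda>Z. (\<Sum>l\<in>UNIV. d_dz l g (H Z) * e l Z) - \<delta> Z * (\<Sum>l\<in>UNIV. d_dzbar l g (H Z) * snd (V (H Z)) $ l)) \<in> P"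
   by (intro prime_at_diff[OF P] prime_at_sum[OF P] prime_at_mult[OF P] sg smooth_\<delta> eP sndP)
  then show "(\<lambda>z. Xop Y (\<lambda>z. g (H z)) z - \<delta> z * Xop V g (H z)) \<in> P"
  proof (rule prime_at_ev[OF P])
   show "\<forall>\<^sub>F Z in nhds p. (\<Sum>l\<in>UNIV. d_dz l g (H Z) * e l Z) - \<delta> Z * (\<Sum>l\<in>UNIV. d_dzbar l g (H Z) * snd (V (H Z)) $ l)
     = Xop Y (\<lambda>z. g (H z)) Z - \<delta> Z * Xop V g (H Z)"
    using chain[OF g[unfolded Hp]]
   proof eventually_elim
    case (elim Z)
    show ?case unfolding elim Xop_def[of V] ct_apply_def[of "V (H Z)"]
     by (simp add: e_def right_diff_distrib left_diff_distrib sum_subtractf sum.distrib distrib_left sum_distrib_left mult_ac)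
   qed
  qed
 qed
 then show ?thesis by blast
qed

lemma vanishing_subset_dcl:
 assumes "N \<subseteq> P" "\<And>Y f. Y \<in> set w \<Longrightarrow> f \<in> N \<Longrightarrow> Xop Y f \<in> N"
 shows "N \<subseteq> dcl w P"
 using assms(2)
proof (induction w)
 case (Cons Y w)
 have "(Xop Y ^^ a) f \<in> N" if "f \<in> N" for f a
  using that by (induction a) (auto intro: Cons.prems)
 moreover have "N \<subseteq> dcl w P" by (rule Cons.IH) (rule Cons.prems, auto)
 ultimately show ?case by (auto simp: dclose_def)
qed (simp add: assms(1))

text \<open>If \<open>D\<close> vanishes at \<open>p\<close>, the relation between \<open>J\<close>,
\<open>\<delta>\<close> and \<open>D\<close> forces \<open>J\<close> to be flat along
\<open>L\<close>, and then to lie in a prime ideal \<open>II\<close> that is preserved by all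
tangential fields and contains neither \<open>\<delta>\<close> nor its conjugate. Finite type
excludes this.\<close>

proposition normal_block_nonzero:
 fixes \<sigma> :: "'m::finite => 'n"
 assumes ft: "finite_type M' d \<rho>' p'" and \<sigma>: "inj \<sigma>" "range \<sigma> = - K"
  and fin: "finite_germ (\<lambda>z. prj \<sigma> (Ht (emb \<sigma> z))) 0"
 shows "D p \<noteq> 0"
proof
 assume D0: "D p = 0"
 obtain c a0 where c: "\<forall>i\<in>K. c $ i = 0" and a0: "(Xop (s.Lc c) ^^ a0) \<delta> p \<noteq> 0"
  using \<delta>_not_flat[OF \<sigma> fin] by blast
 define L where "L = s.Lc c"
 define Lb where "Lb = (\<lambda>Z. ct_cnj (L Z))"
 define m where "m = {f :: complex^'n => complex. smooth_at f p \<and> f p = 0}"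
 have smL: "smooth_at L p" unfolding L_def by (rule s.smooth_Lc)
 have smLb: "smooth_at Lb p" unfolding Lb_def by (intro sm_intros smL)
 have m: "prime_at p m" unfolding m_def by (rule prime_at_maximal)
 have Nm: "N \<subseteq> m" using vanishing_smooth vanishing_value[OF _ s.pM] by (auto simp: m_def)
 have NL: "Xop L f \<in> N" if "f \<in> N" for f using s.vanishing_Lc[OF that c, of 1] by (simp add: L_def)
 have NLb: "Xop Lb f \<in> N" if "f \<in> N" for f
 proof (rule vanishing_cong)
  show "(\<lambda>z. cnj (Xop L (\<lambda>z. cnj (f z)) z)) \<in> N" by (intro vanishing_cnj NL that)
  show "\<forall>\<^sub>F z in nhds p. cnj (Xop L (\<lambda>z. cnj (f z)) z) = Xop Lb f z"
   using Xop_ct_cnj[OF vanishing_smooth[OF that], of L] unfolding Lb_def by eventually_elim simp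
 qed
 define PL where "PL = dclose L m"
 have PL: "prime_at p PL" unfolding PL_def by (rule prime_at_dclose[OF m smL])
 have NPL: "N \<subseteq> PL" using vanishing_subset_dcl[of m "[L]"] Nm NL by (auto simp: PL_def)
 have \<delta>PL: "\<delta> \<notin> PL" using a0 by (auto simp: PL_def dclose_def m_def L_def)
 have kill_Lb: "\<forall>\<^sub>F z in nhds p. Xop Lb J z = 0"
 proof -
  have "\<forall>\<^sub>F z in nhds p. \<forall>j. Xop (s.Eb j) J z = 0" by (intro eventually_all_finite kill_J)
  then have "\<forall>\<^sub>F z in nhds p. \<forall>j. Xop (s.E j) (\<lambda>z. cnj (J z)) z = 0"
   using smooth_at_eventually_diff[OF smooth_J]
   by eventually_elim (simp add: s.Xop_Eb)
  with Xop_ct_cnj[OF smooth_J, of L] show ?thesis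
   unfolding Lb_def by eventually_elim (simp add: L_def s.Xop_Lc)
 qed
 \<comment> \<open>otherwise \<open>D\<close>, being real, is not flat along \<open>Lb\<close>, and leading terms can be compared\<close>
 have JPL: "J \<in> PL"
 proof (rule ccontr)
  assume J: "J \<notin> PL"
  have "\<exists>b. (Xop Lb ^^ b) D p \<noteq> 0"
  proof (rule ccontr)
   assume flat: "\<not> (\<exists>b. (Xop Lb ^^ b) D p \<noteq> 0)"
   have "(Xop L ^^ b) D p = 0" for b
   proof -
    have "(Xop Lb ^^ b) D p = cnj ((Xop L ^^ b) (\<lambda>z. cnj (D z)) p)"
     unfolding Lb_def by (rule eventually_nhds_x_imp_x[OF Xpow_ct_cnj[OF smL smooth_D]])
    then have "(Xop L ^^ b) (\<lambda>z. cnj (D z)) p = 0" using flat by simp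
    moreover have "(Xop L ^^ b) (\<lambda>z. cnj (D z) - D z) p = (Xop L ^^ b) (\<lambda>z. cnj (D z)) p - (Xop L ^^ b) D p"
     by (rule eventually_nhds_x_imp_x[OF Xpow_diff[OF smL smooth_at_cnj[OF smooth_D] smooth_D]])
    moreover have "(Xop L ^^ b) (\<lambda>z. cnj (D z) - D z) p = 0"
     using s.vanishing_Lc[OF cnj_D c, of b] vanishing_value[OF _ s.pM] by (simp add: L_def)
    ultimately show ?thesis by simp
   qed
   then have "D \<in> PL" using smL smooth_D by (auto simp: PL_def dclose_def m_def intro: smooth_at_Xpow)
   then have "(\<lambda>z. (J z * u z - \<delta> z * D z) + \<delta> z * D z) \<in> PL"
    using jacobian_relation NPL by (intro prime_at_add[OF PL] prime_at_mult[OF PL smooth_\<delta>]) auto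
   then have "(\<lambda>z. J z * u z) \<in> PL" by simp
   then have "u \<in> PL" using prime_at_prime[OF PL smooth_J smooth_u] J by blast
   then show False using prime_at_value[OF PL] u_p by blast
  qed
  moreover have "(Xop L ^^ a) ((Xop Lb ^^ b) (\<lambda>z. J z * u z)) p = (Xop L ^^ a) ((Xop Lb ^^ b) (\<lambda>z. \<delta> z * D z)) p" for a b
  proof -
   have sm: "smooth_at (\<lambda>z. J z * u z) p" "smooth_at (\<lambda>z. \<delta> z * D z) p"
    by (intro sm_intros smooth_J smooth_u smooth_\<delta> smooth_D)+
   let ?f = "\<lambda>z. J z * u z - \<delta> z * D z"
   have "(Xop Lb ^^ b) ?f \<in> N" using jacobian_relation by (induction b) (simp_all add: NLb)
   then have N: "(Xop L ^^ a) ((Xop Lb ^^ b) ?f) \<in> N" by (induction a) (simp_all add: NL)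
   have sm': "smooth_at ((Xop Lb ^^ b) (\<lambda>z. J z * u z)) p" "smooth_at ((Xop Lb ^^ b) (\<lambda>z. \<delta> z * D z)) p"
    by (intro smooth_at_Xpow smLb sm)+
   have "\<forall>\<^sub>F z in nhds p. (Xop L ^^ a) ((Xop Lb ^^ b) ?f) z = (Xop L ^^ a) ((Xop Lb ^^ b) (\<lambda>z. J z * u z)) z - (Xop L ^^ a) ((Xop Lb ^^ b) (\<lambda>z. \<delta> z * D z)) z"
    using Xpow_cong[OF Xpow_diff[OF smLb sm, of b], where X = L and n = a] Xpow_diff[OF smL sm', of a] by eventually_elim simp
   from eventually_nhds_x_imp_x[OF this] vanishing_value[OF N s.pM] show ?thesis by simp
  qed
  ultimately show False
   using leading_term_comparison[OF smL smLb smooth_J smooth_u smooth_\<delta> smooth_D u_p D0 kill_Lb] a0 unfolding L_def by blast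
 qed
 \<comment> \<open>the germs \<open>f\<close> for which all derivatives \<open>(L ^ a) (Lb ^ b) f\<close> vanish at \<open>p\<close>\<close>
 define P0 where "P0 = dclose Lb PL"
 have P0: "prime_at p P0" unfolding P0_def by (rule prime_at_dclose[OF PL smLb])
 have NP0: "N \<subseteq> P0" using vanishing_subset_dcl[of PL "[Lb]"] NPL NLb by (auto simp: P0_def)
 have JP0: "J \<in> P0"
 proof -
  have "\<forall>\<^sub>F z in nhds p. (Xop Lb ^^ Suc a) J z = 0" for a
  proof (induction a)
   case (Suc a)
   from Xop_cong[OF this, of Lb] show ?case by eventually_elim (simp add: Xop_def)
  qed (use kill_Lb in simp)
  then have "(Xop Lb ^^ a) J \<in> PL" for a
   using JPL prime_at_zero_ev[OF PL] by (cases a) auto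
  then show ?thesis by (simp add: P0_def dclose_def)
 qed
 have \<delta>P0: "\<delta> \<notin> P0" using \<delta>PL dclose_subset[of Lb PL] by (auto simp: P0_def)
 have \<delta>'P0: "(\<lambda>z. cnj (\<delta> z)) \<notin> P0"
 proof
  assume "(\<lambda>z. cnj (\<delta> z)) \<in> P0"
  then have "(Xop Lb ^^ a0) (\<lambda>z. cnj (\<delta> z)) \<in> PL" by (simp add: P0_def dclose_def)
  then have "(Xop Lb ^^ a0) (\<lambda>z. cnj (\<delta> z)) p = 0" by (rule prime_at_value[OF PL])
  moreover have "(Xop Lb ^^ a0) (\<lambda>z. cnj (\<delta> z)) p = cnj ((Xop L ^^ a0) (\<lambda>z. cnj (cnj (\<delta> z))) p)"
   unfolding Lb_def by (rule eventually_nhds_x_imp_x[OF Xpow_ct_cnj[OF smL smooth_at_cnj[OF smooth_\<delta>]]])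
  ultimately show False using a0 by (simp add: L_def)
 qed
 define S where "S = s.E ` (- K) \<union> s.Eb ` (- K)"
 have smS: "smooth_at Y p" if "Y \<in> S" for Y using that s.smooth_E s.smooth_Eb by (auto simp: S_def)
 have NS: "Xop Y f \<in> N" if "Y \<in> S" "f \<in> N" for Y f using that s.vanishing_E by (auto simp: S_def)
 have Ndcl: "N \<subseteq> dcl w P0" if "w \<in> lists S" for w
  by (rule vanishing_subset_dcl[OF NP0]) (use that NS in \<open>auto simp: in_lists_conv_set\<close>)
 define II where "II = dinf S P0"
 have II: "prime_at p II" unfolding II_def by (rule prime_at_dinf[OF P0 smS])
 have NII: "N \<subseteq> II" using Ndcl by (auto simp: II_def dinf_def)
 have closed: "Xop Y f \<in> II" if "Y \<in> S" "f \<in> II" for Y f using dinf_Xop that by (auto simp: II_def)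
 have IIP0: "II \<subseteq> P0" unfolding II_def by (rule dinf_subset)
 have kill: "(\<forall>\<^sub>F z in nhds p. Xop Y J z = 0) \<or> (\<forall>\<^sub>F z in nhds p. Xop Y (\<lambda>z. cnj (J z)) z = 0)" if "Y \<in> S" for Y
 proof -
  have "\<forall>\<^sub>F z in nhds p. Xop (s.E j) (\<lambda>z. cnj (J z)) z = 0" for j
   using kill_J[of j] smooth_at_eventually_diff[OF smooth_J] by eventually_elim (simp add: s.Xop_Eb)
  then show ?thesis using that kill_J by (auto simp: S_def)
 qed
 have "J \<in> dcl w P0" if w: "w \<in> lists S" for w
 proof (rule words_in_ideals[where J = J and J' = "\<lambda>z. cnj (J z)" and \<delta> = \<delta> and \<delta>' = "\<lambda>z. cnj (\<delta> z)" and D = D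
    and u = u and u' = "\<lambda>z. cnj (u z)", OF P0 smS, THEN conjunct1])
  show "(\<lambda>z. J z * u z - \<delta> z * D z) \<in> dcl w P0" if "w \<in> lists S" for w using Ndcl[OF that] jacobian_relation by blast
  show "(\<lambda>z. cnj (J z) * cnj (u z) - cnj (\<delta> z) * D z) \<in> dcl w P0" if "w \<in> lists S" for w
   using Ndcl[OF that] jacobian_relation_cnj by blast
 qed (use smooth_J smooth_u smooth_\<delta> smooth_D u_p \<delta>P0 \<delta>'P0 JP0 kill w in \<open>auto intro: smooth_at_cnj\<close>)
 then have JII: "J \<in> II" by (auto simp: II_def dinf_def)
 have "J \<notin> II"
  unfolding J_def[abs_def]
 proof (rule jacobian_notin_prime[OF II holH, where \<X> = "lie_alg M' d \<rho>' (H p)"])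
  show "\<exists>X\<in>lie_alg M' d \<rho>' (H p). fst (X (H p)) = w" for w
  proof -
   obtain W where "W \<in> CT d \<rho>' p'" and W: "fst W = w" using t.CT_fst[of w] by blast
   then have "W \<in> (\<lambda>X. X p') ` lie_alg M' d \<rho>' p'" using ft unfolding finite_type_def by simp
   then show ?thesis using W unfolding Hp by auto
  qed
  show "smooth_at X (H p)" if "X \<in> lie_alg M' d \<rho>' (H p)" for X by (rule smooth_at_lie_alg[OF that])
  show "\<exists>Y \<delta>. related II p H Y \<delta> X" if "X \<in> lie_alg M' d \<rho>' (H p)" for X
  proof (rule related_lie_alg[OF II smooth_at_holomorphic_map[OF holH] _ that])
   fix V assume smV: "smooth_at V (H p)" and T: "(\<forall>\<^sub>F q in nhds (H p). q \<in> M' \<longrightarrow> V q \<in> T10 d \<rho>' q) \<or> (\<forall>\<^sub>F q in nhds (H p). q \<in> M' \<longrightarrow> V q \<in> T01 d \<rho>' q)"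
   from T show "\<exists>Y \<delta>. related II p H Y \<delta> V"
   proof
    assume T10: "\<forall>\<^sub>F q in nhds (H p). q \<in> M' \<longrightarrow> V q \<in> T10 d \<rho>' q"
    have "\<exists>Y. related II p H Y \<delta> V"
    proof (rule transported_field10[OF II _ NII])
     show "Xop (s.E j) f \<in> II" if "j \<notin> K" "f \<in> II" for j f using that by (intro closed) (auto simp: S_def)
     show "\<delta> \<notin> II" using \<delta>P0 IIP0 by blast
    qed (use smV T10 in \<open>simp_all add: Hp\<close>)
    then show ?thesis by blast
   next
    assume T01: "\<forall>\<^sub>F q in nhds (H p). q \<in> M' \<longrightarrow> V q \<in> T01 d \<rho>' q"
    let ?P = "{f. (\<lambda>z. cnj (f z)) \<in> II}"
    have P: "prime_at p ?P" by (rule prime_at_cnj[OF II])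
    have "\<exists>Y. related ?P p H Y \<delta> (\<lambda>q. ct_cnj (V q))"
    proof (rule transported_field10[OF P])
     fix j f assume j: "j \<notin> K" and f: "f \<in> ?P"
     have sm: "smooth_at (\<lambda>z. cnj (f z)) p" using f prime_at_smooth[OF II] by simp
     have "Xop (s.Eb j) (\<lambda>z. cnj (f z)) \<in> II" using j f by (intro closed) (auto simp: S_def)
     then have "(\<lambda>z. cnj (Xop (s.E j) f z)) \<in> II"
      by (rule prime_at_ev[OF II]) (use smooth_at_eventually_diff[OF sm] in eventually_elim, simp add: s.Xop_Eb)
     then show "Xop (s.E j) f \<in> ?P" by simp
    next
     show "N \<subseteq> ?P" using NII vanishing_cnj by blast
     show "\<delta> \<notin> ?P" using \<delta>'P0 IIP0 by blast
     show "smooth_at (\<lambda>q. ct_cnj (V q)) p'" using smV unfolding Hp by (intro sm_intros)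
     show "\<forall>\<^sub>F q in nhds p'. q \<in> M' \<longrightarrow> ct_cnj (V q) \<in> T10 d \<rho>' q"
      using T01 unfolding Hp by (auto simp: T10_def elim: eventually_mono)
    qed
    then show ?thesis using related_ct_cnj[OF II holH] by blast
   qed
  qed
 qed
 then show False using JII by blast
qed

lemma X_base: "X (diag p) = \<omega>' ** Jt p ** s.B (diag p)"
 using eventually_nhds_x_imp_x[OF X_factor] by (simp add: Hp t.A_base)

text \<open>The normal components of a given vector are attained by a combination of normal frame
fields.\<close>

lemma transversal:
 assumes D: "D p \<noteq> 0" shows "CR_transversal H p d \<rho>'"
 unfolding CR_transversal_def Hp
proof (intro equalityI subsetI)
 have c: "cdiff (\<lambda>z. H z $ k) p" for k using holH holomorphic_at_imp_cdiff unfolding holomorphic_map_at_def by blast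
 have df: "(\<lambda>z. H z $ k) differentiable (at p)" for k using smooth_at_diff smooth_at_holomorphic holH unfolding holomorphic_map_at_def by blast
 have push: "pushforward H p (a, 0) = (Jt p *v a, 0)" for a
  using cdiff_d_dzbar[OF c] by (simp add: pushforward_def ct_apply_def d_dz_cnj[OF df] Jt_def matrix_vector_mult_def vec_eq_iff mult.commute)
 have T: "V \<in> T10 d \<rho>' p' \<longleftrightarrow> snd V = 0 \<and> (\<forall>i\<in>K. (\<omega>' *v fst V) $ i = 0)" for V
  using eventually_nhds_x_imp_x[OF t.T10_frame] unfolding t.A_base matrix_vector_mult_def vec_lambda_beta by blast
 {
  fix x assume "x \<in> {u + v | u v. u \<in> T10 d \<rho>' p' \<and> v \<in> pushforward H p ` T10_space}"
  then obtain y z where x: "x = y + pushforward H p z" and y: "y \<in> T10 d \<rho>' p'" and z: "snd z = 0" unfolding T10_space_def by blast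
  have "pushforward H p z = (Jt p *v fst z, 0)" using push[of "fst z"] z by (metis prod.collapse)
  then show "x \<in> T10_space" using x y T by (simp add: T10_space_def)
 }
 fix x :: "'n ctvec" assume "x \<in> T10_space"
 then have x: "snd x = 0" by (simp add: T10_space_def)
 obtain v where v: "\<forall>j. j \<notin> K \<longrightarrow> v $ j = 0" "\<forall>i\<in>K. (\<Sum>j\<in>UNIV. X (diag p) $ i $ j * v $ j) = (\<omega>' *v fst x) $ i"
  using blk_solve[OF D[unfolded D_def], of "\<lambda>i. (\<omega>' *v fst x) $ i"] by blast
 define a where "a = s.B (diag p) *v v"
 have "(\<omega>' *v (Jt p *v a)) $ i = (\<omega>' *v fst x) $ i" if "i \<in> K" for i
 proof -
  have "\<omega>' *v (Jt p *v a) = X (diag p) *v v" by (simp add: X_base a_def matrix_vector_mul_assoc matrix_mul_assoc)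
  then show ?thesis using v(2) that by (simp add: matrix_vector_mult_def)
 qed
 then have "(fst x - Jt p *v a, 0) \<in> T10 d \<rho>' p'" unfolding T by (simp add: matrix_vector_mult_diff_distrib)
 moreover have "x = (fst x - Jt p *v a, 0) + pushforward H p (a, 0)" unfolding push using x by (simp add: prod_eq_iff)
 moreover have "(a, 0) \<in> T10_space" by (simp add: T10_space_def)
 ultimately show "x \<in> {u + v | u v. u \<in> T10 d \<rho>' p' \<and> v \<in> pushforward H p ` T10_space}" by blast
qed

end

section \<open>Comparison with the induced map of Segre varieties\<close>

lemma dim_zero_on:
 "dim {y :: complex^'n. \<forall>i\<in>S. y $ i = 0} = 2 * card (- S)"
proof -
 define d :: "(complex^'n) set" where "d = {axis i u | i u. i \<notin> S \<and> u \<in> Basis}"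
 have "d \<subseteq> Basis" by (auto simp: d_def Basis_vec_def)
 moreover have "{y :: complex^'n. \<forall>i\<in>S. y $ i = 0} = {x. \<forall>i\<in>Basis. i \<notin> d \<longrightarrow> x \<bullet> i = 0}"
 proof (intro equalityI subsetI)
  fix y :: "complex^'n" assume y: "y \<in> {y. \<forall>i\<in>S. y $ i = 0}"
  have "y \<bullet> axis i u = 0" if "axis i u \<notin> d" "u \<in> Basis" for i u
  proof -
   have "i \<in> S" using that unfolding d_def by blast
   then show ?thesis using y by (simp add: inner_axis)
  qed
  then show "y \<in> {x. \<forall>i\<in>Basis. i \<notin> d \<longrightarrow> x \<bullet> i = 0}" by (auto simp: Basis_vec_def)
 next
  fix y :: "complex^'n" assume y: "y \<in> {x. \<forall>i\<in>Basis. i \<notin> d \<longrightarrow> x \<bullet> i = 0}"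
  have "y $ i = 0" if i: "i \<in> S" for i
  proof (rule euclidean_eqI)
   fix u :: complex assume u: "u \<in> Basis"
   have "axis i u \<notin> d" using i u by (auto simp: d_def axis_eq_axis nonzero_Basis)
   moreover have "axis i u \<in> (Basis :: (complex^'n) set)" using u by (auto simp: Basis_vec_def)
   ultimately have "y \<bullet> axis i u = 0" using y by blast
   then show "y $ i \<bullet> u = 0 \<bullet> u" by (simp add: inner_axis)
  qed
  then show "y \<in> {y. \<forall>i\<in>S. y $ i = 0}" by simp
 qed
 ultimately have "dim {y :: complex^'n. \<forall>i\<in>S. y $ i = 0} = card d" using dim_substandard[of d] by simp
 also have "d = (\<lambda>(i, u). axis i u) ` ((- S) \<times> Basis)" by (auto simp: d_def)
 also have "card \<dots> = card ((- S) \<times> (Basis :: complex set))"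
  by (rule card_image) (auto simp: inj_on_def axis_eq_axis nonzero_Basis)
 finally show ?thesis by (simp add: card_cartesian_product)
qed

context segre_frame begin

definition Sg :: "(complex^'n) set" where "Sg = {Z. \<forall>i\<in>K. G0 Z $ i = 0}"

text \<open>The given coordinates and the adapted ones are homeomorphisms between neighbourhoods in
the Segre variety and in vector spaces; so the dimensions agree by invariance of domain.\<close>

lemma coords_dimension:
 fixes \<phi> :: "complex^'m::finite => complex^'n"
 assumes lc: "local_coords Sg p \<phi> \<kappa>"
 shows "CARD('m) = card (- K)"
proof -
 obtain V W where V: "open V" "0 \<in> V" and W: "open W" "p \<in> W" and hom: "homeomorphism V (Sg \<inter> W) \<phi> \<kappa>" and \<phi>0: "\<phi> 0 = p"
  using lc unfolding local_coords_def by blast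
 let ?S = "{y :: complex^'n. \<forall>i\<in>K. y $ i = 0}"
 have sub: "subspace ?S" by (auto simp: subspace_def)
 have "\<forall>\<^sub>F z in nhds p. \<Gamma> (G0 z) = z \<and> isCont G0 z"
 proof -
  have "\<forall>\<^sub>F z in nhds p. holomorphic_map_at G0 z"
   using holomorphic_map_at_open[OF holomorphic_G0] unfolding eventually_nhds by blast
  with \<Gamma>_G0 show ?thesis
   by eventually_elim (use has_derivative_continuous[OF jac_has_derivative] in blast)
 qed
 then obtain U1 where U1: "open U1" "p \<in> U1" "\<And>z. z \<in> U1 \<Longrightarrow> \<Gamma> (G0 z) = z \<and> isCont G0 z" unfolding eventually_nhds by blast
 have "\<forall>\<^sub>F y in nhds 0. G0 (\<Gamma> y) = y \<and> isCont \<Gamma> y \<and> \<Gamma> y \<in> W"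
 proof -
  have "\<forall>\<^sub>F y in nhds 0. holomorphic_map_at \<Gamma> y"
   using holomorphic_map_at_open[OF holomorphic_\<Gamma>] unfolding eventually_nhds by blast
  moreover have "\<forall>\<^sub>F y in nhds 0. \<Gamma> y \<in> W"
   by (rule eventually_compose_hol[OF holomorphic_\<Gamma>]) (simp add: \<Gamma>_0 W eventually_nhds_in_open)
  ultimately show ?thesis using G0_\<Gamma>
   by eventually_elim (use has_derivative_continuous[OF jac_has_derivative] in blast)
 qed
 then obtain U2 where U2: "open U2" "0 \<in> U2" "\<And>y. y \<in> U2 \<Longrightarrow> G0 (\<Gamma> y) = y \<and> isCont \<Gamma> y \<and> \<Gamma> y \<in> W" unfolding eventually_nhds by blast
 have \<phi>c: "continuous_on V \<phi>" and \<kappa>c: "continuous_on (Sg \<inter> W) \<kappa>" and \<phi>V: "\<phi> ` V = Sg \<inter> W"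
  and \<kappa>\<phi>: "\<And>z. z \<in> V \<Longrightarrow> \<kappa> (\<phi> z) = z" and \<phi>\<kappa>: "\<And>y. y \<in> Sg \<inter> W \<Longrightarrow> \<phi> (\<kappa> y) = y"
  using hom by (auto simp: homeomorphism_def)
 let ?V = "V \<inter> \<phi> -` U1"
 have i1: "openin (top_of_set UNIV) ?V" using continuous_open_preimage[OF \<phi>c V(1) U1(1)] by simp
 have i2: "continuous_on ?V (\<lambda>z. G0 (\<phi> z))"
 proof (rule continuous_on_compose2[of U1 G0])
  show "continuous_on U1 G0" by (rule continuous_at_imp_continuous_on) (use U1(3) in blast)
  show "continuous_on ?V \<phi>" using \<phi>c continuous_on_subset by blast
 qed blast
 have i3: "(\<lambda>z. G0 (\<phi> z)) \<in> ?V \<rightarrow> ?S" using \<phi>V by (auto simp: Sg_def)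
 have i4: "inj_on (\<lambda>z. G0 (\<phi> z)) ?V"
 proof (rule inj_onI)
  fix a b assume ab: "a \<in> ?V" "b \<in> ?V" "G0 (\<phi> a) = G0 (\<phi> b)"
  have "\<phi> a \<in> U1" "\<phi> b \<in> U1" using ab(1,2) by simp_all
  then have "\<Gamma> (G0 (\<phi> a)) = \<phi> a" "\<Gamma> (G0 (\<phi> b)) = \<phi> b" using U1(3) by blast+
  then have "\<phi> a = \<phi> b" unfolding ab(3) by (rule subst)
  moreover have "\<kappa> (\<phi> a) = a" "\<kappa> (\<phi> b) = b" using \<kappa>\<phi> ab(1,2) by blast+
  ultimately show "a = b" by metis
 qed
 have i5: "?V \<noteq> {}" using V(2) U1(2) \<phi>0 by auto
 have le: "dim (UNIV :: (complex^'m) set) \<le> dim ?S"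
  by (rule invariance_of_dimension_subspaces[OF i1 subspace_UNIV sub i2 i3 i4 i5])
 let ?U = "?S \<inter> U2"
 have \<Gamma>U: "\<Gamma> y \<in> Sg \<inter> W" if "y \<in> ?U" for y using that U2(3) by (simp add: Sg_def)
 have j1: "openin (top_of_set ?S) ?U" using U2(1) by (auto simp: openin_open)
 have j2: "continuous_on ?U (\<lambda>y. \<kappa> (\<Gamma> y))"
 proof (rule continuous_on_compose2[OF \<kappa>c])
  show "continuous_on ?U \<Gamma>" by (rule continuous_at_imp_continuous_on) (use U2(3) in blast)
 qed (use \<Gamma>U in blast)
 have j3: "(\<lambda>y. \<kappa> (\<Gamma> y)) \<in> ?U \<rightarrow> UNIV" by simp
 have j4: "inj_on (\<lambda>y. \<kappa> (\<Gamma> y)) ?U"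
 proof (rule inj_onI)
  fix a b assume ab: "a \<in> ?U" "b \<in> ?U" "\<kappa> (\<Gamma> a) = \<kappa> (\<Gamma> b)"
  have "\<Gamma> a = \<Gamma> b" using \<phi>\<kappa>[OF \<Gamma>U[OF ab(1)]] \<phi>\<kappa>[OF \<Gamma>U[OF ab(2)]] ab(3) by metis
  moreover have "a \<in> U2" "b \<in> U2" using ab by blast+
  ultimately show "a = b" using U2(3)[of a] U2(3)[of b] by metis
 qed
 have j5: "?U \<noteq> {}"
 proof -
  have "0 \<in> ?U" using U2(2) by simp
  then show ?thesis by blast
 qed
 have "dim ?S \<le> dim (UNIV :: (complex^'m) set)"
  by (rule invariance_of_dimension_subspaces[OF j1 sub subspace_UNIV j2 j3 j4 j5])
 with le have "dim (UNIV :: (complex^'m) set) = dim ?S" by simp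
 then show ?thesis by (simp add: dim_zero_on)
qed

text \<open>As \<open>\<kappa>\<close> is only given on the Segre variety, its holomorphy is read
off from the transition map \<open>\<psi>\<close> to the adapted coordinates.\<close>

lemma coords_transition:
 fixes \<phi> :: "complex^'m::finite => complex^'n" and \<sigma> :: "'m => 'n"
 assumes lc: "local_coords Sg p \<phi> \<kappa>" and \<sigma>: "inj \<sigma>" "range \<sigma> = - K"
 shows "\<exists>\<psi> \<Lambda>. holomorphic_map_at \<psi> 0 \<and> \<psi> 0 = 0 \<and> holomorphic_map_at \<Lambda> 0 \<and> \<Lambda> 0 = 0 \<and>
  (\<forall>\<^sub>F z in nhds 0. \<Lambda> (\<psi> z) = z) \<and> (\<forall>\<^sub>F w in nhds 0. \<psi> (\<Lambda> w) = w) \<and>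
  (\<forall>\<^sub>F z in nhds 0. \<phi> z = \<Gamma> (emb \<sigma> (\<psi> z))) \<and> (\<forall>\<^sub>F y in nhds p. y \<in> Sg \<longrightarrow> \<kappa> y = \<Lambda> (prj \<sigma> (G0 y)))"
proof -
 obtain V W where V: "open V" "0 \<in> V" and W: "open W" "p \<in> W" and hom: "homeomorphism V (Sg \<inter> W) \<phi> \<kappa>" and \<phi>0: "\<phi> 0 = p"
  and hol: "holomorphic_map_at \<phi> 0" and inj: "inj (FD \<phi> 0)"
  using lc unfolding local_coords_def by blast
 have \<kappa>c: "continuous_on (Sg \<inter> W) \<kappa>" and \<phi>V: "\<phi> ` V = Sg \<inter> W"
  and \<kappa>\<phi>: "\<And>z. z \<in> V \<Longrightarrow> \<kappa> (\<phi> z) = z" and \<phi>\<kappa>: "\<And>y. y \<in> Sg \<inter> W \<Longrightarrow> \<phi> (\<kappa> y) = y"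
  using hom by (auto simp: homeomorphism_def)
 define \<psi> where "\<psi> = (\<lambda>z. prj \<sigma> (G0 (\<phi> z)))"
 have hf: "holomorphic_map_at (\<lambda>z. G0 (\<phi> z)) 0"
  by (rule holomorphic_map_at_compose[OF hol]) (simp add: \<phi>0 holomorphic_G0)
 have h\<psi>: "holomorphic_map_at \<psi> 0"
  unfolding \<psi>_def by (rule holomorphic_map_at_compose[OF hf holomorphic_map_at_prj])
 have \<psi>0: "\<psi> 0 = 0" by (simp add: \<psi>_def \<phi>0 G0_base)
 have V_emb: "emb \<sigma> (\<psi> z) = G0 (\<phi> z)" if "z \<in> V" for z
 proof -
  have "\<phi> z \<in> Sg" using that \<phi>V by blast
  then show ?thesis using \<sigma> by (auto simp: \<psi>_def emb_prj vec_eq_iff Sg_def)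
 qed
 have evV: "\<forall>\<^sub>F z in nhds 0. z \<in> V" using V by (rule eventually_nhds_in_open)
 have inj\<psi>: "inj (jac \<psi> 0)"
 proof -
  have lin: "linear (jac \<psi> 0)" by (rule has_derivative_linear[OF jac_has_derivative[OF h\<psi>]])
  have d1: "((\<lambda>z. emb \<sigma> (\<psi> z)) has_derivative (\<lambda>v. jac (emb \<sigma>) (\<psi> 0) (jac \<psi> 0 v))) (at 0)"
   by (rule has_derivative_compose[OF jac_has_derivative[OF h\<psi>] jac_has_derivative[OF holomorphic_map_at_emb]])
  have "(G0 has_derivative jac G0 p) (at (\<phi> 0))" using jac_has_derivative[OF holomorphic_G0] \<phi>0 by simp
  from has_derivative_compose[OF jac_has_derivative[OF hol] this]
  have "((\<lambda>z. G0 (\<phi> z)) has_derivative (\<lambda>v. jac G0 p (jac \<phi> 0 v))) (at 0)" .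
  then have d2: "((\<lambda>z. emb \<sigma> (\<psi> z)) has_derivative (\<lambda>v. jac G0 p (jac \<phi> 0 v))) (at 0)"
   by (rule has_derivative_cong_open[OF V, rotated]) (simp add: V_emb)
  have "v = 0" if v: "jac \<psi> 0 v = 0" for v
  proof -
   have "jac (emb \<sigma>) (\<psi> 0) (jac \<psi> 0 v) = jac G0 p (jac \<phi> 0 v)" using has_derivative_unique[OF d1 d2] unfolding fun_eq_iff by blast
   then have "\<omega> *v (jac \<phi> 0 v) = \<omega> *v 0" unfolding v jac_G0 by (simp add: jac_def vec_eq_iff)
   then have "jac \<phi> 0 v = 0" by (rule inj_\<omega>)
   moreover have "FD \<phi> 0 = jac \<phi> 0" by (rule FD_eq[OF jac_has_derivative[OF hol]])
   moreover have "jac \<phi> 0 0 = 0" by (simp add: jac_def vec_eq_iff)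
   ultimately have "FD \<phi> 0 v = FD \<phi> 0 0" by simp
   then show ?thesis by (rule injD[OF inj])
  qed
  then show ?thesis using linear_injective_0[OF lin] by blast
 qed
 obtain U V' \<Lambda> where U: "open U" "U \<subseteq> V" "0 \<in> U" and V': "open V'" "\<psi> 0 \<in> V'" and hom\<psi>: "homeomorphism U V' \<psi> \<Lambda>"
  and h\<Lambda>: "\<forall>w\<in>V'. holomorphic_map_at \<Lambda> w"
  using holomorphic_local_inverse[OF h\<psi> inj\<psi> V] by blast
 have \<Lambda>\<psi>: "\<Lambda> (\<psi> z) = z" if "z \<in> U" for z using hom\<psi> that by (simp add: homeomorphism_def)
 have \<psi>\<Lambda>: "\<psi> (\<Lambda> w) = w" if "w \<in> V'" for w using hom\<psi> that by (simp add: homeomorphism_def)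
 have "\<forall>\<^sub>F z in nhds 0. z \<in> U" "\<forall>\<^sub>F w in nhds 0. w \<in> V'"
  using U V' \<psi>0 by (auto intro: eventually_nhds_in_open)
 then have e1: "\<forall>\<^sub>F z in nhds 0. \<Lambda> (\<psi> z) = z" and e2: "\<forall>\<^sub>F w in nhds 0. \<psi> (\<Lambda> w) = w"
  using \<Lambda>\<psi> \<psi>\<Lambda> by (auto elim: eventually_mono)
 have "\<forall>\<^sub>F z in nhds 0. \<Gamma> (G0 (\<phi> z)) = \<phi> z"
  by (rule eventually_compose_hol[OF hol]) (simp add: \<phi>0 \<Gamma>_G0)
 with evV have e3: "\<forall>\<^sub>F z in nhds 0. \<phi> z = \<Gamma> (emb \<sigma> (\<psi> z))" by eventually_elim (simp add: V_emb)
 have e4: "\<forall>\<^sub>F y in nhds p. y \<in> Sg \<longrightarrow> \<kappa> y = \<Lambda> (prj \<sigma> (G0 y))"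
 proof -
  have pS: "p \<in> Sg \<inter> W" using \<phi>V V(2) \<phi>0 by blast
  have "\<kappa> p = 0" using \<kappa>\<phi>[OF V(2)] \<phi>0 by simp
  then have "\<kappa> p \<in> U" using U(3) by simp
  then obtain A where A: "open A" "p \<in> A" "\<forall>y\<in>Sg \<inter> W. y \<in> A \<longrightarrow> \<kappa> y \<in> U"
   using \<kappa>c pS U(1) unfolding continuous_on_topological by meson
  have "\<forall>\<^sub>F y in nhds p. y \<in> A \<inter> W" using A W by (intro eventually_nhds_in_open) auto
  then show ?thesis
  proof eventually_elim
   case (elim y)
   show ?case
   proof
    assume "y \<in> Sg"
    then have y: "y \<in> Sg \<inter> W" and "\<kappa> y \<in> U" using elim A(3) by auto
    from \<Lambda>\<psi>[OF this(2)] show "\<kappa> y = \<Lambda> (prj \<sigma> (G0 y))" by (simp add: \<psi>_def \<phi>\<kappa>[OF y])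
   qed
  qed
 qed
 have "holomorphic_map_at \<Lambda> 0" using h\<Lambda> V'(2) \<psi>0 by simp
 moreover have "\<Lambda> 0 = 0" using \<Lambda>\<psi>[OF U(3)] \<psi>0 by simp
 ultimately show ?thesis using h\<psi> \<psi>0 e1 e2 e3 e4 by blast
qed

end

context segre_map begin

text \<open>In the adapted coordinates of the Segre varieties the induced map is \<open>k\<close>,
and \<open>H\<close> is \<open>Ht\<close>. As the normal block is invertible, passing from
\<open>Ht\<close> to \<open>k\<close> does not change the codimension of the ideal.\<close>

theorem transversal_and_finite:
 fixes \<phi> \<phi>' :: "complex^'m::finite => complex^'n"
 assumes ft: "finite_type M' d \<rho>' p'"
  and lc: "local_coords s.Sg p \<phi> \<kappa>" "local_coords t.Sg p' \<phi>' \<kappa>'"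
  and fin: "finite_germ (\<kappa>' \<circ> H \<circ> \<phi>) 0"
 shows "CR_transversal H p d \<rho>'"
  and "has_codim (conv_series p) (comp_ideal H p) q \<longleftrightarrow> has_codim (conv_series 0) (comp_ideal (\<kappa>' \<circ> H \<circ> \<phi>) 0) q"
proof -
 have "card (UNIV :: 'm set) = card (- K)" by (rule s.coords_dimension[OF lc(1)])
 then obtain \<sigma> :: "'m => 'n" where "bij_betw \<sigma> UNIV (- K)"
  using finite_same_card_bij[of "UNIV :: 'm set" "- K"] by auto
 then have \<sigma>: "inj \<sigma>" "range \<sigma> = - K" by (auto simp: bij_betw_def)
 obtain \<psi> \<Lambda> where \<psi>: "holomorphic_map_at \<psi> 0" "\<psi> 0 = 0" and \<Lambda>: "holomorphic_map_at \<Lambda> 0" "\<Lambda> 0 = 0"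
  "\<forall>\<^sub>F z in nhds 0. \<Lambda> (\<psi> z) = z" "\<forall>\<^sub>F w in nhds 0. \<psi> (\<Lambda> w) = w" and \<phi>: "\<forall>\<^sub>F z in nhds 0. \<phi> z = s.\<Gamma> (emb \<sigma> (\<psi> z))"
  using s.coords_transition[OF lc(1) \<sigma>] by blast
 obtain \<psi>' \<Lambda>' where \<psi>': "holomorphic_map_at \<psi>' 0" "\<psi>' 0 = 0" and \<Lambda>': "holomorphic_map_at \<Lambda>' 0" "\<Lambda>' 0 = 0"
  "\<forall>\<^sub>F z in nhds 0. \<Lambda>' (\<psi>' z) = z" "\<forall>\<^sub>F w in nhds 0. \<psi>' (\<Lambda>' w) = w" and \<kappa>': "\<forall>\<^sub>F y in nhds p'. y \<in> t.Sg \<longrightarrow> \<kappa>' y = \<Lambda>' (prj \<sigma> (t.G0 y))"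
  using t.coords_transition[OF lc(2) \<sigma>] by blast
 let ?h = "\<kappa>' \<circ> H \<circ> \<phi>"
 define k where "k = (\<lambda>z. prj \<sigma> (Ht (emb \<sigma> z)))"
 have hHte: "holomorphic_map_at (\<lambda>z. Ht (emb \<sigma> z)) 0"
  by (rule holomorphic_map_at_compose[OF holomorphic_map_at_emb]) (simp add: holomorphic_Ht)
 have hk: "holomorphic_map_at k 0"
  unfolding k_def by (rule holomorphic_map_at_compose[OF hHte holomorphic_map_at_prj])
 have k0: "k 0 = 0" by (simp add: k_def Ht_0)
 have van: "\<forall>\<^sub>F z in nhds 0. \<forall>l\<in>K. Ht (emb \<sigma> z) $ l = 0"
 proof (intro eventually_ball_finite ballI)
  fix l assume l: "l \<in> K"
  have "\<forall>\<^sub>F z in nhds 0. (\<forall>j\<in>K. emb \<sigma> z $ j = 0) \<longrightarrow> Ht (emb \<sigma> z) $ l = 0"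
   by (rule eventually_compose_hol[OF holomorphic_map_at_emb]) (use Ht_K[OF l] in simp)
  then show "\<forall>\<^sub>F z in nhds 0. Ht (emb \<sigma> z) $ l = 0"
   by eventually_elim (use \<sigma>(2) emb_nth_out in blast)
 qed simp
 have h: "\<forall>\<^sub>F z in nhds 0. ?h z = \<Lambda>' (k (\<psi> z))"
 proof -
  have "\<forall>\<^sub>F z in nhds 0. \<forall>l\<in>K. Ht (emb \<sigma> (\<psi> z)) $ l = 0"
   by (rule eventually_compose_hol[OF \<psi>(1)]) (use van \<psi>(2) in simp)
  moreover have "\<forall>\<^sub>F z in nhds 0. H (s.\<Gamma> (emb \<sigma> (\<psi> z))) \<in> t.Sg \<longrightarrow> \<kappa>' (H (s.\<Gamma> (emb \<sigma> (\<psi> z)))) = \<Lambda>' (prj \<sigma> (t.G0 (H (s.\<Gamma> (emb \<sigma> (\<psi> z))))))"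
  proof -
   have 1: "holomorphic_map_at (\<lambda>z. emb \<sigma> (\<psi> z)) 0" by (rule holomorphic_map_at_compose[OF \<psi>(1) holomorphic_map_at_emb])
   have 2: "holomorphic_map_at (\<lambda>z. s.\<Gamma> (emb \<sigma> (\<psi> z))) 0"
    by (rule holomorphic_map_at_compose[OF 1]) (simp add: \<psi>(2) s.holomorphic_\<Gamma>)
   have 3: "holomorphic_map_at (\<lambda>z. H (s.\<Gamma> (emb \<sigma> (\<psi> z)))) 0"
    by (rule holomorphic_map_at_compose[OF 2]) (simp add: \<psi>(2) s.\<Gamma>_0 holH)
   show ?thesis by (rule eventually_compose_hol[OF 3]) (use \<kappa>' in \<open>simp add: \<psi>(2) s.\<Gamma>_0 Hp\<close>)
  qed
  ultimately show ?thesis using \<phi>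
  proof eventually_elim
   case (elim z)
   have "H (s.\<Gamma> (emb \<sigma> (\<psi> z))) \<in> t.Sg" using elim(1) by (simp add: t.Sg_def Ht_def)
   then show ?case using elim(2,3) by (simp add: k_def Ht_def)
  qed
 qed
 have codim_k: "has_codim (conv_series 0) (comp_ideal k 0) q \<longleftrightarrow> has_codim (conv_series 0) (comp_ideal ?h 0) q" for q
  using has_codim_biholomorphic[of k \<psi> 0 \<Lambda> \<Lambda>' \<psi>' ?h q] \<psi> \<Lambda> \<psi>' \<Lambda>' hk k0 h by simp
 have fin_k: "finite_germ k 0" using fin codim_k unfolding finite_germ_def by blast
 have D: "D p \<noteq> 0" by (rule normal_block_nonzero[OF ft \<sigma> fin_k[unfolded k_def]])
 show "CR_transversal H p d \<rho>'" by (rule transversal[OF D])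
 have "has_codim (conv_series p) (comp_ideal H p) q \<longleftrightarrow> has_codim (conv_series 0) (comp_ideal Ht 0) q"
  using has_codim_biholomorphic[of H s.\<Gamma> 0 s.G0 t.G0 t.\<Gamma> Ht q]
  by (simp add: s.\<Gamma>_0 holH s.holomorphic_\<Gamma> s.holomorphic_G0 s.G0_base s.\<Gamma>_G0 s.G0_\<Gamma> Hp t.holomorphic_G0 t.G0_base t.holomorphic_\<Gamma> t.\<Gamma>_G0 Ht_def)
 also have "\<dots> \<longleftrightarrow> has_codim (conv_series 0) (comp_ideal k 0) q"
  unfolding k_def
 proof (rule has_codim_slice[OF \<sigma>(1) holomorphic_Ht Ht_0])
  show "\<forall>\<^sub>F z in nhds 0. Ht (emb \<sigma> z) $ l = 0" if "l \<notin> range \<sigma>" for l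
   using van that \<sigma>(2) by (auto elim: eventually_mono)
  fix v :: "complex^'n"
  assume v0: "\<And>j. j \<in> range \<sigma> \<Longrightarrow> v $ j = 0" and v: "\<And>l. l \<notin> range \<sigma> \<Longrightarrow> (\<Sum>s\<in>UNIV. d_dz s (\<lambda>z. Ht z $ l) 0 * v $ s) = 0"
  have Xp: "X (diag p) $ l $ j = d_dz j (\<lambda>z. Ht z $ l) 0" for l j
   using eventually_nhds_x_imp_x[OF X_slice] by (simp add: s.slice_0)
  have "(blk K (X (diag p)) *v v) $ i = 0" for i
  proof (cases "i \<in> K")
   case True
   have "(\<Sum>j\<in>K. X (diag p) $ i $ j * v $ j) = (\<Sum>j\<in>UNIV. X (diag p) $ i $ j * v $ j)"
    by (rule sum.mono_neutral_left) (use v0 \<sigma>(2) in auto)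
   then show ?thesis using v[of i] True \<sigma>(2) by (simp add: matrix_vector_blk Xp)
  next
   case False
   then show ?thesis using v0 \<sigma>(2) by (simp add: matrix_vector_blk)
  qed
  then have "blk K (X (diag p)) *v v = 0" by (simp add: vec_eq_iff)
  then show "v = 0" using D det_nz_iff_kernel unfolding D_def by blast
 qed
 finally show "has_codim (conv_series p) (comp_ideal H p) q \<longleftrightarrow> has_codim (conv_series 0) (comp_ideal ?h 0) q"
  using codim_k by simp
qed

end

lemma adapted_frame:
 fixes \<rho> :: "nat => complex^'n => real"
 assumes "generic_submanifold M p d \<rho>" and R: "\<forall>k<d. complexification_at (\<rho> k) p (R k)"
 shows "d \<le> CARD('n)" "inj_on \<tau> {..<d} \<Longrightarrow> \<exists>\<omega>. segre_frame M p d \<rho> (\<lambda>k w. R k (lft w) (rgt w)) \<tau> \<omega>"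
proof -
 have pM: "p \<in> M" and M: "\<forall>\<^sub>F Z in nhds p. Z \<in> M \<longleftrightarrow> (\<forall>k<d. \<rho> k Z = 0)"
  using assms(1) unfolding generic_submanifold_def by blast+
 obtain v where v: "wedge d (\<lambda>k. del (\<rho> k) p) v \<noteq> 0" using assms(1) unfolding generic_submanifold_def by blast
 define w where "w = (\<lambda>k. \<chi> j. d_dz j (\<lambda>z. complex_of_real (\<rho> k z)) p)"
 have ind: "c k = 0" if c: "(\<Sum>k<d. c k *s w k) = 0" and k: "k < d" for c k
 proof (rule wedge_independent[OF v _ k])
  fix x
  have "(\<Sum>k<d. c k * del (\<rho> k) p x) = (\<Sum>j\<in>UNIV. (\<Sum>k<d. c k *s w k) $ j * x $ j)"
   by (simp add: del_def w_def sum_distrib_left sum_distrib_right mult.assoc) (rule sum.swap)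
  then show "(\<Sum>k<d. c k * del (\<rho> k) p x) = 0" unfolding c by simp
 qed
 show "d \<le> CARD('n)"
 proof (rule extend_rows(1)[of w d])
  show "c k = 0" if "(\<Sum>k<d. c k *s w k) = 0" "k < d" for c k by (rule ind[of c k, OF that])
 qed
 assume \<tau>: "inj_on \<tau> {..<d}"
 have "\<exists>L :: complex^'n^'n. (\<forall>k<d. L $ \<tau> k = w k) \<and> det L \<noteq> 0"
 proof (rule extend_rows(2)[of w d \<tau>])
  show "c k = 0" if "(\<Sum>k<d. c k *s w k) = 0" "k < d" for c k by (rule ind[of c k, OF that])
 qed (rule \<tau>)
 then obtain \<omega> :: "complex^'n^'n" where \<omega>: "\<forall>k<d. \<omega> $ \<tau> k = w k" "det \<omega> \<noteq> 0" by blast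
 have "segre_frame M p d \<rho> (\<lambda>k w. R k (lft w) (rgt w)) \<tau> \<omega>"
 proof
  fix k assume k: "k < d"
  then have "complexification_at (\<rho> k) p (R k)" using R by blast
  from complexification_holomorphic[OF this]
  show "holomorphic_at (\<lambda>w. R k (lft w) (rgt w)) (diag p)" "\<forall>\<^sub>F Z in nhds p. R k (lft (diag Z)) (rgt (diag Z)) = complex_of_real (\<rho> k Z)"
   by simp_all
  show "\<omega> $ \<tau> k $ j = d_dz j (\<lambda>z. complex_of_real (\<rho> k z)) p" for j using \<omega>(1) k by (simp add: w_def)
 qed (use pM M \<tau> \<omega> in auto)
 then show "\<exists>\<omega>. segre_frame M p d \<rho> (\<lambda>k w. R k (lft w) (rgt w)) \<tau> \<omega>" by blast
qed

lemma segre_adapted: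
 assumes "segre_frame M p d \<rho> (\<lambda>k w. R k (lft w) (rgt w)) \<tau> \<omega>"
 shows "segre d R p = segre_frame.Sg p d (\<lambda>k w. R k (lft w) (rgt w)) \<tau> \<omega>"
proof -
 interpret segre_frame M p d \<rho> "\<lambda>k w. R k (lft w) (rgt w)" \<tau> \<omega> by (rule assms)
 show ?thesis unfolding segre_def Sg_def using ball_K[of "\<lambda>k. R k Z (cnj_vec p) = 0" for Z] by (simp add: G0_K)
qed

theorem theorem1p4:
  fixes M M' :: "(complex^'n) set" and p p' :: "complex^'n" and d :: nat
    and \<rho> \<rho>' :: "nat \<Rightarrow> complex^'n \<Rightarrow> real"
    and R R' :: "nat \<Rightarrow> complex^'n \<Rightarrow> complex^'n \<Rightarrow> complex"
    and H :: "complex^'n \<Rightarrow> complex^'n"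
    and \<phi> \<phi>' :: "complex^'m \<Rightarrow> complex^'n" and \<kappa> \<kappa>' :: "complex^'n \<Rightarrow> complex^'m"
  assumes "generic_submanifold M p d \<rho>"
    and "generic_submanifold M' p' d \<rho>'"
    and "finite_type M' d \<rho>' p'"
    and "\<forall>k<d. complexification_at (\<rho> k) p (R k)"
    and "\<forall>k<d. complexification_at (\<rho>' k) p' (R' k)"
    and "holomorphic_map_at H p"
    and "H p = p'"
    and "\<forall>\<^sub>F Z in nhds p. Z \<in> M \<longrightarrow> H Z \<in> M'"
    and "local_coords (segre d R p) p \<phi> \<kappa>"
    and "local_coords (segre d R' p') p' \<phi>' \<kappa>'"
    and "finite_germ (\<kappa>' \<circ> H \<circ> \<phi>) 0"
  shows "CR_transversal H p d \<rho>' \<and> finite_germ H p \<and>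
         multiplicity_germ H p = multiplicity_germ (\<kappa>' \<circ> H \<circ> \<phi>) 0"
proof -
 have "card {..<d} \<le> CARD('n)" using adapted_frame(1)[OF assms(1,4)] by simp
 then obtain \<tau> :: "nat => 'n" where \<tau>: "inj_on \<tau> {..<d}"
  using card_le_inj[of "{..<d}" "UNIV :: 'n set"] by auto
 obtain \<omega> where s: "segre_frame M p d \<rho> (\<lambda>k w. R k (lft w) (rgt w)) \<tau> \<omega>" using adapted_frame(2)[OF assms(1,4) \<tau>] by blast
 obtain \<omega>' where t: "segre_frame M' p' d \<rho>' (\<lambda>k w. R' k (lft w) (rgt w)) \<tau> \<omega>'" using adapted_frame(2)[OF assms(2,5) \<tau>] by blast
 interpret segre_map M M' p p' d \<rho> \<rho>' "\<lambda>k w. R k (lft w) (rgt w)" "\<lambda>k w. R' k (lft w) (rgt w)" \<tau> \<omega> \<omega>' H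
  by (intro segre_map.intro segre_map_axioms.intro s t assms(6-8))
 note res = transversal_and_finite[OF assms(3) assms(9)[unfolded segre_adapted[OF s]] assms(10)[unfolded segre_adapted[OF t]] assms(11)]
 have "has_codim (conv_series p) (comp_ideal H p) = has_codim (conv_series 0) (comp_ideal (\<kappa>' \<circ> H \<circ> \<phi>) 0)"
  by (rule ext) (rule res(2))
 then show ?thesis using res(1) assms(11) unfolding finite_germ_def multiplicity_germ_def by simp
qed

end
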